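(* Assume that $\gamma$ satisfies Hypothesis 1 and that $F$ satisfies Hypothesis 2 (both stated in the context). Let $\rho_0:H\to[0,\infty)$ be Borel measurable with $\int_H\rho_0\,d\gamma=1$ and $$\int_H\rho_0\ln\rho_0\,d\gamma<\infty .$$ Then there exists a $\mathcal B([0,T]\times H)$-measurable function $\rho:[0,T]\times H\to[0,\infty)$ such that for every $t\in[0,T]$ the measure $\nu_t(dx):=\rho(t,x)\gamma(dx)$ is a probability measure on $H$, $\rho$ solves the continuity equation $( * )$ with initial density $\rho_0$, i.e. $$\int_0^T\!\!\int_H\big[\partial_tu(t,x)+\langle D_xu(t,x),F(t,x)\rangle\big]\rho(t,x)\,\gamma(dx)\,dt=-\int_Hu(0,x)\rho_0(x)\,\gamma(dx)\quad\forall u\in\mathcal FC^1_{b,T},$$ and moreover $$\int_0^T\!\!\int_H\rho(t,x)\ln\rho(t,x)\,\gamma(dx)\,dt<\infty .$$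
   Context: $H$ is a real separable Hilbert space with inner product $\langle\cdot,\cdot\rangle$ and norm $|\cdot|_H$; $T>0$ is fixed. For a dense linear subspace $Y\subset H$ and $k\in\mathbb N\cup\{\infty\}$: $\mathcal FC^k_b$ is the set of functions $f(x)=\tilde f(\langle h_1,x\rangle,\dots,\langle h_N,x\rangle)$ with $N\in\mathbb N$, $h_1,\dots,h_N\in Y$, $\tilde f\in C^k_b(\mathbb R^N)$; $\mathcal FC^k_{b,T}$ is the linear span of functions $u(t,x)=g(t)f(x)$ with $g\in C^1([0,T];\mathbb R)$, $g(T)=0$, $f\in\mathcal FC^k_b$. $\partial_h$ is the directional derivative in direction $h$, $D_x$ the gradient in $x$. Hypothesis 1: $\gamma$ is a finite nonnegative Borel measure on $H$ and there is a dense linear subspace $Y\subset H$ such that for every $h\in Y$ there exist a Borel function $\beta_h:H\to\mathbb R$ and $c_h>0$ with $\int_He^{c_h|\beta_h|}d\gamma<\infty$ and $\int_H\partial_hu\,d\gamma=-\int_Hu\,\beta_h\,d\gamma$ for all $u\in\mathcal FC^1_b$. Continuity equation $( * )$: for Borel $F:[0,T]\times H\to H$ and $\rho_0\in L^1(H,\gamma)$, a solution is $\rho\in L^1([0,T]\times H,dt\otimes\gamma)$ satisfying the displayed identity for all $u\in\mathcal FC^1_{b,T}$. Disintegration notation: given an orthonormal basis $(e_n)$ of $H$ with $e_n\in Y$, for $N\in\mathbb N$ let $H_N=\mathrm{span}\{e_1,\dots,e_N\}$, identified with $\mathbb R^N$ via $x\mapsto(\langle x,e_i\rangle)_{i\le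 N}$, let $E_N=H_N^\perp$, write $z\in H$ as $z=(x,y)\in\mathbb R^N\times E_N$, and let $\nu_N$ be the image of $\gamma$ under the orthogonal projection onto $E_N$. $\Psi_N:\mathbb R^N\times E_N\to[0,\infty)$ is a Borel function with $\gamma(dx\,dy)=\Psi_N^2(x,y)\,dx\,\nu_N(dy)$ ($dx$ Lebesgue measure) and $\Psi_N(\cdot,y)\in H^{1,2}(\mathbb R^N)$ for every $y$ (such $\Psi_N$ exists). Quotients $\partial_{x_i}\Psi^2_N/\Psi^2_N$ are set to $0$ on $\{\Psi_N=0\}$. For $M,l\in\mathbb N$ and $y\in E_N$: if $\Psi_N^2(\cdot,y)$ is $C^2$, strictly positive and bounded, put $\Psi_{N,M,l}(\cdot,y)=\Psi_N(\cdot,y)$; otherwise put $\Psi_{N,M}^2(x,y)=(\Psi_N^2(x,y)\wedge M)\vee M^{-1}$ and $\Psi_{N,M,l}^2(\cdot,y)=\Psi_{N,M}^2(\cdot,y)*\delta_l$, where $\delta_l(x)=l^N\eta(lx)$ with $\eta\in C_0^\infty(\mathbb R^N)$, $\eta\ge0$, even, supported in the unit ball, $\int\eta=1$. Hypothesis 2: (i) $F:[0,T]\times H\to H$ is Borel and bounded. (ii) There is an orthonormal basis $(e_n)$ of $H$ with $e_n\in Y$ such that for every $N$, $1\le i\le N$ and $\nu_N$-a.e. $y\in E_N$: $\partial_{x_i}\Psi_N^2(\cdot,y)/\Psi_N^2(\cdot,y)\in L^1_{loc}(\mathbb R^N,dx)$. (iii) There are maps $F_j(t,x)=\sum_{i=1}^{N_j}f_{ij}(t,x)e_i$,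 $j\in\mathbb N$, with $N_j$ increasing, $f_{ij}(t,x)=\tilde f_{ij}(t,\langle x,e_1\rangle,\dots,\langle x,e_{N_j}\rangle)$, $\tilde f_{ij}\in C_b([0,T]\times\mathbb R^{N_j})$, $\tilde f_{ij}(t,\cdot)\in C^2_b(\mathbb R^{N_j})$ for each $t$ with all first and second spatial partial derivatives continuous on $[0,T]\times\mathbb R^{N_j}$, such that $F_j\to F$ $dt\otimes\gamma$-a.e., $\sup_j\|F_j\|_\infty<\infty$, and for some $\delta>0$, $\sup_jC_{F_j}(\delta)<\infty$, where $C_{F_j}(\delta)=\int_{E_{N_j}}C_{F_j}(\delta,y)\nu_{N_j}(dy)$, $$C_{F_j}(\delta,y)=\sup_{M,l\in\mathbb N}\int_0^T\!\!\int_{\mathbb R^{N_j}}\Big(e^{\delta(D^*_{N_j,M,l}F_j(t,(x,y)))^+}-1\Big)\Psi^2_{N_j,M,l}(x,y)\,dx\,dt,$$ $$D^*_{N_j,M,l}F_j(t,(x,y))=-\sum_{i=1}^{N_j}\Big(\partial_{x_i}\tilde f_{ij}(t,x)+\tilde f_{ij}(t,x)\,\frac{\partial_{x_i}\Psi^2_{N_j,M,l}(x,y)}{\Psi^2_{N_j,M,l}(x,y)}\Big).$$ *)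

theory Defs
  imports "HOL-Probability.Probability"
begin

text \<open>R^N is represented by extensional functions on the index set {..<N}
  (coordinates 0..N-1), equipped with the product Lebesgue measure.\<close>

definition RN :: "nat \<Rightarrow> (nat \<Rightarrow> real) set" where
  "RN N = PiE {..<N} (\<lambda>_. UNIV)"

definition lebN :: "nat \<Rightarrow> (nat \<Rightarrow> real) measure" where
  "lebN N = PiM {..<N} (\<lambda>_. lborel)"

definition normsqN :: "nat \<Rightarrow> (nat \<Rightarrow> real) \<Rightarrow> real" where
  "normsqN N x = (\<Sum>i<N. (x i)\<^sup>2)"

definition pderiv :: "nat \<Rightarrow> ((nat \<Rightarrow> real) \<Rightarrow> real) \<Rightarrow> (nat \<Rightarrow> real) \<Rightarrow> real" where
  "pderiv i f x = deriv (\<lambda>s. f (x(i := s))) (x i)"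

definition has_partials :: "nat \<Rightarrow> ((nat \<Rightarrow> real) \<Rightarrow> real) \<Rightarrow> bool" where
  "has_partials N f \<longleftrightarrow> (\<forall>x\<in>RN N. \<forall>i<N. (\<lambda>s. f (x(i := s))) differentiable (at (x i)))"

fun Ck :: "nat \<Rightarrow> nat \<Rightarrow> ((nat \<Rightarrow> real) \<Rightarrow> real) \<Rightarrow> bool" where
  "Ck N 0 f = continuous_on (RN N) f"
| "Ck N (Suc k) f = (continuous_on (RN N) f \<and> has_partials N f \<and> (\<forall>i<N. Ck N k (pderiv i f)))"

fun Ckb :: "nat \<Rightarrow> nat \<Rightarrow> ((nat \<Rightarrow> real) \<Rightarrow> real) \<Rightarrow> bool" where
  "Ckb N 0 f = (continuous_on (RN N) f \<and> bounded (f ` RN N))"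
| "Ckb N (Suc k) f = (continuous_on (RN N) f \<and> bounded (f ` RN N) \<and> has_partials N f
                       \<and> (\<forall>i<N. Ckb N k (pderiv i f)))"

definition smoothN :: "nat \<Rightarrow> ((nat \<Rightarrow> real) \<Rightarrow> real) \<Rightarrow> bool" where
  "smoothN N f \<longleftrightarrow> (\<forall>k. Ck N k f)"

definition test_fun :: "nat \<Rightarrow> ((nat \<Rightarrow> real) \<Rightarrow> real) \<Rightarrow> bool" where
  "test_fun N \<phi> \<longleftrightarrow> smoothN N \<phi> \<and> (\<exists>r. \<forall>x\<in>RN N. (\<exists>i<N. \<bar>x i\<bar> > r) \<longrightarrow> \<phi> x = 0)"

definition locint :: "nat \<Rightarrow> ((nat \<Rightarrow> real) \<Rightarrow> real) \<Rightarrow> bool" where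
  "locint N f \<longleftrightarrow> f \<in> borel_measurable (lebN N) \<and>
     (\<forall>r::real. integrable (lebN N) (\<lambda>x. indicator {x. \<forall>i<N. \<bar>x i\<bar> \<le> r} x * f x))"

definition weak_pderiv :: "nat \<Rightarrow> nat \<Rightarrow> ((nat \<Rightarrow> real) \<Rightarrow> real) \<Rightarrow> ((nat \<Rightarrow> real) \<Rightarrow> real) \<Rightarrow> bool" where
  "weak_pderiv N i f g \<longleftrightarrow> locint N f \<and> locint N g \<and>
     (\<forall>\<phi>. test_fun N \<phi> \<longrightarrow>
        (\<integral>x. f x * pderiv i \<phi> x \<partial>lebN N) = - (\<integral>x. g x * \<phi> x \<partial>lebN N))"

definition L2N :: "nat \<Rightarrow> ((nat \<Rightarrow> real) \<Rightarrow> real) \<Rightarrow> bool" where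
  "L2N N f \<longleftrightarrow> f \<in> borel_measurable (lebN N) \<and> integrable (lebN N) (\<lambda>x. (f x)\<^sup>2)"

definition sobolev12 :: "nat \<Rightarrow> ((nat \<Rightarrow> real) \<Rightarrow> real) \<Rightarrow> bool" where
  "sobolev12 N f \<longleftrightarrow> L2N N f \<and> (\<forall>i<N. \<exists>g. L2N N g \<and> weak_pderiv N i f g)"

definition dirderiv :: "('h::real_normed_vector \<Rightarrow> real) \<Rightarrow> 'h \<Rightarrow> 'h \<Rightarrow> real" where
  "dirderiv f x h = deriv (\<lambda>s. f (x + s *\<^sub>R h)) 0"

definition FCb :: "'h::real_inner set \<Rightarrow> nat \<Rightarrow> ('h \<Rightarrow> real) set" where
  "FCb Y k = {f. \<exists>N h g. (\<forall>i<N. h i \<in> Y) \<and> Ckb N k g \<and>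
                 f = (\<lambda>x. g (restrict (\<lambda>i. inner (h i) x) {..<N}))}"

definition C1_on_interval :: "real \<Rightarrow> (real \<Rightarrow> real) \<Rightarrow> bool" where
  "C1_on_interval T g \<longleftrightarrow> (\<exists>g'. continuous_on {0..T} g' \<and>
      (\<forall>t\<in>{0..T}. (g has_real_derivative g' t) (at t within {0..T})))"

text \<open>FC^k_{b,T}: linear span of g(t) f(x), g in C^1([0,T]), g(T) = 0, f in FC^k_b
  (scalar coefficients are absorbed into the g's)\<close>
definition FCbT :: "real \<Rightarrow> 'h::real_inner set \<Rightarrow> nat \<Rightarrow> (real \<Rightarrow> 'h \<Rightarrow> real) set" where
  "FCbT T Y k = {u. \<exists>(n::nat) (g::nat \<Rightarrow> real \<Rightarrow> real) (f::nat \<Rightarrow> 'h \<Rightarrow> real). (\<forall>m<n. C1_on_interval T (g m) \<and> g m T = 0 \<and> f m \<in> FCb Y k) \<and>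
                     u = (\<lambda>t x. \<Sum>m<n. g m t * f m x)}"

definition lebT :: "real \<Rightarrow> real measure" where
  "lebT T = restrict_space lborel {0..T}"

definition hyp1 :: "'h::{real_inner, complete_space, second_countable_topology} measure \<Rightarrow> 'h set \<Rightarrow> bool" where
  "hyp1 \<gamma> Y \<longleftrightarrow> finite_measure \<gamma> \<and> sets \<gamma> = sets borel \<and>
     subspace Y \<and> closure Y = UNIV \<and>
     (\<forall>h\<in>Y. \<exists>\<beta> c. \<beta> \<in> borel_measurable borel \<and> c > 0 \<and>
        (\<integral>\<^sup>+ x. ennreal (exp (c * \<bar>\<beta> x\<bar>)) \<partial>\<gamma>) < \<infinity> \<and>
        (\<forall>u\<in>FCb Y 1. (\<integral>x. dirderiv u x h \<partial>\<gamma>) = - (\<integral>x. u x * \<beta> x \<partial>\<gamma>)))"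

definition solves_CE :: "'h::{real_inner, complete_space, second_countable_topology} measure \<Rightarrow> 'h set
    \<Rightarrow> real \<Rightarrow> (real \<Rightarrow> 'h \<Rightarrow> 'h) \<Rightarrow> ('h \<Rightarrow> real) \<Rightarrow> (real \<Rightarrow> 'h \<Rightarrow> real) \<Rightarrow> bool" where
  "solves_CE \<gamma> Y T F \<rho>0 \<rho> \<longleftrightarrow>
     integrable (lebT T \<Otimes>\<^sub>M \<gamma>) (\<lambda>(t, x). \<rho> t x) \<and>
     (\<forall>u\<in>FCbT T Y 1.
        (\<integral>t. (\<integral>x. (vector_derivative (\<lambda>s. u s x) (at t within {0..T}) + dirderiv (u t) x (F t x))
                      * \<rho> t x \<partial>\<gamma>) \<partial>lebT T)
        = - (\<integral>x. u 0 x * \<rho>0 x \<partial>\<gamma>))"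

definition orthonormal_basis :: "(nat \<Rightarrow> 'h::real_inner) \<Rightarrow> bool" where
  "orthonormal_basis e \<longleftrightarrow> (\<forall>m n. inner (e m) (e n) = (if m = n then 1 else 0)) \<and>
                           closure (span (range e)) = UNIV"

text \<open>H_N = span{e_0,...,e_{N-1}} identified with R^N; E_N its orthogonal complement\<close>
definition embN :: "(nat \<Rightarrow> 'h::real_inner) \<Rightarrow> nat \<Rightarrow> (nat \<Rightarrow> real) \<Rightarrow> 'h" where
  "embN e N x = (\<Sum>i<N. x i *\<^sub>R e i)"

definition coordN :: "(nat \<Rightarrow> 'h::real_inner) \<Rightarrow> nat \<Rightarrow> 'h \<Rightarrow> (nat \<Rightarrow> real)" where
  "coordN e N z = restrict (\<lambda>i. inner z (e i)) {..<N}"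

definition EN :: "(nat \<Rightarrow> 'h::real_inner) \<Rightarrow> nat \<Rightarrow> 'h set" where
  "EN e N = {y. \<forall>i<N. inner y (e i) = 0}"

definition projE :: "(nat \<Rightarrow> 'h::real_inner) \<Rightarrow> nat \<Rightarrow> 'h \<Rightarrow> 'h" where
  "projE e N z = z - embN e N (coordN e N z)"

definition nuN :: "'h::{real_inner, complete_space, second_countable_topology} measure
    \<Rightarrow> (nat \<Rightarrow> 'h) \<Rightarrow> nat \<Rightarrow> 'h measure" where
  "nuN \<gamma> e N = distr \<gamma> borel (projE e N)"

definition disint_density :: "'h::{real_inner, complete_space, second_countable_topology} measure
    \<Rightarrow> (nat \<Rightarrow> 'h) \<Rightarrow> (nat \<Rightarrow> (nat \<Rightarrow> real) \<Rightarrow> 'h \<Rightarrow> real) \<Rightarrow> bool" where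
  "disint_density \<gamma> e \<Psi> \<longleftrightarrow> (\<forall>N.
     (\<lambda>(x, y). \<Psi> N x y) \<in> borel_measurable (lebN N \<Otimes>\<^sub>M borel) \<and>
     (\<forall>x y. \<Psi> N x y \<ge> 0) \<and>
     (\<forall>A\<in>sets borel. emeasure \<gamma> A =
        (\<integral>\<^sup>+ y. (\<integral>\<^sup>+ x. indicator A (embN e N x + y) * ennreal ((\<Psi> N x y)\<^sup>2) \<partial>lebN N) \<partial>nuN \<gamma> e N)) \<and>
     (\<forall>y\<in>EN e N. sobolev12 N (\<lambda>x. \<Psi> N x y)))"

definition mollifier :: "nat \<Rightarrow> ((nat \<Rightarrow> real) \<Rightarrow> real) \<Rightarrow> bool" where
  "mollifier N \<eta> \<longleftrightarrow> smoothN N \<eta> \<and> (\<forall>x\<in>RN N. \<eta> x \<ge> 0) \<and>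
     (\<forall>x\<in>RN N. \<eta> (restrict (\<lambda>i. - x i) {..<N}) = \<eta> x) \<and>
     (\<forall>x\<in>RN N. normsqN N x > 1 \<longrightarrow> \<eta> x = 0) \<and>
     (\<integral>x. \<eta> x \<partial>lebN N) = 1"

definition delta_l :: "(nat \<Rightarrow> (nat \<Rightarrow> real) \<Rightarrow> real) \<Rightarrow> nat \<Rightarrow> nat \<Rightarrow> (nat \<Rightarrow> real) \<Rightarrow> real" where
  "delta_l \<eta> N l x = real l ^ N * \<eta> N (restrict (\<lambda>i. real l * x i) {..<N})"

definition PsiSq :: "(nat \<Rightarrow> (nat \<Rightarrow> real) \<Rightarrow> 'h \<Rightarrow> real) \<Rightarrow> (nat \<Rightarrow> (nat \<Rightarrow> real) \<Rightarrow> real)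
    \<Rightarrow> nat \<Rightarrow> nat \<Rightarrow> nat \<Rightarrow> (nat \<Rightarrow> real) \<Rightarrow> 'h \<Rightarrow> real" where
  "PsiSq \<Psi> \<eta> N M l x y =
     (if Ck N 2 (\<lambda>x'. (\<Psi> N x' y)\<^sup>2) \<and> (\<forall>x'\<in>RN N. (\<Psi> N x' y)\<^sup>2 > 0) \<and>
         bounded ((\<lambda>x'. (\<Psi> N x' y)\<^sup>2) ` RN N)
      then (\<Psi> N x y)\<^sup>2
      else (\<integral>z. max (1 / real M) (min ((\<Psi> N (restrict (\<lambda>i. x i - z i) {..<N}) y)\<^sup>2) (real M))
                  * delta_l \<eta> N l z \<partial>lebN N))"

definition qdiv :: "real \<Rightarrow> real \<Rightarrow> real" where
  "qdiv a b = (if b = 0 then 0 else a / b)"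

definition Fj :: "(nat \<Rightarrow> 'h::real_inner) \<Rightarrow> (nat \<Rightarrow> nat) \<Rightarrow> (nat \<Rightarrow> nat \<Rightarrow> real \<Rightarrow> (nat \<Rightarrow> real) \<Rightarrow> real)
    \<Rightarrow> nat \<Rightarrow> real \<Rightarrow> 'h \<Rightarrow> 'h" where
  "Fj e Nj ft j t x = (\<Sum>i<Nj j. ft j i t (coordN e (Nj j) x) *\<^sub>R e i)"

definition Dstar :: "(nat \<Rightarrow> (nat \<Rightarrow> real) \<Rightarrow> 'h \<Rightarrow> real) \<Rightarrow> (nat \<Rightarrow> (nat \<Rightarrow> real) \<Rightarrow> real)
    \<Rightarrow> (nat \<Rightarrow> nat) \<Rightarrow> (nat \<Rightarrow> nat \<Rightarrow> real \<Rightarrow> (nat \<Rightarrow> real) \<Rightarrow> real)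
    \<Rightarrow> nat \<Rightarrow> nat \<Rightarrow> nat \<Rightarrow> real \<Rightarrow> (nat \<Rightarrow> real) \<Rightarrow> 'h \<Rightarrow> real" where
  "Dstar \<Psi> \<eta> Nj ft j M l t x y =
     - (\<Sum>i<Nj j. pderiv i (ft j i t) x +
          ft j i t x * qdiv (pderiv i (\<lambda>x'. PsiSq \<Psi> \<eta> (Nj j) M l x' y) x) (PsiSq \<Psi> \<eta> (Nj j) M l x y))"

definition CFy :: "real \<Rightarrow> (nat \<Rightarrow> (nat \<Rightarrow> real) \<Rightarrow> 'h \<Rightarrow> real) \<Rightarrow> (nat \<Rightarrow> (nat \<Rightarrow> real) \<Rightarrow> real)
    \<Rightarrow> (nat \<Rightarrow> nat) \<Rightarrow> (nat \<Rightarrow> nat \<Rightarrow> real \<Rightarrow> (nat \<Rightarrow> real) \<Rightarrow> real)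
    \<Rightarrow> nat \<Rightarrow> real \<Rightarrow> 'h \<Rightarrow> ennreal" where
  "CFy T \<Psi> \<eta> Nj ft j \<delta> y =
     (SUP (M, l)\<in>{1..} \<times> {1..}.
        \<integral>\<^sup>+ t. (\<integral>\<^sup>+ x. ennreal ((exp (\<delta> * max 0 (Dstar \<Psi> \<eta> Nj ft j M l t x y)) - 1)
                                * PsiSq \<Psi> \<eta> (Nj j) M l x y) \<partial>lebN (Nj j)) \<partial>lebT T)"

definition CF :: "'h::{real_inner, complete_space, second_countable_topology} measure \<Rightarrow> (nat \<Rightarrow> 'h)
    \<Rightarrow> real \<Rightarrow> (nat \<Rightarrow> (nat \<Rightarrow> real) \<Rightarrow> 'h \<Rightarrow> real) \<Rightarrow> (nat \<Rightarrow> (nat \<Rightarrow> real) \<Rightarrow> real)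
    \<Rightarrow> (nat \<Rightarrow> nat) \<Rightarrow> (nat \<Rightarrow> nat \<Rightarrow> real \<Rightarrow> (nat \<Rightarrow> real) \<Rightarrow> real) \<Rightarrow> nat \<Rightarrow> real \<Rightarrow> ennreal" where
  "CF \<gamma> e T \<Psi> \<eta> Nj ft j \<delta> = (\<integral>\<^sup>+ y. CFy T \<Psi> \<eta> Nj ft j \<delta> y \<partial>nuN \<gamma> e (Nj j))"

definition coeff_regular :: "real \<Rightarrow> nat \<Rightarrow> (real \<Rightarrow> (nat \<Rightarrow> real) \<Rightarrow> real) \<Rightarrow> bool" where
  "coeff_regular T N f \<longleftrightarrow>
     continuous_on ({0..T} \<times> RN N) (\<lambda>(t, x). f t x) \<and>
     bounded ((\<lambda>(t, x). f t x) ` ({0..T} \<times> RN N)) \<and>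
     (\<forall>t\<in>{0..T}. Ckb N 2 (f t)) \<and>
     (\<forall>k<N. continuous_on ({0..T} \<times> RN N) (\<lambda>(t, x). pderiv k (f t) x)) \<and>
     (\<forall>k<N. \<forall>m<N. continuous_on ({0..T} \<times> RN N) (\<lambda>(t, x). pderiv k (pderiv m (f t)) x))"

definition hyp2 :: "'h::{real_inner, complete_space, second_countable_topology} measure \<Rightarrow> 'h set
    \<Rightarrow> real \<Rightarrow> (real \<Rightarrow> 'h \<Rightarrow> 'h) \<Rightarrow> (nat \<Rightarrow> 'h) \<Rightarrow> (nat \<Rightarrow> (nat \<Rightarrow> real) \<Rightarrow> 'h \<Rightarrow> real)
    \<Rightarrow> (nat \<Rightarrow> (nat \<Rightarrow> real) \<Rightarrow> real) \<Rightarrow> bool" where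
  "hyp2 \<gamma> Y T F e \<Psi> \<eta> \<longleftrightarrow>
     \<comment> \<open>(i)\<close>
     (\<lambda>(t, x). F t x) \<in> borel_measurable (restrict_space borel ({0..T} \<times> UNIV)) \<and>
     (\<exists>C. \<forall>t\<in>{0..T}. \<forall>x. norm (F t x) \<le> C) \<and>
     \<comment> \<open>(ii)\<close>
     orthonormal_basis e \<and> (\<forall>n. e n \<in> Y) \<and>
     (\<forall>N. \<forall>i<N. AE y in nuN \<gamma> e N. \<exists>g. weak_pderiv N i (\<lambda>x. (\<Psi> N x y)\<^sup>2) g \<and>
               locint N (\<lambda>x. qdiv (g x) ((\<Psi> N x y)\<^sup>2))) \<and>
     \<comment> \<open>(iii)\<close>
     (\<exists>Nj ft. mono Nj \<and>
        (\<forall>j. \<forall>i<Nj j. coeff_regular T (Nj j) (ft j i)) \<and>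
        (AE (t, x) in lebT T \<Otimes>\<^sub>M \<gamma>. (\<lambda>j. Fj e Nj ft j t x) \<longlonglongrightarrow> F t x) \<and>
        (\<exists>C. \<forall>j. \<forall>t\<in>{0..T}. \<forall>x. norm (Fj e Nj ft j t x) \<le> C) \<and>
        (\<exists>\<delta>>0. (SUP j. CF \<gamma> e T \<Psi> \<eta> Nj ft j \<delta>) < \<infinity>))"

end

theory Submission
  imports Defs "HOL-Real_Asymp.Real_Asymp"
begin

text \<open>For fixed \<open>j\<close> and fixed \<open>y\<close> in the orthogonal complement, the equation driven by \<open>F\<^sub>j\<close> lives on \<open>R\<^sup>N\<close> and is
  solved by an explicit scheme (one coordinate shift per substep) instead of by a flow.  Each step
  changes the entropy relative to a positive \<open>C\<^sup>1\<close> weight by at most the step size times the integral of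
  \<open>(D\<^sup>*F\<^sub>j)\<^sup>+\<close> against the density; Young's inequality \<open>r a \<le> (r ln r - r + 1) + (e\<^sup>a - 1)\<close> and Gronwall
  bound the entropy by the exponential cost in the hypothesis.  With the weights \<open>\<Psi>\<^sub>N\<^sub>,\<^sub>M\<^sub>,\<^sub>l\<^sup>2\<close>, this bound
  survives \<open>l \<rightarrow> \<infinity>\<close> and \<open>M \<rightarrow> \<infinity>\<close>.  All limits of densities are taken along almost everywhere convergent
  convex combinations: the equation is linear, and the entropy is convex and gives uniform
  integrability.  Testing with functions of \<open>t\<close> alone shows that the mass is 1 for almost every \<open>t\<close>.\<close>

text \<open>A shift in a single coordinate is a one-dimensional change of variables with an explicit
  Jacobian. Mass and entropy after a substep are therefore known exactly; errors arise only from the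
  time and the position at which integrands are read. Speeds are bounded and the initial density is
  cut off to be bounded with support in a cube, so everything happens in one larger cube, where
  uniform continuity controls these errors. The cut-off depends on \<open>j\<close> and is released
  together with the limit in \<open>j\<close>.

  The slices must be solved measurably in \<open>y\<close>. No solution is selected slice by slice:
  the scheme is an explicit formula, hence jointly measurable, and one sequence of convex
  combinations is extracted on the product space of \<open>y\<close>, \<open>t\<close> and
  \<open>x\<close>. Its sections are convex combinations for the single slices.

  The weight \<open>\<Psi>\<close>^2 may vanish. The entropy relative to it is infinite unless the
  density vanishes there too; finiteness is what permits division by the weight and yields a density
  with respect to \<gamma>.\<close>

section \<open>The entropy integrand\<close>

definition hfun :: "real \<Rightarrow> real" where
  "hfun r = r * ln r - r + 1"

lemma hfun_0 [simp]: "hfun 0 = 1"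
  by (simp add: hfun_def)

lemma hfun_nonneg:
  assumes "r \<ge> 0" shows "hfun r \<ge> 0"
proof (cases "r = 0")
  case False
  with assms have r: "r > 0" by simp
  have "ln (1/r) \<le> 1/r - 1" using r by (intro ln_le_minus_one) simp
  hence "- ln r \<le> 1/r - 1" using r by (simp add: ln_div)
  hence "r * (- ln r) \<le> r * (1/r - 1)" using r by (intro mult_left_mono) auto
  thus ?thesis using r by (simp add: hfun_def algebra_simps)
qed simp

text \<open>By scaling: \<open>c * hfun (a / c)\<close> is exactly the gap between
  \<open>hfun\<close> and its tangent at \<open>c\<close>, so nonnegativity of \<open>hfun\<close>
  suffices.\<close>

lemma hfun_tangent:
  assumes "a \<ge> 0" "c > 0" shows "hfun a \<ge> hfun c + ln c * (a - c)"
proof (cases "a = 0")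
  case True
  then show ?thesis using assms by (simp add: hfun_def algebra_simps)
next
  case False
  with assms have a: "a > 0" by simp
  have "0 \<le> c * hfun (a / c)" using hfun_nonneg[of "a/c"] assms by simp
  also have "\<dots> = hfun a - hfun c - ln c * (a - c)"
    using a assms by (simp add: hfun_def ln_div algebra_simps)
  finally show ?thesis by simp
qed

text \<open>The two tangent inequalities at the midpoint are added and their linear terms cancel. A
  tangent exists only at a positive point, hence the separate case of two zeros.\<close>

lemma hfun_midpoint:
  assumes "a \<ge> 0" "b \<ge> 0" shows "hfun ((a + b) / 2) \<le> (hfun a + hfun b) / 2"
proof (cases "a + b = 0")
  case True
  with assms have "a = 0" "b = 0" by auto
  then show ?thesis by simp
next
  case False
  with assms have c: "(a + b) / 2 > 0" by simp
  let ?c = "(a + b) / 2"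
  have e: "ln ?c * (b - ?c) = - (ln ?c * (a - ?c))" by (simp add: field_simps)
  have "hfun a + hfun b \<ge> (hfun ?c + ln ?c * (a - ?c)) + (hfun ?c + ln ?c * (b - ?c))"
    by (intro add_mono hfun_tangent assms c)
  then show ?thesis unfolding e by simp
qed

text \<open>Fenchel's inequality: \<open>exp a - 1\<close> is the convex conjugate of
  \<open>hfun\<close>. It amounts to \<open>1 + s \<le> exp s\<close> at
  \<open>s = a - ln r\<close>.\<close>

lemma hfun_young:
  assumes "r \<ge> 0" shows "r * a \<le> hfun r + (exp a - 1)"
proof (cases "r = 0")
  case False
  with assms have r: "r > 0" by simp
  have "1 + (a - ln r) \<le> exp (a - ln r)" by (rule exp_ge_add_one_self)
  hence "r * (1 + (a - ln r)) \<le> r * exp (a - ln r)" using r by simp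
  also have "r * exp (a - ln r) = exp a" using r by (simp add: exp_diff)
  finally show ?thesis by (simp add: hfun_def algebra_simps)
qed simp

lemma continuous_on_xlnx: "continuous_on {0..} (\<lambda>x::real. x * ln x)"
proof (rule continuous_onI)
  show "\<exists>d>0. \<forall>x'\<in>{0..}. dist x' x < d \<longrightarrow> dist (x' * ln x') (x * ln x) \<le> e"
    if x: "x \<in> {0..}" and e: "e > 0" for x e :: real
  proof (cases "x = 0")
    case True
    have "((\<lambda>x::real. x * ln x) \<longlongrightarrow> 0) (at_right 0)"
      by real_asymp
    hence "\<forall>\<^sub>F y::real in at_right 0. dist (y * ln y) 0 < e" using e by (rule tendstoD)
    then obtain d where d: "d > 0" "\<And>y. 0 < y \<Longrightarrow> y < d \<Longrightarrow> dist (y * ln y) (0::real) < e"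
      by (auto simp: eventually_at_right_field)
    show ?thesis using d True e
      apply (intro exI[of _ d]) apply (auto simp: dist_real_def)
      by (metis abs_zero le_less mult_zero_left)
  next
    case False
    with x have "x > 0" by simp
    hence "isCont (\<lambda>x::real. x * ln x) x" by (intro continuous_intros) auto
    then obtain d where "d > 0" "\<forall>x'. dist x' x < d \<longrightarrow> dist (x' * ln x') (x * ln x) < e"
      using e unfolding continuous_at_eps_delta by blast
    thus ?thesis by (intro exI[of _ d]) (auto intro: less_imp_le)
  qed
qed

lemma continuous_on_hfun: "continuous_on {0..} hfun"
  unfolding hfun_def[abs_def] by (intro continuous_intros continuous_on_xlnx)

lemma borel_measurable_hfun [measurable]: "hfun \<in> borel_measurable borel"
  unfolding hfun_def[abs_def] by measurable

section \<open>Almost everywhere convergent convex combinations\<close>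

text \<open>Closing the tail of a sequence under midpoints only gives all the convexity that is needed,
  and properties of its elements follow by rule induction.\<close>

inductive_set midconv :: "(nat \<Rightarrow> 'a \<Rightarrow> real) \<Rightarrow> nat \<Rightarrow> ('a \<Rightarrow> real) set"
  for f :: "nat \<Rightarrow> 'a \<Rightarrow> real" and n :: nat where
  base: "k \<ge> n \<Longrightarrow> f k \<in> midconv f n"
| mid: "u \<in> midconv f n \<Longrightarrow> v \<in> midconv f n \<Longrightarrow> (\<lambda>x. (u x + v x) / 2) \<in> midconv f n"

lemma midconv_mono: "n \<le> m \<Longrightarrow> g \<in> midconv f m \<Longrightarrow> g \<in> midconv f n"
  by (rotate_tac, induction rule: midconv.induct) (auto intro: midconv.intros)

lemma ennreal_midpoint:
  assumes "a \<ge> 0" "b \<ge> 0"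
  shows "ennreal ((a + b) / 2) = ennreal (1/2) * ennreal a + ennreal (1/2) * ennreal b"
proof -
  have "ennreal (1/2) * ennreal a + ennreal (1/2) * ennreal b = ennreal (1/2 * a) + ennreal (1/2 * b)"
    using assms by (simp only: ennreal_mult)
  also have "\<dots> = ennreal (1/2 * a + 1/2 * b)" using assms by (intro ennreal_plus[symmetric]) auto
  finally show ?thesis by (simp add: add_divide_distrib)
qed

lemma ennreal_half_add_half: "ennreal (1/2) * C + ennreal (1/2) * C = C"
proof -
  have "ennreal (1/2) * C + ennreal (1/2) * C = (ennreal (1/2) + ennreal (1/2)) * C"
    by (simp add: distrib_right)
  also have "ennreal (1/2) + ennreal (1/2) = 1"
    by (subst ennreal_plus[symmetric]) auto
  finally show ?thesis by simp
qed

text \<open>Bounds on a convex functional over the tail survive midpoints. The integrand may depend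
  on the point, as entropies relative to a weight do. Measurability and sign are part of the
  conclusion because the induction step uses them.\<close>

lemma nn_integral_midconv_le:
  assumes "g \<in> midconv f n"
    and [measurable]: "\<And>k. f k \<in> borel_measurable M"
    and nn: "\<And>k x. x \<in> space M \<Longrightarrow> f k x \<ge> 0"
    and [measurable]: "(\<lambda>(x, r). \<Phi> x r) \<in> borel_measurable (M \<Otimes>\<^sub>M borel)"
    and pos: "\<And>x r. x \<in> space M \<Longrightarrow> r \<ge> 0 \<Longrightarrow> \<Phi> x r \<ge> 0"
    and conv: "\<And>x a b. x \<in> space M \<Longrightarrow> a \<ge> 0 \<Longrightarrow> b \<ge> 0 \<Longrightarrow> \<Phi> x ((a + b) / 2) \<le> (\<Phi> x a + \<Phi> x b) / 2"
    and bd: "\<And>k. k \<ge> n \<Longrightarrow> (\<integral>\<^sup>+x. ennreal (\<Phi> x (f k x)) \<partial>M) \<le> C"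
  shows "g \<in> borel_measurable M \<and> (\<forall>x\<in>space M. g x \<ge> 0) \<and> (\<integral>\<^sup>+x. ennreal (\<Phi> x (g x)) \<partial>M) \<le> C"
  using assms(1)
proof induction
  case (base k)
  then show ?case using nn bd by auto
next
  case (mid u v)
  hence [measurable]: "u \<in> borel_measurable M" "v \<in> borel_measurable M" and
    uv: "\<And>x. x \<in> space M \<Longrightarrow> u x \<ge> 0" "\<And>x. x \<in> space M \<Longrightarrow> v x \<ge> 0" by auto
  have "(\<integral>\<^sup>+x. ennreal (\<Phi> x ((u x + v x) / 2)) \<partial>M) \<le>
    (\<integral>\<^sup>+x. ennreal (1/2) * ennreal (\<Phi> x (u x)) + ennreal (1/2) * ennreal (\<Phi> x (v x)) \<partial>M)"
  proof (rule nn_integral_mono)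
    fix x assume x: "x \<in> space M"
    have "ennreal (\<Phi> x ((u x + v x) / 2)) \<le> ennreal ((\<Phi> x (u x) + \<Phi> x (v x)) / 2)"
      using conv[OF x uv(1)[OF x] uv(2)[OF x]] by (rule ennreal_leI)
    also have "\<dots> = ennreal (1/2) * ennreal (\<Phi> x (u x)) + ennreal (1/2) * ennreal (\<Phi> x (v x))"
      using pos[OF x] uv x by (intro ennreal_midpoint) auto
    finally show "ennreal (\<Phi> x ((u x + v x) / 2)) \<le> \<dots>" .
  qed
  also have "\<dots> = ennreal (1/2) * (\<integral>\<^sup>+x. ennreal (\<Phi> x (u x)) \<partial>M) + ennreal (1/2) * (\<integral>\<^sup>+x. ennreal (\<Phi> x (v x)) \<partial>M)"
    by (subst nn_integral_add) (auto simp: nn_integral_cmult)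
  also have "\<dots> \<le> ennreal (1/2) * C + ennreal (1/2) * C"
    using mid by (intro add_mono mult_left_mono) auto
  also have "\<dots> = C" by (rule ennreal_half_add_half)
  finally show ?case using uv by auto
qed

text \<open>A Komlos-type theorem: tail convex combinations that almost minimise the integral of exp(-g)
  make exp(-g/2) a Cauchy sequence in the square mean, because
  (exp(-a) + exp(-b))/2 - exp(-(a+b)/2) is half the square of exp(-a/2) - exp(-b/2).\<close>

lemma (in finite_measure) komlos_midconv:
  assumes fm [measurable]: "\<And>k. f k \<in> borel_measurable M"
    and nn: "\<And>k x. x \<in> space M \<Longrightarrow> f k x \<ge> 0"
    and bd: "\<And>k. (\<integral>\<^sup>+x. ennreal (f k x) \<partial>M) \<le> C" and C: "C < \<infinity>"
  obtains g G where "\<And>n. g n \<in> midconv f n" "G \<in> borel_measurable M" "\<And>x. G x \<ge> 0"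
    "AE x in M. (\<lambda>n. g n x) \<longlonglongrightarrow> G x"
proof -
  have mc: "g \<in> borel_measurable M" "\<And>x. x \<in> space M \<Longrightarrow> g x \<ge> 0" "(\<integral>\<^sup>+x. ennreal (g x) \<partial>M) \<le> C"
    if "g \<in> midconv f n" for g n
    using nn_integral_midconv_le[OF that fm nn, where \<Phi>="\<lambda>x r. r" and C=C] bd by auto
  define J where "J u = (\<integral>x. exp (- u x) \<partial>M)" for u :: "'a \<Rightarrow> real"
  have int: "integrable M (\<lambda>x. exp (- c * u x))" if "u \<in> midconv f n" "c \<ge> 0" for u n c
  proof (rule integrable_const_bound[where B=1])
    note [measurable] = mc(1)[OF that(1)]
    show "(\<lambda>x. exp (- c * u x)) \<in> borel_measurable M" by measurable
    show "AE x in M. norm (exp (- c * u x)) \<le> 1"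
      using mc(2)[OF that(1)] that(2) by (intro AE_I2) auto
  qed
  have int1: "integrable M (\<lambda>x. exp (- u x))" if "u \<in> midconv f n" for u n
    using int[OF that, of 1] by simp
  \<comment> \<open>Tails shrink with \<open>n\<close>, so these infima increase; the total mass
    bounds them and they converge. Near-minimisers are then picked in tails so late that the infimum
    is within \<epsilon> of its limit.\<close>
  define s where "s n = Inf (J ` midconv f n)" for n
  have J0: "J u \<ge> 0" for u unfolding J_def by simp
  have bdd: "bdd_below (J ` midconv f n)" for n using J0 by (intro bdd_belowI[of _ 0]) auto
  have ne: "midconv f n \<noteq> {}" for n using midconv.base[of n n f] by auto
  have s_le: "s n \<le> J u" if "u \<in> midconv f n" for u n
    unfolding s_def using that bdd by (intro cInf_lower) auto
  have "incseq s"
    unfolding s_def by (intro incseq_SucI cInf_superset_mono)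
      (use ne bdd in \<open>auto intro!: imageI dest: midconv_mono[of n "Suc n" for n, rotated]\<close>)
  have s_bd: "s n \<le> measure M (space M)" for n
  proof -
    have "s n \<le> J (f n)" by (intro s_le midconv.base) simp
    also have "\<dots> \<le> (\<integral>x. 1 \<partial>M)"
      unfolding J_def using nn by (intro integral_mono int1[of _ n] midconv.base) auto
    finally show ?thesis by simp
  qed
  obtain S where S: "s \<longlonglongrightarrow> S" "\<And>n. s n \<le> S"
    using incseq_convergent[OF \<open>incseq s\<close>, of "measure M (space M)"] s_bd by auto
  \<comment> \<open>The rate 4^-k leaves a factor 2^k to spare:
    \<open>a \<le> (1/2)^k + 2^k * a^2\<close> will turn a square-mean bound of order 4^-k into a
    summable bound in the mean.\<close>
  define \<epsilon> :: "nat \<Rightarrow> real" where "\<epsilon> k = (1/4)^k" for k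
  have eps: "\<epsilon> k > 0" for k by (simp add: \<epsilon>_def)
  have eps_mono: "\<epsilon> (Suc k) \<le> \<epsilon> k" for k by (simp add: \<epsilon>_def)
  have "\<exists>n\<ge>k. s n \<ge> S - \<epsilon> k" for k
  proof -
    have "\<forall>\<^sub>F n in sequentially. s n > S - \<epsilon> k"
      using S(1) eps[of k] by (intro order_tendstoD(1)) auto
    then obtain m where "\<And>n. n \<ge> m \<Longrightarrow> s n > S - \<epsilon> k" by (auto simp: eventually_sequentially)
    from this[of "max m k"] show ?thesis by (intro exI[of _ "max m k"]) auto
  qed
  then obtain N where N: "\<And>k. N k \<ge> k" "\<And>k. s (N k) \<ge> S - \<epsilon> k" by metis
  have "\<exists>u\<in>midconv f (N k). J u < s (N k) + \<epsilon> k" for k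
    using cInf_lessD[of "J ` midconv f (N k)" "s (N k) + \<epsilon> k"] ne eps[of k] by (auto simp: s_def)
  then obtain g where g: "\<And>k. g k \<in> midconv f (N k)" "\<And>k. J (g k) < s (N k) + \<epsilon> k" by metis
  have gk: "g k \<in> midconv f k" for k using midconv_mono[OF N(1) g(1)] .
  note gm [measurable] = mc(1)[OF gk]
  define v where "v k x = exp (- (g k x / 2))" for k x
  have vm [measurable]: "v k \<in> borel_measurable M" for k unfolding v_def by measurable
  have v_sq: "(v k x)\<^sup>2 = exp (- g k x)" for k x
    by (simp add: v_def power2_eq_square exp_add[symmetric])
  have v_mul: "v k x * v l x = exp (- ((g k x + g l x) / 2))" for k l x
    by (simp add: v_def exp_add[symmetric] field_simps)
  have key: "(\<integral>x. (v k x - v (Suc k) x)\<^sup>2 \<partial>M) \<le> 4 * \<epsilon> k" for k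
  proof -
    let ?m = "\<lambda>x. (g k x + g (Suc k) x) / 2"
    \<comment> \<open>The midpoint of two consecutive choices lies in the longer of their two tails,
      so the infimum over that tail bounds it from below.\<close>
    define n where "n = min (N k) (N (Suc k))"
    have mid: "?m \<in> midconv f n"
      by (intro midconv.mid midconv_mono[OF _ g(1)]) (auto simp: n_def)
    have "S - \<epsilon> k \<le> s n" using N(2)[of k] N(2)[of "Suc k"] eps_mono[of k]
      by (auto simp: n_def min_def)
    also have "\<dots> \<le> J ?m" by (rule s_le[OF mid])
    finally have Jm: "J ?m \<ge> S - \<epsilon> k" .
    have "(\<integral>x. (v k x - v (Suc k) x)\<^sup>2 \<partial>M) = (\<integral>x. exp (- g k x) + exp (- g (Suc k) x) - 2 * exp (- ?m x) \<partial>M)"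
      by (intro Bochner_Integration.integral_cong refl)
         (simp add: power2_diff v_sq mult.assoc v_mul)
    also have "\<dots> = J (g k) + J (g (Suc k)) - 2 * J ?m"
      unfolding J_def using int1[OF gk[of k]] int1[OF gk[of "Suc k"]] int1[OF mid]
      by simp
    also have "\<dots> \<le> 4 * \<epsilon> k" using Jm g(2)[of k] g(2)[of "Suc k"] S(2)[of "N k"] S(2)[of "N (Suc k)"] eps_mono[of k]
      by simp
    finally show ?thesis .
  qed
  have L1: "(\<integral>\<^sup>+x. ennreal \<bar>v (Suc k) x - v k x\<bar> \<partial>M) \<le> ennreal ((measure M (space M) + 4) * (1/2)^k)" for k
  proof -
    have v1: "\<bar>v (Suc k) x - v k x\<bar> \<le> 1" if "x \<in> space M" for x
    proof -
      have "0 < v k x" "0 < v (Suc k) x" "v k x \<le> 1" "v (Suc k) x \<le> 1"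
        using mc(2)[OF gk[of k] that] mc(2)[OF gk[of "Suc k"] that] by (auto simp: v_def)
      thus ?thesis by linarith
    qed
    have i: "integrable M (\<lambda>x. (v k x - v (Suc k) x)\<^sup>2)"
    proof (rule integrable_const_bound[where B=1])
      show "AE x in M. norm ((v k x - v (Suc k) x)\<^sup>2) \<le> 1"
        using v1 by (intro AE_I2) (simp add: abs_square_le_1 abs_minus_commute)
    qed measurable
    have "(\<integral>\<^sup>+x. ennreal \<bar>v (Suc k) x - v k x\<bar> \<partial>M) \<le> (\<integral>\<^sup>+x. ennreal ((1/2)^k + 2^k * (v k x - v (Suc k) x)\<^sup>2) \<partial>M)"
    proof (intro nn_integral_mono ennreal_leI)
      fix x
      have *: "a \<le> (1/2)^k + 2^k * a\<^sup>2" if "a \<ge> 0" for a :: real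
      proof -
        have "0 \<le> ((1/2)^k - a)\<^sup>2" by simp
        hence "2 * (1/2)^k * a \<le> (1/2)^k * (1/2)^k + a\<^sup>2" by (simp add: power2_eq_square algebra_simps)
        hence "2^k * (2 * (1/2)^k * a) \<le> 2^k * ((1/2)^k * (1/2)^k + a\<^sup>2)" by simp
        hence "2 * (2^k * (1/2)^k) * a \<le> (2^k * (1/2)^k) * (1/2)^k + 2^k * a\<^sup>2"
          by (simp only: algebra_simps)
        moreover have "2^k * (1/2::real)^k = 1" by (simp flip: power_mult_distrib)
        ultimately have "2 * a \<le> (1/2)^k + 2^k * a\<^sup>2" by simp
        thus ?thesis using that by linarith
      qed
      show "\<bar>v (Suc k) x - v k x\<bar> \<le> (1/2)^k + 2^k * (v k x - v (Suc k) x)\<^sup>2"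
        using *[of "\<bar>v (Suc k) x - v k x\<bar>"] by (simp add: power2_commute)
    qed
    also have "\<dots> = ennreal (\<integral>x. (1/2)^k + 2^k * (v k x - v (Suc k) x)\<^sup>2 \<partial>M)"
      using i by (intro nn_integral_eq_integral) auto
    also have "\<dots> = ennreal ((1/2)^k * measure M (space M) + 2^k * (\<integral>x. (v k x - v (Suc k) x)\<^sup>2 \<partial>M))"
      using i by (simp add: mult.commute)
    also have "\<dots> \<le> ennreal ((1/2)^k * measure M (space M) + 2^k * (4 * \<epsilon> k))"
      using key[of k] by (intro ennreal_leI add_left_mono mult_left_mono) auto
    also have "2^k * (4 * \<epsilon> k) = 4 * (1/2)^k"
      by (simp add: \<epsilon>_def power_one_over field_simps flip: power_mult_distrib)
    finally show ?thesis by (simp add: algebra_simps)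
  qed
  have "(\<integral>\<^sup>+x. (\<Sum>k. ennreal \<bar>v (Suc k) x - v k x\<bar>) \<partial>M) = (\<Sum>k. \<integral>\<^sup>+x. ennreal \<bar>v (Suc k) x - v k x\<bar> \<partial>M)"
    by (intro nn_integral_suminf) measurable
  also have "\<dots> \<le> (\<Sum>k. ennreal ((measure M (space M) + 4) * (1/2)^k))"
    by (intro suminf_le L1) auto
  also have "\<dots> = ennreal (\<Sum>k. (measure M (space M) + 4) * (1/2)^k)"
    by (intro suminf_ennreal2 summable_mult summable_geometric) (auto intro: add_nonneg_nonneg)
  also have "\<dots> < \<infinity>" by simp
  finally have "AE x in M. (\<Sum>k. ennreal \<bar>v (Suc k) x - v k x\<bar>) \<noteq> \<infinity>"
    by (intro nn_integral_PInf_AE) auto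
  hence conv: "AE x in M. convergent (\<lambda>k. v k x)"
  proof (rule AE_mp, intro AE_I2 impI)
    fix x assume "(\<Sum>k. ennreal \<bar>v (Suc k) x - v k x\<bar>) \<noteq> \<infinity>"
    hence "summable (\<lambda>k. \<bar>v (Suc k) x - v k x\<bar>)" by (intro summable_suminf_not_top) auto
    hence "summable (\<lambda>k. v (Suc k) x - v k x)" by (rule summable_rabs_cancel)
    hence "convergent (\<lambda>n. \<Sum>k<n. v (Suc k) x - v k x)" by (simp add: summable_iff_convergent)
    hence "convergent (\<lambda>n. v n x - v 0 x)" using sum_lessThan_telescope[of "\<lambda>k. v k x"] by simp
    hence "convergent (\<lambda>n. (v n x - v 0 x) + v 0 x)" by (intro convergent_add convergent_const)
    thus "convergent (\<lambda>n. v n x)" by simp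
  qed
  have "(\<integral>\<^sup>+x. liminf (\<lambda>k. ennreal (g k x)) \<partial>M) \<le> liminf (\<lambda>k. \<integral>\<^sup>+x. ennreal (g k x) \<partial>M)"
    by (intro nn_integral_liminf) measurable
  also have "\<dots> \<le> liminf (\<lambda>k::nat. C)" by (intro Liminf_mono always_eventually allI mc(3)[OF gk])
  also have "\<dots> < \<infinity>" using C by (simp add: Liminf_const)
  finally have fin: "AE x in M. liminf (\<lambda>k. ennreal (g k x)) \<noteq> \<infinity>"
    by (intro nn_integral_PInf_AE) auto
  \<comment> \<open>The limit of \<open>exp (- g / 2)\<close> determines that of \<open>g\<close>
    through the logarithm. The maximum with 0 gives a sign everywhere, also where there is no
    convergence.\<close>
  define G where "G x = max 0 (- 2 * ln (lim (\<lambda>k. v k x)))" for x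
  have Gm: "G \<in> borel_measurable M" unfolding G_def by measurable
  have lim: "AE x in M. (\<lambda>n. g n x) \<longlonglongrightarrow> G x"
    using conv fin AE_space
  proof (eventually_elim)
    case (elim x)
    define V where "V = lim (\<lambda>k. v k x)"
    have V: "(\<lambda>k. v k x) \<longlonglongrightarrow> V" unfolding V_def using elim(1) by (simp add: convergent_LIMSEQ_iff)
    have v0: "v k x > 0" for k by (simp add: v_def)
    have "V \<ge> 0" using V v0 by (intro LIMSEQ_le_const[OF V]) (auto intro: less_imp_le)
    have gv: "g k x = - 2 * ln (v k x)" for k by (simp add: v_def)
    \<comment> \<open>A limit 0 would mean that \<open>g k x\<close> tends to infinity, which
      Fatou's lemma has excluded for almost every point.\<close>
    have "V \<noteq> 0"
    proof
      assume "V = 0"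
      hence "filterlim (\<lambda>k. v k x) (at_right 0) sequentially"
        using V v0 by (intro tendsto_imp_filterlim_at_right) auto
      hence "filterlim (\<lambda>k. ln (v k x)) at_bot sequentially"
        by (rule filterlim_compose[OF ln_at_0])
      hence "filterlim (\<lambda>k. - ln (v k x)) at_top sequentially"
        by (simp add: filterlim_uminus_at_bot)
      hence "filterlim (\<lambda>k. 2 * (- ln (v k x))) at_top sequentially"
        by (intro filterlim_tendsto_pos_mult_at_top[OF tendsto_const]) auto
      hence "filterlim (\<lambda>k. -2 * ln (v k x)) at_top sequentially" by simp
      hence "(\<lambda>k. ennreal (g k x)) \<longlonglongrightarrow> \<infinity>"
        unfolding gv infinity_ennreal_def by (rule ennreal_tendsto_top_eq_at_top[THEN iffD2])
      hence "liminf (\<lambda>k. ennreal (g k x)) = \<infinity>" by (intro lim_imp_Liminf) auto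
      with elim(2) show False by simp
    qed
    with \<open>V \<ge> 0\<close> have "V > 0" by simp
    hence l: "(\<lambda>n. g n x) \<longlonglongrightarrow> - 2 * ln V"
      unfolding gv by (intro tendsto_intros V) auto
    have "- 2 * ln V \<ge> 0" using mc(2)[OF gk elim(3)] by (intro LIMSEQ_le_const[OF l]) auto
    thus ?case using l by (simp add: G_def V_def)
  qed
  show thesis by (rule that[OF gk Gm _ lim]) (simp add: G_def)
qed

section \<open>Cubes, compactness and measurability in R^N\<close>

definition cubeN :: "nat \<Rightarrow> real \<Rightarrow> (nat \<Rightarrow> real) set" where
  "cubeN N r = {x \<in> RN N. \<forall>i<N. \<bar>x i\<bar> \<le> r}"

abbreviation icube :: "nat \<Rightarrow> real \<Rightarrow> (nat \<Rightarrow> real) \<Rightarrow> 'a::zero_neq_one" where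
  "icube N r \<equiv> indicator (cubeN N r)"

lemma space_lebN [simp]: "space (lebN N) = RN N"
  by (auto simp: lebN_def RN_def space_PiM)

lemma sigma_finite_lebN: "sigma_finite_measure (lebN N)"
proof -
  interpret product_sigma_finite "\<lambda>_::nat. lborel :: real measure" ..
  show ?thesis unfolding lebN_def by (rule sigma_finite) simp
qed

lemma space_lebT [simp]: "space (lebT T) = {0..T}"
  by (simp add: lebT_def space_restrict_space)

lemma emeasure_lebT: "T \<ge> 0 \<Longrightarrow> emeasure (lebT T) (space (lebT T)) = T"
  by (simp add: lebT_def emeasure_restrict_space space_restrict_space)

lemma finite_measure_lebT: "finite_measure (lebT T)"
  by (rule finite_measureI) (simp add: lebT_def emeasure_restrict_space space_restrict_space emeasure_lborel_Icc_eq)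

lemma fun_upd_RN [simp]: "x \<in> RN N \<Longrightarrow> i < N \<Longrightarrow> x(i := s) \<in> RN N"
  by (auto simp: RN_def PiE_def extensional_def)

lemma restrict_RN [simp]: "restrict f {..<N} \<in> RN N"
  by (auto simp: RN_def)

lemma RN_eqI: "x \<in> RN N \<Longrightarrow> y \<in> RN N \<Longrightarrow> (\<And>i. i < N \<Longrightarrow> x i = y i) \<Longrightarrow> x = y"
  unfolding RN_def by (rule PiE_ext) auto

lemma RN_undefined: "x \<in> RN N \<Longrightarrow> i \<ge> N \<Longrightarrow> x i = undefined"
  by (auto simp: RN_def PiE_def extensional_def)

lemma restrict_RN_id: "x \<in> RN N \<Longrightarrow> restrict x {..<N} = x"
  by (auto simp: RN_def)

lemma cubeN_subset: "cubeN N r \<subseteq> RN N"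
  by (auto simp: cubeN_def)

lemma cubeN_mono: "r \<le> r' \<Longrightarrow> cubeN N r \<subseteq> cubeN N r'"
  by (auto simp: cubeN_def intro: order_trans)

lemma cubeN_PiE: "cubeN N r = PiE {..<N} (\<lambda>_. {-r..r})"
  by (auto simp: cubeN_def RN_def PiE_def Pi_def abs_le_iff; fastforce)

lemma sets_cubeN [measurable]: "cubeN N r \<in> sets (lebN N)"
  unfolding cubeN_PiE lebN_def by (intro sets_PiM_I_finite) auto

lemma emeasure_cubeN: "emeasure (lebN N) (cubeN N r) < \<infinity>"
proof -
  interpret product_sigma_finite "\<lambda>_::nat. lborel :: real measure" ..
  show ?thesis unfolding lebN_def cubeN_PiE
    by (subst emeasure_PiM) (auto simp: ennreal_power power_0_left emeasure_lborel_Icc_eq)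
qed

lemma measurable_lebN_component [measurable]: "i < N \<Longrightarrow> (\<lambda>x. x i) \<in> borel_measurable (lebN N)"
  unfolding lebN_def by (rule measurable_component_singleton[of _ _ "\<lambda>_. lborel", simplified]) auto

text \<open>Embeds R^N into the space of all functions with its Borel sets: coordinates from
  \<open>N\<close> on are constantly \<open>undefined\<close>. Continuity in the function space
  topology thus gives measurability for \<open>lebN N\<close>.\<close>

lemma measurable_id_lebN: "(\<lambda>x. x) \<in> borel_measurable (lebN N)"
proof (rule measurable_coordinatewise_then_product)
  fix i show "(\<lambda>x. x i) \<in> borel_measurable (lebN N)"
  proof (cases "i < N")
    case False
    have "(\<lambda>x. x i) \<in> borel_measurable (lebN N) \<longleftrightarrow> (\<lambda>x::nat \<Rightarrow> real. undefined::real) \<in> borel_measurable (lebN N)"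
      using False by (intro measurable_cong) (auto simp: RN_undefined)
    then show ?thesis by simp
  qed measurable
qed

lemma sets_RN_borel: "RN N \<in> sets borel"
proof -
  have "RN N = (\<Inter>i. {x. i \<ge> N \<longrightarrow> x i = undefined})"
    by (auto simp: RN_def PiE_def extensional_def)
  also have "\<dots> \<in> sets borel" by measurable
  finally show ?thesis .
qed

lemma borel_measurable_lebN_continuous:
  assumes "continuous_on (RN N) f"
  shows "f \<in> borel_measurable (lebN N)"
proof -
  have 1: "f \<in> borel_measurable (restrict_space borel (RN N))"
    using assms by (rule borel_measurable_continuous_on_restrict)
  have 2: "(\<lambda>x. x) \<in> lebN N \<rightarrow>\<^sub>M restrict_space borel (RN N)"
    by (rule measurable_restrict_space2[OF _ measurable_id_lebN]) auto
  from measurable_compose[OF 2 1] show ?thesis .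
qed

lemma borel_measurable_lebT_lebN_continuous:
  assumes "continuous_on ({0..T} \<times> RN N) (\<lambda>(t, x). f t x :: real)"
  shows "(\<lambda>(t, x). f t x) \<in> borel_measurable (lebT T \<Otimes>\<^sub>M lebN N)"
proof -
  have 1: "(\<lambda>(t, x). f t x) \<in> borel_measurable (restrict_space borel ({0..T} \<times> RN N))"
    using assms by (rule borel_measurable_continuous_on_restrict)
  have a: "(\<lambda>z. fst z) \<in> borel_measurable (lebT T \<Otimes>\<^sub>M lebN N)"
    by (rule measurable_compose[OF measurable_fst]) (auto simp: lebT_def intro: measurable_restrict_space1)
  have b: "(\<lambda>z. snd z) \<in> borel_measurable (lebT T \<Otimes>\<^sub>M lebN N)"
    by (rule measurable_compose[OF measurable_snd measurable_id_lebN])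
  have "(\<lambda>z. (fst z, snd z)) \<in> borel_measurable (lebT T \<Otimes>\<^sub>M lebN N)"
    by (rule borel_measurable_Pair[OF a b])
  hence 2: "(\<lambda>z. z) \<in> (lebT T \<Otimes>\<^sub>M lebN N) \<rightarrow>\<^sub>M restrict_space borel ({0..T} \<times> RN N)"
    by (intro measurable_restrict_space2) (auto simp: space_pair_measure)
  from measurable_compose[OF 2 1] show ?thesis .
qed

lemma measurable_fun_upd_lebN [measurable (raw)]:
  assumes [measurable]: "f \<in> M \<rightarrow>\<^sub>M lebN N" "g \<in> borel_measurable M" and i: "i < N"
  shows "(\<lambda>z. (f z)(i := g z)) \<in> M \<rightarrow>\<^sub>M lebN N"
  unfolding lebN_def
proof (rule measurable_PiM_single')
  fix k assume k: "k \<in> {..<N}"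
  have f: "(\<lambda>z. f z k) \<in> borel_measurable M" 
    by (rule measurable_compose[OF assms(1) measurable_lebN_component]) (use k in auto)
  show "(\<lambda>z. ((f z)(i := g z)) k) \<in> M \<rightarrow>\<^sub>M lborel"
    using f by (cases "k = i") auto
next
  have "f \<in> space M \<rightarrow> RN N" using measurable_space[OF assms(1)] by auto
  thus "(\<lambda>z. (f z)(i := g z)) \<in> space M \<rightarrow> {..<N} \<rightarrow>\<^sub>E space lborel"
    using i by (auto simp: RN_def PiE_def extensional_def Pi_def)
qed

text \<open>With the coordinates from \<open>N\<close> on frozen to one value, the cube is a product
  of compact sets over all indices, and Tychonoff's theorem applies.\<close>

lemma compact_cubeN: "compact (cubeN N r)"
proof -
  let ?S = "\<lambda>i. if i < N then {-r..r} else {undefined :: real}"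
  have "compactin (product_topology (\<lambda>_::nat. euclidean :: real topology) UNIV) (PiE UNIV ?S)"
    by (subst compactin_PiE) auto
  hence "compact (PiE UNIV ?S)" by (simp add: euclidean_product_topology)
  also have "PiE UNIV ?S = cubeN N r"
    by (auto simp: cubeN_PiE PiE_def Pi_def extensional_def split: if_splits)
  finally show ?thesis .
qed

text \<open>The metric of the function space is at most twice the largest distance among finitely
  many coordinates plus a geometric tail. This translates coordinatewise closeness into the metric
  in which uniform continuity is stated.\<close>

lemma dist_RN_le:
  assumes "x \<in> RN N" "y \<in> RN N" "\<And>i. i < N \<Longrightarrow> \<bar>x i - y i\<bar> \<le> d" "d \<ge> 0"
  shows "dist x y \<le> 2 * d"
proof (rule field_le_epsilon)
  fix e :: real assume "e > 0"
  then obtain n where n: "(1/2)^n < e" using real_arch_pow_inv[of e "1/2"] by auto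
  have le: "dist (x k) (y k) \<le> d" for k
    using assms RN_undefined[of x N k] RN_undefined[of y N k]
    by (cases "k < N") (auto simp: dist_real_def)
  have "dist x y \<le> 2 * Max {dist (x (from_nat m)) (y (from_nat m))|m. m \<le> n} + (1/2)^n"
    by (rule dist_fun_le_dist_first_terms)
  also have "Max {dist (x (from_nat m)) (y (from_nat m))|m. m \<le> n} \<le> d"
  proof (rule Max.boundedI)
    have "{dist (x (from_nat m)) (y (from_nat m))|m. m \<le> n} = (\<lambda>m. dist (x (from_nat m)) (y (from_nat m))) ` {..n}"
      by auto
    thus "finite {dist (x (from_nat m)) (y (from_nat m))|m. m \<le> n}" by simp
  qed (use le in auto)
  finally show "dist x y \<le> 2 * d + e" using n by simp
qed

lemma cubeN_uniformly_continuous: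
  assumes c: "continuous_on ({0..T} \<times> RN N) (\<lambda>(t, x). f t x :: real)" and e: "e > 0"
  obtains d where "d > 0" "\<And>t t' x x'. t \<in> {0..T} \<Longrightarrow> t' \<in> {0..T} \<Longrightarrow> x \<in> cubeN N r \<Longrightarrow> x' \<in> cubeN N r \<Longrightarrow>
     \<bar>t - t'\<bar> \<le> d \<Longrightarrow> (\<And>i. i < N \<Longrightarrow> \<bar>x i - x' i\<bar> \<le> d) \<Longrightarrow> \<bar>f t x - f t' x'\<bar> < e"
proof -
  have "compact ({0..T} \<times> cubeN N r)" by (intro compact_Times compact_cubeN) auto
  moreover have "continuous_on ({0..T} \<times> cubeN N r) (\<lambda>(t, x). f t x)"
    by (rule continuous_on_subset[OF c]) (use cubeN_subset in auto)
  ultimately have "uniformly_continuous_on ({0..T} \<times> cubeN N r) (\<lambda>(t, x). f t x)"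
    by (intro compact_uniformly_continuous)
  then obtain d where d: "d > 0" "\<And>z z'. z \<in> {0..T} \<times> cubeN N r \<Longrightarrow> z' \<in> {0..T} \<times> cubeN N r \<Longrightarrow>
     dist z' z < d \<Longrightarrow> dist ((\<lambda>(t, x). f t x) z') ((\<lambda>(t, x). f t x) z) < e"
    using e unfolding uniformly_continuous_on_def by metis
  show thesis
  proof (rule that[of "d/4"])
    fix t t' x x' assume *: "t \<in> {0..T}" "t' \<in> {0..T}" "x \<in> cubeN N r" "x' \<in> cubeN N r"
      "\<bar>t - t'\<bar> \<le> d/4" "\<And>i. i < N \<Longrightarrow> \<bar>x i - x' i\<bar> \<le> d/4"
    have "dist x x' \<le> 2 * (d/4)" using * d(1) cubeN_subset[of N r] by (intro dist_RN_le[of _ N]) auto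
    hence "dist (t, x) (t', x') < d"
      using *(5) d(1) unfolding dist_Pair_Pair
      by (intro le_less_trans[OF sqrt_sum_squares_le_sum_abs]) (auto simp: dist_real_def)
    from d(2)[of "(t', x')" "(t, x)", OF _ _ this] show "\<bar>f t x - f t' x'\<bar> < e"
      using * by (auto simp: dist_real_def)
  qed (use d in auto)
qed

lemma cubeN_bounded:
  fixes T :: real
  assumes c: "continuous_on ({0..T} \<times> RN N) (\<lambda>(t, x). f t x :: real)"
  obtains B where "B > 0" "\<And>t x. t \<in> {0..T} \<Longrightarrow> x \<in> cubeN N r \<Longrightarrow> \<bar>f t x\<bar> \<le> B"
proof -
  have "compact ((\<lambda>(t, x). f t x) ` ({0..T} \<times> cubeN N r))"
    by (intro compact_continuous_image compact_Times compact_cubeN continuous_on_subset[OF c] compact_Icc)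
       (use cubeN_subset in auto)
  hence "bounded ((\<lambda>(t, x). f t x) ` ({0..T} \<times> cubeN N r))" by (rule compact_imp_bounded)
  then obtain B where "B > 0" "\<forall>y\<in>(\<lambda>(t, x). f t x) ` ({0..T} \<times> cubeN N r). norm y \<le> B"
    by (auto simp: bounded_pos)
  thus thesis by (intro that[of B]) auto
qed

lemma continuous_on_lift_time: "continuous_on S f \<Longrightarrow> continuous_on (A \<times> S) (\<lambda>(t, x). f x)"
  unfolding case_prod_unfold
  by (rule continuous_on_compose2[of S f]) (auto intro: continuous_intros)

lemma continuous_on_slice_time:
  assumes "continuous_on (A \<times> S) (\<lambda>(t, x). f t x)" "t \<in> A" shows "continuous_on S (f t)"
proof -
  have "continuous_on S (\<lambda>x. (\<lambda>(t, x). f t x) (t, x))"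
    by (rule continuous_on_compose2[OF assms(1)]) (use assms(2) in \<open>auto intro!: continuous_intros\<close>)
  thus ?thesis by simp
qed

section \<open>Partial derivatives and compactly supported densities\<close>

text \<open>Explicit partial derivatives are easier to work with than those defined through \<^const>\<open>deriv\<close>.\<close>

definition C1N :: "nat \<Rightarrow> ((nat \<Rightarrow> real) \<Rightarrow> real) \<Rightarrow> (nat \<Rightarrow> (nat \<Rightarrow> real) \<Rightarrow> real) \<Rightarrow> bool" where
  "C1N N \<phi> \<phi>' \<longleftrightarrow> continuous_on (RN N) \<phi> \<and> (\<forall>i<N. continuous_on (RN N) (\<phi>' i) \<and>
     (\<forall>x\<in>RN N. ((\<lambda>s. \<phi> (x(i := s))) has_real_derivative \<phi>' i x) (at (x i))))"

lemma C1N_D: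
  assumes "C1N N \<phi> \<phi>'"
  shows "continuous_on (RN N) \<phi>" "i < N \<Longrightarrow> continuous_on (RN N) (\<phi>' i)"
    "i < N \<Longrightarrow> x \<in> RN N \<Longrightarrow> ((\<lambda>s. \<phi> (x(i := s))) has_real_derivative \<phi>' i (x(i := s))) (at s)"
proof -
  show "continuous_on (RN N) \<phi>" "i < N \<Longrightarrow> continuous_on (RN N) (\<phi>' i)"
    using assms by (auto simp: C1N_def)
  assume "i < N" "x \<in> RN N"
  hence "((\<lambda>s'. \<phi> ((x(i := s))(i := s'))) has_real_derivative \<phi>' i (x(i := s))) (at ((x(i := s)) i))"
    using assms unfolding C1N_def by (metis fun_upd_RN)
  thus "((\<lambda>s. \<phi> (x(i := s))) has_real_derivative \<phi>' i (x(i := s))) (at s)" by simp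
qed

lemma C1N_pderiv:
  assumes "continuous_on (RN N) f" "has_partials N f" "\<And>i. i < N \<Longrightarrow> continuous_on (RN N) (pderiv i f)"
  shows "C1N N f (\<lambda>i. pderiv i f)"
  using assms unfolding C1N_def has_partials_def pderiv_def
  by (auto simp: DERIV_deriv_iff_real_differentiable)

lemma pderiv_C1N: "C1N N f f' \<Longrightarrow> i < N \<Longrightarrow> x \<in> RN N \<Longrightarrow> pderiv i f x = f' i x"
  unfolding C1N_def pderiv_def by (auto intro: DERIV_imp_deriv)

lemma C1N_ln:
  assumes "C1N N w w'" "\<And>x. x \<in> RN N \<Longrightarrow> w x > 0"
  shows "C1N N (\<lambda>x. ln (w x)) (\<lambda>i x. w' i x / w x)"
  unfolding C1N_def
proof (intro conjI allI impI ballI)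
  have nz: "\<And>x. x \<in> RN N \<Longrightarrow> w x \<noteq> 0" using assms(2) by (metis less_irrefl)
  show "continuous_on (RN N) (\<lambda>x. ln (w x))"
    using C1N_D(1)[OF assms(1)] nz by (intro continuous_intros) auto
  fix i assume i: "i < N"
  show "continuous_on (RN N) (\<lambda>x. w' i x / w x)"
    using C1N_D(1,2)[OF assms(1)] i nz by (intro continuous_intros) auto
  fix x assume x: "x \<in> RN N"
  show "((\<lambda>s. ln (w (x(i := s)))) has_real_derivative w' i x / w x) (at (x i))"
    using C1N_D(3)[OF assms(1) i x, of "x i"] assms(2)[OF x]
    by (auto intro!: derivative_eq_intros simp: divide_inverse mult.commute)
qed

text \<open>Radius, height and mass are parameters because a substep enlarges the first two in a
  controlled way and keeps the third.\<close>

definition dens :: "nat \<Rightarrow> real \<Rightarrow> real \<Rightarrow> real \<Rightarrow> ((nat \<Rightarrow> real) \<Rightarrow> real) \<Rightarrow> bool" where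
  "dens N r b m p \<longleftrightarrow> p \<in> borel_measurable (lebN N) \<and>
     (\<forall>x\<in>RN N. 0 \<le> p x \<and> p x \<le> b \<and> (p x \<noteq> 0 \<longrightarrow> x \<in> cubeN N r)) \<and> (\<integral>x. p x \<partial>lebN N) = m"

lemma dens_D:
  assumes "dens N r b m p"
  shows "p \<in> borel_measurable (lebN N)" "x \<in> RN N \<Longrightarrow> 0 \<le> p x" "x \<in> RN N \<Longrightarrow> p x \<le> b"
    "x \<in> RN N \<Longrightarrow> p x \<noteq> 0 \<Longrightarrow> x \<in> cubeN N r" "(\<integral>x. p x \<partial>lebN N) = m"
  using assms by (auto simp: dens_def)

lemma integrable_cubeN:
  fixes g :: "(nat \<Rightarrow> real) \<Rightarrow> real"
  assumes "g \<in> borel_measurable (lebN N)" "\<And>x. x \<in> RN N \<Longrightarrow> \<bar>g x\<bar> \<le> B"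
    "\<And>x. x \<in> RN N \<Longrightarrow> g x \<noteq> 0 \<Longrightarrow> x \<in> cubeN N r"
  shows "integrable (lebN N) g"
proof (rule Bochner_Integration.integrable_bound[where f="\<lambda>x. B * icube N r x"])
  show "integrable (lebN N) (\<lambda>x. B * icube N r x)"
    using emeasure_cubeN by (intro integrable_mult_right integrable_real_indicator) auto
  show "AE x in lebN N. norm (g x) \<le> norm (B * icube N r x)"
  proof (rule AE_I2)
    fix x assume "x \<in> space (lebN N)"
    hence x: "x \<in> RN N" by simp
    show "norm (g x) \<le> norm (B * icube N r x)"
      using assms(2)[OF x] assms(3)[OF x] by (cases "g x = 0") (auto simp: indicator_def)
  qed
qed fact

lemma dens_integrable:
  assumes "dens N r b m p" "\<kappa> \<in> borel_measurable (lebN N)"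
    "\<And>x. x \<in> RN N \<Longrightarrow> p x \<noteq> 0 \<Longrightarrow> \<bar>\<kappa> x\<bar> \<le> \<epsilon>"
  shows "integrable (lebN N) (\<lambda>x. \<kappa> x * p x)"
proof (rule integrable_cubeN[where B="\<bar>\<epsilon>\<bar> * \<bar>b\<bar>" and r=r])
  note [measurable] = dens_D(1)[OF assms(1)] assms(2)
  show "(\<lambda>x. \<kappa> x * p x) \<in> borel_measurable (lebN N)" by measurable
  fix x assume x: "x \<in> RN N"
  show "\<bar>\<kappa> x * p x\<bar> \<le> \<bar>\<epsilon>\<bar> * \<bar>b\<bar>"
  proof (cases "p x = 0")
    case False
    thus ?thesis using dens_D(2,3)[OF assms(1) x] assms(3)[OF x] unfolding abs_mult
      by (intro mult_mono) auto
  qed auto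
  show "\<kappa> x * p x \<noteq> 0 \<Longrightarrow> x \<in> cubeN N r" using dens_D(4)[OF assms(1) x] by auto
qed

lemma dens_integrable1: "dens N r b m p \<Longrightarrow> integrable (lebN N) p"
  using dens_integrable[of N r b m p "\<lambda>_. 1" 1] by simp

lemma dens_mass_nonneg: "dens N r b m p \<Longrightarrow> m \<ge> 0"
  using dens_D(2,5)[of N r b m p] by (metis Bochner_Integration.integral_nonneg space_lebN)

lemma dens_integral_le:
  assumes "dens N r b m p" "\<kappa> \<in> borel_measurable (lebN N)"
    "\<And>x. x \<in> RN N \<Longrightarrow> p x \<noteq> 0 \<Longrightarrow> \<bar>\<kappa> x\<bar> \<le> \<epsilon>"
  shows "\<bar>\<integral>x. \<kappa> x * p x \<partial>lebN N\<bar> \<le> \<epsilon> * m"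
proof -
  have "\<bar>\<integral>x. \<kappa> x * p x \<partial>lebN N\<bar> \<le> (\<integral>x. \<bar>\<kappa> x * p x\<bar> \<partial>lebN N)"
    by (rule integral_abs_bound)
  also have "\<dots> \<le> (\<integral>x. \<epsilon> * p x \<partial>lebN N)"
  proof (rule integral_mono)
    show "integrable (lebN N) (\<lambda>x. \<bar>\<kappa> x * p x\<bar>)" using dens_integrable[OF assms] by simp
    show "integrable (lebN N) (\<lambda>x. \<epsilon> * p x)" using dens_integrable1[OF assms(1)] by simp
    fix x assume "x \<in> space (lebN N)"
    hence x: "x \<in> RN N" by simp
    show "\<bar>\<kappa> x * p x\<bar> \<le> \<epsilon> * p x"
      using dens_D(2)[OF assms(1) x] assms(3)[OF x] unfolding abs_mult
      by (cases "p x = 0") (auto intro!: mult_right_mono)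
  qed
  also have "\<dots> = \<epsilon> * m" using dens_D(5)[OF assms(1)] by simp
  finally show ?thesis .
qed

lemma dens_mono: "dens N r b m p \<Longrightarrow> r \<le> r' \<Longrightarrow> b \<le> b' \<Longrightarrow> dens N r' b' m p"
  using cubeN_mono[of r r' N] unfolding dens_def by (auto intro: order_trans)

text \<open>\<open>x * ln x\<close> is continuous on a compact interval starting at 0, hence bounded
  along a bounded density, and the product vanishes off the cube.\<close>

lemma dens_xlnx_integrable:
  assumes q: "dens N r' b' m' q" shows "integrable (lebN N) (\<lambda>x. ln (q x) * q x)"
proof -
  note [measurable] = dens_D(1)[OF q]
  have "compact ((\<lambda>x. x * ln x) ` {0..b'})"
    by (intro compact_continuous_image continuous_on_subset[OF continuous_on_xlnx]) auto
  then obtain B where B: "\<And>x. x \<in> {0..b'} \<Longrightarrow> \<bar>x * ln x\<bar> \<le> B"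
    using compact_imp_bounded bounded_iff by (metis (no_types, lifting) image_eqI real_norm_def)
  show ?thesis
  proof (rule integrable_cubeN[where r=r' and B=B])
    fix x assume x: "x \<in> RN N"
    show "\<bar>ln (q x) * q x\<bar> \<le> B" using B[of "q x"] dens_D(2,3)[OF q x] by (simp add: mult.commute)
    show "ln (q x) * q x \<noteq> 0 \<Longrightarrow> x \<in> cubeN N r'" using dens_D(4)[OF q x] by auto
  qed measurable
qed

section \<open>A single coordinate shift\<close>

text \<open>\<open>f' i\<close> is the derivative of \<open>f i\<close> in its own coordinate:
  substep \<open>i\<close> moves this coordinate alone and its Jacobian contains no other
  derivative. \<open>C\<close> bounds speeds everywhere, \<open>c\<close> bounds these derivatives
  in the cube of radius \<open>R\<close> in which all mass will stay.\<close>

locale euler_scheme =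
  fixes N :: nat and T C R c :: real and f f' :: "nat \<Rightarrow> real \<Rightarrow> (nat \<Rightarrow> real) \<Rightarrow> real"
  assumes T_pos: "T > 0" and C_pos: "C > 0" and R_pos: "R > 0" and c_pos: "c > 0"
    and f_cont: "\<And>i. i < N \<Longrightarrow> continuous_on ({0..T} \<times> RN N) (\<lambda>(t, x). f i t x)"
    and f'_cont: "\<And>i. i < N \<Longrightarrow> continuous_on ({0..T} \<times> RN N) (\<lambda>(t, x). f' i t x)"
    and f_deriv: "\<And>i t x. i < N \<Longrightarrow> t \<in> {0..T} \<Longrightarrow> x \<in> RN N \<Longrightarrow>
       ((\<lambda>s. f i t (x(i := s))) has_real_derivative f' i t x) (at (x i))"
    and f_bound: "\<And>i t x. i < N \<Longrightarrow> t \<in> {0..T} \<Longrightarrow> x \<in> RN N \<Longrightarrow> \<bar>f i t x\<bar> \<le> C"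
    and f'_bound: "\<And>i t x. i < N \<Longrightarrow> t \<in> {0..T} \<Longrightarrow> x \<in> cubeN N R \<Longrightarrow> \<bar>f' i t x\<bar> \<le> c"
begin

abbreviation "leb \<equiv> lebN N"

definition shift :: "real \<Rightarrow> real \<Rightarrow> nat \<Rightarrow> (nat \<Rightarrow> real) \<Rightarrow> nat \<Rightarrow> real" where
  "shift \<tau> t i x = x(i := x i - \<tau> * f i t x)"

text \<open>Characteristics are traced backwards: the new value at \<open>x\<close> is the old one
  at the shifted point times the Jacobian of the shift, so no map has to be inverted. Outside the
  cube the Jacobian is not controlled and the value is set to 0.\<close>

definition substep :: "real \<Rightarrow> real \<Rightarrow> nat \<Rightarrow> ((nat \<Rightarrow> real) \<Rightarrow> real) \<Rightarrow> (nat \<Rightarrow> real) \<Rightarrow> real" where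
  "substep \<tau> t i p x = (if x \<in> cubeN N R then p (shift \<tau> t i x) * (1 - \<tau> * f' i t x) else 0)"

lemma f_measurable: "i < N \<Longrightarrow> t \<in> {0..T} \<Longrightarrow> f i t \<in> borel_measurable leb"
  "i < N \<Longrightarrow> t \<in> {0..T} \<Longrightarrow> f' i t \<in> borel_measurable leb"
  using continuous_on_slice_time[OF f_cont] continuous_on_slice_time[OF f'_cont]
  by (auto intro!: borel_measurable_lebN_continuous)

lemma shift_RN [simp]: "i < N \<Longrightarrow> x \<in> RN N \<Longrightarrow> shift \<tau> t i x \<in> RN N"
  by (simp add: shift_def)

lemma shift_measurable: "i < N \<Longrightarrow> t \<in> {0..T} \<Longrightarrow> shift \<tau> t i \<in> leb \<rightarrow>\<^sub>M leb"
  using f_measurable(1)[of i t] unfolding shift_def[abs_def] by measurable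

lemma substep_measurable:
  assumes "i < N" "t \<in> {0..T}" and [measurable]: "p \<in> borel_measurable leb"
  shows "substep \<tau> t i p \<in> borel_measurable leb"
proof -
  note [measurable] = f_measurable[OF assms(1,2)] shift_measurable[OF assms(1,2)]
  show ?thesis unfolding substep_def[abs_def] by measurable
qed

text \<open>Substitution on each line parallel to coordinate \<open>i\<close>. The step restriction
  keeps the Jacobian nonnegative; the gap between \<open>r\<close> and \<open>R\<close> ensures that
  the image of the segment still covers the support of \<open>p\<close>.\<close>

lemma nn_integral_substep:
  assumes i: "i < N" and t: "t \<in> {0..T}" and \<tau>: "\<tau> > 0" "\<tau> * c \<le> 1/2"
    and p [measurable]: "p \<in> borel_measurable leb"
    and p0: "\<And>x. x \<in> RN N \<Longrightarrow> 0 \<le> p x"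
    and ps: "\<And>x. x \<in> RN N \<Longrightarrow> p x \<noteq> 0 \<Longrightarrow> x \<in> cubeN N r" and r: "r + \<tau> * C \<le> R"
    and \<phi> [measurable]: "\<phi> \<in> borel_measurable leb"
  shows "(\<integral>\<^sup>+x. \<phi> (shift \<tau> t i x) * ennreal (substep \<tau> t i p x) \<partial>leb) = (\<integral>\<^sup>+x. \<phi> x * ennreal (p x) \<partial>leb)"
proof -
  interpret product_sigma_finite "\<lambda>_::nat. lborel :: real measure" ..
  let ?I = "{..<N} - {i}"
  have ins: "{..<N} = insert i ?I" using i by auto
  note [measurable] = shift_measurable[OF i t, of \<tau>] substep_measurable[OF i t p, of \<tau>]
  have split: "(\<integral>\<^sup>+x. F x \<partial>leb) = (\<integral>\<^sup>+x. (\<integral>\<^sup>+s. F (x(i := s)) \<partial>lborel) \<partial>PiM ?I (\<lambda>_. lborel))"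
    if "F \<in> borel_measurable leb" for F :: "(nat \<Rightarrow> real) \<Rightarrow> ennreal"
  proof -
    have "F \<in> borel_measurable (PiM (insert i ?I) (\<lambda>_. lborel))"
      using that unfolding lebN_def ins[symmetric] .
    from product_nn_integral_insert[OF _ _ this] show ?thesis
      unfolding lebN_def ins[symmetric] by auto
  qed
  have "(\<integral>\<^sup>+s. \<phi> (shift \<tau> t i (x(i := s))) * ennreal (substep \<tau> t i p (x(i := s))) \<partial>lborel) =
    (\<integral>\<^sup>+s. \<phi> (x(i := s)) * ennreal (p (x(i := s))) \<partial>lborel)" if x: "x \<in> space (PiM ?I (\<lambda>_. lborel))" for x
  proof -
    have xR: "x \<in> RN N" using x by (auto simp: space_PiM RN_def PiE_def extensional_def)
    hence xsR: "x(i := s) \<in> RN N" for s using i by simp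
    show ?thesis
    proof (cases "\<forall>k<N. k \<noteq> i \<longrightarrow> \<bar>x k\<bar> \<le> R")
      \<comment> \<open>The line runs outside the cube in another coordinate, which the shift does
        not touch, and both sides vanish.\<close>
      case False
      then obtain k where k: "k < N" "k \<noteq> i" "\<bar>x k\<bar> > R" by force
      have "substep \<tau> t i p (x(i := s)) = 0" for s
        using k by (force simp: substep_def cubeN_def)
      moreover have "p (x(i := s)) = 0" for s
      proof (rule ccontr)
        assume "p (x(i := s)) \<noteq> 0"
        from ps[OF xsR this] have "\<bar>x k\<bar> \<le> r" using k by (force simp: cubeN_def)
        also have "r \<le> R" using r \<tau> C_pos by (smt (verit) mult_nonneg_nonneg)
        finally show False using k by simp
      qed
      ultimately show ?thesis by simp
    next
      case True
      have cube: "x(i := s) \<in> cubeN N R \<longleftrightarrow> s \<in> {-R..R}" for s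
        using True xsR[of s] i by (auto simp: cubeN_def abs_le_iff)
      define g where "g s = s - \<tau> * f i t (x(i := s))" for s
      define g' where "g' s = 1 - \<tau> * f' i t (x(i := s))" for s
      have sh: "shift \<tau> t i (x(i := s)) = x(i := g s)" for s
        by (simp add: shift_def g_def)
      define \<Phi> where "\<Phi> u = \<phi> (x(i := u)) * ennreal (p (x(i := u)))" for u
      have upd: "(\<lambda>u. x(i := u)) \<in> borel \<rightarrow>\<^sub>M leb"
        using xR by (intro measurable_fun_upd_lebN i) auto
      note [measurable] = measurable_compose[OF upd \<phi>] measurable_compose[OF upd p]
      have \<Phi>m: "\<Phi> \<in> borel_measurable borel" unfolding \<Phi>_def by measurable
      have fd: "((\<lambda>s. f i t (x(i := s))) has_real_derivative f' i t (x(i := s))) (at s)" for s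
        using f_deriv[OF i t xsR[of s]] by simp
      have gd: "(g has_real_derivative g' s) (at s)" for s
        unfolding g_def g'_def by (auto intro!: derivative_eq_intros fd)
      have upd_cont: "continuous_on UNIV (\<lambda>s. x(i := s))"
      proof (rule continuous_on_coordinatewise_then_product)
        fix k show "continuous_on UNIV (\<lambda>s. (x(i := s)) k)" by (cases "k = i") auto
      qed
      have gc: "continuous_on {-R..R} g'"
        unfolding g'_def
        by (intro continuous_intros continuous_on_compose2[OF continuous_on_slice_time[OF f'_cont[OF i] t]]
              continuous_on_subset[OF upd_cont]) (use xsR in auto)
      have g'0: "g' s \<ge> 0" if "s \<in> {-R..R}" for s
      proof -
        have "\<bar>f' i t (x(i := s))\<bar> \<le> c" using f'_bound[OF i t] cube that by blast
        hence "\<tau> * f' i t (x(i := s)) \<le> \<tau> * c" using \<tau> by (intro mult_left_mono) auto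
        thus ?thesis using \<tau> unfolding g'_def by linarith
      qed
      have "(\<integral>\<^sup>+s. \<phi> (shift \<tau> t i (x(i := s))) * ennreal (substep \<tau> t i p (x(i := s))) \<partial>lborel) =
        (\<integral>\<^sup>+s. \<Phi> (g s) * ennreal (g' s) * indicator {-R..R} s \<partial>lborel)"
        using g'0 p0[OF xsR] by (intro nn_integral_cong)
          (auto simp: substep_def cube \<Phi>_def sh g'_def[symmetric] ennreal_mult mult_ac indicator_def)
      also have "\<dots> = (\<integral>\<^sup>+u. \<Phi> u * indicator {g (-R)..g R} u \<partial>lborel)"
        using R_pos by (intro nn_integral_substitution_aux[OF \<Phi>m _ gd gc g'0, symmetric]) auto
      \<comment> \<open>The end points move by at most \<open>\<tau> * C\<close>, so the image
        interval contains the segment from \<open>-r\<close> to \<open>r\<close>, off which \<Phi>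
        vanishes.\<close>
      also have "\<dots> = (\<integral>\<^sup>+u. \<Phi> u \<partial>lborel)"
      proof (rule nn_integral_cong)
        fix u :: real
        have "u \<in> {g (-R)..g R}" if "\<Phi> u \<noteq> 0"
        proof -
          have "p (x(i := u)) \<noteq> 0" using that by (auto simp: \<Phi>_def)
          from ps[OF xsR this] have u: "\<bar>u\<bar> \<le> r" using i by (auto simp: cubeN_def)
          have "\<bar>\<tau> * f i t (x(i := s))\<bar> \<le> \<tau> * C" for s
            using f_bound[OF i t xsR[of s]] \<tau> by (simp add: abs_mult)
          from this[of "-R"] this[of R] show ?thesis using u r by (auto simp: g_def abs_le_iff)
        qed
        thus "\<Phi> u * indicator {g (-R)..g R} u = \<Phi> u" by (cases "\<Phi> u = 0") auto
      qed
      finally show ?thesis by (simp add: \<Phi>_def)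
    qed
  qed
  thus ?thesis
    by (subst (1 2) split) (measurable, rule nn_integral_cong, simp)
qed

text \<open>In push-forward form the substitution applies to signed functions, and gives
  integrability and value of the integral alike.\<close>

lemma distr_substep:
  assumes "i < N" "t \<in> {0..T}" "\<tau> > 0" "\<tau> * c \<le> 1/2" "dens N r b m p" "r + \<tau> * C \<le> R"
  shows "distr (density leb (\<lambda>x. ennreal (substep \<tau> t i p x))) leb (shift \<tau> t i) = density leb (\<lambda>x. ennreal (p x))"
proof (rule measure_eqI)
  note [measurable] = dens_D(1)[OF assms(5)] shift_measurable[OF assms(1,2)] substep_measurable[OF assms(1,2)]
  fix A assume "A \<in> sets (distr (density leb (\<lambda>x. ennreal (substep \<tau> t i p x))) leb (shift \<tau> t i))"
  hence A [measurable]: "A \<in> sets leb" by simp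
  have "emeasure (distr (density leb (\<lambda>x. ennreal (substep \<tau> t i p x))) leb (shift \<tau> t i)) A
    = (\<integral>\<^sup>+x. ennreal (substep \<tau> t i p x) * indicator (shift \<tau> t i -` A \<inter> RN N) x \<partial>leb)"
    using measurable_sets[OF shift_measurable[OF assms(1,2)] A]
    by (subst emeasure_distr) (auto simp: emeasure_density)
  also have "\<dots> = (\<integral>\<^sup>+x. indicator A (shift \<tau> t i x) * ennreal (substep \<tau> t i p x) \<partial>leb)"
    by (intro nn_integral_cong) (auto simp: indicator_def)
  also have "\<dots> = (\<integral>\<^sup>+x. indicator A x * ennreal (p x) \<partial>leb)"
    using assms dens_D[OF assms(5)] by (intro nn_integral_substep) auto
  also have "\<dots> = emeasure (density leb (\<lambda>x. ennreal (p x))) A"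
    by (simp add: emeasure_density mult.commute)
  finally show "emeasure (distr (density leb (\<lambda>x. ennreal (substep \<tau> t i p x))) leb (shift \<tau> t i)) A = \<dots>" .
qed simp

text \<open>The two integral statements are the push-forward identity read through densities. The
  support grows by \<open>\<tau> * C\<close> because a point charged after the step is that close to
  one charged before; the height grows by the largest Jacobian.\<close>

lemma substep_facts:
  assumes i: "i < N" and t: "t \<in> {0..T}" and \<tau>: "\<tau> > 0" "\<tau> * c \<le> 1/2"
    and p: "dens N r b m p" and r: "r + \<tau> * C \<le> R"
  shows substep_integral: "\<And>\<phi>. \<phi> \<in> borel_measurable leb \<Longrightarrow>
        (\<integral>x. \<phi> (shift \<tau> t i x) * substep \<tau> t i p x \<partial>leb) = (\<integral>x. \<phi> x * p x \<partial>leb)" 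
    and substep_integrable: "\<And>\<phi>. \<phi> \<in> borel_measurable leb \<Longrightarrow>
        integrable leb (\<lambda>x. \<phi> (shift \<tau> t i x) * substep \<tau> t i p x) \<longleftrightarrow> integrable leb (\<lambda>x. \<phi> x * p x)" 
    and substep_dens: "dens N (r + \<tau> * C) (b * (1 + \<tau> * c)) m (substep \<tau> t i p)"
    and substep_shift: "\<And>x. x \<in> RN N \<Longrightarrow> substep \<tau> t i p x \<noteq> 0 \<Longrightarrow> x \<in> cubeN N R \<and> shift \<tau> t i x \<in> cubeN N R \<and>
          p (shift \<tau> t i x) > 0 \<and> substep \<tau> t i p x = p (shift \<tau> t i x) * (1 - \<tau> * f' i t x)"
    and shift_close: "\<And>x k. x \<in> RN N \<Longrightarrow> \<bar>x k - shift \<tau> t i x k\<bar> \<le> \<tau> * C"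
proof -
  note [measurable] = dens_D(1)[OF p] shift_measurable[OF i t] substep_measurable[OF i t]
  have J: "1 - \<tau> * f' i t x \<ge> 0" "1 - \<tau> * f' i t x \<le> 1 + \<tau> * c" if "x \<in> cubeN N R" for x
  proof -
    have "\<bar>\<tau> * f' i t x\<bar> \<le> \<tau> * c"
      using f'_bound[OF i t that] \<tau> by (simp add: abs_mult)
    hence "\<tau> * f' i t x \<le> \<tau> * c" "- (\<tau> * f' i t x) \<le> \<tau> * c" by (simp_all only: abs_le_iff)
    thus "1 - \<tau> * f' i t x \<ge> 0" "1 - \<tau> * f' i t x \<le> 1 + \<tau> * c" using \<tau> by linarith+
  qed
  have \<tau>C: "\<tau> * C > 0" using \<tau> C_pos by simp
  have nn: "substep \<tau> t i p x \<ge> 0" if "x \<in> RN N" for x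
    using J[of x] dens_D(2)[OF p shift_RN[OF i that, of \<tau> t]] by (auto simp: substep_def)
  show cl: "\<bar>x k - shift \<tau> t i x k\<bar> \<le> \<tau> * C" if "x \<in> RN N" for x k
    using f_bound[OF i t that] \<tau> \<tau>C by (auto simp: shift_def abs_mult)
  show fact4: "x \<in> cubeN N R \<and> shift \<tau> t i x \<in> cubeN N R \<and>
          p (shift \<tau> t i x) > 0 \<and> substep \<tau> t i p x = p (shift \<tau> t i x) * (1 - \<tau> * f' i t x)" 
    if x: "x \<in> RN N" and nz: "substep \<tau> t i p x \<noteq> 0" for x
  proof -
    have a: "x \<in> cubeN N R" "p (shift \<tau> t i x) \<noteq> 0" using nz by (auto simp: substep_def split: if_splits)
    have "shift \<tau> t i x \<in> cubeN N r" using a x i by (intro dens_D(4)[OF p]) auto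
    hence "shift \<tau> t i x \<in> cubeN N R" using cubeN_mono[of r R N] r \<tau>C by auto
    thus ?thesis using a dens_D(2)[OF p shift_RN[OF i x, of \<tau> t]] by (auto simp: substep_def)
  qed
  have int: "(\<integral>x. \<phi> (shift \<tau> t i x) * substep \<tau> t i p x \<partial>leb) = (\<integral>x. \<phi> x * p x \<partial>leb)"
    if [measurable]: "\<phi> \<in> borel_measurable leb" for \<phi> :: "_ \<Rightarrow> real"
  proof -
    have "(\<integral>x. \<phi> x * p x \<partial>leb) = (\<integral>x. \<phi> x \<partial>density leb (\<lambda>x. ennreal (p x)))"
      using dens_D(2)[OF p] by (subst integral_density) (auto simp: mult.commute)
    also have "\<dots> = (\<integral>x. \<phi> (shift \<tau> t i x) * substep \<tau> t i p x \<partial>leb)"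
      using nn unfolding distr_substep[OF i t \<tau> p r, symmetric]
      by (subst integral_distr; (subst integral_density)?) (auto simp: mult.commute)
    finally show ?thesis by simp
  qed
  show "(\<integral>x. \<phi> (shift \<tau> t i x) * substep \<tau> t i p x \<partial>leb) = (\<integral>x. \<phi> x * p x \<partial>leb)"
    if "\<phi> \<in> borel_measurable leb" for \<phi> :: "_ \<Rightarrow> real"
    by (rule int[OF that])
  show "integrable leb (\<lambda>x. \<phi> (shift \<tau> t i x) * substep \<tau> t i p x) \<longleftrightarrow> integrable leb (\<lambda>x. \<phi> x * p x)"
    if [measurable]: "\<phi> \<in> borel_measurable leb" for \<phi> :: "_ \<Rightarrow> real"
  proof -
    have "integrable leb (\<lambda>x. \<phi> x * p x) \<longleftrightarrow> integrable (density leb (\<lambda>x. ennreal (p x))) \<phi>"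
      using dens_D(2)[OF p] by (subst integrable_density) (auto simp: mult.commute)
    also have "\<dots> \<longleftrightarrow> integrable leb (\<lambda>x. \<phi> (shift \<tau> t i x) * substep \<tau> t i p x)"
      using nn unfolding distr_substep[OF i t \<tau> p r, symmetric]
      by (subst integrable_distr_eq; (subst integrable_density)?) (auto simp: mult.commute)
    finally show ?thesis by simp
  qed
  show "dens N (r + \<tau> * C) (b * (1 + \<tau> * c)) m (substep \<tau> t i p)"
    unfolding dens_def
  proof (intro conjI ballI impI)
    show "substep \<tau> t i p \<in> borel_measurable leb" by measurable
    show "(\<integral>x. substep \<tau> t i p x \<partial>leb) = m" using int[of "\<lambda>_. 1"] dens_D(5)[OF p] by simp
    fix x assume x: "x \<in> RN N"
    show "0 \<le> substep \<tau> t i p x" by (rule nn[OF x])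
    have b: "b \<ge> 0" using dens_D(2,3)[OF p x] by simp
    show "substep \<tau> t i p x \<le> b * (1 + \<tau> * c)"
    proof (cases "x \<in> cubeN N R")
      case True
      thus ?thesis using J[OF True] dens_D(2,3)[OF p shift_RN[OF i x, of \<tau> t]] b
        by (auto simp: substep_def intro!: mult_mono)
    next
      case False
      thus ?thesis using b \<tau> c_pos by (simp add: substep_def)
    qed
    assume nz: "substep \<tau> t i p x \<noteq> 0"
    hence "shift \<tau> t i x \<in> cubeN N r" using fact4[OF x nz] x i by (intro dens_D(4)[OF p]) auto
    hence "\<bar>x k\<bar> \<le> r + \<tau> * C" if "k < N" for k
      using cl[OF x, of k] that by (auto simp: cubeN_def)
    thus "x \<in> cubeN N (r + \<tau> * C)" using x by (auto simp: cubeN_def)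
  qed
qed

primrec substeps :: "real \<Rightarrow> real \<Rightarrow> nat \<Rightarrow> ((nat \<Rightarrow> real) \<Rightarrow> real) \<Rightarrow> (nat \<Rightarrow> real) \<Rightarrow> real" where
  "substeps \<tau> t 0 p = p"
| "substeps \<tau> t (Suc i) p = substep \<tau> t i (substeps \<tau> t i p)"

lemma substeps_dens:
  assumes t: "t \<in> {0..T}" and \<tau>: "\<tau> > 0" "\<tau> * c \<le> 1/2"
    and p: "dens N r b m p" and r: "r + real N * (\<tau> * C) \<le> R" and i: "i \<le> N"
  shows "dens N (r + real i * (\<tau> * C)) (b * (1 + \<tau> * c) ^ i) m (substeps \<tau> t i p)"
  using i
proof (induction i)
  case 0
  then show ?case using p by simp
next
  case (Suc i)
  have "r + real (Suc i) * (\<tau> * C) \<le> r + real N * (\<tau> * C)"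
    using Suc.prems \<tau> C_pos by (intro add_left_mono mult_right_mono) auto
  hence "r + real i * (\<tau> * C) + \<tau> * C \<le> R" using r by (simp add: algebra_simps)
  from substep_dens[OF _ t \<tau> Suc.IH this, of i] Suc.prems show ?case
    by (simp add: algebra_simps)
qed

text \<open>Oscillation over the largest displacement \<open>\<tau> * C\<close> of one substep; the
  spatial reading errors of the scheme are measured by it.\<close>

definition close_on_cube :: "real \<Rightarrow> real \<Rightarrow> ((nat \<Rightarrow> real) \<Rightarrow> real) \<Rightarrow> bool" where
  "close_on_cube \<tau> \<epsilon> \<kappa> \<longleftrightarrow> (\<forall>x\<in>cubeN N R. \<forall>x'\<in>cubeN N R. (\<forall>k<N. \<bar>x k - x' k\<bar> \<le> \<tau> * C) \<longrightarrow> \<bar>\<kappa> x - \<kappa> x'\<bar> \<le> \<epsilon>)"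

context
  fixes i t \<tau> r b m p
  assumes i: "i < N" and t: "t \<in> {0..T}" and \<tau>: "\<tau> > 0" "\<tau> * c \<le> 1/2"
    and p: "dens N r b m p" and r: "r + \<tau> * C \<le> R"
begin

lemma dens_cube_R: "x \<in> RN N \<Longrightarrow> p x \<noteq> 0 \<Longrightarrow> x \<in> cubeN N R"
proof -
  assume "x \<in> RN N" "p x \<noteq> 0"
  hence "x \<in> cubeN N r" by (rule dens_D(4)[OF p])
  moreover have "r \<le> R" using r mult_pos_pos[OF \<tau>(1) C_pos] by linarith
  ultimately show ?thesis using cubeN_mono by blast
qed

lemma substep_change:
  assumes km [measurable]: "\<kappa> \<in> borel_measurable leb" and kb: "\<And>x. x \<in> cubeN N R \<Longrightarrow> \<bar>\<kappa> x\<bar> \<le> B"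
  shows "(\<integral>x. \<kappa> x * substep \<tau> t i p x \<partial>leb) - (\<integral>x. \<kappa> x * p x \<partial>leb) = (\<integral>x. (\<kappa> x - \<kappa> (shift \<tau> t i x)) * substep \<tau> t i p x \<partial>leb)"
proof -
  note F = substep_facts[OF i t \<tau> p r]
  have "(\<integral>x. \<kappa> x * p x \<partial>leb) = (\<integral>x. \<kappa> (shift \<tau> t i x) * substep \<tau> t i p x \<partial>leb)"
    by (rule F(1)[symmetric]) fact
  moreover have "integrable leb (\<lambda>x. \<kappa> (shift \<tau> t i x) * substep \<tau> t i p x)"
    unfolding F(2)[OF km] by (rule dens_integrable[OF p km]) (use dens_cube_R kb in blast)
  moreover have "integrable leb (\<lambda>x. \<kappa> x * substep \<tau> t i p x)"
    by (rule dens_integrable[OF F(3) km]) (use F(4) kb in blast)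
  ultimately show ?thesis by (simp add: left_diff_distrib)
qed

lemma substep_change_le:
  assumes km: "\<kappa> \<in> borel_measurable leb" and kb: "\<And>x. x \<in> cubeN N R \<Longrightarrow> \<bar>\<kappa> x\<bar> \<le> B"
    and "close_on_cube \<tau> \<epsilon> \<kappa>"
  shows "\<bar>(\<integral>x. \<kappa> x * substep \<tau> t i p x \<partial>leb) - (\<integral>x. \<kappa> x * p x \<partial>leb)\<bar> \<le> \<epsilon> * m"
proof -
  note F = substep_facts[OF i t \<tau> p r]
  note [measurable] = km shift_measurable[OF i t, of \<tau>]
  have eq: "(\<integral>x. \<kappa> x * substep \<tau> t i p x \<partial>leb) - (\<integral>x. \<kappa> x * p x \<partial>leb) = (\<integral>x. (\<kappa> x - \<kappa> (shift \<tau> t i x)) * substep \<tau> t i p x \<partial>leb)"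
    by (rule substep_change[OF km kb])
  show ?thesis unfolding eq
  proof (rule dens_integral_le[OF F(3)])
    show "(\<lambda>x. \<kappa> x - \<kappa> (shift \<tau> t i x)) \<in> borel_measurable leb" by measurable
    fix x assume x: "x \<in> RN N" "substep \<tau> t i p x \<noteq> 0"
    show "\<bar>\<kappa> x - \<kappa> (shift \<tau> t i x)\<bar> \<le> \<epsilon>"
      using F(4)[OF x] F(5)[OF x(1)] assms(3) unfolding close_on_cube_def by blast
  qed
qed

text \<open>The mean value theorem in coordinate \<open>i\<close> writes the increment of \<phi> as
  \<open>\<tau> * f i t x\<close> times the derivative at an intermediate point. The displacement is
  at most \<open>\<tau> * C\<close>, which explains the tolerance \<open>\<epsilon> / C\<close> for
  the derivative.\<close>

lemma substep_test:
  assumes \<phi>: "C1N N \<phi> \<phi>'" and cl: "close_on_cube \<tau> (\<epsilon> / C) (\<phi>' i)" and \<epsilon>: "\<epsilon> \<ge> 0"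
  shows "\<bar>(\<integral>x. \<phi> x * substep \<tau> t i p x \<partial>leb) - (\<integral>x. \<phi> x * p x \<partial>leb) - \<tau> * (\<integral>x. (f i t x * \<phi>' i x) * substep \<tau> t i p x \<partial>leb)\<bar> \<le> \<tau> * \<epsilon> * m"
proof -
  note F = substep_facts[OF i t \<tau> p r]
  have m1: "\<phi> \<in> borel_measurable leb" "\<phi>' i \<in> borel_measurable leb"
    using C1N_D(1,2)[OF \<phi>] i by (auto intro: borel_measurable_lebN_continuous)
  note [measurable] = m1 shift_measurable[OF i t, of \<tau>] f_measurable(1)[OF i t]
  obtain B where B: "\<And>x. x \<in> cubeN N R \<Longrightarrow> \<bar>\<phi> x\<bar> \<le> B"
    using cubeN_bounded[OF continuous_on_lift_time[OF C1N_D(1)[OF \<phi>], of "{0..T}"], of R] t by metis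
  obtain B' where B': "B' > 0" "\<And>x. x \<in> cubeN N R \<Longrightarrow> \<bar>\<phi>' i x\<bar> \<le> B'"
    using cubeN_bounded[OF continuous_on_lift_time[OF C1N_D(2)[OF \<phi> i], of "{0..T}"], of R] t by metis
  have pt: "\<bar>\<phi> x - \<phi> (shift \<tau> t i x) - \<tau> * (f i t x * \<phi>' i x)\<bar> \<le> \<tau> * \<epsilon>" 
    if x: "x \<in> RN N" "substep \<tau> t i p x \<noteq> 0" for x
  proof -
    let ?a = "x i - \<tau> * f i t x"
    have xc: "x \<in> cubeN N R" "shift \<tau> t i x \<in> cubeN N R" using F(4)[OF x] by auto
    have "\<exists>z. min ?a (x i) \<le> z \<and> z \<le> max ?a (x i) \<and> \<phi> x - \<phi> (x(i := ?a)) = (x i - ?a) * \<phi>' i (x(i := z))"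
    proof (cases ?a "x i" rule: linorder_cases)
      case less
      from MVT2[OF less, of "\<lambda>s. \<phi> (x(i := s))" "\<lambda>s. \<phi>' i (x(i := s))"] C1N_D(3)[OF \<phi> i x(1)]
      obtain z where "?a < z" "z < x i" "\<phi> (x(i := x i)) - \<phi> (x(i := ?a)) = (x i - ?a) * \<phi>' i (x(i := z))" by auto
      then show ?thesis by (intro exI[of _ z]) auto
    next
      case equal
      then show ?thesis by (intro exI[of _ "x i"]) auto
    next
      case greater
      from MVT2[OF greater, of "\<lambda>s. \<phi> (x(i := s))" "\<lambda>s. \<phi>' i (x(i := s))"] C1N_D(3)[OF \<phi> i x(1)]
      obtain z where "x i < z" "z < ?a" "\<phi> (x(i := ?a)) - \<phi> (x(i := x i)) = (?a - x i) * \<phi>' i (x(i := z))" by auto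
      then show ?thesis by (intro exI[of _ z]) (auto simp: algebra_simps)
    qed
    then obtain z where z: "min ?a (x i) \<le> z" "z \<le> max ?a (x i)"
      "\<phi> x - \<phi> (x(i := ?a)) = (x i - ?a) * \<phi>' i (x(i := z))" by blast
    have "\<bar>x i\<bar> \<le> R" "\<bar>?a\<bar> \<le> R" using xc i by (auto simp: cubeN_def shift_def)
    hence "\<bar>z\<bar> \<le> R" using z by (auto simp: min_def max_def split: if_splits)
    hence zc: "x(i := z) \<in> cubeN N R" using xc i by (auto simp: cubeN_def)
    have "\<bar>\<tau> * f i t x\<bar> \<le> \<tau> * C" using f_bound[OF i t x(1)] \<tau> by (simp add: abs_mult)
    hence "\<bar>z - x i\<bar> \<le> \<tau> * C" using z(1,2) by (auto simp: min_def max_def split: if_splits)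
    hence "\<forall>k<N. \<bar>(x(i := z)) k - x k\<bar> \<le> \<tau> * C" using mult_pos_pos[OF \<tau>(1) C_pos] by auto
    hence "\<bar>\<phi>' i (x(i := z)) - \<phi>' i x\<bar> \<le> \<epsilon> / C" using cl zc xc unfolding close_on_cube_def by blast
    moreover have "\<phi> x - \<phi> (shift \<tau> t i x) - \<tau> * (f i t x * \<phi>' i x) = (\<tau> * f i t x) * (\<phi>' i (x(i := z)) - \<phi>' i x)"
      using z(3) by (simp add: shift_def algebra_simps)
    ultimately have "\<bar>\<phi> x - \<phi> (shift \<tau> t i x) - \<tau> * (f i t x * \<phi>' i x)\<bar> \<le> (\<tau> * C) * (\<epsilon> / C)"
      using \<open>\<bar>\<tau> * f i t x\<bar> \<le> \<tau> * C\<close> \<tau> C_pos by (simp only: abs_mult) (intro mult_mono, auto)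
    thus ?thesis using C_pos by simp
  qed
  have i1: "integrable leb (\<lambda>x. (\<phi> x - \<phi> (shift \<tau> t i x)) * substep \<tau> t i p x)"
  proof (rule dens_integrable[OF F(3), where \<epsilon>="B + B"])
    fix x assume "x \<in> RN N" "substep \<tau> t i p x \<noteq> 0"
    with F(4)[OF this] show "\<bar>\<phi> x - \<phi> (shift \<tau> t i x)\<bar> \<le> B + B"
      using B[of x] B[of "shift \<tau> t i x"] by auto
  qed measurable
  have i2: "integrable leb (\<lambda>x. (f i t x * \<phi>' i x) * substep \<tau> t i p x)"
  proof (rule dens_integrable[OF F(3), where \<epsilon>="C * B'"])
    fix x assume "x \<in> RN N" "substep \<tau> t i p x \<noteq> 0"
    with F(4)[OF this] show "\<bar>f i t x * \<phi>' i x\<bar> \<le> C * B'"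
      unfolding abs_mult using B'(2)[of x] f_bound[OF i t, of x] C_pos by (intro mult_mono) auto
  qed measurable
  have "(\<integral>x. \<phi> x * substep \<tau> t i p x \<partial>leb) - (\<integral>x. \<phi> x * p x \<partial>leb) - \<tau> * (\<integral>x. (f i t x * \<phi>' i x) * substep \<tau> t i p x \<partial>leb)
    = (\<integral>x. (\<phi> x - \<phi> (shift \<tau> t i x)) * substep \<tau> t i p x - \<tau> * ((f i t x * \<phi>' i x) * substep \<tau> t i p x) \<partial>leb)"
    using substep_change[OF m1(1) B] i1 i2 by simp
  also have "\<dots> = (\<integral>x. (\<phi> x - \<phi> (shift \<tau> t i x) - \<tau> * (f i t x * \<phi>' i x)) * substep \<tau> t i p x \<partial>leb)"
    by (intro Bochner_Integration.integral_cong) (auto simp: algebra_simps)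
  also have "\<bar>\<dots>\<bar> \<le> \<tau> * \<epsilon> * m"
    by (rule dens_integral_le[OF F(3)]) (use pt in auto)
  finally show ?thesis .
qed

text \<open>After the change of variables the entropy changes exactly by the integral of the
  logarithm of the Jacobian. Its quadratic remainder is at most 2 (\<tau> c)^2, that is \<tau> times
  \<open>2 * \<tau> * c\<close>^2 with \<open>c\<close> squared first.\<close>

lemma substep_entropy:
  assumes \<epsilon>: "2 * \<tau> * c\<^sup>2 \<le> \<epsilon>"
  shows "\<bar>(\<integral>x. ln (substep \<tau> t i p x) * substep \<tau> t i p x \<partial>leb) - (\<integral>x. ln (p x) * p x \<partial>leb) - \<tau> * (\<integral>x. (- f' i t x) * substep \<tau> t i p x \<partial>leb)\<bar> \<le> \<tau> * \<epsilon> * m"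
proof -
  note F = substep_facts[OF i t \<tau> p r]
  note [measurable] = dens_D(1)[OF p] dens_D(1)[OF F(3)] shift_measurable[OF i t, of \<tau>] f_measurable[OF i t]
  have lm: "(\<lambda>x. ln (p x)) \<in> borel_measurable leb" by measurable
  have i0: "integrable leb (\<lambda>x. ln (p (shift \<tau> t i x)) * substep \<tau> t i p x)"
    using F(2)[OF lm] dens_xlnx_integrable[OF p] by blast
  have i1: "integrable leb (\<lambda>x. ln (substep \<tau> t i p x) * substep \<tau> t i p x)"
    by (rule dens_xlnx_integrable[OF F(3)])
  have i2: "integrable leb (\<lambda>x. (- f' i t x) * substep \<tau> t i p x)"
    by (rule dens_integrable[OF F(3), where \<epsilon>=c]) (use F(4) f'_bound[OF i t] in auto)
  have pt: "ln (substep \<tau> t i p x) * substep \<tau> t i p x - ln (p (shift \<tau> t i x)) * substep \<tau> t i p x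
     = ln (1 - \<tau> * f' i t x) * substep \<tau> t i p x" 
    and pt2: "substep \<tau> t i p x \<noteq> 0 \<Longrightarrow> \<bar>ln (1 - \<tau> * f' i t x) + \<tau> * f' i t x\<bar> \<le> \<tau> * \<epsilon>" if x: "x \<in> RN N" for x
  proof -
    have *: "\<bar>\<tau> * f' i t x\<bar> \<le> \<tau> * c" if "substep \<tau> t i p x \<noteq> 0"
      using f'_bound[OF i t] F(4)[OF x that] \<tau> by (auto simp: abs_mult)
    show "ln (substep \<tau> t i p x) * substep \<tau> t i p x - ln (p (shift \<tau> t i x)) * substep \<tau> t i p x
     = ln (1 - \<tau> * f' i t x) * substep \<tau> t i p x"
    proof (cases "substep \<tau> t i p x = 0")
      case False
      from *[OF False] \<tau> have J: "1 - \<tau> * f' i t x > 0" by linarith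
      have "ln (substep \<tau> t i p x) = ln (p (shift \<tau> t i x)) + ln (1 - \<tau> * f' i t x)"
        using F(4)[OF x False] J by (metis ln_mult_pos)
      thus ?thesis by (simp add: algebra_simps)
    qed simp
    assume nz: "substep \<tau> t i p x \<noteq> 0"
    have "\<bar>- (\<tau> * f' i t x)\<bar> \<le> 1/2" using *[OF nz] \<tau> by linarith
    from abs_ln_one_plus_x_minus_x_bound[OF this]
    have "\<bar>ln (1 - \<tau> * f' i t x) + \<tau> * f' i t x\<bar> \<le> 2 * (\<tau> * f' i t x)\<^sup>2" by simp
    also have "\<dots> \<le> 2 * (\<tau> * c)\<^sup>2"
      using power_mono[OF *[OF nz], of 2] by simp
    also have "\<dots> = \<tau> * (2 * \<tau> * c\<^sup>2)" by (simp add: power2_eq_square)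
    also have "\<dots> \<le> \<tau> * \<epsilon>" using \<tau> \<epsilon> by (intro mult_left_mono) auto
    finally show "\<bar>ln (1 - \<tau> * f' i t x) + \<tau> * f' i t x\<bar> \<le> \<tau> * \<epsilon>" .
  qed
  have "(\<integral>x. ln (substep \<tau> t i p x) * substep \<tau> t i p x \<partial>leb) - (\<integral>x. ln (p x) * p x \<partial>leb) - \<tau> * (\<integral>x. (- f' i t x) * substep \<tau> t i p x \<partial>leb)
    = (\<integral>x. ln (substep \<tau> t i p x) * substep \<tau> t i p x - ln (p (shift \<tau> t i x)) * substep \<tau> t i p x
         - \<tau> * ((- f' i t x) * substep \<tau> t i p x) \<partial>leb)"
    unfolding F(1)[OF lm, symmetric] using i0 i1 i2 by simp
  also have "\<dots> = (\<integral>x. (ln (1 - \<tau> * f' i t x) + \<tau> * f' i t x) * substep \<tau> t i p x \<partial>leb)"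
  proof (intro Bochner_Integration.integral_cong refl)
    fix x assume "x \<in> space leb"
    hence "x \<in> RN N" by simp
    from pt[OF this] show "ln (substep \<tau> t i p x) * substep \<tau> t i p x - ln (p (shift \<tau> t i x)) * substep \<tau> t i p x
         - \<tau> * ((- f' i t x) * substep \<tau> t i p x) = (ln (1 - \<tau> * f' i t x) + \<tau> * f' i t x) * substep \<tau> t i p x"
      by (simp add: distrib_right)
  qed
  also have "\<bar>\<dots>\<bar> \<le> \<tau> * \<epsilon> * m"
    by (rule dens_integral_le[OF F(3)]) (use pt2 in auto)
  finally show ?thesis .
qed

end

end

section \<open>Full time steps and bounds uniform in the step size\<close>

context euler_scheme
begin

text \<open>\<Lambda> stands for a test integral or for the entropy. Substep \<open>i\<close>
  produces an integral against the density right after it; rereading it against the density after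
  all \<open>N\<close> substeps costs at most \<epsilon> \<open>m\<close> per later substep, which
  accounts for the factor \<open>real N * (1 + real N)\<close>.\<close>

lemma substeps_functional:
  assumes t: "t \<in> {0..T}" and \<tau>: "\<tau> > 0" "\<tau> * c \<le> 1/2"
    and p: "dens N r b m p" and r: "r + real N * (\<tau> * C) \<le> R" and \<epsilon>: "\<epsilon> \<ge> 0"
    and km: "\<And>i. i < N \<Longrightarrow> \<kappa> i \<in> borel_measurable leb"
    and kb: "\<And>i x. i < N \<Longrightarrow> x \<in> cubeN N R \<Longrightarrow> \<bar>\<kappa> i x\<bar> \<le> B"
    and kc: "\<And>i. i < N \<Longrightarrow> close_on_cube \<tau> \<epsilon> (\<kappa> i)"
    and \<Lambda>: "\<And>i. i < N \<Longrightarrow> \<bar>\<Lambda> (substeps \<tau> t (Suc i) p) - \<Lambda> (substeps \<tau> t i p)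
        - \<tau> * (\<integral>x. \<kappa> i x * substeps \<tau> t (Suc i) p x \<partial>leb)\<bar> \<le> \<tau> * \<epsilon> * m"
  shows "\<bar>\<Lambda> (substeps \<tau> t N p) - \<Lambda> p - \<tau> * (\<integral>x. (\<Sum>i<N. \<kappa> i x) * substeps \<tau> t N p x \<partial>leb)\<bar>
     \<le> \<tau> * (real N * (1 + real N) * \<epsilon> * m)"
proof -
  define Q where "Q i = substeps \<tau> t i p" for i
  have m0: "m \<ge> 0" by (rule dens_mass_nonneg[OF p])
  have Qd: "dens N (r + real i * (\<tau> * C)) (b * (1 + \<tau> * c) ^ i) m (Q i)" if "i \<le> N" for i
    unfolding Q_def by (rule substeps_dens[OF t \<tau> p r that])
  have rr: "r + real i * (\<tau> * C) + \<tau> * C \<le> R" if "i < N" for i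
  proof -
    have "r + real (Suc i) * (\<tau> * C) \<le> r + real N * (\<tau> * C)"
      using that \<tau> C_pos by (intro add_left_mono mult_right_mono) auto
    thus ?thesis using r by (simp add: algebra_simps)
  qed
  have ch: "\<bar>(\<integral>x. \<kappa> i x * Q (Suc j) x \<partial>leb) - (\<integral>x. \<kappa> i x * Q j x \<partial>leb)\<bar> \<le> \<epsilon> * m" if "i < N" "j < N" for i j
  proof -
    have Qs: "Q (Suc j) = substep \<tau> t j (Q j)" by (simp add: Q_def)
    show ?thesis unfolding Qs
      using substep_change_le[OF that(2) t \<tau> Qd rr[OF that(2)] km[OF that(1)] kb[OF that(1)] kc[OF that(1)]] that by simp
  qed
  \<comment> \<open>The induction states all earlier terms with the current density: one more
    substep adds one new term and rereads the old ones.\<close>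
  have "\<bar>\<Lambda> (Q j) - \<Lambda> (Q 0) - \<tau> * (\<Sum>i<j. \<integral>x. \<kappa> i x * Q j x \<partial>leb)\<bar> \<le> \<tau> * (real j * (1 + real N) * \<epsilon> * m)" if "j \<le> N" for j
    using that
  proof (induction j)
    case (Suc j)
    let ?X = "\<lambda>i j. \<integral>x. \<kappa> i x * Q j x \<partial>leb"
    have 1: "\<bar>\<Lambda> (Q (Suc j)) - \<Lambda> (Q j) - \<tau> * ?X j (Suc j)\<bar> \<le> \<tau> * \<epsilon> * m"
      using \<Lambda>[of j] Suc.prems by (simp add: Q_def)
    have "\<bar>(\<Sum>i<j. ?X i (Suc j)) - (\<Sum>i<j. ?X i j)\<bar> \<le> (\<Sum>i<j. \<bar>?X i (Suc j) - ?X i j\<bar>)"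
      by (simp add: sum_subtractf[symmetric])
    also have "\<dots> \<le> (\<Sum>i<j. \<epsilon> * m)" using Suc.prems by (intro sum_mono ch) auto
    also have "\<dots> \<le> real N * (\<epsilon> * m)" using Suc.prems \<epsilon> m0 by (auto intro!: mult_right_mono)
    finally have "\<tau> * \<bar>(\<Sum>i<j. ?X i (Suc j)) - (\<Sum>i<j. ?X i j)\<bar> \<le> \<tau> * (real N * (\<epsilon> * m))"
      using \<tau> by (intro mult_left_mono) auto
    hence 2: "\<bar>\<tau> * (\<Sum>i<j. ?X i (Suc j)) - \<tau> * (\<Sum>i<j. ?X i j)\<bar> \<le> \<tau> * (real N * (\<epsilon> * m))"
      using \<tau>(1) by (simp add: abs_mult flip: right_diff_distrib)
    have e1: "\<tau> * (\<Sum>i<Suc j. ?X i (Suc j)) = \<tau> * (\<Sum>i<j. ?X i (Suc j)) + \<tau> * ?X j (Suc j)"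
      by (simp add: algebra_simps)
    have e2: "\<tau> * (real (Suc j) * (1 + real N) * \<epsilon> * m) = \<tau> * (real j * (1 + real N) * \<epsilon> * m) + \<tau> * \<epsilon> * m + \<tau> * (real N * (\<epsilon> * m))"
      by (simp add: algebra_simps)
    have IH: "\<bar>\<Lambda> (Q j) - \<Lambda> (Q 0) - \<tau> * (\<Sum>i<j. ?X i j)\<bar> \<le> \<tau> * (real j * (1 + real N) * \<epsilon> * m)"
      using Suc by simp
    show ?case unfolding e1 e2 using 1 2 IH by linarith
  qed (use \<epsilon> m0 in simp)
  from this[of N] have "\<bar>\<Lambda> (Q N) - \<Lambda> (Q 0) - \<tau> * (\<Sum>i<N. \<integral>x. \<kappa> i x * Q N x \<partial>leb)\<bar> \<le> \<tau> * (real N * (1 + real N) * \<epsilon> * m)"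
    by simp
  moreover have "(\<Sum>i<N. \<integral>x. \<kappa> i x * Q N x \<partial>leb) = (\<integral>x. (\<Sum>i<N. \<kappa> i x) * Q N x \<partial>leb)"
  proof -
    have "integrable leb (\<lambda>x. \<kappa> i x * Q N x)" if "i < N" for i
    proof (rule dens_integrable[OF Qd[of N] km[OF that]])
      fix x assume "x \<in> RN N" "Q N x \<noteq> 0"
      from dens_D(4)[OF Qd[of N] this] have "x \<in> cubeN N R" using cubeN_mono[OF r, of N] by auto
      thus "\<bar>\<kappa> i x\<bar> \<le> B" by (rule kb[OF that])
    qed simp
    thus ?thesis by (subst Bochner_Integration.integral_sum[symmetric]) (auto simp: sum_distrib_right)
  qed
  ultimately show ?thesis by (simp add: Q_def)
qed

primrec evol :: "real \<Rightarrow> ((nat \<Rightarrow> real) \<Rightarrow> real) \<Rightarrow> nat \<Rightarrow> (nat \<Rightarrow> real) \<Rightarrow> real" where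
  "evol \<tau> p 0 = p"
| "evol \<tau> p (Suc k) = substeps \<tau> (real k * \<tau>) N (evol \<tau> p k)"

lemma evol_dens_aux:
  assumes \<tau>: "\<tau> > 0" "\<tau> * c \<le> 1/2" and k: "real k * \<tau> \<le> T"
    and p: "dens N K b m p" and R: "K + real N * (C * T) \<le> R"
  shows "dens N (K + real k * (real N * (\<tau> * C))) (b * (1 + \<tau> * c) ^ (k * N)) m (evol \<tau> p k)"
  using k
proof (induction k)
  case (Suc k)
  have kT: "real k * \<tau> \<le> T" using Suc.prems \<tau> by (simp add: algebra_simps)
  have "real (Suc k) * (real N * (\<tau> * C)) = (real (Suc k) * \<tau>) * (real N * C)" by simp
  also have "\<dots> \<le> T * (real N * C)" using Suc.prems C_pos by (intro mult_right_mono) auto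
  finally have "K + real k * (real N * (\<tau> * C)) + real N * (\<tau> * C) \<le> R" using R by (simp add: algebra_simps)
  from substeps_dens[OF _ \<tau> Suc.IH[OF kT] this, of "real k * \<tau>" N] kT \<tau>
  show ?case by (simp add: algebra_simps power_add)
qed (use p in simp)

text \<open>Powers of \<open>1 + \<tau> * c\<close> up to the final time are bounded by an
  exponential, so the height bound is free of the step size. The second claim keeps the smaller
  current radius, which the next step needs.\<close>

lemma evol_dens:
  assumes \<tau>: "\<tau> > 0" "\<tau> * c \<le> 1/2" and k: "real k * \<tau> \<le> T"
    and p: "dens N K b m p" and R: "K + real N * (C * T) \<le> R"
  shows "dens N R (b * exp (c * T * real N)) m (evol \<tau> p k)"
    and "\<exists>r b'. dens N r b' m (evol \<tau> p k) \<and> (real (Suc k) * \<tau> \<le> T \<longrightarrow> r + real N * (\<tau> * C) \<le> R)"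
proof -
  note E = evol_dens_aux[OF assms]
  have *: "K + real k * (real N * (\<tau> * C)) \<le> R" if "real k * \<tau> \<le> T" for k
  proof -
    have "real k * (real N * (\<tau> * C)) = (real k * \<tau>) * (real N * C)" by simp
    also have "\<dots> \<le> T * (real N * C)" using that C_pos by (intro mult_right_mono) auto
    finally show ?thesis using R by (simp add: algebra_simps)
  qed
  have b: "b \<ge> 0"
  proof -
    have "restrict (\<lambda>_. 0) {..<N} \<in> RN N" by simp
    from dens_D(2,3)[OF p this] show ?thesis by simp
  qed
  have "(1 + \<tau> * c) ^ (k * N) \<le> exp (\<tau> * c) ^ (k * N)"
    using \<tau> c_pos by (intro power_mono exp_ge_add_one_self) auto
  also have "\<dots> = exp ((real k * \<tau>) * (c * real N))" by (simp add: exp_of_nat_mult[symmetric] algebra_simps)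
  also have "\<dots> \<le> exp (T * (c * real N))" using k c_pos by (subst exp_le_cancel_iff, intro mult_right_mono) auto
  finally have "b * (1 + \<tau> * c) ^ (k * N) \<le> b * exp (c * T * real N)" using b by (intro mult_left_mono) (simp_all add: algebra_simps)
  from dens_mono[OF E *[OF k] this] show "dens N R (b * exp (c * T * real N)) m (evol \<tau> p k)" .
  show "\<exists>r b'. dens N r b' m (evol \<tau> p k) \<and> (real (Suc k) * \<tau> \<le> T \<longrightarrow> r + real N * (\<tau> * C) \<le> R)"
    using E *[of "Suc k"] by (intro exI conjI impI) (auto simp: algebra_simps)
qed

lemma eventually_close_on_cube:
  assumes k: "continuous_on ({0..T} \<times> RN N) (\<lambda>(t, x). \<kappa> t x)" and e: "\<epsilon> > 0"
  shows "\<forall>\<^sub>F \<tau> in at_right 0. (\<forall>t\<in>{0..T}. close_on_cube \<tau> \<epsilon> (\<kappa> t)) \<and>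
     (\<forall>t\<in>{0..T}. \<forall>t'\<in>{0..T}. \<forall>x\<in>cubeN N R. \<bar>t - t'\<bar> \<le> \<tau> \<longrightarrow> \<bar>\<kappa> t x - \<kappa> t' x\<bar> \<le> \<epsilon>)"
proof -
  obtain d where d: "d > 0" "\<And>t t' x x'. t \<in> {0..T} \<Longrightarrow> t' \<in> {0..T} \<Longrightarrow> x \<in> cubeN N R \<Longrightarrow> x' \<in> cubeN N R \<Longrightarrow>
     \<bar>t - t'\<bar> \<le> d \<Longrightarrow> (\<And>i. i < N \<Longrightarrow> \<bar>x i - x' i\<bar> \<le> d) \<Longrightarrow> \<bar>\<kappa> t x - \<kappa> t' x'\<bar> < \<epsilon>"
    by (rule cubeN_uniformly_continuous[OF k e, of R]) blast
  have "\<forall>\<^sub>F \<tau> in at_right 0. \<tau> < min d (d / C)"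
    using d C_pos eventually_at_right_real[of 0 "min d (d / C)"] by (auto elim!: eventually_mono)
  moreover have "\<forall>\<^sub>F \<tau>::real in at_right 0. 0 < \<tau>" by (simp add: eventually_at_right_less)
  ultimately show ?thesis
  proof eventually_elim
    case (elim \<tau>)
    hence \<tau>: "\<tau> \<le> d" "\<tau> * C \<le> d" using C_pos by (auto simp: field_simps)
    show ?case unfolding close_on_cube_def
    proof (intro conjI ballI impI)
      fix t x x' assume "t \<in> {0..T}" "x \<in> cubeN N R" "x' \<in> cubeN N R" "\<forall>k<N. \<bar>x k - x' k\<bar> \<le> \<tau> * C"
      thus "\<bar>\<kappa> t x - \<kappa> t x'\<bar> \<le> \<epsilon>" using \<tau> d(1) by (intro less_imp_le[OF d(2)]) (auto intro: order_trans)
    next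
      fix t t' x assume "t \<in> {0..T}" "t' \<in> {0..T}" "x \<in> cubeN N R" "\<bar>t - t'\<bar> \<le> \<tau>"
      thus "\<bar>\<kappa> t x - \<kappa> t' x\<bar> \<le> \<epsilon>" using \<tau> d(1) by (intro less_imp_le[OF d(2)]) auto
    qed
  qed
qed

section \<open>Piecewise constant paths in space-time\<close>

abbreviation "PM \<equiv> lebT T \<Otimes>\<^sub>M leb"

lemma pair_sigma_finite_PM: "pair_sigma_finite (lebT T) leb"
  using finite_measure_lebT[of T] sigma_finite_lebN
  by (simp add: pair_sigma_finite_def finite_measure_def)

lemma integrable_PM:
  fixes g :: "real \<times> (nat \<Rightarrow> real) \<Rightarrow> real"
  assumes "g \<in> borel_measurable PM" "\<And>t x. t \<in> {0..T} \<Longrightarrow> x \<in> RN N \<Longrightarrow> \<bar>g (t, x)\<bar> \<le> B"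
    "\<And>t x. t \<in> {0..T} \<Longrightarrow> x \<in> RN N \<Longrightarrow> g (t, x) \<noteq> 0 \<Longrightarrow> x \<in> cubeN N r"
  shows "integrable PM g"
proof (rule Bochner_Integration.integrable_bound[where f="\<lambda>z. B * indicator (space (lebT T) \<times> cubeN N r) z"])
  interpret leb: sigma_finite_measure leb by (rule sigma_finite_lebN)
  have "emeasure PM (space (lebT T) \<times> cubeN N r) = emeasure (lebT T) (space (lebT T)) * emeasure leb (cubeN N r)"
    by (intro leb.emeasure_pair_measure_Times) (simp_all only: sets.top sets_cubeN)
  also have "\<dots> < \<infinity>"
    using emeasure_lebT[of T] T_pos emeasure_cubeN[of N r] by (simp add: ennreal_mult_less_top)
  finally show "integrable PM (\<lambda>z. B * indicator (space (lebT T) \<times> cubeN N r) z)"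
    by (intro integrable_mult_right integrable_real_indicator pair_measureI sets.top sets_cubeN) auto
  show "AE z in PM. norm (g z) \<le> norm (B * indicator (space (lebT T) \<times> cubeN N r) z)"
  proof (rule AE_I2)
    fix z assume "z \<in> space PM"
    then obtain t x where z: "z = (t, x)" "t \<in> {0..T}" "x \<in> RN N" by (auto simp: space_pair_measure)
    show "norm (g z) \<le> norm (B * indicator (space (lebT T) \<times> cubeN N r) z)"
      using assms(2,3)[OF z(2,3)] z by (cases "g z = 0") (auto simp: indicator_def)
  qed
qed fact

definition pw :: "nat \<Rightarrow> (nat \<Rightarrow> (nat \<Rightarrow> real) \<Rightarrow> real) \<Rightarrow> real \<Rightarrow> (nat \<Rightarrow> real) \<Rightarrow> real" where
  "pw n q t x = (\<Sum>k<n. indicator {real k * (T / n)<..real (Suc k) * (T / n)} t * q k x)"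

text \<open>On the slab after time \<open>real k * (T / n)\<close> the path carries the density
  after step \<open>k\<close>, that is \<open>evol\<close> at \<open>Suc k\<close>. This matches the
  step estimates, where coefficients are read at the left end of the slab and the density at its
  right end. At \<open>t = 0\<close> the path is 0.\<close>

definition path :: "nat \<Rightarrow> ((nat \<Rightarrow> real) \<Rightarrow> real) \<Rightarrow> real \<Rightarrow> (nat \<Rightarrow> real) \<Rightarrow> real" where
  "path n p = pw n (\<lambda>k. evol (T / n) p (Suc k))"

lemma pw_eq:
  assumes "k < n" "t \<in> {real k * (T / n)<..real (Suc k) * (T / n)}"
  shows "pw n q t x = q k x"
proof -
  have "indicator {real j * (T / n)<..real (Suc j) * (T / n)} t * q j x = (if j = k then q j x else 0)" for j
  proof -
    have T: "T / n > 0" using assms T_pos by simp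
    have "t \<notin> {real j * (T / n)<..real (Suc j) * (T / n)}" if "j \<noteq> k"
    proof
      assume t: "t \<in> {real j * (T / n)<..real (Suc j) * (T / n)}"
      have "real k * (T / n) < real (Suc j) * (T / n)" "real j * (T / n) < real (Suc k) * (T / n)"
        using t assms(2) by (auto intro: less_le_trans)
      hence "real k < real (Suc j)" "real j < real (Suc k)" using T by (metis mult_less_cancel_right_pos)+
      thus False using that by simp
    qed
    thus ?thesis using assms(2) by auto
  qed
  thus ?thesis using assms(1) by (simp add: pw_def)
qed

lemma pw_cover:
  assumes "0 < t" "t \<le> T" "n > 0" obtains k where "k < n" "t \<in> {real k * (T / n)<..real (Suc k) * (T / n)}"
proof -
  have "t \<le> real m * (T / n) \<Longrightarrow> \<exists>k<m. t \<in> {real k * (T / n)<..real (Suc k) * (T / n)}" for m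
  proof (induction m)
    case (Suc m)
    then show ?case by (cases "t \<le> real m * (T / n)") (auto simp: less_Suc_eq)
  qed (use assms in simp)
  from this[of n] assms that show thesis by auto
qed

lemma pw_zero:
  assumes "t \<le> 0" shows "pw n q t x = 0"
proof -
  have "t \<notin> {real j * (T / n)<..real (Suc j) * (T / n)}" for j
    using assms T_pos by (auto simp: not_less intro!: order_trans[OF assms])
  thus ?thesis by (simp add: pw_def)
qed

lemma pw_measurable:
  assumes [measurable]: "\<And>k. k < n \<Longrightarrow> q k \<in> borel_measurable leb"
  shows "(\<lambda>(t, x). pw n q t x) \<in> borel_measurable PM"
proof -
  have [measurable]: "(\<lambda>t. t) \<in> borel_measurable (lebT T)"
    unfolding lebT_def by (rule measurable_restrict_space1) simp
  have "(\<lambda>z. indicator {real k * (T / n)<..real (Suc k) * (T / n)} (fst z) * q k (snd z)) \<in> borel_measurable PM" if "k < n" for k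
    using that by measurable
  thus ?thesis unfolding pw_def case_prod_unfold by (intro borel_measurable_sum) auto
qed

lemma measure_lebT_Ioc:
  assumes "0 \<le> a" "a \<le> b" "b \<le> T" shows "measure (lebT T) {a<..b} = b - a"
proof -
  have "measure (lebT T) {a<..b} = measure lborel {a<..b}"
    unfolding lebT_def using assms by (intro measure_restrict_space) auto
  thus ?thesis using assms by simp
qed

text \<open>Fubini reduces the slab to its time sections; freezing \<kappa> at the left end changes
  each section by at most \<open>\<epsilon> * m\<close>.\<close>

lemma slab_integral:
  assumes q: "dens N R b m q" and k [measurable]: "(\<lambda>(t, x). \<kappa> t x) \<in> borel_measurable PM"
    and B: "\<And>t x. t \<in> {0..T} \<Longrightarrow> x \<in> cubeN N R \<Longrightarrow> \<bar>\<kappa> t x\<bar> \<le> B"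
    and a: "0 \<le> a" "a \<le> a'" "a' \<le> T"
    and cl: "\<And>t x. t \<in> {a<..a'} \<Longrightarrow> x \<in> cubeN N R \<Longrightarrow> \<bar>\<kappa> t x - \<kappa> a x\<bar> \<le> \<epsilon>"
  shows "integrable PM (\<lambda>(t, x). indicator {a<..a'} t * (\<kappa> t x * q x))" (is "integrable PM ?g")
    and "\<bar>(\<integral>(t, x). indicator {a<..a'} t * (\<kappa> t x * q x) \<partial>PM) - (a' - a) * (\<integral>x. \<kappa> a x * q x \<partial>leb)\<bar> \<le> (a' - a) * (\<epsilon> * m)"
proof -
  interpret PS: pair_sigma_finite "lebT T" leb by (rule pair_sigma_finite_PM)
  interpret fT: finite_measure "lebT T" by (rule finite_measure_lebT)
  note [measurable] = dens_D(1)[OF q]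
  have Im [measurable]: "{a<..a'} \<in> sets (lebT T)"
    unfolding lebT_def using a by (subst sets_restrict_space_iff) auto
  have km: "\<kappa> t \<in> borel_measurable leb" if "t \<in> {0..T}" for t
    using measurable_Pair2[OF k, of t] that by simp
  show int: "integrable PM ?g"
  proof (rule integrable_PM[where B="\<bar>B\<bar> * \<bar>b\<bar>" and r=R])
    have "(\<lambda>z. indicator {a<..a'} (fst z) * ((\<lambda>(t, x). \<kappa> t x) z * q (snd z))) \<in> borel_measurable PM" by measurable
    thus "?g \<in> borel_measurable PM" by (simp add: case_prod_unfold)
    fix t x assume tx: "t \<in> {0..T}" "x \<in> RN N"
    show "\<bar>case (t, x) of (t, x) \<Rightarrow> indicator {a<..a'} t * (\<kappa> t x * q x)\<bar> \<le> \<bar>B\<bar> * \<bar>b\<bar>"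
    proof (cases "q x = 0")
      case False
      have "\<bar>\<kappa> t x\<bar> * \<bar>q x\<bar> \<le> \<bar>B\<bar> * \<bar>b\<bar>"
        using B[OF tx(1) dens_D(4)[OF q tx(2) False]] dens_D(2,3)[OF q tx(2)] by (intro mult_mono) auto
      thus ?thesis by (auto simp: indicator_def abs_mult)
    qed auto
    show "(case (t, x) of (t, x) \<Rightarrow> indicator {a<..a'} t * (\<kappa> t x * q x)) \<noteq> 0 \<Longrightarrow> x \<in> cubeN N R"
      using dens_D(4)[OF q tx(2)] by auto
  qed
  define X where "X t = (\<integral>x. \<kappa> t x * q x \<partial>leb)" for t
  have iX: "integrable (lebT T) (\<lambda>t. indicator {a<..a'} t * X t)"
    using PS.integrable_fst'[OF int] by (simp add: X_def)
  have eq: "(\<integral>z. ?g z \<partial>PM) = (\<integral>t. indicator {a<..a'} t * X t \<partial>lebT T)"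
    using PS.integral_fst'[OF int] by (simp add: X_def)
  have d: "\<bar>X t - X a\<bar> \<le> \<epsilon> * m" if "t \<in> {a<..a'}" for t
  proof -
    have t: "t \<in> {0..T}" "a \<in> {0..T}" using that a by auto
    have bb: "\<bar>\<kappa> s x\<bar> \<le> B" if "s \<in> {0..T}" "x \<in> RN N" "q x \<noteq> 0" for s x
      by (rule B[OF that(1) dens_D(4)[OF q that(2,3)]])
    have "X t - X a = (\<integral>x. (\<kappa> t x - \<kappa> a x) * q x \<partial>leb)"
      unfolding X_def using dens_integrable[OF q km[OF t(1)] bb[OF t(1)]] dens_integrable[OF q km[OF t(2)] bb[OF t(2)]]
      by (simp add: left_diff_distrib)
    also have "\<bar>\<dots>\<bar> \<le> \<epsilon> * m"
      by (rule dens_integral_le[OF q]) (use km t cl[OF that] dens_D(4)[OF q] in auto)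
    finally show ?thesis .
  qed
  have iI: "integrable (lebT T) (\<lambda>t. indicator {a<..a'} t * c')" for c' :: real
    by (intro integrable_mult_left integrable_real_indicator Im) (simp add: fT.emeasure_finite less_top[symmetric])
  have vI: "(\<integral>t. indicator {a<..a'} t * c' \<partial>lebT T) = (a' - a) * c'" for c' :: real
  proof -
    have "{a<..a'} \<inter> {0..T} = {a<..a'}" using a by auto
    thus ?thesis using measure_lebT_Ioc[OF a] by simp
  qed
  have "(\<integral>z. ?g z \<partial>PM) - (a' - a) * X a = (\<integral>t. indicator {a<..a'} t * X t - indicator {a<..a'} t * X a \<partial>lebT T)"
    unfolding eq vI[of "X a", symmetric] by (rule Bochner_Integration.integral_diff[OF iX iI, symmetric])
  also have "\<bar>\<dots>\<bar> \<le> (\<integral>t. \<bar>indicator {a<..a'} t * X t - indicator {a<..a'} t * X a\<bar> \<partial>lebT T)"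
    by (rule integral_abs_bound)
  also have "\<dots> \<le> (\<integral>t. indicator {a<..a'} t * (\<epsilon> * m) \<partial>lebT T)"
    using iX iI[of "X a"] iI[of "\<epsilon> * m"] d by (intro integral_mono) (auto simp: indicator_def)
  also have "\<dots> = (a' - a) * (\<epsilon> * m)" by (rule vI)
  finally show "\<bar>(\<integral>z. ?g z \<partial>PM) - (a' - a) * (\<integral>x. \<kappa> a x * q x \<partial>leb)\<bar> \<le> (a' - a) * (\<epsilon> * m)"
    by (simp add: X_def)
qed

text \<open>Compares a space-time integral with its left-end Riemann sum in time. Besides the scheme
  itself, it will also treat the exponential cost, with the indicator of the cube in the place of
  the densities.\<close>

lemma pw_integral:
  assumes n: "n > 0" and q: "\<And>k. k < n \<Longrightarrow> dens N R b m (q k)"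
    and k: "continuous_on ({0..T} \<times> RN N) (\<lambda>(t, x). \<kappa> t x)"
    and cl: "\<And>t t' x. t \<in> {0..T} \<Longrightarrow> t' \<in> {0..T} \<Longrightarrow> x \<in> cubeN N R \<Longrightarrow> \<bar>t - t'\<bar> \<le> T / n \<Longrightarrow> \<bar>\<kappa> t x - \<kappa> t' x\<bar> \<le> \<epsilon>"
  shows "integrable PM (\<lambda>(t, x). \<kappa> t x * pw n q t x)"
    and "\<bar>(\<integral>(t, x). \<kappa> t x * pw n q t x \<partial>PM) - (\<Sum>k<n. T / n * (\<integral>x. \<kappa> (real k * (T / n)) x * q k x \<partial>leb))\<bar> \<le> T * (\<epsilon> * m)"
proof -
  define \<tau> where "\<tau> = T / n"
  have \<tau>: "\<tau> > 0" "real n * \<tau> = T" using n T_pos by (auto simp: \<tau>_def)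
  obtain B where B: "\<And>t x. t \<in> {0..T} \<Longrightarrow> x \<in> cubeN N R \<Longrightarrow> \<bar>\<kappa> t x\<bar> \<le> B"
    using cubeN_bounded[OF k, of R] by metis
  note km = borel_measurable_lebT_lebN_continuous[OF k]
  have kT: "real (Suc k) * \<tau> \<le> T" if "k < n" for k
    using mult_right_mono[of "real (Suc k)" "real n" \<tau>] that \<tau> by auto
  have kT0: "real k * \<tau> \<le> T" "real k * \<tau> \<le> real (Suc k) * \<tau>" if "k < n" for k
    using kT[OF that] \<tau> by (auto simp: algebra_simps)
  have S: "integrable PM (\<lambda>(t, x). indicator {real k * \<tau><..real (Suc k) * \<tau>} t * (\<kappa> t x * q k x))"
    "\<bar>(\<integral>(t, x). indicator {real k * \<tau><..real (Suc k) * \<tau>} t * (\<kappa> t x * q k x) \<partial>PM) - \<tau> * (\<integral>x. \<kappa> (real k * \<tau>) x * q k x \<partial>leb)\<bar> \<le> \<tau> * (\<epsilon> * m)"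
    if kn: "k < n" for k
  proof -
    have cl': "\<bar>\<kappa> t x - \<kappa> (real k * \<tau>) x\<bar> \<le> \<epsilon>" if "t \<in> {real k * \<tau><..real (Suc k) * \<tau>}" "x \<in> cubeN N R" for t x
    proof (rule cl)
      have "0 \<le> real k * \<tau>" using \<tau> by simp
      thus "t \<in> {0..T}" "real k * \<tau> \<in> {0..T}" using that kT[OF kn] kT0[OF kn] by auto
      show "\<bar>t - real k * \<tau>\<bar> \<le> T / n" using that unfolding \<tau>_def[symmetric] by (auto simp: algebra_simps)
    qed fact
    have dd: "real (Suc k) * \<tau> - real k * \<tau> = \<tau>" by (simp add: algebra_simps)
    show "integrable PM (\<lambda>(t, x). indicator {real k * \<tau><..real (Suc k) * \<tau>} t * (\<kappa> t x * q k x))"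
      by (rule slab_integral(1)[OF q[OF kn] km B _ kT0(2)[OF kn] kT[OF kn] cl']) (use \<tau> in auto)
    show "\<bar>(\<integral>(t, x). indicator {real k * \<tau><..real (Suc k) * \<tau>} t * (\<kappa> t x * q k x) \<partial>PM) - \<tau> * (\<integral>x. \<kappa> (real k * \<tau>) x * q k x \<partial>leb)\<bar> \<le> \<tau> * (\<epsilon> * m)"
      using slab_integral(2)[OF q[OF kn] km B _ kT0(2)[OF kn] kT[OF kn] cl'] \<tau> unfolding dd by auto
  qed
  have e: "(\<lambda>(t, x). \<kappa> t x * pw n q t x) = (\<lambda>z. \<Sum>k<n. (\<lambda>(t, x). indicator {real k * \<tau><..real (Suc k) * \<tau>} t * (\<kappa> t x * q k x)) z)"
    by (auto simp: pw_def \<tau>_def sum_distrib_left fun_eq_iff intro!: sum.cong)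
  show "integrable PM (\<lambda>(t, x). \<kappa> t x * pw n q t x)"
    unfolding e by (intro Bochner_Integration.integrable_sum S) auto
  have "(\<integral>(t, x). \<kappa> t x * pw n q t x \<partial>PM) = (\<Sum>k<n. \<integral>(t, x). indicator {real k * \<tau><..real (Suc k) * \<tau>} t * (\<kappa> t x * q k x) \<partial>PM)"
    unfolding e by (intro Bochner_Integration.integral_sum S) auto
  hence "\<bar>(\<integral>(t, x). \<kappa> t x * pw n q t x \<partial>PM) - (\<Sum>k<n. \<tau> * (\<integral>x. \<kappa> (real k * \<tau>) x * q k x \<partial>leb))\<bar>
    = \<bar>\<Sum>k<n. (\<integral>(t, x). indicator {real k * \<tau><..real (Suc k) * \<tau>} t * (\<kappa> t x * q k x) \<partial>PM) - \<tau> * (\<integral>x. \<kappa> (real k * \<tau>) x * q k x \<partial>leb)\<bar>"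
    by (simp add: sum_subtractf)
  also have "\<dots> \<le> (\<Sum>k<n. \<tau> * (\<epsilon> * m))" by (intro order_trans[OF sum_abs] sum_mono S(2)) auto
  also have "\<dots> = T * (\<epsilon> * m)" using \<tau> by simp
  finally show "\<bar>(\<integral>(t, x). \<kappa> t x * pw n q t x \<partial>PM) - (\<Sum>k<n. T / n * (\<integral>x. \<kappa> (real k * (T / n)) x * q k x \<partial>leb))\<bar> \<le> T * (\<epsilon> * m)"
    by (simp add: \<tau>_def)
qed

end

section \<open>The weak equation for vanishing step size\<close>

context euler_scheme
begin

text \<open>The two uses of \<open>substeps_functional\<close>: \<kappa> is \<open>f i\<close> times
  the derivative of \<phi> for a test integral, and \<open>- f' i\<close> for the entropy.\<close>

lemma evol_step:
  assumes \<tau>: "\<tau> > 0" "\<tau> * c \<le> 1/2" and k: "real (Suc k) * \<tau> \<le> T"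
    and p: "dens N K b m p" and R: "K + real N * (C * T) \<le> R" and \<epsilon>: "\<epsilon> \<ge> 0"
  shows evol_step_test: "C1N N \<phi> \<phi>' \<Longrightarrow> (\<And>i. i < N \<Longrightarrow> close_on_cube \<tau> (\<epsilon> / C) (\<phi>' i)) \<Longrightarrow>
       (\<And>i. i < N \<Longrightarrow> close_on_cube \<tau> \<epsilon> (\<lambda>x. f i (real k * \<tau>) x * \<phi>' i x)) \<Longrightarrow>
       \<bar>(\<integral>x. \<phi> x * evol \<tau> p (Suc k) x \<partial>leb) - (\<integral>x. \<phi> x * evol \<tau> p k x \<partial>leb)
         - \<tau> * (\<integral>x. (\<Sum>i<N. f i (real k * \<tau>) x * \<phi>' i x) * evol \<tau> p (Suc k) x \<partial>leb)\<bar> \<le> \<tau> * (real N * (1 + real N) * \<epsilon> * m)"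
    and evol_step_entropy: "2 * \<tau> * c\<^sup>2 \<le> \<epsilon> \<Longrightarrow>
       (\<And>i. i < N \<Longrightarrow> close_on_cube \<tau> \<epsilon> (\<lambda>x. - f' i (real k * \<tau>) x)) \<Longrightarrow>
       \<bar>(\<integral>x. ln (evol \<tau> p (Suc k) x) * evol \<tau> p (Suc k) x \<partial>leb) - (\<integral>x. ln (evol \<tau> p k x) * evol \<tau> p k x \<partial>leb)
         - \<tau> * (\<integral>x. (\<Sum>i<N. - f' i (real k * \<tau>) x) * evol \<tau> p (Suc k) x \<partial>leb)\<bar> \<le> \<tau> * (real N * (1 + real N) * \<epsilon> * m)"
proof -
  let ?t = "real k * \<tau>"
  have kT: "real k * \<tau> \<le> T" using k \<tau> by (simp add: algebra_simps)
  have t: "?t \<in> {0..T}" using kT \<tau> by simp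
  obtain r b' where q: "dens N r b' m (evol \<tau> p k)" and r: "r + real N * (\<tau> * C) \<le> R"
    using evol_dens(2)[OF \<tau> kT p R] k by blast
  have Qd: "dens N (r + real i * (\<tau> * C)) (b' * (1 + \<tau> * c) ^ i) m (substeps \<tau> ?t i (evol \<tau> p k))" if "i \<le> N" for i
    by (rule substeps_dens[OF t \<tau> q r that])
  have rr: "r + real i * (\<tau> * C) + \<tau> * C \<le> R" if "i < N" for i
  proof -
    have "r + real (Suc i) * (\<tau> * C) \<le> r + real N * (\<tau> * C)"
      using that \<tau> C_pos by (intro add_left_mono mult_right_mono) auto
    thus ?thesis using r by (simp add: algebra_simps)
  qed
  {
    assume \<phi>: "C1N N \<phi> \<phi>'" and cl1: "\<And>i. i < N \<Longrightarrow> close_on_cube \<tau> (\<epsilon> / C) (\<phi>' i)"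
      and cl2: "\<And>i. i < N \<Longrightarrow> close_on_cube \<tau> \<epsilon> (\<lambda>x. f i ?t x * \<phi>' i x)"
    have "\<exists>B>0. \<forall>x\<in>cubeN N R. \<bar>\<phi>' i x\<bar> \<le> B" if "i < N" for i
      using cubeN_bounded[OF continuous_on_lift_time[OF C1N_D(2)[OF \<phi> that], of "{0..T}"], of R] t by metis
    then obtain B where B: "\<And>i. i < N \<Longrightarrow> B i > 0" "\<And>i x. i < N \<Longrightarrow> x \<in> cubeN N R \<Longrightarrow> \<bar>\<phi>' i x\<bar> \<le> B i" by metis
    have "B i \<le> sum B {..<N}" if "i < N" for i
      using that B(1) by (intro member_le_sum) (auto intro: less_imp_le)
    hence B': "\<bar>f i ?t x * \<phi>' i x\<bar> \<le> C * sum B {..<N}" if "i < N" "x \<in> cubeN N R" for i x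
      using B(2)[OF that] f_bound[OF that(1) t, of x] that cubeN_subset[of N R] C_pos
      unfolding abs_mult by (intro mult_mono) (auto intro: order_trans)
    show "\<bar>(\<integral>x. \<phi> x * evol \<tau> p (Suc k) x \<partial>leb) - (\<integral>x. \<phi> x * evol \<tau> p k x \<partial>leb)
         - \<tau> * (\<integral>x. (\<Sum>i<N. f i ?t x * \<phi>' i x) * evol \<tau> p (Suc k) x \<partial>leb)\<bar> \<le> \<tau> * (real N * (1 + real N) * \<epsilon> * m)"
      unfolding evol.simps
    proof (rule substeps_functional[OF t \<tau> q r \<epsilon> _ B' cl2, where \<Lambda>="\<lambda>q. \<integral>x. \<phi> x * q x \<partial>leb"])
      fix i assume i: "i < N"
      show "(\<lambda>x. f i ?t x * \<phi>' i x) \<in> borel_measurable leb"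
        using f_measurable(1)[OF i t] borel_measurable_lebN_continuous[OF C1N_D(2)[OF \<phi> i]] by measurable
      show "\<bar>(\<integral>x. \<phi> x * substeps \<tau> ?t (Suc i) (evol \<tau> p k) x \<partial>leb) - (\<integral>x. \<phi> x * substeps \<tau> ?t i (evol \<tau> p k) x \<partial>leb)
        - \<tau> * (\<integral>x. f i ?t x * \<phi>' i x * substeps \<tau> ?t (Suc i) (evol \<tau> p k) x \<partial>leb)\<bar> \<le> \<tau> * \<epsilon> * m"
        unfolding substeps.simps using i
        by (intro substep_test[OF i t \<tau> Qd[of i] rr[OF i] \<phi> cl1 \<epsilon>]) auto
    qed
  }
  {
    assume \<epsilon>': "2 * \<tau> * c\<^sup>2 \<le> \<epsilon>"
      and cl2: "\<And>i. i < N \<Longrightarrow> close_on_cube \<tau> \<epsilon> (\<lambda>x. - f' i ?t x)"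
    show "\<bar>(\<integral>x. ln (evol \<tau> p (Suc k) x) * evol \<tau> p (Suc k) x \<partial>leb) - (\<integral>x. ln (evol \<tau> p k x) * evol \<tau> p k x \<partial>leb)
         - \<tau> * (\<integral>x. (\<Sum>i<N. - f' i ?t x) * evol \<tau> p (Suc k) x \<partial>leb)\<bar> \<le> \<tau> * (real N * (1 + real N) * \<epsilon> * m)"
      unfolding evol.simps
    proof (rule substeps_functional[OF t \<tau> q r \<epsilon> _ _ cl2, where \<Lambda>="\<lambda>q. \<integral>x. ln (q x) * q x \<partial>leb" and B=c])
      fix i assume i: "i < N"
      show "(\<lambda>x. - f' i ?t x) \<in> borel_measurable leb"
        using f_measurable(2)[OF i t] by measurable
      show "\<bar>- f' i ?t x\<bar> \<le> c" if "x \<in> cubeN N R" for x using f'_bound[OF i t that] by simp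
      show "\<bar>(\<integral>x. ln (substeps \<tau> ?t (Suc i) (evol \<tau> p k) x) * substeps \<tau> ?t (Suc i) (evol \<tau> p k) x \<partial>leb)
        - (\<integral>x. ln (substeps \<tau> ?t i (evol \<tau> p k) x) * substeps \<tau> ?t i (evol \<tau> p k) x \<partial>leb)
        - \<tau> * (\<integral>x. - f' i ?t x * substeps \<tau> ?t (Suc i) (evol \<tau> p k) x \<partial>leb)\<bar> \<le> \<tau> * \<epsilon> * m"
        unfolding substeps.simps using i
        by (intro substep_entropy[OF i t \<tau> Qd[of i] rr[OF i] \<epsilon>']) auto
    qed
  }
qed

lemma filterlim_step: "filterlim (\<lambda>n::nat. T / n) (at_right 0) sequentially"
proof (rule tendsto_imp_filterlim_at_right)
  show "(\<lambda>n::nat. T / n) \<longlonglongrightarrow> 0" by (rule lim_const_over_n)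
  show "\<forall>\<^sub>F n::nat in sequentially. 0 < T / n"
    using T_pos by (intro eventually_mono[OF eventually_gt_at_top[of "0::nat"]]) auto
qed

lemma eventually_small_mult:
  assumes "a > 0" "B \<ge> 0" shows "\<forall>\<^sub>F \<tau>::real in at_right 0. \<tau> * B \<le> a"
proof -
  have "\<forall>\<^sub>F \<tau>::real in at_right 0. \<tau> \<in> {0<..<a / (B + 1)}"
    using assms by (intro eventually_at_right_real) auto
  thus ?thesis
  proof eventually_elim
    case (elim \<tau>)
    hence "\<tau> * (B + 1) \<le> a" using assms by (auto simp: field_simps)
    thus ?case using elim by (auto simp: algebra_simps)
  qed
qed

lemma eventually_close_family:
  assumes "\<And>i. i < N \<Longrightarrow> continuous_on ({0..T} \<times> RN N) (\<lambda>(t, x). \<kappa> i t x)" "\<epsilon> > 0"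
  shows "\<forall>\<^sub>F \<tau> in at_right 0. \<forall>i\<in>{..<N}. \<forall>t\<in>{0..T}. close_on_cube \<tau> \<epsilon> (\<kappa> i t)"
proof (rule eventually_ball_finite)
  show "\<forall>i\<in>{..<N}. \<forall>\<^sub>F \<tau> in at_right 0. \<forall>t\<in>{0..T}. close_on_cube \<tau> \<epsilon> (\<kappa> i t)"
  proof
    fix i assume "i \<in> {..<N}"
    hence "i < N" by simp
    from eventually_close_on_cube[OF assms(1)[OF this] assms(2)]
    show "\<forall>\<^sub>F \<tau> in at_right 0. \<forall>t\<in>{0..T}. close_on_cube \<tau> \<epsilon> (\<kappa> i t)"
      by (rule eventually_mono) blast
  qed
qed simp

text \<open>Discrete integration by parts in time: the products of \<open>g\<close> with the test
  integrals telescope, and since \<open>g T = 0\<close> only the initial term remains.\<close>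

lemma path_weak:
  assumes p: "dens N K b m p" and R: "K + real N * (C * T) \<le> R"
    and \<phi>: "C1N N \<phi> \<phi>'"
    and g: "\<And>t. t \<in> {0..T} \<Longrightarrow> (g has_real_derivative g' t) (at t within {0..T})"
    and g': "continuous_on {0..T} g'" and gT: "g T = 0"
  shows "(\<lambda>n. \<integral>(t, x). (g' t * \<phi> x + g t * (\<Sum>i<N. f i t x * \<phi>' i x)) * path n p t x \<partial>PM)
     \<longlonglongrightarrow> - g 0 * (\<integral>x. \<phi> x * p x \<partial>leb)"
proof (rule tendstoI)
  fix e :: real assume e: "e > 0"
  have m0: "m \<ge> 0" by (rule dens_mass_nonneg[OF p])
  have gc: "continuous_on {0..T} g" using g by (intro DERIV_continuous_on) auto
  define \<kappa> where "\<kappa> t x = g' t * \<phi> x + g t * (\<Sum>i<N. f i t x * \<phi>' i x)" for t x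
  have lift: "continuous_on ({0..T} \<times> RN N) (\<lambda>(t, x). u t)" if "continuous_on {0..T} u" for u :: "real \<Rightarrow> real"
    unfolding case_prod_unfold by (rule continuous_on_compose2[OF that]) (auto intro: continuous_intros)
  have c1: "continuous_on ({0..T} \<times> RN N) (\<lambda>(t, x). f i t x * \<phi>' i x)" if "i < N" for i
    using continuous_on_mult[OF f_cont[OF that] continuous_on_lift_time[OF C1N_D(2)[OF \<phi> that]]]
    by (simp add: case_prod_unfold)
  have kc: "continuous_on ({0..T} \<times> RN N) (\<lambda>(t, x). \<kappa> t x)"
    unfolding \<kappa>_def case_prod_unfold
    using lift[OF gc] lift[OF g'] f_cont continuous_on_lift_time[OF C1N_D(2)[OF \<phi>]] continuous_on_lift_time[OF C1N_D(1)[OF \<phi>], of "{0..T}"]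
    by (intro continuous_intros) (auto simp: case_prod_unfold)
  obtain B\<phi> where B\<phi>: "B\<phi> > 0" "\<And>x. x \<in> cubeN N R \<Longrightarrow> \<bar>\<phi> x\<bar> \<le> B\<phi>"
    using cubeN_bounded[OF continuous_on_lift_time[OF C1N_D(1)[OF \<phi>], of "{0..T}"], of R] T_pos
    by (metis atLeastAtMost_iff le_less order_refl)
  obtain Bg where Bg: "Bg > 0" "\<And>t. t \<in> {0..T} \<Longrightarrow> \<bar>g t\<bar> \<le> Bg"
    using compact_imp_bounded[OF compact_continuous_image[OF gc]] by (auto simp: bounded_pos)
  \<comment> \<open>Per unit of \<epsilon>, the three errors: reading \<kappa> at the left end of a
    slab, replacing a difference of \<open>g\<close> by its derivative, and the step error of the
    scheme.\<close>
  define K1 where "K1 = T * m + T * (B\<phi> * m) + T * (Bg * (real N * (1 + real N) * m))"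
  have K1: "K1 \<ge> 0" using T_pos m0 B\<phi> Bg by (auto simp: K1_def)
  define \<epsilon> where "\<epsilon> = e / (K1 + 1)"
  have \<epsilon>: "\<epsilon> > 0" using e K1 by (simp add: \<epsilon>_def)
  have \<epsilon>K: "\<epsilon> * K1 < e" using e K1 by (simp add: \<epsilon>_def field_simps)
  have eC: "\<epsilon> / C > 0" using \<epsilon> C_pos by simp
  have e1: "\<forall>\<^sub>F \<tau> in at_right 0. \<forall>i\<in>{..<N}. \<forall>t\<in>{0..T}. close_on_cube \<tau> \<epsilon> (\<lambda>x. f i t x * \<phi>' i x)"
    using c1 by (intro eventually_close_family \<epsilon>)
  have e2: "\<forall>\<^sub>F \<tau> in at_right 0. \<forall>i\<in>{..<N}. \<forall>t\<in>{0..T}. close_on_cube \<tau> (\<epsilon> / C) (\<phi>' i)"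
    by (intro eventually_close_family eC continuous_on_lift_time C1N_D(2)[OF \<phi>])
  have ev: "\<forall>\<^sub>F \<tau> in at_right 0. (\<tau> * c \<le> 1/2) \<and>
     (\<forall>i\<in>{..<N}. \<forall>t\<in>{0..T}. close_on_cube \<tau> (\<epsilon> / C) (\<phi>' i)) \<and>
     (\<forall>i\<in>{..<N}. \<forall>t\<in>{0..T}. close_on_cube \<tau> \<epsilon> (\<lambda>x. f i t x * \<phi>' i x)) \<and>
     (\<forall>t\<in>{0..T}. \<forall>t'\<in>{0..T}. \<forall>x\<in>cubeN N R. \<bar>t - t'\<bar> \<le> \<tau> \<longrightarrow> \<bar>\<kappa> t x - \<kappa> t' x\<bar> \<le> \<epsilon>) \<and>
     (\<forall>t\<in>{0..T}. \<forall>t'\<in>{0..T}. \<forall>x\<in>cubeN N R. \<bar>t - t'\<bar> \<le> \<tau> \<longrightarrow> \<bar>g' t - g' t'\<bar> \<le> \<epsilon>)"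
    using eventually_close_on_cube[OF kc \<epsilon>] eventually_close_on_cube[OF lift[OF g'] \<epsilon>]
      e1 e2
      eventually_small_mult[OF half_gt_zero[OF zero_less_one] less_imp_le[OF c_pos]]
    by eventually_elim (use c_pos in auto)
  \<comment> \<open>The modulus of continuity of \<open>g'\<close> comes from the space-time
    statement, which quantifies over points of the cube; the origin is the point at which it is
    read.\<close>
  have cube0: "(\<lambda>i\<in>{..<N}. 0) \<in> cubeN N R" using R_pos by (auto simp: cubeN_def)
  from filterlim_step[unfolded filterlim_iff, rule_format, OF ev]
  show "\<forall>\<^sub>F n in sequentially. dist (\<integral>(t, x). (g' t * \<phi> x + g t * (\<Sum>i<N. f i t x * \<phi>' i x)) * path n p t x \<partial>PM) (- g 0 * (\<integral>x. \<phi> x * p x \<partial>leb)) < e"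
    using eventually_gt_at_top[of 0]
  proof eventually_elim
    case (elim n)
    define \<tau> where "\<tau> = T / n"
    have \<tau>: "\<tau> > 0" "real n * \<tau> = T" "\<tau> * c \<le> 1/2" using elim T_pos by (auto simp: \<tau>_def)
    let ?E = "evol \<tau> p"
    have kT: "real k * \<tau> \<le> T" if "k \<le> n" for k
      using mult_right_mono[of "real k" "real n" \<tau>] that \<tau> by auto
    have tk: "real k * \<tau> \<in> {0..T}" if "k \<le> n" for k using kT[OF that] \<tau> by simp
    have Ed: "dens N R (b * exp (c * T * real N)) m (?E k)" if "k \<le> n" for k
      by (rule evol_dens(1)[OF \<tau>(1,3) kT[OF that] p R])
    define I where "I k = (\<integral>x. \<phi> x * ?E k x \<partial>leb)" for k
    define Y where "Y k = (\<integral>x. (\<Sum>i<N. f i (real k * \<tau>) x * \<phi>' i x) * ?E (Suc k) x \<partial>leb)" for k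
    have \<phi>m: "\<phi> \<in> borel_measurable leb" by (rule borel_measurable_lebN_continuous[OF C1N_D(1)[OF \<phi>]])
    have Ib: "\<bar>I k\<bar> \<le> B\<phi> * m" if "k \<le> n" for k
      unfolding I_def by (rule dens_integral_le[OF Ed[OF that] \<phi>m]) (use B\<phi>(2) dens_D(4)[OF Ed[OF that]] in blast)
    have st: "\<bar>I (Suc k) - I k - \<tau> * Y k\<bar> \<le> \<tau> * (real N * (1 + real N) * \<epsilon> * m)" if "k < n" for k
      unfolding I_def Y_def
      by (rule evol_step_test[OF \<tau>(1,3) kT[OF Suc_leI[OF that]] p R less_imp_le[OF \<epsilon>] \<phi>])
         (use elim tk[of k] that in \<open>auto simp: \<tau>_def\<close>)
    have gd: "\<bar>g (real (Suc k) * \<tau>) - g (real k * \<tau>) - \<tau> * g' (real k * \<tau>)\<bar> \<le> \<tau> * \<epsilon>" if "k < n" for k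
    proof -
      have tks: "real k * \<tau> \<in> {0..T}" "real (Suc k) * \<tau> \<in> {0..T}" using tk[of k] tk[of "Suc k"] that by auto
      have lt: "real k * \<tau> < real (Suc k) * \<tau>" using \<tau> by simp
      have "\<exists>z\<in>{real k * \<tau><..<real (Suc k) * \<tau>}. g (real (Suc k) * \<tau>) - g (real k * \<tau>) = g' z * (real (Suc k) * \<tau> - real k * \<tau>)"
      proof (rule mvt_simple[OF lt, where f'="\<lambda>z y. g' z * y"])
        fix z assume "real k * \<tau> \<le> z" "z \<le> real (Suc k) * \<tau>"
        hence "(g has_real_derivative g' z) (at z within {real k * \<tau>..real (Suc k) * \<tau>})"
          using tks by (intro DERIV_subset[OF g]) auto
        thus "(g has_derivative (\<lambda>y. g' z * y)) (at z within {real k * \<tau>..real (Suc k) * \<tau>})"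
          by (simp add: has_field_derivative_def)
      qed
      then obtain z where z: "z \<in> {real k * \<tau><..<real (Suc k) * \<tau>}" "g (real (Suc k) * \<tau>) - g (real k * \<tau>) = g' z * \<tau>"
        by (auto simp: algebra_simps)
      have "\<bar>z - real k * \<tau>\<bar> \<le> \<tau>" using z(1) by (auto simp: algebra_simps)
      moreover have "z \<in> {0..T}" using z(1) tks unfolding greaterThanLessThan_iff atLeastAtMost_iff by linarith
      ultimately have "\<bar>g' z - g' (real k * \<tau>)\<bar> \<le> \<epsilon>" using elim tks cube0 unfolding \<tau>_def by blast
      hence "\<tau> * \<bar>g' z - g' (real k * \<tau>)\<bar> \<le> \<tau> * \<epsilon>" using \<tau> by simp
      moreover have "\<bar>g' z * \<tau> - \<tau> * g' (real k * \<tau>)\<bar> = \<tau> * \<bar>g' z - g' (real k * \<tau>)\<bar>"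
        using \<tau>(1) abs_mult[of \<tau> "g' z - g' (real k * \<tau>)"] by (simp add: right_diff_distrib mult.commute)
      ultimately show ?thesis unfolding z(2) by simp
    qed
    have kE: "(\<integral>x. \<kappa> (real k * \<tau>) x * ?E (Suc k) x \<partial>leb) = g' (real k * \<tau>) * I (Suc k) + g (real k * \<tau>) * Y k" if "k < n" for k
    proof -
      have dE: "dens N R (b * exp (c * T * real N)) m (?E (Suc k))" using Ed that by (simp del: evol.simps)
      have cY: "continuous_on (RN N) (\<lambda>x. \<Sum>i<N. f i (real k * \<tau>) x * \<phi>' i x)"
        using continuous_on_slice_time[OF c1 tk[of k]] that by (intro continuous_on_sum) auto
      obtain BY where BY: "\<And>x. x \<in> cubeN N R \<Longrightarrow> \<bar>\<Sum>i<N. f i (real k * \<tau>) x * \<phi>' i x\<bar> \<le> BY"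
        using cubeN_bounded[OF continuous_on_lift_time[OF cY, of "{0..T}"], of R] T_pos
        by (metis atLeastAtMost_iff le_less order_refl)
      have i1: "integrable leb (\<lambda>x. \<phi> x * ?E (Suc k) x)"
        by (rule dens_integrable[OF dE \<phi>m]) (use B\<phi>(2) dens_D(4)[OF dE] in blast)
      have i2: "integrable leb (\<lambda>x. (\<Sum>i<N. f i (real k * \<tau>) x * \<phi>' i x) * ?E (Suc k) x)"
        by (rule dens_integrable[OF dE borel_measurable_lebN_continuous[OF cY]]) (use BY dens_D(4)[OF dE] in blast)
      have "(\<integral>x. \<kappa> (real k * \<tau>) x * ?E (Suc k) x \<partial>leb) = (\<integral>x. g' (real k * \<tau>) * (\<phi> x * ?E (Suc k) x) +
          g (real k * \<tau>) * ((\<Sum>i<N. f i (real k * \<tau>) x * \<phi>' i x) * ?E (Suc k) x) \<partial>leb)"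
        by (intro Bochner_Integration.integral_cong) (auto simp: \<kappa>_def distrib_right mult.assoc)
      thus ?thesis using i1 i2 by (simp add: I_def Y_def)
    qed
    have "\<bar>(\<integral>(t, x). \<kappa> t x * path n p t x \<partial>PM) - (\<Sum>k<n. \<tau> * (\<integral>x. \<kappa> (real k * \<tau>) x * ?E (Suc k) x \<partial>leb))\<bar> \<le> T * (\<epsilon> * m)"
    proof -
      have Ed': "dens N R (b * exp (c * T * real N)) m (evol (T / n) p (Suc k))" if "k < n" for k
        using Ed[of "Suc k"] that unfolding \<tau>_def by simp
      show ?thesis unfolding path_def \<tau>_def
        by (rule pw_integral(2)[OF _ Ed' kc]) (use elim in auto)
    qed
    moreover have "(\<Sum>k<n. \<tau> * (\<integral>x. \<kappa> (real k * \<tau>) x * ?E (Suc k) x \<partial>leb)) = (\<Sum>k<n. \<tau> * (g' (real k * \<tau>) * I (Suc k) + g (real k * \<tau>) * Y k))"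
      using kE by (intro sum.cong) auto
    moreover have "\<bar>(\<Sum>k<n. \<tau> * (g' (real k * \<tau>) * I (Suc k) + g (real k * \<tau>) * Y k)) - (- g 0 * I 0)\<bar>
      \<le> T * (\<epsilon> * (B\<phi> * m)) + T * (Bg * (real N * (1 + real N) * \<epsilon> * m))"
    proof -
      have "(\<Sum>k<n. g (real (Suc k) * \<tau>) * I (Suc k) - g (real k * \<tau>) * I k) = g (real n * \<tau>) * I n - g (real 0 * \<tau>) * I 0"
        by (rule sum_lessThan_telescope)
      hence tele: "- g 0 * I 0 = (\<Sum>k<n. g (real (Suc k) * \<tau>) * I (Suc k) - g (real k * \<tau>) * I k)"
        using gT \<tau> by simp
      have "\<bar>(\<Sum>k<n. \<tau> * (g' (real k * \<tau>) * I (Suc k) + g (real k * \<tau>) * Y k)) - (- g 0 * I 0)\<bar>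
         = \<bar>\<Sum>k<n. \<tau> * (g' (real k * \<tau>) * I (Suc k) + g (real k * \<tau>) * Y k) - (g (real (Suc k) * \<tau>) * I (Suc k) - g (real k * \<tau>) * I k)\<bar>"
        unfolding tele by (simp add: sum_subtractf)
      also have "\<dots> \<le> (\<Sum>k<n. \<tau> * \<epsilon> * (B\<phi> * m) + Bg * (\<tau> * (real N * (1 + real N) * \<epsilon> * m)))"
      proof (intro order_trans[OF sum_abs] sum_mono)
        fix k assume "k \<in> {..<n}"
        hence k: "k < n" by simp
        let ?a = "g (real (Suc k) * \<tau>) - g (real k * \<tau>) - \<tau> * g' (real k * \<tau>)"
        let ?b = "I (Suc k) - I k - \<tau> * Y k"
        \<comment> \<open>Product rule for differences: the increment of \<open>g * I\<close> splits
          into the increment of \<open>g\<close> times the new value of \<open>I\<close> and the old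
          value of \<open>g\<close> times the increment of \<open>I\<close>, matching the right-end
          reading of the density.\<close>
        have "\<bar>\<tau> * (g' (real k * \<tau>) * I (Suc k) + g (real k * \<tau>) * Y k) - (g (real (Suc k) * \<tau>) * I (Suc k) - g (real k * \<tau>) * I k)\<bar>
           = \<bar>?a * I (Suc k) + g (real k * \<tau>) * ?b\<bar>"
          by (subst abs_minus_cancel[symmetric]) (simp add: algebra_simps)
        also have "\<dots> \<le> \<bar>?a\<bar> * \<bar>I (Suc k)\<bar> + \<bar>g (real k * \<tau>)\<bar> * \<bar>?b\<bar>"
          by (metis abs_mult abs_triangle_ineq)
        also have "\<dots> \<le> \<tau> * \<epsilon> * (B\<phi> * m) + Bg * (\<tau> * (real N * (1 + real N) * \<epsilon> * m))"
          using gd[OF k] Ib[of "Suc k"] k Bg(2)[OF tk[of k]] st[OF k] \<tau> \<epsilon> Bg(1) by (intro add_mono mult_mono) auto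
        finally show "\<bar>\<tau> * (g' (real k * \<tau>) * I (Suc k) + g (real k * \<tau>) * Y k) - (g (real (Suc k) * \<tau>) * I (Suc k) - g (real k * \<tau>) * I k)\<bar> \<le> \<dots>" .
      qed
      also have "\<dots> = (real n * \<tau>) * (\<epsilon> * (B\<phi> * m)) + (real n * \<tau>) * (Bg * (real N * (1 + real N) * \<epsilon> * m))"
        by (simp add: algebra_simps)
      finally show ?thesis using \<tau> by simp
    qed
    ultimately have "\<bar>(\<integral>(t, x). \<kappa> t x * path n p t x \<partial>PM) - (- g 0 * I 0)\<bar> \<le> T * (\<epsilon> * m) + (T * (\<epsilon> * (B\<phi> * m)) + T * (Bg * (real N * (1 + real N) * \<epsilon> * m)))"
      by linarith
    also have "\<dots> = \<epsilon> * K1" by (simp add: K1_def algebra_simps)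
    also have "\<dots> < e" by (rule \<epsilon>K)
    finally show ?case by (simp add: \<kappa>_def I_def dist_real_def)
  qed
qed

section \<open>Entropy of the scheme relative to a positive weight\<close>

text \<open>As \<open>hfun 0 = 1\<close>, the integrand equals \<open>w\<close> wherever
  \<open>q\<close> vanishes; restriction to the cube keeps this part finite for every continuous
  weight.\<close>

definition relent :: "((nat \<Rightarrow> real) \<Rightarrow> real) \<Rightarrow> ((nat \<Rightarrow> real) \<Rightarrow> real) \<Rightarrow> real" where
  "relent w q = (\<integral>x. icube N R x * (w x * hfun (q x / w x)) \<partial>leb)"

text \<open>Minus the divergence of the field with respect to the measure with Lebesgue density
  \<open>w\<close>.\<close>

definition Dst :: "((nat \<Rightarrow> real) \<Rightarrow> real) \<Rightarrow> (nat \<Rightarrow> (nat \<Rightarrow> real) \<Rightarrow> real) \<Rightarrow> real \<Rightarrow> (nat \<Rightarrow> real) \<Rightarrow> real" where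
  "Dst w w' t x = - (\<Sum>i<N. f' i t x + f i t x * (w' i x / w x))"

lemma integrable_indicator_cube:
  assumes "continuous_on (RN N) u"
  shows "integrable leb (\<lambda>x. icube N R x * u x :: real)"
proof -
  note [measurable] = borel_measurable_lebN_continuous[OF assms]
  obtain B where B: "B > 0" "\<And>x. x \<in> cubeN N R \<Longrightarrow> \<bar>u x\<bar> \<le> B"
    using cubeN_bounded[OF continuous_on_lift_time[OF assms, of "{0..T}"], of R] T_pos
    by (metis atLeastAtMost_iff le_less order_refl)
  show ?thesis by (rule integrable_cubeN[where B=B and r=R]) (use B in \<open>auto simp: indicator_def\<close>)
qed

lemma dens_indicator_cube: "dens N R 1 (measure leb (cubeN N R)) (icube N R)"
proof -
  have "(\<integral>x. icube N R x \<partial>leb) = measure leb (cubeN N R)"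
    using cubeN_subset[of N R] by (simp add: Int_absorb2)
  thus ?thesis by (auto simp: dens_def indicator_def[of "cubeN N R"] simp del: Bochner_Integration.integral_indicator)
qed

context
  fixes w w' and \<delta> :: real
  assumes w: "C1N N w w'" and wpos: "\<And>x. x \<in> RN N \<Longrightarrow> w x > 0" and \<delta>: "\<delta> > 0"
begin

lemma dens_lnw_integrable:
  assumes q: "dens N R b m q" shows "integrable leb (\<lambda>x. ln (w x) * q x)"
proof -
  note lw = C1N_D(1)[OF C1N_ln[OF w wpos]]
  obtain B where B: "B > 0" "\<And>x. x \<in> cubeN N R \<Longrightarrow> \<bar>ln (w x)\<bar> \<le> B"
    using cubeN_bounded[OF continuous_on_lift_time[OF lw, of "{0..T}"], of R] T_pos
    by (metis atLeastAtMost_iff le_less order_refl)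
  show ?thesis
    by (rule dens_integrable[OF q borel_measurable_lebN_continuous[OF lw], where \<epsilon>=B]) (use B dens_D(4)[OF q] in auto)
qed

text \<open>The last two terms of the splitting do not change in a step. What changes is the entropy
  of \<open>q\<close>, and the integral of \<open>ln (w x)\<close>, to which the estimate for test
  functions applies; their difference produces \<open>Dst\<close>.\<close>

lemma relent_facts:
  assumes q: "dens N R b m q"
  shows relent_integrable: "integrable leb (\<lambda>x. icube N R x * (w x * hfun (q x / w x)))"
    and relent_eq: "relent w q = (\<integral>x. ln (q x) * q x \<partial>leb) - (\<integral>x. ln (w x) * q x \<partial>leb) - m + (\<integral>x. icube N R x * w x \<partial>leb)"
proof -
  have pt: "icube N R x * (w x * hfun (q x / w x)) = ln (q x) * q x - ln (w x) * q x - q x + icube N R x * w x"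
    if x: "x \<in> RN N" for x
  proof (cases "q x = 0")
    case False
    with dens_D(2,4)[OF q x] have q0: "q x > 0" "x \<in> cubeN N R" by auto
    thus ?thesis using wpos[OF x] by (simp add: hfun_def ln_div field_simps)
  qed simp
  note i1 = dens_xlnx_integrable[OF q] and i2 = dens_lnw_integrable[OF q] and i3 = dens_integrable1[OF q]
    and i4 = integrable_indicator_cube[OF C1N_D(1)[OF w]]
  have i: "integrable leb (\<lambda>x. ln (q x) * q x - ln (w x) * q x - q x + icube N R x * w x)"
    using i1 i2 i3 i4 by simp
  show "integrable leb (\<lambda>x. icube N R x * (w x * hfun (q x / w x)))"
    using i by (subst Bochner_Integration.integrable_cong[OF refl pt]) auto
  have "relent w q = (\<integral>x. ln (q x) * q x - ln (w x) * q x - q x + icube N R x * w x \<partial>leb)"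
    unfolding relent_def using pt by (intro Bochner_Integration.integral_cong) auto
  thus "relent w q = (\<integral>x. ln (q x) * q x \<partial>leb) - (\<integral>x. ln (w x) * q x \<partial>leb) - m + (\<integral>x. icube N R x * w x \<partial>leb)"
    using i1 i2 i3 i4 dens_D(5)[OF q] by simp
qed

lemma relent_nonneg: "relent w q \<ge> 0" if "dens N R b m q"
  unfolding relent_def using that wpos dens_D(2)[OF that]
  by (intro Bochner_Integration.integral_nonneg)
     (auto simp: indicator_def intro!: mult_nonneg_nonneg[OF less_imp_le] hfun_nonneg divide_nonneg_pos)

lemma Dst_continuous: "continuous_on ({0..T} \<times> RN N) (\<lambda>(t, x). Dst w w' t x)"
proof -
  have nz: "w x \<noteq> 0" if "x \<in> RN N" for x using wpos[OF that] by simp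
  show ?thesis unfolding Dst_def case_prod_unfold
    using f_cont f'_cont continuous_on_lift_time[OF C1N_D(2)[OF w], of _ "{0..T}"]
      continuous_on_lift_time[OF C1N_D(1)[OF w], of "{0..T}"] nz
    by (intro continuous_intros) (auto simp: case_prod_unfold)
qed

definition ecost :: "real \<Rightarrow> (nat \<Rightarrow> real) \<Rightarrow> real" where
  "ecost t x = (exp (\<delta> * max 0 (Dst w w' t x)) - 1) * w x"

lemma ecost_continuous: "continuous_on ({0..T} \<times> RN N) (\<lambda>(t, x). ecost t x)"
  using Dst_continuous continuous_on_lift_time[OF C1N_D(1)[OF w], of "{0..T}"]
  unfolding ecost_def case_prod_unfold by (intro continuous_intros) auto

lemma ecost_nonneg: "x \<in> RN N \<Longrightarrow> ecost t x \<ge> 0"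
  using wpos[of x] \<delta> by (simp add: ecost_def)

text \<open>Young's inequality at \<open>q x / w x\<close> with exponent \<delta> times the positive
  part of \<open>Dst\<close>, multiplied by \<open>w x\<close>. The exponential term is then the
  integrand of the assumed cost.\<close>

lemma relent_young:
  assumes q: "dens N R b m q" and t: "t \<in> {0..T}"
  shows "(\<integral>x. Dst w w' t x * q x \<partial>leb) \<le> (relent w q + (\<integral>x. ecost t x * icube N R x \<partial>leb)) / \<delta>"
proof -
  note Dc = continuous_on_slice_time[OF Dst_continuous t]
  obtain B where B: "B > 0" "\<And>x. x \<in> cubeN N R \<Longrightarrow> \<bar>Dst w w' t x\<bar> \<le> B"
    using cubeN_bounded[OF Dst_continuous, of R] t by metis
  have i1: "integrable leb (\<lambda>x. Dst w w' t x * q x)"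
    by (rule dens_integrable[OF q borel_measurable_lebN_continuous[OF Dc]]) (use B dens_D(4)[OF q] in blast)
  have i2: "integrable leb (\<lambda>x. ecost t x * icube N R x)"
    using integrable_indicator_cube[OF continuous_on_slice_time[OF ecost_continuous t]] by (simp add: mult.commute)
  have "\<delta> * (\<integral>x. Dst w w' t x * q x \<partial>leb) = (\<integral>x. \<delta> * (Dst w w' t x * q x) \<partial>leb)" by simp
  also have "\<dots> \<le> (\<integral>x. icube N R x * (w x * hfun (q x / w x)) + ecost t x * icube N R x \<partial>leb)"
  proof (rule integral_mono)
    show "integrable leb (\<lambda>x. \<delta> * (Dst w w' t x * q x))" using i1 by simp
    show "integrable leb (\<lambda>x. icube N R x * (w x * hfun (q x / w x)) + ecost t x * icube N R x)"
      using relent_integrable[OF q] i2 by simp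
    fix x assume "x \<in> space leb"
    hence x: "x \<in> RN N" by simp
    show "\<delta> * (Dst w w' t x * q x) \<le> icube N R x * (w x * hfun (q x / w x)) + ecost t x * icube N R x"
    proof (cases "x \<in> cubeN N R")
      case True
      let ?a = "\<delta> * max 0 (Dst w w' t x)"
      have "\<delta> * (Dst w w' t x * q x) \<le> ?a * q x"
        using \<delta> dens_D(2)[OF q x] unfolding mult.assoc by (intro mult_left_mono mult_right_mono) auto
      also have "\<dots> = w x * (q x / w x * ?a)" using wpos[OF x] by simp
      also have "\<dots> \<le> w x * (hfun (q x / w x) + (exp ?a - 1))"
        using wpos[OF x] dens_D(2)[OF q x] by (intro mult_left_mono hfun_young) auto
      also have "\<dots> = icube N R x * (w x * hfun (q x / w x)) + ecost t x * icube N R x"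
        using True by (simp add: ecost_def algebra_simps)
      finally show ?thesis .
    next
      case False
      hence "q x = 0" using dens_D(4)[OF q x] by blast
      thus ?thesis using False by simp
    qed
  qed
  also have "\<dots> = relent w q + (\<integral>x. ecost t x * icube N R x \<partial>leb)"
    unfolding relent_def using relent_integrable[OF q] i2 by simp
  finally show ?thesis using \<delta> by (simp add: field_simps)
qed

text \<open>The Riemann sum of the cost is the one that \<open>pw_integral\<close> compares with an
  integral if all densities are the indicator of the cube. The resulting path is at most that
  indicator, and the cost is nonnegative.\<close>

lemma ecost_sum_le:
  assumes n: "n > 0"
    and cl: "\<And>t t' x. t \<in> {0..T} \<Longrightarrow> t' \<in> {0..T} \<Longrightarrow> x \<in> cubeN N R \<Longrightarrow> \<bar>t - t'\<bar> \<le> T / n \<Longrightarrow> \<bar>ecost t x - ecost t' x\<bar> \<le> \<epsilon>"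
  shows "(\<Sum>k<n. T / n * (\<integral>x. ecost (real k * (T / n)) x * icube N R x \<partial>leb))
     \<le> (\<integral>(t, x). ecost t x * icube N R x \<partial>PM) + T * (\<epsilon> * measure leb (cubeN N R))"
proof -
  note P = pw_integral[OF n dens_indicator_cube ecost_continuous cl]
  obtain B where B: "B > 0" "\<And>t x. t \<in> {0..T} \<Longrightarrow> x \<in> cubeN N R \<Longrightarrow> \<bar>ecost t x\<bar> \<le> B"
    using cubeN_bounded[OF ecost_continuous, of R] by metis
  have i: "integrable PM (\<lambda>(t, x). ecost t x * icube N R x)"
  proof (rule integrable_PM[where B=B and r=R])
    have [measurable]: "(\<lambda>z. ecost (fst z) (snd z)) \<in> borel_measurable PM"
      using borel_measurable_lebT_lebN_continuous[OF ecost_continuous] by (simp add: case_prod_unfold)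
    have "(\<lambda>z. ecost (fst z) (snd z) * icube N R (snd z)) \<in> borel_measurable PM" by measurable
    thus "(\<lambda>(t, x). ecost t x * icube N R x) \<in> borel_measurable PM" by (simp add: case_prod_unfold)
  qed (use B in \<open>auto simp: indicator_def\<close>)
  have "(\<integral>(t, x). ecost t x * pw n (\<lambda>k. icube N R) t x \<partial>PM) \<le> (\<integral>(t, x). ecost t x * icube N R x \<partial>PM)"
  proof (rule integral_mono[OF P(1) i])
    fix z assume "z \<in> space PM"
    then obtain t x where z: "z = (t, x)" "t \<in> {0..T}" "x \<in> RN N" by (auto simp: space_pair_measure)
    have "pw n (\<lambda>k. icube N R) t x \<le> (icube N R x :: real)"
    proof (cases "t \<le> 0")
      case True thus ?thesis by (simp add: pw_zero)
    next
      case False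
      then obtain k where "k < n" "t \<in> {real k * (T / n)<..real (Suc k) * (T / n)}"
        using z n by (auto intro: pw_cover[of t n])
      thus ?thesis by (simp add: pw_eq)
    qed
    thus "(case z of (t, x) \<Rightarrow> ecost t x * pw n (\<lambda>k. icube N R) t x) \<le> (case z of (t, x) \<Rightarrow> ecost t x * icube N R x)"
      using ecost_nonneg[OF z(3), of t] by (auto simp: z intro: mult_left_mono)
  qed auto
  with P(2) show ?thesis by (simp add: abs_le_iff)
qed

text \<open>Discrete Gronwall inequality. The new entropy occurs on both sides of the step estimate,
  since densities are read at the right end, and is absorbed for steps of size at most
  \<open>\<delta> / 2\<close>.\<close>

lemma path_entropy:
  assumes p: "dens N K b m p" and R: "K + real N * (C * T) \<le> R" and \<eta>: "\<eta> > 0"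
  shows "\<forall>\<^sub>F n in sequentially. (\<integral>\<^sup>+z. ennreal (icube N R (snd z) * (w (snd z) * hfun (path n p (fst z) (snd z) / w (snd z)))) \<partial>PM)
     \<le> ennreal (T * (exp (2 * T / \<delta>) * (relent w p + (\<integral>(t, x). ecost t x * icube N R x \<partial>PM) / \<delta>)) + \<eta>)"
proof -
  have m0: "m \<ge> 0" by (rule dens_mass_nonneg[OF p])
  define A where "A = (\<integral>(t, x). ecost t x * icube N R x \<partial>PM)"
  define V where "V = measure leb (cubeN N R)"
  \<comment> \<open>Per unit of \<epsilon>, what the Gronwall factor and the integration in time
    make of the Riemann error of the cost and of the two step errors, one for the entropy and one
    for \<open>ln (w x)\<close>.\<close>
  define K2 where "K2 = T * (exp (2 * T / \<delta>) * (T * V / \<delta> + 2 * T * (real N * (1 + real N) * m)))"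
  have V: "V \<ge> 0" by (simp add: V_def)
  have K2: "K2 \<ge> 0" using V T_pos \<delta> m0 by (auto simp: K2_def)
  define \<epsilon> where "\<epsilon> = \<eta> / (K2 + 1)"
  have \<epsilon>: "\<epsilon> > 0" using \<eta> K2 by (simp add: \<epsilon>_def)
  have \<epsilon>K: "\<epsilon> * K2 \<le> \<eta>" using \<eta> K2 by (simp add: \<epsilon>_def field_simps)
  have eC: "\<epsilon> / C > 0" using \<epsilon> C_pos by simp
  note lw = C1N_ln[OF w wpos]
  have c1: "continuous_on ({0..T} \<times> RN N) (\<lambda>(t, x). f i t x * (w' i x / w x))" if "i < N" for i
    using continuous_on_mult[OF f_cont[OF that] continuous_on_lift_time[OF C1N_D(2)[OF lw that]]]
    by (simp add: case_prod_unfold)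
  have c2: "continuous_on ({0..T} \<times> RN N) (\<lambda>(t, x). - f' i t x)" if "i < N" for i
    using continuous_on_minus[OF f'_cont[OF that]] by (simp add: case_prod_unfold)
  have e1: "\<forall>\<^sub>F \<tau> in at_right 0. \<forall>i\<in>{..<N}. \<forall>t\<in>{0..T}. close_on_cube \<tau> \<epsilon> (\<lambda>x. f i t x * (w' i x / w x))"
    using c1 by (intro eventually_close_family \<epsilon>)
  have e2: "\<forall>\<^sub>F \<tau> in at_right 0. \<forall>i\<in>{..<N}. \<forall>t\<in>{0..T}. close_on_cube \<tau> (\<epsilon> / C) (\<lambda>x. w' i x / w x)"
    using C1N_D(2)[OF lw] by (intro eventually_close_family eC continuous_on_lift_time)
  have e3: "\<forall>\<^sub>F \<tau> in at_right 0. \<forall>i\<in>{..<N}. \<forall>t\<in>{0..T}. close_on_cube \<tau> \<epsilon> (\<lambda>x. - f' i t x)"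
    using c2 by (intro eventually_close_family \<epsilon>)
  have e4: "\<forall>\<^sub>F \<tau> in at_right 0. \<tau> * (2 * c\<^sup>2) \<le> \<epsilon>"
    using \<epsilon> by (intro eventually_small_mult) auto
  have e5: "\<forall>\<^sub>F \<tau> in at_right 0. \<tau> * (1 / \<delta>) \<le> 1/2"
    using \<delta> by (intro eventually_small_mult) auto
  have ev: "\<forall>\<^sub>F \<tau> in at_right 0. (\<tau> * c \<le> 1/2) \<and> \<tau> / \<delta> \<le> 1/2 \<and> 2 * \<tau> * c\<^sup>2 \<le> \<epsilon> \<and>
     (\<forall>i\<in>{..<N}. \<forall>t\<in>{0..T}. close_on_cube \<tau> (\<epsilon> / C) (\<lambda>x. w' i x / w x)) \<and>
     (\<forall>i\<in>{..<N}. \<forall>t\<in>{0..T}. close_on_cube \<tau> \<epsilon> (\<lambda>x. f i t x * (w' i x / w x))) \<and>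
     (\<forall>i\<in>{..<N}. \<forall>t\<in>{0..T}. close_on_cube \<tau> \<epsilon> (\<lambda>x. - f' i t x)) \<and>
     (\<forall>t\<in>{0..T}. \<forall>t'\<in>{0..T}. \<forall>x\<in>cubeN N R. \<bar>t - t'\<bar> \<le> \<tau> \<longrightarrow> \<bar>ecost t x - ecost t' x\<bar> \<le> \<epsilon>)"
    using eventually_close_on_cube[OF ecost_continuous \<epsilon>] e1 e2 e3 e4 e5
      eventually_small_mult[OF half_gt_zero[OF zero_less_one] less_imp_le[OF c_pos]]
    by eventually_elim (auto simp: mult_ac)
  show ?thesis
    unfolding A_def[symmetric] using filterlim_step[unfolded filterlim_iff, rule_format, OF ev] eventually_gt_at_top[of 0]
  proof eventually_elim
    case (elim n)
    define \<tau> where "\<tau> = T / n"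
    have \<tau>: "\<tau> > 0" "real n * \<tau> = T" "\<tau> * c \<le> 1/2" "\<tau> / \<delta> \<le> 1/2" using elim T_pos by (auto simp: \<tau>_def)
    let ?E = "evol \<tau> p"
    let ?d = "real N * (1 + real N) * \<epsilon> * m"
    have kT: "real k * \<tau> \<le> T" if "k \<le> n" for k
      using mult_right_mono[of "real k" "real n" \<tau>] that \<tau> by auto
    have tk: "real k * \<tau> \<in> {0..T}" if "k \<le> n" for k using kT[OF that] \<tau> by simp
    have Ed: "dens N R (b * exp (c * T * real N)) m (?E k)" if "k \<le> n" for k
      by (rule evol_dens(1)[OF \<tau>(1,3) kT[OF that] p R])
    define cc where "cc k = (\<integral>x. ecost (real k * \<tau>) x * icube N R x \<partial>leb)" for k
    have cc0: "cc k \<ge> 0" for k unfolding cc_def using ecost_nonneg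
      by (intro Bochner_Integration.integral_nonneg) (auto simp: indicator_def)
    define G where "G k = relent w (?E k)" for k
    have G0: "G k \<ge> 0" if "k \<le> n" for k unfolding G_def by (rule relent_nonneg[OF Ed[OF that]])
    have step: "G (Suc k) \<le> G k + \<tau> * ((G (Suc k) + cc k) / \<delta>) + 2 * \<tau> * ?d" if k: "k < n" for k
    proof -
      have t: "real k * \<tau> \<in> {0..T}" using tk k by simp
      have dk: "dens N R (b * exp (c * T * real N)) m (?E k)" and dk': "dens N R (b * exp (c * T * real N)) m (?E (Suc k))"
        using Ed k by (simp_all del: evol.simps)
      let ?X = "\<integral>x. (\<Sum>i<N. - f' i (real k * \<tau>) x) * ?E (Suc k) x \<partial>leb"
      let ?Y = "\<integral>x. (\<Sum>i<N. f i (real k * \<tau>) x * (w' i x / w x)) * ?E (Suc k) x \<partial>leb"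
      have 1: "\<bar>(\<integral>x. ln (w x) * ?E (Suc k) x \<partial>leb) - (\<integral>x. ln (w x) * ?E k x \<partial>leb) - \<tau> * ?Y\<bar> \<le> \<tau> * ?d"
        by (rule evol_step_test[OF \<tau>(1,3) kT[OF Suc_leI[OF k]] p R less_imp_le[OF \<epsilon>] lw])
           (use elim t in \<open>auto simp: \<tau>_def\<close>)
      have 2: "\<bar>(\<integral>x. ln (?E (Suc k) x) * ?E (Suc k) x \<partial>leb) - (\<integral>x. ln (?E k x) * ?E k x \<partial>leb) - \<tau> * ?X\<bar> \<le> \<tau> * ?d"
        by (rule evol_step_entropy[OF \<tau>(1,3) kT[OF Suc_leI[OF k]] p R less_imp_le[OF \<epsilon>]])
           (use elim t in \<open>auto simp: \<tau>_def\<close>)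
      have cX: "continuous_on (RN N) (\<lambda>x. \<Sum>i<N. - f' i (real k * \<tau>) x)"
        using continuous_on_slice_time[OF c2 t] by (intro continuous_on_sum) auto
      have cY: "continuous_on (RN N) (\<lambda>x. \<Sum>i<N. f i (real k * \<tau>) x * (w' i x / w x))"
        using continuous_on_slice_time[OF c1 t] by (intro continuous_on_sum) auto
      have int: "integrable leb (\<lambda>x. u x * ?E (Suc k) x)" if uc: "continuous_on (RN N) u" for u
      proof -
        obtain B where B: "B > 0" "\<And>x. x \<in> cubeN N R \<Longrightarrow> \<bar>u x\<bar> \<le> B"
          using cubeN_bounded[OF continuous_on_lift_time[OF uc, of "{0..T}"], of R] T_pos
          by (metis atLeastAtMost_iff le_less order_refl)
        show ?thesis by (rule dens_integrable[OF dk' borel_measurable_lebN_continuous[OF uc], where \<epsilon>=B])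
          (use B dens_D(4)[OF dk'] in auto)
      qed
      have "?X - ?Y = (\<integral>x. Dst w w' (real k * \<tau>) x * ?E (Suc k) x \<partial>leb)"
      proof -
        have "?X - ?Y = (\<integral>x. (\<Sum>i<N. - f' i (real k * \<tau>) x) * ?E (Suc k) x - (\<Sum>i<N. f i (real k * \<tau>) x * (w' i x / w x)) * ?E (Suc k) x \<partial>leb)"
          by (rule Bochner_Integration.integral_diff[symmetric, OF int[OF cX] int[OF cY]])
        also have "\<dots> = (\<integral>x. Dst w w' (real k * \<tau>) x * ?E (Suc k) x \<partial>leb)"
          by (intro Bochner_Integration.integral_cong refl)
             (simp add: Dst_def sum_negf sum.distrib left_diff_distrib distrib_right del: evol.simps)
        finally show ?thesis .
      qed
      also have "\<dots> \<le> (G (Suc k) + cc k) / \<delta>"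
        unfolding G_def cc_def by (rule relent_young[OF dk' t])
      finally have 3: "\<tau> * ?X - \<tau> * ?Y \<le> \<tau> * ((G (Suc k) + cc k) / \<delta>)"
        using \<tau>(1) by (simp only: right_diff_distrib[symmetric]) (intro mult_left_mono, auto)
      \<comment> \<open>The constant terms of the relative entropy cancel, which leaves precisely
        the two quantities estimated before.\<close>
      have G: "G (Suc k) - G k = ((\<integral>x. ln (?E (Suc k) x) * ?E (Suc k) x \<partial>leb) - (\<integral>x. ln (?E k x) * ?E k x \<partial>leb))
          - ((\<integral>x. ln (w x) * ?E (Suc k) x \<partial>leb) - (\<integral>x. ln (w x) * ?E k x \<partial>leb))"
        unfolding G_def relent_eq[OF dk] relent_eq[OF dk'] by simp
      have 4: "2 * \<tau> * ?d = \<tau> * ?d + \<tau> * ?d" by simp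
      show ?thesis unfolding 4 using 1 2 3 G by linarith
    qed
    \<comment> \<open>For \<open>u = \<tau> / \<delta>\<close> at most 1/2, the inverse of
      \<open>1 - u\<close> is at most \<open>1 + 2 * u\<close>, hence at most
      \<open>exp (2 * u)\<close>. Over \<open>n\<close> steps this becomes the factor
      \<open>exp (2 * T / \<delta>)\<close>.\<close>
    define a where "a = exp (2 * \<tau> / \<delta>)"
    have a1: "a \<ge> 1" using \<tau> \<delta> by (simp add: a_def)
    define s where "s k = \<tau> * cc k / \<delta> + 2 * \<tau> * ?d" for k
    have s0: "s k \<ge> 0" for k using cc0 \<tau> \<delta> m0 \<epsilon> by (simp add: s_def)
    have step': "G (Suc k) \<le> a * (G k + s k)" if k: "k < n" for k
    proof -
      let ?u = "\<tau> / \<delta>"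
      have u: "0 < ?u" "?u \<le> 1/2" using \<tau> \<delta> by auto
      have le: "(1 - ?u) * G (Suc k) \<le> G k + s k"
        using step[OF k] by (simp add: s_def algebra_simps add_divide_distrib)
      have "1 \<le> (1 + 2 * ?u) * (1 - ?u)"
      proof -
        have "(1 + 2 * ?u) * (1 - ?u) = 1 + ?u * (1 - 2 * ?u)" by (simp only: algebra_simps)
        moreover have "0 \<le> ?u * (1 - 2 * ?u)" by (rule mult_nonneg_nonneg) (use u in linarith)+
        ultimately show ?thesis by linarith
      qed
      also have "\<dots> \<le> a * (1 - ?u)"
      proof (rule mult_right_mono)
        show "1 + 2 * ?u \<le> a" using exp_ge_add_one_self[of "2 * \<tau> / \<delta>"] by (simp add: a_def)
        show "0 \<le> 1 - ?u" using u by linarith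
      qed
      finally have "1 * G (Suc k) \<le> (a * (1 - ?u)) * G (Suc k)"
        using G0[of "Suc k"] k by (intro mult_right_mono) auto
      also have "\<dots> = a * ((1 - ?u) * G (Suc k))" by simp
      also have "\<dots> \<le> a * (G k + s k)" using le a1 by (intro mult_left_mono) auto
      finally show ?thesis by simp
    qed
    have Gk: "G k \<le> a ^ k * (G 0 + (\<Sum>j<k. s j))" if "k \<le> n" for k
      using that
    proof (induction k)
      case (Suc k)
      have "G (Suc k) \<le> a * (G k + s k)" using step' Suc.prems by simp
      also have "\<dots> \<le> a * (a ^ k * (G 0 + (\<Sum>j<k. s j)) + a ^ k * s k)"
        using Suc a1 s0 one_le_power[OF a1, of k] mult_right_mono[of 1 "a ^ k" "s k"] by (intro mult_left_mono add_mono) auto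
      finally show ?case by (simp add: algebra_simps)
    qed simp
    define Bd where "Bd = exp (2 * T / \<delta>) * (relent w p + (A + T * (\<epsilon> * V)) / \<delta> + 2 * T * ?d)"
    have GB: "G k \<le> Bd" if "k \<le> n" for k
    proof -
      have "a ^ k \<le> a ^ n" using that a1 by (intro power_increasing) auto
      also have "a ^ n = exp (real n * (2 * \<tau> / \<delta>))" unfolding a_def by (rule exp_of_nat_mult[symmetric])
      also have "real n * (2 * \<tau> / \<delta>) = 2 * (real n * \<tau>) / \<delta>" by simp
      also have "\<dots> = 2 * T / \<delta>" by (simp only: \<tau>(2))
      finally have ak: "a ^ k \<le> exp (2 * T / \<delta>)" .
      have "(\<Sum>j<k. s j) \<le> (\<Sum>j<n. s j)" using that s0 by (intro sum_mono2) auto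
      also have "\<dots> = (\<Sum>j<n. \<tau> * cc j) / \<delta> + 2 * (real n * \<tau>) * ?d"
        by (simp add: s_def sum.distrib sum_divide_distrib)
      also have "(\<Sum>j<n. \<tau> * cc j) \<le> A + T * (\<epsilon> * V)"
        unfolding A_def V_def cc_def \<tau>_def by (rule ecost_sum_le) (use elim in \<open>auto\<close>)
      finally have s: "(\<Sum>j<k. s j) \<le> (A + T * (\<epsilon> * V)) / \<delta> + 2 * T * ?d"
        using \<delta> \<tau>(2) by (simp add: divide_right_mono)
      have "G k \<le> a ^ k * (G 0 + (\<Sum>j<k. s j))" by (rule Gk[OF that])
      also have "\<dots> \<le> exp (2 * T / \<delta>) * (G 0 + (\<Sum>j<k. s j))"
        using ak G0[of 0] s0 by (intro mult_right_mono add_nonneg_nonneg sum_nonneg) auto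
      also have "\<dots> \<le> Bd" unfolding Bd_def using s by (intro mult_left_mono) (auto simp: G_def)
      finally show ?thesis .
    qed
    have Bd0: "Bd \<ge> 0" using GB[of 0] G0[of 0] by simp
    have inner: "(\<integral>\<^sup>+x. ennreal (icube N R x * (w x * hfun (path n p t x / w x))) \<partial>leb) \<le> ennreal Bd"
      if t: "t \<in> {0<..T}" for t
    proof -
      obtain k where k: "k < n" "t \<in> {real k * (T / n)<..real (Suc k) * (T / n)}"
        using pw_cover[of t n] t elim by auto
      have e: "path n p t x = ?E (Suc k) x" for x unfolding path_def \<tau>_def by (rule pw_eq[OF k])
      have dk: "dens N R (b * exp (c * T * real N)) m (?E (Suc k))" using Ed k by (simp del: evol.simps)
      have nn: "0 \<le> icube N R x * (w x * hfun (?E (Suc k) x / w x))" if "x \<in> RN N" for x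
        using wpos[OF that] dens_D(2)[OF dk that]
        by (intro mult_nonneg_nonneg hfun_nonneg divide_nonneg_pos) auto
      have "(\<integral>\<^sup>+x. ennreal (icube N R x * (w x * hfun (path n p t x / w x))) \<partial>leb) = ennreal (G (Suc k))"
        unfolding e G_def relent_def using nn by (intro nn_integral_eq_integral relent_integrable[OF dk]) auto
      also have "\<dots> \<le> ennreal Bd" using GB[of "Suc k"] k by (intro ennreal_leI) auto
      finally show ?thesis .
    qed
    interpret leb: sigma_finite_measure leb by (rule sigma_finite_lebN)
    have [measurable]: "w \<in> borel_measurable leb" by (rule borel_measurable_lebN_continuous[OF C1N_D(1)[OF w]])
    have "(\<lambda>(t, x). path n p t x) \<in> borel_measurable PM"
      unfolding path_def
    proof (rule pw_measurable)
      fix k assume "k < n"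
      from dens_D(1)[OF Ed[of "Suc k"]] this show "evol (T / real n) p (Suc k) \<in> borel_measurable leb"
        by (simp add: \<tau>_def del: evol.simps)
    qed
    hence [measurable]: "(\<lambda>z. path n p (fst z) (snd z)) \<in> borel_measurable PM" by (simp add: case_prod_unfold)
    let ?h = "\<lambda>z. ennreal (icube N R (snd z) * (w (snd z) * hfun (path n p (fst z) (snd z) / w (snd z))))"
    have hm: "?h \<in> borel_measurable PM" by measurable
    \<comment> \<open>At time 0 the path is 0 and not a value of the scheme, but a single time is
      negligible.\<close>
    have AE0: "AE t in lebT T. t \<noteq> 0"
      unfolding lebT_def by (subst AE_restrict_space_iff) (auto intro: AE_mp[OF AE_lborel_singleton[of 0]])
    have "(\<integral>\<^sup>+z. ?h z \<partial>PM) = (\<integral>\<^sup>+t. (\<integral>\<^sup>+x. ?h (t, x) \<partial>leb) \<partial>lebT T)"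
      by (rule leb.nn_integral_fst[OF hm, symmetric])
    also have "\<dots> \<le> (\<integral>\<^sup>+t. ennreal Bd \<partial>lebT T)"
    proof (rule nn_integral_mono_AE)
      show "AE t in lebT T. (\<integral>\<^sup>+x. ?h (t, x) \<partial>leb) \<le> ennreal Bd"
        using AE0 AE_space
      proof eventually_elim
        case (elim t)
        thus ?case using inner[of t] by auto
      qed
    qed
    also have "\<dots> = ennreal (Bd * T)" using T_pos Bd0 emeasure_lebT[of T] by (simp add: ennreal_mult)
    also have "\<dots> \<le> ennreal (T * (exp (2 * T / \<delta>) * (relent w p + A / \<delta>)) + \<eta>)"
    proof (rule ennreal_leI)
      have "Bd * T = T * (exp (2 * T / \<delta>) * (relent w p + A / \<delta>)) + \<epsilon> * K2"
        by (simp add: Bd_def K2_def algebra_simps add_divide_distrib)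
      thus "Bd * T \<le> T * (exp (2 * T / \<delta>) * (relent w p + A / \<delta>)) + \<eta>" using \<epsilon>K by simp
    qed
    finally show ?case .
  qed
qed

end

end

section \<open>Affine changes of variables in R^N\<close>

text \<open>A product measure is determined by boxes, and on a box the claim factors into the
  one-dimensional affine formula.\<close>

lemma lebN_affine:
  assumes c: "c \<noteq> 0"
  shows "lebN N = density (distr (lebN N) (lebN N) (\<lambda>x. \<lambda>i\<in>{..<N}. a i + c * x i)) (\<lambda>_. ennreal (\<bar>c\<bar> ^ N))" (is "_ = ?P")
proof -
  interpret product_sigma_finite "\<lambda>_::nat. lborel :: real measure" ..
  let ?A = "\<lambda>x. \<lambda>i\<in>{..<N}. a i + c * x i"
  have Am [measurable]: "?A \<in> lebN N \<rightarrow>\<^sub>M lebN N"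
    unfolding lebN_def by (rule measurable_restrict) measurable
  have "?P = PiM {..<N} (\<lambda>_. lborel)"
  proof (rule PiM_eqI)
    fix B :: "nat \<Rightarrow> real set" assume B: "\<And>i. i \<in> {..<N} \<Longrightarrow> B i \<in> sets lborel"
    have Bm: "PiE {..<N} B \<in> sets (lebN N)" unfolding lebN_def using B by (intro sets_PiM_I_finite) auto
    have vim: "?A -` PiE {..<N} B \<inter> space (lebN N) = PiE {..<N} (\<lambda>i. (\<lambda>s. a i + c * s) -` B i)"
      by (auto simp: RN_def PiE_iff)
    have Bm': "(\<lambda>s. a i + c * s) -` B i \<in> sets lborel" if "i < N" for i
      using B[of i] that measurable_sets[of "\<lambda>s. a i + c * s" lborel borel "B i"] by simp
    have "emeasure ?P (PiE {..<N} B) = ennreal (\<bar>c\<bar> ^ N) * emeasure (distr (lebN N) (lebN N) ?A) (PiE {..<N} B)"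
      using Bm by (subst emeasure_density_const) auto
    also have "\<dots> = ennreal (\<bar>c\<bar> ^ N) * emeasure (lebN N) (PiE {..<N} (\<lambda>i. (\<lambda>s. a i + c * s) -` B i))"
      using Bm vim by (subst emeasure_distr) auto
    also have "\<dots> = ennreal (\<bar>c\<bar> ^ N) * (\<Prod>i<N. emeasure lborel ((\<lambda>s. a i + c * s) -` B i))"
      unfolding lebN_def using Bm' by (subst emeasure_PiM) auto
    also have "\<dots> = (\<Prod>i<N. ennreal \<bar>c\<bar> * emeasure lborel ((\<lambda>s. a i + c * s) -` B i))"
      by (simp add: prod.distrib ennreal_power)
    also have "\<dots> = (\<Prod>i<N. emeasure lborel (B i))"
    proof (rule prod.cong[OF refl])
      fix i assume "i \<in> {..<N}"
      hence Bi: "B i \<in> sets borel" using B by simp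
      have "emeasure lborel (B i) = emeasure (density (distr lborel borel (\<lambda>x. a i + c * x)) (\<lambda>_. ennreal \<bar>c\<bar>)) (B i)"
        using lborel_real_affine[OF c, of "a i"] by simp
      also have "\<dots> = ennreal \<bar>c\<bar> * emeasure lborel ((\<lambda>s. a i + c * s) -` B i)"
        using Bi by (subst emeasure_density_const) (auto simp: emeasure_distr)
      finally show "ennreal \<bar>c\<bar> * emeasure lborel ((\<lambda>s. a i + c * s) -` B i) = emeasure lborel (B i)" by simp
    qed
    finally show "emeasure ?P (PiE {..<N} B) = (\<Prod>i<N. emeasure lborel (B i))" .
  qed (auto simp: lebN_def)
  thus ?thesis by (simp add: lebN_def)
qed

lemma affine_measurable [measurable]: "(\<lambda>x. \<lambda>i\<in>{..<N}. a i + c * x i) \<in> lebN N \<rightarrow>\<^sub>M lebN N"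
  unfolding lebN_def by (rule measurable_restrict) measurable

lemma lebN_affine_integral:
  fixes F :: "(nat \<Rightarrow> real) \<Rightarrow> real"
  assumes c: "c \<noteq> 0" and F [measurable]: "F \<in> borel_measurable (lebN N)"
  shows "(\<integral>x. F x \<partial>lebN N) = \<bar>c\<bar> ^ N * (\<integral>x. F (\<lambda>i\<in>{..<N}. a i + c * x i) \<partial>lebN N)"
  by (subst lebN_affine[OF c, of N a])
     (simp add: integral_density integral_distr)

lemma lebN_affine_nn_integral:
  assumes c: "c \<noteq> 0" and F [measurable]: "F \<in> borel_measurable (lebN N)"
  shows "(\<integral>\<^sup>+x. F x \<partial>lebN N) = ennreal (\<bar>c\<bar> ^ N) * (\<integral>\<^sup>+x. F (\<lambda>i\<in>{..<N}. a i + c * x i) \<partial>lebN N)"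
  by (subst lebN_affine[OF c, of N a])
     (simp add: nn_integral_density nn_integral_distr nn_integral_cmult)

definition rsub :: "nat \<Rightarrow> (nat \<Rightarrow> real) \<Rightarrow> (nat \<Rightarrow> real) \<Rightarrow> nat \<Rightarrow> real" where
  "rsub N x z = restrict (\<lambda>i. x i - z i) {..<N}"

lemma rsub_RN [simp]: "rsub N x z \<in> RN N" by (simp add: rsub_def)

lemma rsub_measurable [measurable (raw)]:
  assumes [measurable]: "F \<in> M \<rightarrow>\<^sub>M lebN N" "G \<in> M \<rightarrow>\<^sub>M lebN N"
  shows "(\<lambda>w. rsub N (F w) (G w)) \<in> M \<rightarrow>\<^sub>M lebN N"
  unfolding rsub_def lebN_def
proof (rule measurable_restrict)
  fix i assume "i \<in> {..<N}"
  hence i: "i < N" by simp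
  note [measurable] = measurable_compose[OF assms(1) measurable_lebN_component[OF i]] measurable_compose[OF assms(2) measurable_lebN_component[OF i]]
  show "(\<lambda>w. F w i - G w i) \<in> M \<rightarrow>\<^sub>M lborel" by measurable
qed

lemma integral_reflect:
  fixes F :: "(nat \<Rightarrow> real) \<Rightarrow> real"
  assumes "F \<in> borel_measurable (lebN N)"
  shows "(\<integral>z. F (rsub N x z) \<partial>lebN N) = (\<integral>z. F z \<partial>lebN N)"
  using lebN_affine_integral[of "-1" F N x] assms by (simp add: rsub_def)

lemma integral_translate:
  fixes F :: "(nat \<Rightarrow> real) \<Rightarrow> real"
  assumes "F \<in> borel_measurable (lebN N)"
  shows "(\<integral>x. F (rsub N x z) \<partial>lebN N) = (\<integral>x. F x \<partial>lebN N)"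
proof -
  have "restrict (\<lambda>i. - z i + 1 * x i) {..<N} = rsub N x z" for x by (auto simp: rsub_def fun_eq_iff)
  thus ?thesis using lebN_affine_integral[of 1 F N "\<lambda>i. - z i"] assms by simp
qed

lemma rsub_cube: "x \<in> cubeN N r \<Longrightarrow> z \<in> cubeN N s \<Longrightarrow> rsub N x z \<in> cubeN N (r + s)"
  by (auto simp: cubeN_def rsub_def intro!: order_trans[OF abs_triangle_ineq4] add_mono)

lemma tendsto_RN:
  fixes x :: "nat \<Rightarrow> nat \<Rightarrow> real"
  assumes "\<And>n. x n \<in> RN N" "y \<in> RN N" "\<And>i. i < N \<Longrightarrow> (\<lambda>n. x n i) \<longlonglongrightarrow> y i"
  shows "x \<longlonglongrightarrow> y"
proof (rule metric_LIMSEQ_I)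
  fix e :: real assume e: "e > 0"
  have "\<forall>\<^sub>F n in sequentially. \<forall>i\<in>{..<N}. \<bar>x n i - y i\<bar> < e / 3"
  proof (intro eventually_ball_finite ballI)
    fix i assume "i \<in> {..<N}"
    hence "i < N" by simp
    from tendstoD[OF assms(3)[OF this], of "e / 3"] e
    show "\<forall>\<^sub>F n in sequentially. \<bar>x n i - y i\<bar> < e / 3" by (simp add: dist_real_def)
  qed simp
  then obtain n0 where n0: "\<And>n i. n \<ge> n0 \<Longrightarrow> i < N \<Longrightarrow> \<bar>x n i - y i\<bar> < e / 3"
    by (auto simp: eventually_sequentially)
  have "dist (x n) y < e" if "n \<ge> n0" for n
  proof -
    have "dist (x n) y \<le> 2 * (e / 3)"
      using n0[OF that] assms e by (intro dist_RN_le[of _ N]) (auto intro: less_imp_le)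
    thus ?thesis using e by simp
  qed
  thus "\<exists>n0. \<forall>n\<ge>n0. dist (x n) y < e" by blast
qed

lemma tendsto_component: "(x \<longlonglongrightarrow> (y :: nat \<Rightarrow> real)) \<Longrightarrow> (\<lambda>n. x n i) \<longlonglongrightarrow> y i"
  by (rule continuous_on_tendsto_compose[OF continuous_on_product_coordinates]) auto

lemma continuous_on_RN_sequentially:
  assumes "continuous_on (RN N) f" "\<And>n. x n \<in> RN N" "y \<in> RN N" "x \<longlonglongrightarrow> y"
  shows "(\<lambda>n. f (x n)) \<longlonglongrightarrow> f y"
  using assms by (simp add: continuous_on_sequentially o_def)

section \<open>Smoothness of convolutions\<close>

context
  fixes N :: nat and g k :: "(nat \<Rightarrow> real) \<Rightarrow> real" and k' and B r :: real
  assumes g [measurable]: "g \<in> borel_measurable (lebN N)" and gB: "\<And>x. x \<in> RN N \<Longrightarrow> \<bar>g x\<bar> \<le> B"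
    and k: "C1N N k k'"
    and ks: "\<And>x. x \<in> RN N \<Longrightarrow> x \<notin> cubeN N r \<Longrightarrow> k x = 0"
    and ks': "\<And>i x. i < N \<Longrightarrow> x \<in> RN N \<Longrightarrow> x \<notin> cubeN N r \<Longrightarrow> k' i x = 0"
begin

lemma conv_B: "B \<ge> 0"
  using gB[of "restrict (\<lambda>_. 0) {..<N}"] by (simp add: order_trans[OF abs_ge_zero])

text \<open>A convergent sequence stays in some cube, so all integrands vanish off one larger cube
  and are bounded there: dominated convergence applies. Formulated for a general \<open>u\<close>,
  it serves the kernel and its derivatives.\<close>

lemma conv_continuous_aux:
  assumes u: "continuous_on (RN N) u" and us: "\<And>x. x \<in> RN N \<Longrightarrow> x \<notin> cubeN N r \<Longrightarrow> u x = 0"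
  shows "continuous_on (RN N) (\<lambda>x. \<integral>z. g z * u (rsub N x z) \<partial>lebN N)"
    and "\<exists>U\<ge>0. \<forall>x\<in>RN N. \<bar>u x\<bar> \<le> U"
proof -
  note [measurable] = borel_measurable_lebN_continuous[OF u]
  obtain U where U: "U > 0" "\<And>x. x \<in> cubeN N r \<Longrightarrow> \<bar>u x\<bar> \<le> U"
    using cubeN_bounded[OF continuous_on_lift_time[OF u, of "{0..1::real}"], of r]
    by (metis atLeastAtMost_iff order_refl zero_le_one)
  have U': "\<bar>u x\<bar> \<le> U" if "x \<in> RN N" for x using U us[OF that] by (cases "x \<in> cubeN N r") auto
  show "\<exists>U\<ge>0. \<forall>x\<in>RN N. \<bar>u x\<bar> \<le> U" using U U' by (intro exI[of _ U]) auto
  show "continuous_on (RN N) (\<lambda>x. \<integral>z. g z * u (rsub N x z) \<partial>lebN N)"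
    unfolding continuous_on_sequentially
  proof (intro allI ballI impI, elim conjE)
    fix x y assume x: "\<forall>n. x n \<in> RN N" and y: "y \<in> RN N" and xy: "x \<longlonglongrightarrow> y"
    have xy': "(\<lambda>n. x n i) \<longlonglongrightarrow> y i" for i by (rule tendsto_component[OF xy])
    have "\<exists>X. \<forall>n. \<bar>x n i\<bar> \<le> X" for i
      using convergent_imp_Bseq[OF convergentI[OF xy'[of i]]] by (auto simp: Bseq_def)
    then obtain X where X: "\<And>i n. \<bar>x n i\<bar> \<le> X i" by metis
    define X' where "X' = (\<Sum>i<N. \<bar>X i\<bar>)"
    have X': "x n \<in> cubeN N X'" for n
    proof -
      have "\<bar>x n i\<bar> \<le> X'" if "i < N" for i
        using X[of n i] member_le_sum[of i "{..<N}" "\<lambda>i. \<bar>X i\<bar>"] that by (auto simp: X'_def)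
      thus ?thesis using x by (auto simp: cubeN_def)
    qed
    show "((\<lambda>x. \<integral>z. g z * u (rsub N x z) \<partial>lebN N) \<circ> x) \<longlonglongrightarrow> (\<integral>z. g z * u (rsub N y z) \<partial>lebN N)"
      unfolding o_def
    proof (rule integral_dominated_convergence[where w="\<lambda>z. (B * U) * icube N (X' + r) z"])
      have xs [measurable]: "x n \<in> space (lebN N)" "y \<in> space (lebN N)" for n using x y by auto
      show "(\<lambda>z. g z * u (rsub N y z)) \<in> borel_measurable (lebN N)" "(\<lambda>z. g z * u (rsub N (x n) z)) \<in> borel_measurable (lebN N)" for n
        using xs by measurable
      show "integrable (lebN N) (\<lambda>z. (B * U) * icube N (X' + r) z)"
        using emeasure_cubeN by (intro integrable_mult_right integrable_real_indicator) auto
      show "AE z in lebN N. (\<lambda>n. g z * u (rsub N (x n) z)) \<longlonglongrightarrow> g z * u (rsub N y z)"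
        by (intro AE_I2 tendsto_intros continuous_on_RN_sequentially[OF u] tendsto_RN[of _ N])
           (auto simp: rsub_def intro!: tendsto_intros xy')
      show "AE z in lebN N. norm (g z * u (rsub N (x n) z)) \<le> B * U * icube N (X' + r) z" for n
      proof (rule AE_I2)
        fix z assume "z \<in> space (lebN N)"
        hence z: "z \<in> RN N" by simp
        show "norm (g z * u (rsub N (x n) z)) \<le> B * U * icube N (X' + r) z"
        proof (cases "rsub N (x n) z \<in> cubeN N r")
          case True
          have "rsub N (x n) (rsub N (x n) z) = z" using z
            by (intro RN_eqI[of _ N]) (auto simp: rsub_def)
          with rsub_cube[OF X' True, of n] have "z \<in> cubeN N (X' + r)" by simp
          thus ?thesis using gB[OF z] U'[of "rsub N (x n) z"] conv_B
            by (auto simp: abs_mult intro!: mult_mono)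
        next
          case False
          thus ?thesis using us conv_B U by simp
        qed
      qed
    qed
  qed
qed

text \<open>Difference quotients of the kernel are bounded by its derivative and vanish off a common
  cube, so the limit may be taken under the integral.\<close>

lemma conv_C1N: "C1N N (\<lambda>x. \<integral>z. g z * k (rsub N x z) \<partial>lebN N) (\<lambda>i x. \<integral>z. g z * k' i (rsub N x z) \<partial>lebN N)"
  unfolding C1N_def
proof (intro conjI allI impI ballI)
  show "continuous_on (RN N) (\<lambda>x. \<integral>z. g z * k (rsub N x z) \<partial>lebN N)"
    by (rule conv_continuous_aux(1)[OF C1N_D(1)[OF k] ks])
  fix i assume i: "i < N"
  show "continuous_on (RN N) (\<lambda>x. \<integral>z. g z * k' i (rsub N x z) \<partial>lebN N)"
    by (rule conv_continuous_aux(1)[OF C1N_D(2)[OF k i] ks'[OF i]])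
  fix x assume x: "x \<in> RN N"
  obtain U where U: "U \<ge> 0" "\<And>x. x \<in> RN N \<Longrightarrow> \<bar>k x\<bar> \<le> U"
    using conv_continuous_aux(2)[OF C1N_D(1)[OF k] ks] by blast
  obtain U' where U': "U' \<ge> 0" "\<And>x. x \<in> RN N \<Longrightarrow> \<bar>k' i x\<bar> \<le> U'"
    using conv_continuous_aux(2)[OF C1N_D(2)[OF k i] ks'[OF i]] by blast
  note [measurable] = borel_measurable_lebN_continuous[OF C1N_D(1)[OF k]] borel_measurable_lebN_continuous[OF C1N_D(2)[OF k i]]
  \<comment> \<open>Room for increments of size at most 1 in coordinate \<open>i\<close>; the
    sequence of increments is started late enough for this.\<close>
  define X where "X = (\<Sum>j<N. \<bar>x j\<bar>) + 1"
  have xX: "\<bar>x j\<bar> \<le> X - 1" if "j < N" for j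
    using member_le_sum[of j "{..<N}" "\<lambda>j. \<bar>x j\<bar>"] that by (auto simp: X_def)
  have rs: "rsub N (x(i := s)) z = (rsub N x z)(i := s - z i)" for s z
    using i by (auto simp: rsub_def fun_eq_iff)
  have kd: "((\<lambda>s. k (rsub N (x(i := s)) z)) has_real_derivative k' i (rsub N (x(i := s)) z)) (at s)" for s z
  proof -
    have "((\<lambda>v. k ((rsub N x z)(i := v))) has_real_derivative k' i ((rsub N x z)(i := s - z i))) (at (s - z i))"
      by (rule C1N_D(3)[OF k i]) simp
    moreover have "((\<lambda>s. s - z i) has_real_derivative 1) (at s)"
      by (auto intro!: derivative_eq_intros)
    ultimately have "((\<lambda>s. k ((rsub N x z)(i := s - z i))) has_real_derivative k' i ((rsub N x z)(i := s - z i)) * 1) (at s)"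
      by (rule DERIV_chain2[where g="\<lambda>s. s - z i"])
    thus ?thesis unfolding rs by simp
  qed
  have lip: "\<bar>k (rsub N (x(i := s)) z) - k (rsub N (x(i := s')) z)\<bar> \<le> U' * \<bar>s - s'\<bar>" for s s' z
  proof -
    have "norm (k (rsub N (x(i := s)) z) - k (rsub N (x(i := s')) z)) \<le> U' * norm (s - s')"
    proof (rule field_differentiable_bound[where S=UNIV and f="\<lambda>s. k (rsub N (x(i := s)) z)" and f'="\<lambda>s. k' i (rsub N (x(i := s)) z)"])
      show "((\<lambda>s. k (rsub N (x(i := s)) z)) has_real_derivative k' i (rsub N (x(i := s)) z)) (at s)" for s by (rule kd)
      show "norm (k' i (rsub N (x(i := s)) z)) \<le> U'" for s using U'(2)[of "rsub N (x(i := s)) z"] by simp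
    qed auto
    thus ?thesis by simp
  qed
  have sup: "z \<in> cubeN N (X + \<bar>r\<bar>)" if z: "z \<in> RN N" and s: "\<bar>s - x i\<bar> \<le> 1" and nz: "rsub N (x(i := s)) z \<in> cubeN N r" for z s
  proof -
    have "\<bar>z j\<bar> \<le> X + \<bar>r\<bar>" if "j < N" for j
    proof -
      have "\<bar>(x(i := s)) j - z j\<bar> \<le> r" using nz that by (auto simp: cubeN_def rsub_def)
      moreover have "\<bar>(x(i := s)) j\<bar> \<le> X" using xX[OF that] s by (cases "j = i") auto
      ultimately show ?thesis by linarith
    qed
    thus ?thesis using z by (auto simp: cubeN_def)
  qed
  have kint: "integrable (lebN N) (\<lambda>z. g z * k (rsub N (x(i := s)) z))" if s: "\<bar>s - x i\<bar> \<le> 1" for s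
  proof (rule Bochner_Integration.integrable_bound[where f="\<lambda>z. (B * U) * indicator (cubeN N (X + \<bar>r\<bar>)) z"])
    have [measurable]: "x(i := s) \<in> space (lebN N)" using x i by simp
    show "(\<lambda>z. g z * k (rsub N (x(i := s)) z)) \<in> borel_measurable (lebN N)" by measurable
    show "integrable (lebN N) (\<lambda>z. (B * U) * indicator (cubeN N (X + \<bar>r\<bar>)) z)"
      using emeasure_cubeN by (intro integrable_mult_right integrable_real_indicator) auto
    show "AE z in lebN N. norm (g z * k (rsub N (x(i := s)) z)) \<le> norm (B * U * indicator (cubeN N (X + \<bar>r\<bar>)) z)"
    proof (rule AE_I2)
      fix z assume "z \<in> space (lebN N)"
      hence z: "z \<in> RN N" by simp
      show "norm (g z * k (rsub N (x(i := s)) z)) \<le> norm (B * U * indicator (cubeN N (X + \<bar>r\<bar>)) z)"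
      proof (cases "rsub N (x(i := s)) z \<in> cubeN N r")
        case True
        from sup[OF z s True] show ?thesis using gB[OF z] U(2)[of "rsub N (x(i := s)) z"] conv_B U(1)
          by (auto simp: abs_mult intro!: mult_mono)
      qed (use ks in simp)
    qed
  qed
  let ?F = "\<lambda>s. \<integral>z. g z * k (rsub N (x(i := s)) z) \<partial>lebN N"
  have "((\<lambda>h. (?F (x i + h) - ?F (x i)) / h) \<longlongrightarrow> (\<integral>z. g z * k' i (rsub N x z) \<partial>lebN N)) (at 0)"
    unfolding tendsto_at_iff_sequentially
  proof (intro allI impI)
    fix h :: "nat \<Rightarrow> real" assume h0: "\<forall>n. h n \<in> UNIV - {0}" and h: "h \<longlonglongrightarrow> 0"
    obtain n0 where n0: "\<And>n. n \<ge> n0 \<Longrightarrow> \<bar>h n\<bar> \<le> 1"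
      using LIMSEQ_D[OF h, of 1] by (auto intro: less_imp_le)
    define q where "q n z = g z * ((k (rsub N (x(i := x i + h n)) z) - k (rsub N (x(i := x i)) z)) / h n)" for n z
    have "(\<lambda>n. \<integral>z. q (n + n0) z \<partial>lebN N) \<longlonglongrightarrow> (\<integral>z. g z * k' i (rsub N x z) \<partial>lebN N)"
    proof (rule integral_dominated_convergence[where w="\<lambda>z. (B * U') * indicator (cubeN N (X + \<bar>r\<bar>)) z"])
      have [measurable]: "x(i := s) \<in> space (lebN N)" "x \<in> space (lebN N)" for s using x i by auto
      show "(\<lambda>z. g z * k' i (rsub N x z)) \<in> borel_measurable (lebN N)" by measurable
      show "q (n + n0) \<in> borel_measurable (lebN N)" for n unfolding q_def by measurable
      show "integrable (lebN N) (\<lambda>z. (B * U') * indicator (cubeN N (X + \<bar>r\<bar>)) z)"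
        using emeasure_cubeN by (intro integrable_mult_right integrable_real_indicator) auto
      show "AE z in lebN N. (\<lambda>n. q (n + n0) z) \<longlonglongrightarrow> g z * k' i (rsub N x z)"
      proof (rule AE_I2)
        fix z
        have "((\<lambda>h. (k (rsub N (x(i := x i + h)) z) - k (rsub N (x(i := x i)) z)) / h) \<longlongrightarrow> k' i (rsub N (x(i := x i)) z)) (at 0)"
          using kd[of z "x i"] unfolding DERIV_def .
        hence "(\<lambda>n. (k (rsub N (x(i := x i + h n)) z) - k (rsub N (x(i := x i)) z)) / h n) \<longlonglongrightarrow> k' i (rsub N (x(i := x i)) z)"
          unfolding tendsto_at_iff_sequentially o_def using h0 h by blast
        from LIMSEQ_ignore_initial_segment[OF this, of n0]
        show "(\<lambda>n. q (n + n0) z) \<longlonglongrightarrow> g z * k' i (rsub N x z)"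
          unfolding q_def by (intro tendsto_intros) simp
      qed
      show "AE z in lebN N. norm (q (n + n0) z) \<le> B * U' * indicator (cubeN N (X + \<bar>r\<bar>)) z" for n
      proof (rule AE_I2)
        fix z assume "z \<in> space (lebN N)"
        hence z: "z \<in> RN N" by simp
        let ?h = "h (n + n0)"
        have hn: "\<bar>(x i + ?h) - x i\<bar> \<le> 1" "?h \<noteq> 0" using n0[of "n + n0"] h0 by auto
        show "norm (q (n + n0) z) \<le> B * U' * indicator (cubeN N (X + \<bar>r\<bar>)) z"
        proof (cases "z \<in> cubeN N (X + \<bar>r\<bar>)")
          case True
          have "\<bar>(k (rsub N (x(i := x i + ?h)) z) - k (rsub N (x(i := x i)) z)) / ?h\<bar> \<le> U'"
            using lip[of "x i + ?h" z "x i"] hn by (simp add: abs_divide divide_le_eq)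
          hence "\<bar>g z\<bar> * \<bar>(k (rsub N (x(i := x i + ?h)) z) - k (rsub N (x(i := x i)) z)) / ?h\<bar> \<le> B * U'"
            using gB[OF z] conv_B by (intro mult_mono) auto
          thus ?thesis using True by (simp add: q_def abs_mult)
        next
          case False
          have "k (rsub N (x(i := x i + ?h)) z) = 0" by (rule ks) (use sup[OF z hn(1)] False in auto)
          moreover have "k (rsub N (x(i := x i)) z) = 0" by (rule ks) (use sup[OF z, of "x i"] False in auto)
          ultimately show ?thesis using False by (simp add: q_def)
        qed
      qed
    qed
    moreover have "(\<integral>z. q (n + n0) z \<partial>lebN N) = (?F (x i + h (n + n0)) - ?F (x i)) / h (n + n0)" for n
    proof -
      have "(\<integral>z. q (n + n0) z \<partial>lebN N) = (\<integral>z. (g z * k (rsub N (x(i := x i + h (n + n0))) z) - g z * k (rsub N (x(i := x i)) z)) / h (n + n0) \<partial>lebN N)"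
        by (intro Bochner_Integration.integral_cong) (auto simp: q_def right_diff_distrib)
      thus ?thesis using kint[of "x i + h (n + n0)"] kint[of "x i"] n0[of "n + n0"] by simp
    qed
    ultimately have "(\<lambda>n. (?F (x i + h (n + n0)) - ?F (x i)) / h (n + n0)) \<longlonglongrightarrow> (\<integral>z. g z * k' i (rsub N x z) \<partial>lebN N)"
      by simp
    hence "(\<lambda>n. (?F (x i + h n) - ?F (x i)) / h n) \<longlonglongrightarrow> (\<integral>z. g z * k' i (rsub N x z) \<partial>lebN N)"
      by (rule LIMSEQ_offset)
    thus "((\<lambda>h. (?F (x i + h) - ?F (x i)) / h) \<circ> h) \<longlonglongrightarrow> (\<integral>z. g z * k' i (rsub N x z) \<partial>lebN N)"
      unfolding o_def .
  qed
  thus "(?F has_real_derivative (\<integral>z. g z * k' i (rsub N x z) \<partial>lebN N)) (at (x i))"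
    unfolding DERIV_def .
qed

end

section \<open>Continuity of translations in local L^1\<close>

text \<open>Continuity of translations at 0 in the mean over every cube. Sequences suffice, since it
  will be used along \<open>z / (l + 1)\<close> for fixed \<open>z\<close>.\<close>

definition TC :: "nat \<Rightarrow> ((nat \<Rightarrow> real) \<Rightarrow> real) \<Rightarrow> bool" where
  "TC N g \<longleftrightarrow> (\<forall>r z. (\<forall>n. z n \<in> RN N) \<longrightarrow> (\<forall>i<N. (\<lambda>n. z n i) \<longlonglongrightarrow> 0) \<longrightarrow>
     (\<lambda>n. \<integral>x. icube N r x * \<bar>g (rsub N x (z n)) - g x\<bar> \<partial>lebN N) \<longlonglongrightarrow> 0)"

lemma integrable_cube_bounded:
  fixes u :: "(nat \<Rightarrow> real) \<Rightarrow> real"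
  assumes [measurable]: "u \<in> borel_measurable (lebN N)" and "\<And>x. x \<in> RN N \<Longrightarrow> \<bar>u x\<bar> \<le> B"
  shows "integrable (lebN N) (\<lambda>x. icube N r x * u x)"
proof (rule Bochner_Integration.integrable_bound[where f="\<lambda>z. B * icube N r z"])
  show "integrable (lebN N) (\<lambda>z. B * icube N r z)"
    using emeasure_cubeN by (intro integrable_mult_right integrable_real_indicator) auto
  show "AE x in lebN N. norm (icube N r x * u x) \<le> norm (B * icube N r x)"
    using assms(2) by (intro AE_I2) (auto simp: indicator_def intro: order_trans[OF _ abs_ge_self])
qed measurable

text \<open>The usual three-term estimate. The approximation error is measured on a cube larger by
  1, because translations eventually move points by less than 1; translation invariance bounds the
  shifted error by the same integral.\<close>

lemma TC_limit:
  assumes g [measurable]: "g \<in> borel_measurable (lebN N)" and gB: "\<And>x. x \<in> RN N \<Longrightarrow> \<bar>g x\<bar> \<le> B"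
    and u [measurable]: "\<And>k::nat. u k \<in> borel_measurable (lebN N)" and uB: "\<And>k x. x \<in> RN N \<Longrightarrow> \<bar>u k x\<bar> \<le> B"
    and uT: "\<And>k. TC N (u k)" and lim: "\<And>x. x \<in> RN N \<Longrightarrow> (\<lambda>k. u k x) \<longlonglongrightarrow> g x"
  shows "TC N g"
  unfolding TC_def
proof (intro allI impI)
  fix r z assume z: "\<forall>n. z n \<in> RN N" and z0: "\<forall>i<N. (\<lambda>n. z n i) \<longlonglongrightarrow> 0"
  have zs: "z n \<in> space (lebN N)" for n using z by simp
  note [measurable] = zs
  define d where "d k = (\<integral>x. icube N (r + 1) x * \<bar>g x - u k x\<bar> \<partial>lebN N)" for k
  have dm: "(\<lambda>x. \<bar>g x - u k x\<bar>) \<in> borel_measurable (lebN N)" for k by measurable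
  have dB: "\<bar>\<bar>g x - u k x\<bar>\<bar> \<le> 2 * B" if "x \<in> RN N" for x k using gB[OF that] uB[OF that, of k] by simp
  have d: "d \<longlonglongrightarrow> 0"
  proof -
    have "d \<longlonglongrightarrow> (\<integral>x. 0 \<partial>lebN N)"
      unfolding d_def
    proof (rule integral_dominated_convergence[where w="\<lambda>x. (2 * B) * icube N (r + 1) x"])
      show "integrable (lebN N) (\<lambda>z. (2 * B) * icube N (r + 1) z)"
        using emeasure_cubeN by (intro integrable_mult_right integrable_real_indicator) auto
      show "AE x in lebN N. (\<lambda>k. icube N (r + 1) x * \<bar>g x - u k x\<bar>) \<longlonglongrightarrow> 0"
      proof (rule AE_I2)
        fix x assume "x \<in> space (lebN N)"
        hence "(\<lambda>k. icube N (r + 1) x * \<bar>g x - u k x\<bar>) \<longlonglongrightarrow> icube N (r + 1) x * \<bar>g x - g x\<bar>"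
          using lim[of x] by (intro tendsto_intros) simp
        thus "(\<lambda>k. icube N (r + 1) x * \<bar>g x - u k x\<bar>) \<longlonglongrightarrow> 0" by simp
      qed
      show "AE x in lebN N. norm (icube N (r + 1) x * \<bar>g x - u k x\<bar>) \<le> 2 * B * icube N (r + 1) x" for k
        using dB by (intro AE_I2) (auto simp: indicator_def)
    qed measurable
    thus ?thesis by simp
  qed
  define \<theta> where "\<theta> v n = (\<integral>x. icube N r x * \<bar>v (rsub N x (z n)) - v x\<bar> \<partial>lebN N)" for v :: "(nat \<Rightarrow> real) \<Rightarrow> real" and n
  have "\<forall>\<^sub>F n in sequentially. \<forall>i\<in>{..<N}. \<bar>z n i\<bar> < 1"
  proof (intro eventually_ball_finite ballI)
    fix i assume "i \<in> {..<N}"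
    hence "(\<lambda>n. z n i) \<longlonglongrightarrow> 0" using z0 by simp
    from tendstoD[OF this, of 1] show "\<forall>\<^sub>F n in sequentially. \<bar>z n i\<bar> < 1" by (simp add: dist_real_def)
  qed simp
  hence ev: "\<forall>\<^sub>F n in sequentially. z n \<in> cubeN N 1"
    by (rule eventually_mono) (use z in \<open>auto simp: cubeN_def intro: less_imp_le\<close>)
  have bound: "\<theta> g n \<le> \<theta> (u k) n + 2 * d k" if zn: "z n \<in> cubeN N 1" for n k
  proof -
    have rB: "\<bar>\<bar>v (rsub N x (z n)) - v x\<bar>\<bar> \<le> 2 * B" if "\<And>x. x \<in> RN N \<Longrightarrow> \<bar>v x\<bar> \<le> B" "x \<in> RN N" for v x
      using that(1)[of "rsub N x (z n)"] that(1)[OF that(2)] by simp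
    have i1: "integrable (lebN N) (\<lambda>x. icube N r x * \<bar>g (rsub N x (z n)) - g x\<bar>)"
      by (rule integrable_cube_bounded) (measurable, use rB[of g] gB in auto)
    have i2: "integrable (lebN N) (\<lambda>x. icube N r x * \<bar>u k (rsub N x (z n)) - u k x\<bar>)"
      by (rule integrable_cube_bounded) (measurable, use rB[of "u k"] uB[of _ k] in auto)
    have i3: "integrable (lebN N) (\<lambda>x. icube N (r + 1) x * \<bar>g x - u k x\<bar>)"
      by (rule integrable_cube_bounded[OF dm dB])
    let ?D = "\<lambda>x. icube N (r + 1) x * \<bar>g x - u k x\<bar>"
    have Dm: "?D \<in> borel_measurable (lebN N)" by measurable
    have i4: "integrable (lebN N) (\<lambda>x. ?D (rsub N x (z n)))"
    proof (rule integrableI_nonneg)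
      show "(\<lambda>x. ?D (rsub N x (z n))) \<in> borel_measurable (lebN N)"
        by (rule measurable_compose[OF _ Dm]) measurable
      have "restrict (\<lambda>i. - z n i + 1 * x i) {..<N} = rsub N x (z n)" for x by (auto simp: rsub_def fun_eq_iff)
      hence "(\<integral>\<^sup>+x. ennreal (?D (rsub N x (z n))) \<partial>lebN N) = (\<integral>\<^sup>+x. ennreal (?D x) \<partial>lebN N)"
        using lebN_affine_nn_integral[of 1 "\<lambda>x. ennreal (?D x)" N "\<lambda>i. - z n i"] by simp
      also have "\<dots> < \<infinity>" using i3 by (subst nn_integral_eq_integral) auto
      finally show "(\<integral>\<^sup>+x. ennreal (?D (rsub N x (z n))) \<partial>lebN N) < \<infinity>" .
    qed auto
    have "\<theta> g n \<le> (\<integral>x. icube N r x * \<bar>u k (rsub N x (z n)) - u k x\<bar> + (?D (rsub N x (z n)) + ?D x) \<partial>lebN N)"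
      unfolding \<theta>_def
    proof (rule integral_mono[OF i1])
      show "integrable (lebN N) (\<lambda>x. icube N r x * \<bar>u k (rsub N x (z n)) - u k x\<bar> + (?D (rsub N x (z n)) + ?D x))"
        using i2 i3 i4 by (intro Bochner_Integration.integrable_add)
      fix x
      show "icube N r x * \<bar>g (rsub N x (z n)) - g x\<bar> \<le> icube N r x * \<bar>u k (rsub N x (z n)) - u k x\<bar> + (?D (rsub N x (z n)) + ?D x)"
      proof (cases "x \<in> cubeN N r")
        case True
        hence "x \<in> cubeN N (r + 1)" "rsub N x (z n) \<in> cubeN N (r + 1)"
          using cubeN_mono[of r "r + 1" N] rsub_cube[OF True zn] by auto
        thus ?thesis using True by (simp add: indicator_def)
      next
        case False
        have "0 \<le> ?D (rsub N x (z n)) + ?D x" by (intro add_nonneg_nonneg mult_nonneg_nonneg) auto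
        thus ?thesis using False by simp
      qed
    qed
    also have "\<dots> = \<theta> (u k) n + ((\<integral>x. ?D (rsub N x (z n)) \<partial>lebN N) + d k)"
      using i2 i3 i4 unfolding \<theta>_def d_def
      by (subst Bochner_Integration.integral_add[OF i2 Bochner_Integration.integrable_add[OF i4 i3]], subst Bochner_Integration.integral_add[OF i4 i3]) (rule refl)
    also have "(\<integral>x. ?D (rsub N x (z n)) \<partial>lebN N) = d k"
      unfolding d_def by (rule integral_translate[OF Dm])
    finally show ?thesis by simp
  qed
  have \<theta>0: "\<theta> v n \<ge> 0" for v n unfolding \<theta>_def by (intro Bochner_Integration.integral_nonneg) auto
  have "\<theta> g \<longlonglongrightarrow> 0"
  proof (rule tendstoI)
    fix e :: real assume e: "e > 0"
    from tendstoD[OF d, of "e / 4"] e obtain k where k: "\<bar>d k\<bar> < e / 4"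
      by (auto simp: eventually_sequentially dist_real_def)
    have "\<theta> (u k) \<longlonglongrightarrow> 0" using uT[of k] z z0 unfolding TC_def \<theta>_def by blast
    from tendstoD[OF this, of "e / 2"] e have "\<forall>\<^sub>F n in sequentially. \<theta> (u k) n < e / 2" 
      using \<theta>0 by (simp add: dist_real_def)
    with ev show "\<forall>\<^sub>F n in sequentially. dist (\<theta> g n) 0 < e"
    proof eventually_elim
      case (elim n)
      from bound[OF elim(1), of k] elim(2) k show ?case using \<theta>0[of g n] by (simp add: dist_real_def)
    qed
  qed
  thus "(\<lambda>n. \<integral>x. icube N r x * \<bar>g (rsub N x (z n)) - g x\<bar> \<partial>lebN N) \<longlonglongrightarrow> 0"
    unfolding \<theta>_def .
qed

lemma integrable_translate:
  fixes D :: "(nat \<Rightarrow> real) \<Rightarrow> real"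
  assumes D: "integrable (lebN N) D" and z: "z \<in> RN N"
  shows "integrable (lebN N) (\<lambda>x. D (rsub N x z))"
proof -
  have [measurable]: "D \<in> borel_measurable (lebN N)" "z \<in> space (lebN N)" using D z by auto
  have "(\<integral>\<^sup>+x. ennreal (norm (D (rsub N x z))) \<partial>lebN N) = (\<integral>\<^sup>+x. ennreal (norm (D x)) \<partial>lebN N)"
    using lebN_affine_nn_integral[of 1 "\<lambda>x. ennreal (norm (D x))" N "\<lambda>i. - z i"] by (simp add: rsub_def)
  also have "\<dots> < \<infinity>" using D by (simp add: integrable_iff_bounded)
  finally have "(\<integral>\<^sup>+x. ennreal (norm (D (rsub N x z))) \<partial>lebN N) < \<infinity>" .
  moreover have "(\<lambda>x. D (rsub N x z)) \<in> borel_measurable (lebN N)" by measurable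
  ultimately show ?thesis unfolding integrable_iff_bounded by blast
qed

lemma TC_add:
  assumes [measurable]: "g \<in> borel_measurable (lebN N)" "h \<in> borel_measurable (lebN N)"
    and gB: "\<And>x. x \<in> RN N \<Longrightarrow> \<bar>g x\<bar> \<le> B" and hB: "\<And>x. x \<in> RN N \<Longrightarrow> \<bar>h x\<bar> \<le> B"
    and T: "TC N g" "TC N h"
  shows "TC N (\<lambda>x. g x + h x)"
  unfolding TC_def
proof (intro allI impI)
  fix r z assume z: "\<forall>n. z n \<in> RN N" and z0: "\<forall>i<N. (\<lambda>n. z n i) \<longlonglongrightarrow> 0"
  have zs [measurable]: "z n \<in> space (lebN N)" for n using z by simp
  define \<theta> where "\<theta> v n = (\<integral>x. icube N r x * \<bar>v (rsub N x (z n)) - v x\<bar> \<partial>lebN N)" for v :: "(nat \<Rightarrow> real) \<Rightarrow> real" and n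
  have int: "integrable (lebN N) (\<lambda>x. icube N r x * \<bar>v (rsub N x (z n)) - v x\<bar>)"
    if [measurable]: "v \<in> borel_measurable (lebN N)" and "\<And>x. x \<in> RN N \<Longrightarrow> \<bar>v x\<bar> \<le> B'" for v :: "(nat \<Rightarrow> real) \<Rightarrow> real" and B' n
  proof (rule integrable_cube_bounded[where B="2 * B'"])
    fix x assume "x \<in> RN N"
    thus "\<bar>\<bar>v (rsub N x (z n)) - v x\<bar>\<bar> \<le> 2 * B'" using that(2)[of "rsub N x (z n)"] that(2)[of x] by simp
  qed measurable
  have le: "\<theta> (\<lambda>x. g x + h x) n \<le> \<theta> g n + \<theta> h n" for n
  proof -
    have "\<theta> (\<lambda>x. g x + h x) n \<le> (\<integral>x. icube N r x * \<bar>g (rsub N x (z n)) - g x\<bar> + icube N r x * \<bar>h (rsub N x (z n)) - h x\<bar> \<partial>lebN N)"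
      unfolding \<theta>_def
    proof (rule integral_mono)
      have "\<bar>g x + h x\<bar> \<le> 2 * B" if "x \<in> RN N" for x using gB[OF that] hB[OF that] by simp
      thus "integrable (lebN N) (\<lambda>x. icube N r x * \<bar>g (rsub N x (z n)) + h (rsub N x (z n)) - (g x + h x)\<bar>)"
        by (intro int) measurable
      show "integrable (lebN N) (\<lambda>x. icube N r x * \<bar>g (rsub N x (z n)) - g x\<bar> + icube N r x * \<bar>h (rsub N x (z n)) - h x\<bar>)"
        using int[of g B n] int[of h B n] gB hB by (intro Bochner_Integration.integrable_add) auto
    qed (auto simp: indicator_def)
    also have "\<dots> = \<theta> g n + \<theta> h n"
      unfolding \<theta>_def using int[of g B n] int[of h B n] gB hB by (intro Bochner_Integration.integral_add) auto
    finally show ?thesis .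
  qed
  have nn: "0 \<le> \<theta> (\<lambda>x. g x + h x) n" for n unfolding \<theta>_def by (intro Bochner_Integration.integral_nonneg) auto
  have "\<theta> g \<longlonglongrightarrow> 0" "\<theta> h \<longlonglongrightarrow> 0"
    using T z z0 unfolding TC_def \<theta>_def by blast+
  hence lim: "(\<lambda>n. \<theta> g n + \<theta> h n) \<longlonglongrightarrow> 0" using tendsto_add_zero by blast
  have "\<theta> (\<lambda>x. g x + h x) \<longlonglongrightarrow> 0"
    by (rule tendsto_sandwich[OF always_eventually always_eventually tendsto_const lim]) (use le nn in blast)+
  thus "(\<lambda>n. \<integral>x. icube N r x * \<bar>g (rsub N x (z n)) + h (rsub N x (z n)) - (g x + h x)\<bar> \<partial>lebN N) \<longlonglongrightarrow> 0"
    unfolding \<theta>_def .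
qed

lemma indicator_borel_lebN [measurable]: "A \<in> sets borel \<Longrightarrow> (indicator A :: (nat \<Rightarrow> real) \<Rightarrow> real) \<in> borel_measurable (lebN N)"
  by (rule measurable_compose[OF measurable_id_lebN borel_measurable_indicator])

text \<open>Scheffe's argument: translation preserves the measure of a bounded open set, and one of the two
  parts of the symmetric difference vanishes by lower semicontinuity of the indicator.\<close>

lemma TC_open:
  assumes U: "open U" shows "TC N (indicator U)"
  unfolding TC_def
proof (intro allI impI)
  fix r z assume z: "\<forall>n. z n \<in> RN N" and z0: "\<forall>i<N. (\<lambda>n. z n i) \<longlonglongrightarrow> 0"
  have zs [measurable]: "z n \<in> space (lebN N)" for n using z by simp
  \<comment> \<open>A bounded open set has finite measure. Points of the cube of radius
    \<open>r\<close> do not see the difference once the translation is smaller than 1 in each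
    coordinate.\<close>
  define U' where "U' = U \<inter> (\<Inter>i<N. {x::nat \<Rightarrow> real. \<bar>x i\<bar> < r + 1})"
  have "open U'" unfolding U'_def
    by (intro open_Int U open_INT finite_lessThan ballI open_Collect_less continuous_intros) auto
  hence Ub: "U \<in> sets borel" "U' \<in> sets borel" using U by auto
  define a :: "(nat \<Rightarrow> real) \<Rightarrow> real" where "a = indicator U'"
  have am [measurable]: "a \<in> borel_measurable (lebN N)" unfolding a_def using Ub by measurable
  have ai: "integrable (lebN N) a"
  proof -
    have "a x = icube N (r + 1) x * a x" if "x \<in> RN N" for x
      using that by (auto simp: a_def indicator_def U'_def cubeN_def intro: less_imp_le)
    moreover have "integrable (lebN N) (\<lambda>x. icube N (r + 1) x * a x)"
      by (rule integrable_cube_bounded[where B=1, OF am]) (auto simp: a_def indicator_def)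
    ultimately show ?thesis by (subst Bochner_Integration.integrable_cong[OF refl]) auto
  qed
  have ani: "integrable (lebN N) (\<lambda>x. a (rsub N x (z n)))" for n using integrable_translate[OF ai] z by blast
  define P where "P n = (\<integral>x. max 0 (a x - a (rsub N x (z n))) \<partial>lebN N)" for n
  have pi: "integrable (lebN N) (\<lambda>x. max 0 (a x - a (rsub N x (z n))))" for n
    using ai ani[of n] by (intro integrable_max) auto
  have "P \<longlonglongrightarrow> (\<integral>x. 0 \<partial>lebN N)"
    unfolding P_def
  proof (rule integral_dominated_convergence[where w=a])
    show "AE x in lebN N. (\<lambda>n. max 0 (a x - a (rsub N x (z n)))) \<longlonglongrightarrow> 0"
    proof (rule AE_I2)
      fix x assume "x \<in> space (lebN N)"
      hence x: "x \<in> RN N" by simp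
      have "(\<lambda>n. x i - z n i) \<longlonglongrightarrow> x i - 0" if "i < N" for i
        using z0 that by (intro tendsto_intros) auto
      hence l: "(\<lambda>n. rsub N x (z n)) \<longlonglongrightarrow> x"
        using x by (intro tendsto_RN[of _ N]) (auto simp: rsub_def)
      show "(\<lambda>n. max 0 (a x - a (rsub N x (z n)))) \<longlonglongrightarrow> 0"
      proof (cases "x \<in> U'")
        case True
        from topological_tendstoD[OF l \<open>open U'\<close> True]
        have "\<forall>\<^sub>F n in sequentially. max 0 (a x - a (rsub N x (z n))) = 0"
          by (rule eventually_mono) (use True in \<open>auto simp: a_def\<close>)
        thus ?thesis by (rule tendsto_eventually)
      next
        case False
        hence "max 0 (a x - a (rsub N x (z n))) = 0" for n by (auto simp: a_def indicator_def)
        thus ?thesis by simp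
      qed
    qed
    show "AE x in lebN N. norm (max 0 (a x - a (rsub N x (z n)))) \<le> a x" for n
      by (intro AE_I2) (auto simp: a_def indicator_def)
    show "(\<lambda>x. max 0 (a x - a (rsub N x (z n)))) \<in> borel_measurable (lebN N)" for n
      using borel_measurable_integrable[OF pi] .
  qed (auto intro: ai)
  hence "P \<longlonglongrightarrow> 0" by simp
  hence P0: "(\<lambda>n. 2 * P n) \<longlonglongrightarrow> 0" by (rule tendsto_mult_right_zero)
  have abs_eq: "(\<integral>x. \<bar>a (rsub N x (z n)) - a x\<bar> \<partial>lebN N) = 2 * P n" for n
  proof -
    \<comment> \<open>The absolute difference is twice one positive part minus the difference
      itself, and the difference integrates to 0 by invariance.\<close>
    have "(\<integral>x. \<bar>a (rsub N x (z n)) - a x\<bar> \<partial>lebN N) = (\<integral>x. 2 * max 0 (a x - a (rsub N x (z n))) - (a x - a (rsub N x (z n))) \<partial>lebN N)"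
      by (intro Bochner_Integration.integral_cong) (auto simp: max_def)
    also have "\<dots> = 2 * P n - ((\<integral>x. a x \<partial>lebN N) - (\<integral>x. a (rsub N x (z n)) \<partial>lebN N))"
      unfolding P_def using pi[of n] ai ani[of n] by simp
    finally show ?thesis using integral_translate[OF am] by simp
  qed
  have "\<forall>\<^sub>F n in sequentially. \<forall>i\<in>{..<N}. \<bar>z n i\<bar> < 1"
  proof (intro eventually_ball_finite ballI)
    fix i assume "i \<in> {..<N}"
    hence "(\<lambda>n. z n i) \<longlonglongrightarrow> 0" using z0 by simp
    from tendstoD[OF this, of 1] show "\<forall>\<^sub>F n in sequentially. \<bar>z n i\<bar> < 1" by (simp add: dist_real_def)
  qed simp
  hence ev: "\<forall>\<^sub>F n in sequentially. (\<integral>x. icube N r x * \<bar>indicator U (rsub N x (z n)) - indicator U x :: real\<bar> \<partial>lebN N) \<le> 2 * P n"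
  proof eventually_elim
    case (elim n)
    show ?case unfolding abs_eq[symmetric]
    proof (rule integral_mono)
      show "integrable (lebN N) (\<lambda>x. icube N r x * \<bar>indicator U (rsub N x (z n)) - indicator U x :: real\<bar>)"
      proof (rule integrable_cube_bounded[where B=1])
        note [measurable] = indicator_borel_lebN[OF Ub(1), of N]
        have "(\<lambda>x. indicator U (rsub N x (z n)) :: real) \<in> borel_measurable (lebN N)"
          by (rule measurable_compose[OF _ indicator_borel_lebN[OF Ub(1)]]) measurable
        thus "(\<lambda>x. \<bar>indicator U (rsub N x (z n)) - indicator U x :: real\<bar>) \<in> borel_measurable (lebN N)" by measurable
      qed (auto simp: indicator_def)
      show "integrable (lebN N) (\<lambda>x. \<bar>a (rsub N x (z n)) - a x\<bar>)" using ai ani[of n] by simp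
      fix x
      show "icube N r x * \<bar>indicator U (rsub N x (z n)) - indicator U x :: real\<bar> \<le> \<bar>a (rsub N x (z n)) - a x\<bar>"
      proof (cases "x \<in> cubeN N r")
        case True
        have "\<bar>x i - z n i\<bar> < r + 1" "\<bar>x i\<bar> < r + 1" if "i < N" for i
        proof -
          have "\<bar>x i\<bar> \<le> r" "\<bar>z n i\<bar> < 1" using True that elim by (auto simp: cubeN_def)
          thus "\<bar>x i - z n i\<bar> < r + 1" "\<bar>x i\<bar> < r + 1" by linarith+
        qed
        hence "a (rsub N x (z n)) = indicator U (rsub N x (z n))" "a x = indicator U x"
          by (auto simp: a_def U'_def indicator_def rsub_def)
        thus ?thesis using True by simp
      qed simp
    qed
  qed
  have nn: "\<forall>\<^sub>F n in sequentially. 0 \<le> (\<integral>x. icube N r x * \<bar>indicator U (rsub N x (z n)) - indicator U x :: real\<bar> \<partial>lebN N)"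
    by (intro always_eventually allI Bochner_Integration.integral_nonneg mult_nonneg_nonneg abs_ge_zero indicator_pos_le)
  show "(\<lambda>n. \<integral>x. icube N r x * \<bar>indicator U (rsub N x (z n)) - indicator U x\<bar> \<partial>lebN N) \<longlonglongrightarrow> (0::real)"
    by (rule tendsto_sandwich[OF nn ev tendsto_const P0])
qed

text \<open>Dynkin class argument from the open sets, which are stable under intersection:
  complements have the same translation error, and disjoint unions follow from finite sums and a
  bounded limit.\<close>

lemma TC_borel:
  assumes "A \<in> sets borel" shows "TC N (indicator A)"
proof -
  have "Int_stable (Collect open :: (nat \<Rightarrow> real) set set)" by (auto simp: Int_stable_def)
  moreover have "Collect open \<subseteq> Pow (UNIV :: (nat \<Rightarrow> real) set)" by auto
  moreover have "A \<in> sigma_sets UNIV (Collect open)" using assms by (simp add: borel_def)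
  ultimately show ?thesis
  proof (induction rule: sigma_sets_induct_disjoint)
    case (basic A)
    then show ?case by (simp add: TC_open)
  next
    case empty
    show ?case by (simp add: TC_def)
  next
    case (compl A)
    have "\<bar>indicator (UNIV - A) u - indicator (UNIV - A) v :: real\<bar> = \<bar>indicator A u - indicator A v\<bar>" for u v :: "nat \<Rightarrow> real"
      by (auto simp: indicator_def)
    then show ?case using compl unfolding TC_def by (simp only:)
  next
    case (union A)
    have Am: "A k \<in> sets borel" for k using union(2) by (auto simp: borel_def)
    note [measurable] = indicator_borel_lebN[OF Am]
    define u :: "nat \<Rightarrow> (nat \<Rightarrow> real) \<Rightarrow> real" where "u k x = (\<Sum>j<k. indicator (A j) x)" for k x
    have u_eq: "u k x = indicator (\<Union>j<k. A j) x" for k x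
      unfolding u_def using union(1) by (intro indicator_UN_disjoint[symmetric]) (auto simp: disjoint_family_on_def)
    have um: "u k \<in> borel_measurable (lebN N)" for k unfolding u_def by measurable
    have uB: "\<bar>u k x\<bar> \<le> 1" for k x unfolding u_eq by (auto simp: indicator_def)
    have uT: "TC N (u k)" for k
    proof (induction k)
      case 0
      show ?case by (simp add: u_def TC_def)
    next
      case (Suc k)
      have "u (Suc k) = (\<lambda>x. u k x + indicator (A k) x)" by (auto simp: u_def)
      moreover have "TC N (\<lambda>x. u k x + indicator (A k) x)"
        by (rule TC_add[OF um indicator_borel_lebN[OF Am] uB _ Suc union(3)]) (simp add: indicator_def)
      ultimately show ?case by simp
    qed
    show ?case
    proof (rule TC_limit[OF _ _ um uB uT])
      show "(indicator (\<Union> (range A)) :: _ \<Rightarrow> real) \<in> borel_measurable (lebN N)" using Am by (intro indicator_borel_lebN) auto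
      show "\<bar>indicator (\<Union> (range A)) x :: real\<bar> \<le> 1" for x by (auto simp: indicator_def)
      fix x :: "nat \<Rightarrow> real"
      show "(\<lambda>k. u k x) \<longlonglongrightarrow> indicator (\<Union> (range A)) x" unfolding u_eq
      proof (rule tendsto_eventually)
        show "\<forall>\<^sub>F k in sequentially. indicator (\<Union>j<k. A j) x = (indicator (\<Union> (range A)) x :: real)"
        proof (cases "x \<in> \<Union> (range A)")
          case True
          then obtain j where "x \<in> A j" by auto
          hence "indicator (\<Union>j<k. A j) x = (1::real)" if "k > j" for k using that by (auto simp: indicator_def)
          thus ?thesis using True by (intro eventually_mono[OF eventually_gt_at_top[of j]]) simp
        qed (auto simp: indicator_def)
      qed
    qed
  qed
qed

text \<open>The converse of the embedding of R^N: the coordinates are Borel on the function space,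
  so sets measurable for \<open>lebN N\<close> are Borel there and fall under
  \<open>TC_borel\<close>.\<close>

lemma sets_lebN_borel: "A \<in> sets (lebN N) \<Longrightarrow> A \<in> sets borel"
proof -
  assume A: "A \<in> sets (lebN N)"
  have "(\<lambda>x. x) \<in> restrict_space borel (RN N) \<rightarrow>\<^sub>M lebN N"
    unfolding lebN_def
  proof (rule measurable_PiM_single')
    fix i assume "i \<in> {..<N}"
    show "(\<lambda>x. x i) \<in> restrict_space borel (RN N) \<rightarrow>\<^sub>M lborel"
      by (rule measurable_restrict_space1) (simp add: borel_measurable_continuous_onI)
  qed (auto simp: RN_def space_restrict_space)
  from measurable_sets[OF this A] have "A \<inter> RN N \<in> sets (restrict_space borel (RN N))"
    by (simp add: space_restrict_space)
  moreover have "A \<subseteq> RN N" using sets.sets_into_space[OF A] by simp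
  ultimately show ?thesis using sets_RN_borel[of N] by (simp add: sets_restrict_space_iff Int_absorb2)
qed

lemma TC_bounded:
  assumes "g \<in> borel_measurable (lebN N)" "\<And>x. 0 \<le> g x" "\<And>x. x \<in> RN N \<Longrightarrow> g x \<le> B"
  shows "TC N g"
proof -
  \<comment> \<open>Boundedness becomes a premise of the induction claim: the intermediate functions
    of the induction inherit it from the final one, by nonnegativity or monotonicity.\<close>
  have "(\<exists>B. \<forall>x\<in>RN N. g x \<le> B) \<longrightarrow> TC N g"
    using assms(1,2)
  proof (induction rule: borel_measurable_induct_real)
    case (set A)
    then show ?case using TC_borel[OF sets_lebN_borel] by blast
  next
    case (mult u c)
    show ?case
    proof (cases "c = 0")
      case True
      then show ?thesis by (simp add: TC_def)
    next
      case False
      with mult have c: "c > 0" by simp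
      show ?thesis
      proof
        assume "\<exists>B. \<forall>x\<in>RN N. c * u x \<le> B"
        then obtain B where B: "\<forall>x\<in>RN N. c * u x \<le> B" by blast
        hence "\<forall>x\<in>RN N. u x \<le> B / c" using c by (simp add: pos_le_divide_eq mult.commute)
        hence T: "TC N u" using mult.IH by blast
        show "TC N (\<lambda>x. c * u x)" unfolding TC_def
        proof (intro allI impI)
          fix r z assume z: "\<forall>n. z n \<in> RN N" "\<forall>i<N. (\<lambda>n. z n i) \<longlonglongrightarrow> 0"
          have e: "icube N r x * \<bar>c * u (rsub N x (z n)) - c * u x\<bar> = c * (icube N r x * \<bar>u (rsub N x (z n)) - u x\<bar>)" for x n
            using c by (simp add: abs_mult flip: right_diff_distrib)
          have "(\<lambda>n. c * (\<integral>x. icube N r x * \<bar>u (rsub N x (z n)) - u x\<bar> \<partial>lebN N)) \<longlonglongrightarrow> c * 0"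
            using T z unfolding TC_def by (intro tendsto_intros) blast
          thus "(\<lambda>n. \<integral>x. icube N r x * \<bar>c * u (rsub N x (z n)) - c * u x\<bar> \<partial>lebN N) \<longlonglongrightarrow> 0"
            unfolding e by simp
        qed
      qed
    qed
  next
    case (add u v)
    show ?case
    proof
      assume "\<exists>B. \<forall>x\<in>RN N. v x + u x \<le> B"
      then obtain B where B: "\<forall>x\<in>RN N. v x + u x \<le> B" by blast
      have b: "\<bar>u x\<bar> \<le> B" "\<bar>v x\<bar> \<le> B" if "x \<in> RN N" for x
        using bspec[OF B that] add(2)[of x] add(4)[of x] by simp_all
      have "\<forall>x\<in>RN N. u x \<le> B" "\<forall>x\<in>RN N. v x \<le> B" using b by (auto dest: abs_le_D1)
      hence "TC N u" "TC N v" using add.IH by blast+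
      thus "TC N (\<lambda>x. v x + u x)" using b by (intro TC_add[OF add(3) add(1), where B=B])
    qed
  next
    case (seq U)
    show ?case
    proof
      assume "\<exists>B. \<forall>x\<in>RN N. g x \<le> B"
      then obtain B where B: "\<forall>x\<in>RN N. g x \<le> B" by blast
      have le: "U i x \<le> g x" if "x \<in> RN N" for i x
        using seq(4)[of x] seq(3) that by (intro incseq_le[of "\<lambda>i. U i x"]) (auto simp: incseq_def le_fun_def)
      have Ub: "\<bar>U i x\<bar> \<le> B" if "x \<in> RN N" for i x using le[OF that, of i] B that seq(2)[of i x] by force
      have gb: "\<bar>g x\<bar> \<le> B" if "x \<in> RN N" for x using B that assms(2)[of x] by simp
      have "\<forall>x\<in>RN N. U i x \<le> B" for i using Ub[of _ i] by (auto dest: abs_le_D1)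
      hence "TC N (U i)" for i using seq.IH[of i] by blast
      thus "TC N g" using seq(4) by (intro TC_limit[OF assms(1) gb seq(1) Ub]) auto
    qed
  qed
  thus ?thesis using assms(3) by blast
qed

section \<open>Mollification\<close>

lemma rsub_rsub: "z \<in> RN N \<Longrightarrow> rsub N x (rsub N x z) = z"
  by (intro RN_eqI[of _ N]) (auto simp: rsub_def)

text \<open>The mean error over a cube is at most the average of translation errors with weight
  \<eta>, which tends to 0. Convergence in the mean gives convergence almost everywhere along a
  subsequence. The index \<open>Suc l\<close> avoids scaling by 0.\<close>

lemma mollify_AE:
  fixes g \<eta> :: "(nat \<Rightarrow> real) \<Rightarrow> real" and N :: nat
  defines "W \<equiv> \<lambda>l x. \<integral>z. g (rsub N x z) * (real (Suc l) ^ N * \<eta> (\<lambda>i\<in>{..<N}. real (Suc l) * z i)) \<partial>lebN N"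
  assumes g [measurable]: "g \<in> borel_measurable (lebN N)" and g0: "\<And>x. A \<le> g x" and gB: "\<And>x. g x \<le> B" and A: "A \<ge> 0"
    and \<eta> [measurable]: "\<eta> \<in> borel_measurable (lebN N)" and \<eta>0: "\<And>x. x \<in> RN N \<Longrightarrow> \<eta> x \<ge> 0"
    and \<eta>1: "(\<integral>x. \<eta> x \<partial>lebN N) = 1"
  shows mollify_bounds: "\<And>l x. x \<in> RN N \<Longrightarrow> A \<le> W l x \<and> W l x \<le> B"
    and "\<exists>\<sigma>. strict_mono \<sigma> \<and> (AE x in lebN N. x \<in> cubeN N r \<longrightarrow> (\<lambda>n. W (\<sigma> n) x) \<longlonglongrightarrow> g x)"
proof -
  interpret leb: sigma_finite_measure "lebN N" by (rule sigma_finite_lebN)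
  interpret P: pair_sigma_finite "lebN N" "lebN N" by (simp add: pair_sigma_finite_def sigma_finite_lebN)
  have \<eta>i: "integrable (lebN N) \<eta>" using \<eta>1 not_integrable_integral_eq by fastforce
  have B0: "0 \<le> B" using order_trans[OF A order_trans[OF g0 gB]] .
  \<comment> \<open>The substitution moves the scaling from the kernel to the translation, so that
    the weight \<eta> is the same for all \<open>l\<close>.\<close>
  define zl where "zl l z = (\<lambda>i\<in>{..<N}. 0 + 1 / real (Suc l) * z i)" for l and z :: "nat \<Rightarrow> real"
  have zlm [measurable]: "zl l \<in> lebN N \<rightarrow>\<^sub>M lebN N" for l unfolding zl_def by (rule affine_measurable)
  have zlR: "zl l z \<in> RN N" for l z by (simp add: zl_def)
  have W_eq: "W l x = (\<integral>z. g (rsub N x (zl l z)) * \<eta> z \<partial>lebN N)" if x: "x \<in> RN N" for l x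
  proof -
    have [measurable]: "x \<in> space (lebN N)" using x by simp
    have sm: "(\<lambda>z. \<lambda>i\<in>{..<N}. real (Suc l) * z i) \<in> lebN N \<rightarrow>\<^sub>M lebN N"
      using affine_measurable[of "\<lambda>_. 0" "real (Suc l)" N] by simp
    have [measurable]: "(\<lambda>z. \<eta> (\<lambda>i\<in>{..<N}. real (Suc l) * z i)) \<in> borel_measurable (lebN N)"
      by (rule measurable_compose[OF sm \<eta>])
    let ?F = "\<lambda>z. g (rsub N x z) * (real (Suc l) ^ N * \<eta> (\<lambda>i\<in>{..<N}. real (Suc l) * z i))"
    have Fm: "?F \<in> borel_measurable (lebN N)" by measurable
    have inv: "(\<lambda>i\<in>{..<N}. real (Suc l) * zl l z i) = z" if "z \<in> RN N" for z
      using that by (intro RN_eqI[of _ N]) (auto simp: zl_def)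
    have "W l x = \<bar>1 / real (Suc l)\<bar> ^ N * (\<integral>z. ?F (zl l z) \<partial>lebN N)"
      unfolding W_def zl_def by (rule lebN_affine_integral[OF _ Fm]) simp
    also have "(\<integral>z. ?F (zl l z) \<partial>lebN N) = (\<integral>z. real (Suc l) ^ N * (g (rsub N x (zl l z)) * \<eta> z) \<partial>lebN N)"
      by (intro Bochner_Integration.integral_cong) (simp_all add: inv del: of_nat_Suc)
    also have "\<dots> = real (Suc l) ^ N * (\<integral>z. g (rsub N x (zl l z)) * \<eta> z \<partial>lebN N)" by simp
    also have "\<bar>1 / real (Suc l)\<bar> ^ N * (real (Suc l) ^ N * (\<integral>z. g (rsub N x (zl l z)) * \<eta> z \<partial>lebN N)) = (\<integral>z. g (rsub N x (zl l z)) * \<eta> z \<partial>lebN N)"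
      by (simp add: power_one_over divide_simps del: of_nat_Suc)
    finally show ?thesis .
  qed
  have int: "integrable (lebN N) (\<lambda>z. u z * \<eta> z)" if um: "u \<in> borel_measurable (lebN N)" and ub: "\<And>z. \<bar>u z\<bar> \<le> B'" for u and B' :: real
    by (rule Bochner_Integration.integrable_bound[OF integrable_mult_right[OF \<eta>i, of B']])
       (use um ub \<eta>0 in \<open>auto simp: abs_mult intro!: mult_right_mono order_trans[OF ub abs_ge_self]\<close>)
  have gb: "\<bar>g x\<bar> \<le> B" for x using g0[of x] gB[of x] A by simp
  have gi: "integrable (lebN N) (\<lambda>z. g (rsub N x (zl l z)) * \<eta> z)" if "x \<in> RN N" for x l
  proof -
    have [measurable]: "x \<in> space (lebN N)" using that by simp
    show ?thesis by (rule int[where B'=B]) (measurable, use gb in auto)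
  qed
  show bounds: "A \<le> W l x \<and> W l x \<le> B" if x: "x \<in> RN N" for l x
  proof
    have "A = (\<integral>z. A * \<eta> z \<partial>lebN N)" using \<eta>1 by simp
    also have "\<dots> \<le> W l x" unfolding W_eq[OF x]
      using \<eta>i gi[OF x] g0 \<eta>0 by (intro integral_mono) (auto intro: mult_right_mono)
    finally show "A \<le> W l x" .
    have "W l x \<le> (\<integral>z. B * \<eta> z \<partial>lebN N)" unfolding W_eq[OF x]
      using \<eta>i gi[OF x] gB \<eta>0 by (intro integral_mono) (auto intro: mult_right_mono)
    thus "W l x \<le> B" using \<eta>1 by simp
  qed
  have Wm: "W l \<in> borel_measurable (lebN N)" for l
  proof -
    have "(\<lambda>x. \<integral>z. g (rsub N x (zl l z)) * \<eta> z \<partial>lebN N) \<in> borel_measurable (lebN N)"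
      by (rule leb.borel_measurable_lebesgue_integral) measurable
    thus ?thesis by (subst measurable_cong[OF W_eq]) auto
  qed
  note [measurable] = Wm
  have TCg: "TC N g" by (rule TC_bounded[OF g order_trans[OF A g0] gB])
  define \<theta> where "\<theta> l z = (\<integral>x. icube N r x * \<bar>g (rsub N x (zl l z)) - g x\<bar> \<partial>lebN N)" for l z
  define V where "V = measure (lebN N) (cubeN N r)"
  have \<theta>i: "integrable (lebN N) (\<lambda>x. icube N r x * \<bar>g (rsub N x (zl l z)) - g x\<bar>)" for l z
  proof (rule integrable_cube_bounded[where B="2 * B"])
    have [measurable]: "zl l z \<in> space (lebN N)" using zlR by simp
    show "(\<lambda>x. \<bar>g (rsub N x (zl l z)) - g x\<bar>) \<in> borel_measurable (lebN N)" by measurable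
    show "\<bar>\<bar>g (rsub N x (zl l z)) - g x\<bar>\<bar> \<le> 2 * B" for x using gb[of x] gb[of "rsub N x (zl l z)"] by simp
  qed
  have \<theta>0: "\<theta> l z \<ge> 0" for l z unfolding \<theta>_def by (intro Bochner_Integration.integral_nonneg) auto
  have \<theta>b: "\<theta> l z \<le> 2 * B * V" for l z
  proof -
    have "\<theta> l z \<le> (\<integral>x. 2 * B * icube N r x \<partial>lebN N)"
      unfolding \<theta>_def
    proof (rule integral_mono[OF \<theta>i])
      show "integrable (lebN N) (\<lambda>x. 2 * B * icube N r x)"
        using emeasure_cubeN by (intro integrable_mult_right integrable_real_indicator) auto
      show "icube N r x * \<bar>g (rsub N x (zl l z)) - g x\<bar> \<le> 2 * B * icube N r x" for x
        using gb[of x] gb[of "rsub N x (zl l z)"] by (auto simp: indicator_def)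
    qed
    also have "\<dots> = 2 * B * V" using cubeN_subset[of N r] by (simp add: V_def Int_absorb2)
    finally show ?thesis .
  qed
  have \<theta>lim: "(\<lambda>l. \<theta> l z) \<longlonglongrightarrow> 0" for z
  proof -
    have "(\<lambda>n. zl n z i) \<longlonglongrightarrow> 0" if "i < N" for i
    proof -
      have "(\<lambda>n. z i * (1 / real (Suc n))) \<longlonglongrightarrow> 0"
        by (rule tendsto_mult_right_zero[OF LIMSEQ_Suc[OF lim_inverse_n', unfolded of_nat_Suc[symmetric]]])
      thus ?thesis using that by (simp add: zl_def mult.commute)
    qed
    thus ?thesis unfolding \<theta>_def
      by (intro TCg[unfolded TC_def, rule_format, where z="\<lambda>n. zl n z" and r=r] zlR)
  qed
  define u where "u l x = icube N r x * (W l x - g x)" for l x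
  have ui: "integrable (lebN N) (u l)" for l
    unfolding u_def
  proof (rule integrable_cube_bounded[where B="2 * B"])
    fix x assume "x \<in> RN N"
    thus "\<bar>W l x - g x\<bar> \<le> 2 * B" using bounds[of x l] gb[of x] A by auto
  qed measurable
  \<comment> \<open>The integral of \<eta> is 1, so the error is an average of differences; the norm
    goes inside and Fubini's theorem integrates over the cube first.\<close>
  have le: "ennreal (\<integral>x. norm (u l x) \<partial>lebN N) \<le> (\<integral>\<^sup>+z. ennreal (\<eta> z * \<theta> l z) \<partial>lebN N)" for l
  proof -
    have "ennreal (\<integral>x. norm (u l x) \<partial>lebN N) = (\<integral>\<^sup>+x. ennreal (norm (u l x)) \<partial>lebN N)"
      using ui by (intro nn_integral_eq_integral[symmetric]) auto
    also have "\<dots> \<le> (\<integral>\<^sup>+x. (\<integral>\<^sup>+z. ennreal (icube N r x * \<bar>g (rsub N x (zl l z)) - g x\<bar> * \<eta> z) \<partial>lebN N) \<partial>lebN N)"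
    proof (rule nn_integral_mono)
      fix x assume "x \<in> space (lebN N)"
      hence x: "x \<in> RN N" and [measurable]: "x \<in> space (lebN N)" by auto
      have i: "integrable (lebN N) (\<lambda>z. (icube N r x * \<bar>g (rsub N x (zl l z)) - g x\<bar>) * \<eta> z)"
      proof (rule int[where B'="2 * B"])
        show "\<bar>icube N r x * \<bar>g (rsub N x (zl l z)) - g x\<bar>\<bar> \<le> 2 * B" for z
          using gb[of x] gb[of "rsub N x (zl l z)"] B0 by (auto simp: indicator_def)
      qed measurable
      have "u l x = icube N r x * (\<integral>z. g (rsub N x (zl l z)) * \<eta> z - g x * \<eta> z \<partial>lebN N)"
        unfolding u_def W_eq[OF x] using gi[OF x] \<eta>i \<eta>1 by simp
      also have "\<dots> = (\<integral>z. icube N r x * (g (rsub N x (zl l z)) - g x) * \<eta> z \<partial>lebN N)"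
        by (simp add: left_diff_distrib mult.assoc)
      finally have "norm (u l x) \<le> (\<integral>z. norm (icube N r x * (g (rsub N x (zl l z)) - g x) * \<eta> z) \<partial>lebN N)"
        by (simp only: integral_norm_bound)
      also have "\<dots> = (\<integral>z. icube N r x * \<bar>g (rsub N x (zl l z)) - g x\<bar> * \<eta> z \<partial>lebN N)"
        using \<eta>0 by (intro Bochner_Integration.integral_cong) (auto simp: abs_mult)
      finally have "ennreal (norm (u l x)) \<le> ennreal (\<integral>z. icube N r x * \<bar>g (rsub N x (zl l z)) - g x\<bar> * \<eta> z \<partial>lebN N)"
        by (rule ennreal_leI)
      also have "\<dots> = (\<integral>\<^sup>+z. ennreal (icube N r x * \<bar>g (rsub N x (zl l z)) - g x\<bar> * \<eta> z) \<partial>lebN N)"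
        using i \<eta>0 by (intro nn_integral_eq_integral[symmetric]) auto
      finally show "ennreal (norm (u l x)) \<le> \<dots>" .
    qed
    also have "\<dots> = (\<integral>\<^sup>+z. (\<integral>\<^sup>+x. ennreal (icube N r x * \<bar>g (rsub N x (zl l z)) - g x\<bar> * \<eta> z) \<partial>lebN N) \<partial>lebN N)"
      by (rule P.Fubini') measurable
    also have "\<dots> = (\<integral>\<^sup>+z. ennreal (\<eta> z * \<theta> l z) \<partial>lebN N)"
    proof (rule nn_integral_cong)
      fix z assume "z \<in> space (lebN N)"
      hence "\<eta> z \<ge> 0" using \<eta>0 by simp
      hence "(\<integral>\<^sup>+x. ennreal (icube N r x * \<bar>g (rsub N x (zl l z)) - g x\<bar> * \<eta> z) \<partial>lebN N)
         = ennreal (\<integral>x. icube N r x * \<bar>g (rsub N x (zl l z)) - g x\<bar> * \<eta> z \<partial>lebN N)"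
        using \<theta>i by (intro nn_integral_eq_integral) auto
      thus "(\<integral>\<^sup>+x. ennreal (icube N r x * \<bar>g (rsub N x (zl l z)) - g x\<bar> * \<eta> z) \<partial>lebN N) = ennreal (\<eta> z * \<theta> l z)"
        by (simp add: \<theta>_def mult.commute)
    qed
    finally show ?thesis .
  qed
  have \<theta>m: "\<theta> l \<in> borel_measurable (lebN N)" for l
    unfolding \<theta>_def by (rule leb.borel_measurable_lebesgue_integral) measurable
  have "(\<lambda>l. \<integral>\<^sup>+z. ennreal (\<eta> z * \<theta> l z) \<partial>lebN N) \<longlonglongrightarrow> (\<integral>\<^sup>+z. 0 \<partial>lebN N)"
  proof (rule nn_integral_dominated_convergence[where w="\<lambda>z. ennreal (\<eta> z * (2 * B * V))"])
    note [measurable] = \<theta>m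
    show "(\<lambda>z. ennreal (\<eta> z * \<theta> l z)) \<in> borel_measurable (lebN N)" for l by measurable
    show "(\<lambda>z. ennreal (\<eta> z * (2 * B * V))) \<in> borel_measurable (lebN N)" by measurable
    show "AE z in lebN N. ennreal (\<eta> z * \<theta> l z) \<le> ennreal (\<eta> z * (2 * B * V))" for l
      using \<eta>0 \<theta>b by (intro AE_I2 ennreal_leI mult_left_mono) auto
    have "integrable (lebN N) (\<lambda>z. \<eta> z * (2 * B * V))" using \<eta>i by simp
    hence "(\<integral>\<^sup>+z. ennreal (norm (\<eta> z * (2 * B * V))) \<partial>lebN N) < \<infinity>" by (simp only: integrable_iff_bounded)
    moreover have "(\<integral>\<^sup>+z. ennreal (\<eta> z * (2 * B * V)) \<partial>lebN N) \<le> (\<integral>\<^sup>+z. ennreal (norm (\<eta> z * (2 * B * V))) \<partial>lebN N)"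
      by (intro nn_integral_mono ennreal_leI) simp
    ultimately show "(\<integral>\<^sup>+z. ennreal (\<eta> z * (2 * B * V)) \<partial>lebN N) < \<infinity>" by (rule le_less_trans[rotated])
    show "AE z in lebN N. (\<lambda>l. ennreal (\<eta> z * \<theta> l z)) \<longlonglongrightarrow> 0"
    proof (rule AE_I2)
      fix z
      have "(\<lambda>l. \<eta> z * \<theta> l z) \<longlonglongrightarrow> 0" by (rule tendsto_mult_right_zero[OF \<theta>lim])
      from tendsto_ennrealI[OF this] show "(\<lambda>l. ennreal (\<eta> z * \<theta> l z)) \<longlonglongrightarrow> 0" by simp
    qed
  qed measurable
  hence l0: "(\<lambda>l. \<integral>\<^sup>+z. ennreal (\<eta> z * \<theta> l z) \<partial>lebN N) \<longlonglongrightarrow> 0" by simp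
  have "(\<lambda>l. ennreal (\<integral>x. norm (u l x) \<partial>lebN N)) \<longlonglongrightarrow> 0"
    by (rule tendsto_sandwich[OF always_eventually always_eventually tendsto_const l0]) (use le in auto)
  hence "(\<lambda>l. ennreal (\<integral>x. norm (u l x) \<partial>lebN N)) \<longlonglongrightarrow> ennreal 0" by simp
  hence "(\<lambda>l. \<integral>x. norm (u l x) \<partial>lebN N) \<longlonglongrightarrow> 0"
    by (subst (asm) tendsto_ennreal_iff) (auto intro!: always_eventually Bochner_Integration.integral_nonneg)
  from tendsto_L1_AE_subseq[OF ui this] obtain \<sigma> where \<sigma>: "strict_mono \<sigma>" "AE x in lebN N. (\<lambda>n. u (\<sigma> n) x) \<longlonglongrightarrow> 0"
    by blast
  have "AE x in lebN N. x \<in> cubeN N r \<longrightarrow> (\<lambda>n. W (\<sigma> n) x) \<longlonglongrightarrow> g x"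
    using \<sigma>(2)
  proof eventually_elim
    case (elim x)
    show ?case
    proof
      assume "x \<in> cubeN N r"
      with elim have "(\<lambda>n. W (\<sigma> n) x - g x) \<longlonglongrightarrow> 0" by (simp add: u_def)
      thus "(\<lambda>n. W (\<sigma> n) x) \<longlonglongrightarrow> g x" by (rule LIM_zero_cancel)
    qed
  qed
  with \<sigma>(1) show "\<exists>\<sigma>. strict_mono \<sigma> \<and> (AE x in lebN N. x \<in> cubeN N r \<longrightarrow> (\<lambda>n. W (\<sigma> n) x) \<longlonglongrightarrow> g x)" by blast
qed

text \<open>Outside the closed unit ball \<eta> vanishes on an open piece of every coordinate line,
  hence so does the derivative along it.\<close>

lemma mollifier_C1N:
  assumes "mollifier N \<eta>"
  shows "C1N N \<eta> (\<lambda>i. pderiv i \<eta>)"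
    and "\<And>i x. i < N \<Longrightarrow> x \<in> RN N \<Longrightarrow> normsqN N x > 1 \<Longrightarrow> pderiv i \<eta> x = 0"
proof -
  have "Ck N (Suc 0) \<eta>" using assms by (auto simp only: mollifier_def smoothN_def)
  thus C1: "C1N N \<eta> (\<lambda>i. pderiv i \<eta>)" by (intro C1N_pderiv) auto
  fix i x assume i: "i < N" and x: "x \<in> RN N" and n: "normsqN N x > 1"
  have z: "\<eta> u = 0" if "u \<in> RN N" "normsqN N u > 1" for u using assms that by (auto simp: mollifier_def)
  let ?S = "{s. 1 < normsqN N (x(i := s))}"
  have "continuous_on UNIV (\<lambda>s. (x(i := s)) k)" for k by (cases "k = i") auto
  hence "continuous_on UNIV (\<lambda>s. normsqN N (x(i := s)))"
    unfolding normsqN_def by (intro continuous_on_sum continuous_on_power)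
  hence S: "open ?S" by (intro open_Collect_less continuous_intros)
  have "((\<lambda>s. \<eta> (x(i := s))) has_real_derivative 0) (at (x i))"
    by (rule has_field_derivative_transform_within_open[OF _ S, where f="\<lambda>_. 0"])
       (use n z x i in auto)
  thus "pderiv i \<eta> x = 0" unfolding pderiv_def by (rule DERIV_imp_deriv)
qed

lemma normsqN_outside: "x \<in> RN N \<Longrightarrow> x \<notin> cubeN N 1 \<Longrightarrow> normsqN N x > 1"
proof -
  assume "x \<in> RN N" "x \<notin> cubeN N 1"
  then obtain i where i: "i < N" "\<bar>x i\<bar> > 1" by (force simp: cubeN_def)
  hence "1 < (x i)\<^sup>2" using one_less_power[of "\<bar>x i\<bar>" 2] by simp
  also have "\<dots> \<le> normsqN N x" unfolding normsqN_def using i by (intro member_le_sum) auto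
  finally show ?thesis .
qed

lemma delta_l_C1N:
  assumes \<eta>: "mollifier N (\<eta> N)" and l: "l \<ge> 1"
  defines "d \<equiv> \<lambda>i x. real l ^ N * (real l * pderiv i (\<eta> N) (\<lambda>i\<in>{..<N}. real l * x i))"
  shows "C1N N (delta_l \<eta> N l) d"
    and "\<And>x. x \<in> RN N \<Longrightarrow> x \<notin> cubeN N 1 \<Longrightarrow> delta_l \<eta> N l x = 0"
    and "\<And>i x. i < N \<Longrightarrow> x \<in> RN N \<Longrightarrow> x \<notin> cubeN N 1 \<Longrightarrow> d i x = 0"
proof -
  note C1 = mollifier_C1N[OF \<eta>]
  let ?s = "\<lambda>x. \<lambda>i\<in>{..<N}. real l * x i"
  have sc: "continuous_on (RN N) ?s"
  proof (rule continuous_on_coordinatewise_then_product)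
    fix k show "continuous_on (RN N) (\<lambda>x. ?s x k)"
      by (cases "k < N") (auto intro!: continuous_intros continuous_on_subset[OF continuous_on_product_coordinates])
  qed
  have comp: "continuous_on (RN N) (\<lambda>x. u (?s x))" if "continuous_on (RN N) u" for u :: "(nat \<Rightarrow> real) \<Rightarrow> real"
    by (rule continuous_on_compose2[OF that sc]) auto
  show "C1N N (delta_l \<eta> N l) d"
    unfolding C1N_def
  proof (intro conjI allI impI ballI)
    show "continuous_on (RN N) (delta_l \<eta> N l)"
      unfolding delta_l_def[abs_def] by (intro continuous_intros comp C1N_D(1)[OF C1(1)])
    fix i assume i: "i < N"
    show "continuous_on (RN N) (d i)"
      unfolding d_def by (intro continuous_intros comp C1N_D(2)[OF C1(1) i])
    fix x assume x: "x \<in> RN N"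
    have e: "?s (x(i := s)) = (?s x)(i := real l * s)" for s using i by (auto simp: fun_eq_iff)
    have "((\<lambda>v. \<eta> N ((?s x)(i := v))) has_real_derivative pderiv i (\<eta> N) ((?s x)(i := real l * x i))) (at (real l * x i))"
      by (rule C1N_D(3)[OF C1(1) i]) simp
    moreover have "((\<lambda>s. real l * s) has_real_derivative real l) (at (x i))" by (auto intro!: derivative_eq_intros)
    ultimately have "((\<lambda>s. \<eta> N ((?s x)(i := real l * s))) has_real_derivative pderiv i (\<eta> N) ((?s x)(i := real l * x i)) * real l) (at (x i))"
      by (rule DERIV_chain2[where g="\<lambda>s. real l * s"])
    hence "((\<lambda>s. \<eta> N (?s (x(i := s)))) has_real_derivative pderiv i (\<eta> N) (?s x) * real l) (at (x i))"
      unfolding e[symmetric] by simp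
    from DERIV_cmult[OF this, of "real l ^ N"] show "((\<lambda>s. delta_l \<eta> N l (x(i := s))) has_real_derivative d i x) (at (x i))"
      unfolding delta_l_def d_def by (simp add: mult.commute)
  qed
  have out: "normsqN N (?s x) > 1" if x: "x \<in> RN N" "x \<notin> cubeN N 1" for x
  proof -
    obtain i where i: "i < N" "\<bar>x i\<bar> > 1" using x by (force simp: cubeN_def)
    have "1 * 1 < real l * \<bar>x i\<bar>" using l i by (intro mult_le_less_imp_less) auto
    hence "?s x \<notin> cubeN N 1" using i by (auto simp: cubeN_def abs_mult not_le)
    thus ?thesis by (intro normsqN_outside) auto
  qed
  show "delta_l \<eta> N l x = 0" if "x \<in> RN N" "x \<notin> cubeN N 1" for x
    using out[OF that] \<eta> unfolding delta_l_def mollifier_def by simp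
  show "d i x = 0" if "i < N" "x \<in> RN N" "x \<notin> cubeN N 1" for i x
    unfolding d_def using C1(2)[OF that(1) _ out[OF that(2,3)]] by simp
qed

section \<open>The regularised weights\<close>

definition psi_regular :: "(nat \<Rightarrow> (nat \<Rightarrow> real) \<Rightarrow> 'h \<Rightarrow> real) \<Rightarrow> nat \<Rightarrow> 'h \<Rightarrow> bool" where
  "psi_regular \<Psi> N y \<longleftrightarrow> Ck N 2 (\<lambda>x'. (\<Psi> N x' y)\<^sup>2) \<and> (\<forall>x'\<in>RN N. (\<Psi> N x' y)\<^sup>2 > 0) \<and>
         bounded ((\<lambda>x'. (\<Psi> N x' y)\<^sup>2) ` RN N)"

lemma PsiSq_regular: "psi_regular \<Psi> N y \<Longrightarrow> PsiSq \<Psi> \<eta> N M l x y = (\<Psi> N x y)\<^sup>2"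
  by (simp add: PsiSq_def psi_regular_def)

definition psi_clip :: "(nat \<Rightarrow> (nat \<Rightarrow> real) \<Rightarrow> 'h \<Rightarrow> real) \<Rightarrow> nat \<Rightarrow> nat \<Rightarrow> 'h \<Rightarrow> (nat \<Rightarrow> real) \<Rightarrow> real" where
  "psi_clip \<Psi> N M y x = max (1 / real M) (min ((\<Psi> N x y)\<^sup>2) (real M))"

lemma PsiSq_irregular:
  "\<not> psi_regular \<Psi> N y \<Longrightarrow> PsiSq \<Psi> \<eta> N M l x y = (\<integral>z. psi_clip \<Psi> N M y (rsub N x z) * delta_l \<eta> N l z \<partial>lebN N)"
  unfolding PsiSq_def psi_regular_def psi_clip_def rsub_def by (rule if_not_P)

text \<open>An irregular slice uses the mollification of a function with values between
  \<open>1 / real M\<close> and \<open>real M\<close>: averaging keeps these bounds, and the kernel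
  supplies the derivatives. A regular slice uses \<open>\<Psi>\<close>^2 itself.\<close>

lemma PsiSq_facts:
  assumes \<eta>: "mollifier N (\<eta> N)" and Psi [measurable]: "(\<lambda>x. \<Psi> N x y) \<in> borel_measurable (lebN N)" and M: "M \<ge> (1::nat)"
  shows PsiSq_C1N: "l \<ge> 1 \<Longrightarrow> \<exists>w'. C1N N (\<lambda>x. PsiSq \<Psi> \<eta> N M l x y) w'"
    and PsiSq_bounds: "\<not> psi_regular \<Psi> N y \<Longrightarrow> l \<ge> 1 \<Longrightarrow> x \<in> RN N \<Longrightarrow> 1 / real M \<le> PsiSq \<Psi> \<eta> N M l x y \<and> PsiSq \<Psi> \<eta> N M l x y \<le> real M"
    and PsiSq_pos: "l \<ge> 1 \<Longrightarrow> x \<in> RN N \<Longrightarrow> PsiSq \<Psi> \<eta> N M l x y > 0"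
    and PsiSq_AE: "\<not> psi_regular \<Psi> N y \<Longrightarrow> \<exists>\<sigma>. strict_mono \<sigma> \<and> (AE x in lebN N. x \<in> cubeN N r \<longrightarrow>
           (\<lambda>n. PsiSq \<Psi> \<eta> N M (Suc (\<sigma> n)) x y) \<longlonglongrightarrow> psi_clip \<Psi> N M y x)"
proof -
  let ?g = "psi_clip \<Psi> N M y"
  have gm [measurable]: "?g \<in> borel_measurable (lebN N)" unfolding psi_clip_def by measurable
  have "1 / real M \<le> 1" "1 \<le> real M" using M by (auto simp: divide_le_eq)
  hence M1: "1 / real M \<le> real M" by (rule order_trans)
  have g1: "1 / real M \<le> ?g x" "?g x \<le> real M" for x using M1 by (auto simp: psi_clip_def)
  have \<eta>m: "\<eta> N \<in> borel_measurable (lebN N)"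
    by (rule borel_measurable_lebN_continuous[OF C1N_D(1)[OF mollifier_C1N(1)[OF \<eta>]]])
  have \<eta>0: "\<And>x. x \<in> RN N \<Longrightarrow> 0 \<le> \<eta> N x" and \<eta>1: "(\<integral>x. \<eta> N x \<partial>lebN N) = 1" using \<eta> by (auto simp: mollifier_def)
  note MA = mollify_AE[where g="?g" and \<eta>="\<eta> N" and A="1 / real M" and B="real M" and N=N, OF gm g1 _ \<eta>m \<eta>0 \<eta>1]
  have M0: "0 \<le> 1 / real M" by simp
  \<comment> \<open>The mollification statement counts from \<open>Suc l\<close>, hence the index
    \<open>l - 1\<close>.\<close>
  show bd: "1 / real M \<le> PsiSq \<Psi> \<eta> N M l x y \<and> PsiSq \<Psi> \<eta> N M l x y \<le> real M"
    if "\<not> psi_regular \<Psi> N y" "l \<ge> 1" "x \<in> RN N" for l x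
    using MA(1)[OF M0 _ that(3), of "l - 1", OF asm_rl] that(2) unfolding PsiSq_irregular[OF that(1)] delta_l_def by simp
  show "PsiSq \<Psi> \<eta> N M l x y > 0" if "l \<ge> 1" "x \<in> RN N" for l x
  proof (cases "psi_regular \<Psi> N y")
    case True
    then show ?thesis using that by (simp add: PsiSq_regular) (simp add: psi_regular_def)
  next
    case False
    from bd[OF False that] M show ?thesis by (auto intro: less_le_trans[of 0 "1 / real M"])
  qed
  show "\<exists>w'. C1N N (\<lambda>x. PsiSq \<Psi> \<eta> N M l x y) w'" if l: "l \<ge> 1" for l
  proof (cases "psi_regular \<Psi> N y")
    case True
    have "Ck N (Suc (Suc 0)) (\<lambda>x'. (\<Psi> N x' y)\<^sup>2)" using True by (simp add: psi_regular_def numeral_2_eq_2)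
    hence "C1N N (\<lambda>x'. (\<Psi> N x' y)\<^sup>2) (\<lambda>i. pderiv i (\<lambda>x'. (\<Psi> N x' y)\<^sup>2))"
      by (intro C1N_pderiv) auto
    then show ?thesis unfolding PsiSq_regular[OF True] by blast
  next
    case False
    note D = delta_l_C1N[where N=N and \<eta>=\<eta>, OF \<eta> l]
    have [measurable]: "delta_l \<eta> N l \<in> borel_measurable (lebN N)"
      by (rule borel_measurable_lebN_continuous[OF C1N_D(1)[OF D(1)]])
    have gb: "\<bar>?g x\<bar> \<le> real M" for x using g1[of x] order_trans[OF M0 g1(1)] by simp
    obtain w' where w': "C1N N (\<lambda>x. \<integral>z. ?g z * delta_l \<eta> N l (rsub N x z) \<partial>lebN N) w'"
      using conv_C1N[OF gm gb D(1) D(2) D(3)] by blast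
    \<comment> \<open>Reflection puts \<open>x\<close> into the kernel alone, where it can be
      differentiated; the clipped function is only measurable.\<close>
    have "PsiSq \<Psi> \<eta> N M l x y = (\<integral>z. ?g z * delta_l \<eta> N l (rsub N x z) \<partial>lebN N)" if "x \<in> RN N" for x
    proof -
      have [measurable]: "x \<in> space (lebN N)" using that by simp
      let ?F = "\<lambda>u. ?g u * delta_l \<eta> N l (rsub N x u)"
      have Fm: "?F \<in> borel_measurable (lebN N)" by measurable
      have "PsiSq \<Psi> \<eta> N M l x y = (\<integral>z. ?F (rsub N x z) \<partial>lebN N)"
        unfolding PsiSq_irregular[OF False] by (intro Bochner_Integration.integral_cong) (auto simp: rsub_rsub)
      also have "\<dots> = (\<integral>z. ?F z \<partial>lebN N)" by (rule integral_reflect[OF Fm])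
      finally show ?thesis .
    qed
    hence eq: "\<And>x. x \<in> RN N \<Longrightarrow> (\<lambda>x. \<integral>z. ?g z * delta_l \<eta> N l (rsub N x z) \<partial>lebN N) x = PsiSq \<Psi> \<eta> N M l x y" by simp
    have "C1N N (\<lambda>x. PsiSq \<Psi> \<eta> N M l x y) w'"
      unfolding C1N_def
    proof (intro conjI allI impI ballI)
      show "continuous_on (RN N) (\<lambda>x. PsiSq \<Psi> \<eta> N M l x y)"
        by (rule continuous_on_eq[OF C1N_D(1)[OF w'] eq])
      fix i assume i: "i < N"
      show "continuous_on (RN N) (w' i)" by (rule C1N_D(2)[OF w' i])
      fix x assume x: "x \<in> RN N"
      show "((\<lambda>s. PsiSq \<Psi> \<eta> N M l (x(i := s)) y) has_real_derivative w' i x) (at (x i))"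
        using C1N_D(3)[OF w' i x, of "x i"] x i by (simp add: eq del: fun_upd_apply)
    qed
    thus ?thesis by blast
  qed
  show "\<exists>\<sigma>. strict_mono \<sigma> \<and> (AE x in lebN N. x \<in> cubeN N r \<longrightarrow>
           (\<lambda>n. PsiSq \<Psi> \<eta> N M (Suc (\<sigma> n)) x y) \<longlonglongrightarrow> psi_clip \<Psi> N M y x)" if "\<not> psi_regular \<Psi> N y"
    using MA(2)[OF M0 asm_rl, of r] unfolding PsiSq_irregular[OF that] delta_l_def .
qed

section \<open>Relative entropy with a vanishing weight\<close>

text \<open>The lower semicontinuous extension of \<open>w * hfun (p / w)\<close> to weight 0. The
  infinite value for \<open>p > 0\<close> is what forces a density of finite entropy to vanish with
  the weight.\<close>

definition entL :: "real \<Rightarrow> real \<Rightarrow> ennreal" where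
  "entL p w = (if w = 0 then if p = 0 then 0 else \<infinity> else ennreal (w * hfun (p / w)))"

lemma entL_measurable [measurable (raw)]:
  assumes [measurable]: "f \<in> borel_measurable M" "g \<in> borel_measurable M"
  shows "(\<lambda>x. entL (f x) (g x)) \<in> borel_measurable M"
  unfolding entL_def by measurable

lemma perspective_continuous:
  assumes "\<And>n. w n > (0::real)" "w \<longlonglongrightarrow> w'" "w' > 0" "\<And>n. p n \<ge> 0" "p \<longlonglongrightarrow> p'" "p' \<ge> 0"
  shows "(\<lambda>n. w n * hfun (p n / w n)) \<longlonglongrightarrow> w' * hfun (p' / w')"
proof (intro tendsto_mult assms(2) continuous_on_tendsto_compose[OF continuous_on_hfun])
  show "(\<lambda>n. p n / w n) \<longlonglongrightarrow> p' / w'" using assms by (intro tendsto_divide) auto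
  show "p' / w' \<in> {0..}" using assms by simp
  show "\<forall>\<^sub>F n in sequentially. p n / w n \<in> {0..}" using assms(1,4) by (intro always_eventually) (auto intro: divide_nonneg_pos)
qed

lemma perspective_eq: "w > 0 \<Longrightarrow> p > 0 \<Longrightarrow> w * hfun (p / w) = p * ln p - p * ln w - p + (w::real)"
  by (simp add: hfun_def ln_div field_simps)

lemma perspective_nonneg: "w > 0 \<Longrightarrow> p \<ge> 0 \<Longrightarrow> w * hfun (p / w) \<ge> 0"
  by (intro mult_nonneg_nonneg hfun_nonneg divide_nonneg_pos) auto

text \<open>At a positive limit weight the perspective is continuous. If the weights tend to 0 while
  \<open>p > 0\<close>, the term \<open>- p * ln (w n)\<close> tends to infinity.\<close>

lemma entL_liminf:
  assumes w: "\<And>n. w n > 0" "w \<longlonglongrightarrow> w'" and w': "w' \<ge> 0" and p: "p \<ge> 0"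
  shows "entL p w' \<le> liminf (\<lambda>n. ennreal (w n * hfun (p / w n)))"
proof (cases "w' = 0")
  case False
  with w' have "w' > 0" by simp
  hence "(\<lambda>n. ennreal (w n * hfun (p / w n))) \<longlonglongrightarrow> ennreal (w' * hfun (p / w'))"
    using w p by (intro tendsto_ennrealI perspective_continuous[where p="\<lambda>_. p"]) auto
  hence "liminf (\<lambda>n. ennreal (w n * hfun (p / w n))) = ennreal (w' * hfun (p / w'))"
    by (intro lim_imp_Liminf) auto
  thus ?thesis using False by (simp add: entL_def)
next
  case True
  show ?thesis
  proof (cases "p = 0")
    case False
    with p have p0: "p > 0" by simp
    have "filterlim w (at_right 0) sequentially"
      using w True by (intro tendsto_imp_filterlim_at_right) auto
    hence "filterlim (\<lambda>n. ln (w n)) at_bot sequentially" by (rule filterlim_compose[OF ln_at_0])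
    hence "filterlim (\<lambda>n. - ln (w n)) at_top sequentially" by (simp add: filterlim_uminus_at_bot)
    hence 1: "filterlim (\<lambda>n. p * (- ln (w n))) at_top sequentially"
      using p0 by (intro filterlim_tendsto_pos_mult_at_top[OF tendsto_const]) auto
    have 2: "(\<lambda>n. p * ln p - p + w n) \<longlonglongrightarrow> p * ln p - p + 0"
      using w(2) True by (intro tendsto_intros) auto
    have "filterlim (\<lambda>n. (p * ln p - p + w n) + p * (- ln (w n))) at_top sequentially"
      by (rule filterlim_tendsto_add_at_top[OF 2 1])
    hence "filterlim (\<lambda>n. w n * hfun (p / w n)) at_top sequentially"
      by (rule filterlim_cong[THEN iffD1, rotated -1]) (auto simp: perspective_eq[OF w(1) p0])
    hence "(\<lambda>n. ennreal (w n * hfun (p / w n))) \<longlonglongrightarrow> \<infinity>"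
      unfolding infinity_ennreal_def by (rule ennreal_tendsto_top_eq_at_top[THEN iffD2])
    hence "liminf (\<lambda>n. ennreal (w n * hfun (p / w n))) = \<infinity>" by (intro lim_imp_Liminf) auto
    thus ?thesis by simp
  qed (use True in \<open>simp add: entL_def\<close>)
qed

section \<open>The limit of the scheme in one slice\<close>

context euler_scheme
begin

lemma path_bounds:
  assumes p: "dens N K b m p" and R: "K + real N * (C * T) \<le> R" and n: "n > 0" "2 * T * c \<le> real n"
  shows "(\<lambda>z. path n p (fst z) (snd z)) \<in> borel_measurable PM"
    and "\<And>t x. t \<in> {0..T} \<Longrightarrow> x \<in> RN N \<Longrightarrow> 0 \<le> path n p t x \<and> path n p t x \<le> b * exp (c * T * real N) \<and> (x \<notin> cubeN N R \<longrightarrow> path n p t x = 0)"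
proof -
  have \<tau>: "T / n > 0" "T / n * c \<le> 1/2" using n T_pos by (auto simp: field_simps)
  have d: "dens N R (b * exp (c * T * real N)) m (evol (T / n) p (Suc k))" if "k < n" for k
  proof (rule evol_dens(1)[OF \<tau> _ p R])
    have "real (Suc k) * (T / n) \<le> real n * (T / n)" using that T_pos by (intro mult_right_mono) auto
    thus "real (Suc k) * (T / n) \<le> T" using n by simp
  qed
  have "(\<lambda>(t, x). path n p t x) \<in> borel_measurable PM"
    unfolding path_def by (rule pw_measurable) (use dens_D(1)[OF d] in blast)
  thus "(\<lambda>z. path n p (fst z) (snd z)) \<in> borel_measurable PM" by (simp add: case_prod_unfold)
  fix t x assume t: "t \<in> {0..T}" and x: "x \<in> RN N"
  have b: "b * exp (c * T * real N) \<ge> 0" using dens_D(2,3)[OF d[of 0] x] n by simp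
  show "0 \<le> path n p t x \<and> path n p t x \<le> b * exp (c * T * real N) \<and> (x \<notin> cubeN N R \<longrightarrow> path n p t x = 0)"
  proof (cases "t \<le> 0")
    case True
    then show ?thesis using b by (simp add: path_def pw_zero)
  next
    case False
    then obtain k where k: "k < n" "t \<in> {real k * (T / n)<..real (Suc k) * (T / n)}"
      using t n by (auto intro: pw_cover[of t n])
    have "path n p t x = evol (T / n) p (Suc k) x" unfolding path_def by (rule pw_eq[OF k])
    thus ?thesis using dens_D(2,3,4)[OF d[OF k(1)] x] by auto
  qed
qed

text \<open>From \<open>n0\<close> on the step size satisfies \<open>T / n * c \<le> 1/2\<close>.
  \<open>G\<close> and \<open>P\<close> are given rather than constructed: in the application they
  are sections of a choice made jointly for all slices.\<close>

context
  fixes K b m p n0 G P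
  assumes p: "dens N K b m p" and R: "K + real N * (C * T) \<le> R" and n0: "n0 > 0" "2 * T * c \<le> real n0"
    and G: "\<And>n. G n \<in> midconv (\<lambda>k z. path (n0 + k) p (fst z) (snd z)) n"
    and P [measurable]: "P \<in> borel_measurable PM" and P0: "\<And>z. P z \<ge> 0"
    and lim: "AE z in PM. (\<lambda>n. G n z) \<longlonglongrightarrow> P z"
begin

abbreviation "F k z \<equiv> path (n0 + k) p (fst z) (snd z)"

lemma F_facts:
  shows F_meas: "F k \<in> borel_measurable PM"
    and F_bounds: "z \<in> space PM \<Longrightarrow> 0 \<le> F k z \<and> F k z \<le> b * exp (c * T * real N) \<and> (snd z \<notin> cubeN N R \<longrightarrow> F k z = 0)"
proof -
  have n: "n0 + k > 0" "2 * T * c \<le> real (n0 + k)" using n0 by auto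
  show "F k \<in> borel_measurable PM" by (rule path_bounds(1)[OF p R n])
  show "0 \<le> F k z \<and> F k z \<le> b * exp (c * T * real N) \<and> (snd z \<notin> cubeN N R \<longrightarrow> F k z = 0)" if "z \<in> space PM"
    using path_bounds(2)[OF p R n, of "fst z" "snd z"] that by (auto simp: space_pair_measure)
qed

lemma midconv_F:
  assumes "g \<in> midconv F n"
  shows "g \<in> borel_measurable PM \<and> (\<forall>z\<in>space PM. 0 \<le> g z \<and> g z \<le> b * exp (c * T * real N) \<and> (snd z \<notin> cubeN N R \<longrightarrow> g z = 0))"
  using assms
proof induction
  case (base k)
  then show ?case using F_meas F_bounds by blast
next
  case (mid u v)
  hence [measurable]: "u \<in> borel_measurable PM" "v \<in> borel_measurable PM" by auto
  have "0 \<le> (u z + v z) / 2 \<and> (u z + v z) / 2 \<le> b * exp (c * T * real N) \<and> (snd z \<notin> cubeN N R \<longrightarrow> (u z + v z) / 2 = 0)"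
    if "z \<in> space PM" for z
  proof -
    have "0 \<le> u z" "u z \<le> b * exp (c * T * real N)" "snd z \<notin> cubeN N R \<longrightarrow> u z = 0"
      "0 \<le> v z" "v z \<le> b * exp (c * T * real N)" "snd z \<notin> cubeN N R \<longrightarrow> v z = 0" using mid that by auto
    thus ?thesis by auto
  qed
  thus ?case by auto
qed

lemma G_facts:
  shows G_meas: "G n \<in> borel_measurable PM"
    and G_bounds: "z \<in> space PM \<Longrightarrow> 0 \<le> G n z" "z \<in> space PM \<Longrightarrow> G n z \<le> b * exp (c * T * real N)"
      "z \<in> space PM \<Longrightarrow> snd z \<notin> cubeN N R \<Longrightarrow> G n z = 0"
  using midconv_F[OF G] by auto

lemma integrable_bounded_cube:
  fixes \<kappa> :: "real \<Rightarrow> (nat \<Rightarrow> real) \<Rightarrow> real"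
  assumes [measurable]: "u \<in> borel_measurable PM" and k: "continuous_on ({0..T} \<times> RN N) (\<lambda>(t, x). \<kappa> t x)"
    and "\<And>z. z \<in> space PM \<Longrightarrow> \<bar>u z\<bar> \<le> B" "\<And>z. z \<in> space PM \<Longrightarrow> snd z \<notin> cubeN N R \<Longrightarrow> u z = 0"
  shows "integrable PM (\<lambda>z. \<kappa> (fst z) (snd z) * u z)"
proof -
  obtain B' where B': "B' > 0" "\<And>t x. t \<in> {0..T} \<Longrightarrow> x \<in> cubeN N R \<Longrightarrow> \<bar>\<kappa> t x\<bar> \<le> B'"
    using cubeN_bounded[OF k, of R] by metis
  have [measurable]: "(\<lambda>z. \<kappa> (fst z) (snd z)) \<in> borel_measurable PM"
    using borel_measurable_lebT_lebN_continuous[OF k] by (simp add: case_prod_unfold)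
  show ?thesis
  proof (rule integrable_PM[where B="B' * \<bar>B\<bar>" and r=R])
    fix t x assume tx: "t \<in> {0..T}" "x \<in> RN N"
    hence z: "(t, x) \<in> space PM" by (simp add: space_pair_measure)
    show "\<bar>\<kappa> (fst (t, x)) (snd (t, x)) * u (t, x)\<bar> \<le> B' * \<bar>B\<bar>"
    proof (cases "x \<in> cubeN N R")
      case True
      have "\<bar>\<kappa> t x\<bar> * \<bar>u (t, x)\<bar> \<le> B' * \<bar>B\<bar>"
        using B'(2)[OF tx(1) True] assms(3)[OF z] B'(1) by (intro mult_mono) auto
      thus ?thesis by (simp add: abs_mult)
    next
      case False
      thus ?thesis using assms(4)[OF z] B'(1) by simp
    qed
    show "\<kappa> (fst (t, x)) (snd (t, x)) * u (t, x) \<noteq> 0 \<Longrightarrow> x \<in> cubeN N R" using assms(4)[OF z] by auto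
  qed measurable
qed

text \<open>The functional is linear, so its convergence along the scheme carries over to convex
  combinations of tails; the common bound on the cube then gives convergence to the value at
  \<open>P\<close>.\<close>

lemma slice_weak:
  assumes \<phi>: "C1N N \<phi> \<phi>'"
    and g: "\<And>t. t \<in> {0..T} \<Longrightarrow> (g has_real_derivative g' t) (at t within {0..T})"
    and g': "continuous_on {0..T} g'" and gT: "g T = 0"
  shows "(\<integral>z. (g' (fst z) * \<phi> (snd z) + g (fst z) * (\<Sum>i<N. f i (fst z) (snd z) * \<phi>' i (snd z))) * P z \<partial>PM) = - g 0 * (\<integral>x. \<phi> x * p x \<partial>leb)"
proof -
  define \<kappa> where "\<kappa> t x = g' t * \<phi> x + g t * (\<Sum>i<N. f i t x * \<phi>' i x)" for t x
  define L where "L = - g 0 * (\<integral>x. \<phi> x * p x \<partial>leb)"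
  have gc: "continuous_on {0..T} g" using g by (intro DERIV_continuous_on) auto
  have lift: "continuous_on ({0..T} \<times> RN N) (\<lambda>(t, x). u t)" if "continuous_on {0..T} u" for u :: "real \<Rightarrow> real"
    unfolding case_prod_unfold by (rule continuous_on_compose2[OF that]) (auto intro: continuous_intros)
  have kc: "continuous_on ({0..T} \<times> RN N) (\<lambda>(t, x). \<kappa> t x)"
    unfolding \<kappa>_def case_prod_unfold
    using lift[OF gc] lift[OF g'] f_cont continuous_on_lift_time[OF C1N_D(2)[OF \<phi>]] continuous_on_lift_time[OF C1N_D(1)[OF \<phi>], of "{0..T}"]
    by (intro continuous_intros) (auto simp: case_prod_unfold)
  have [measurable]: "(\<lambda>z. \<kappa> (fst z) (snd z)) \<in> borel_measurable PM"
    using borel_measurable_lebT_lebN_continuous[OF kc] by (simp add: case_prod_unfold)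
  define I where "I u = (\<integral>z. \<kappa> (fst z) (snd z) * u z \<partial>PM)" for u
  have int: "integrable PM (\<lambda>z. \<kappa> (fst z) (snd z) * u z)" if "u \<in> midconv F n" for u n
    using midconv_F[OF that] by (intro integrable_bounded_cube[OF _ kc, where B="b * exp (c * T * real N)"]) auto
  have "(\<lambda>n. I (\<lambda>z. path n p (fst z) (snd z))) \<longlonglongrightarrow> L"
    using path_weak[OF p R \<phi> g g' gT] unfolding I_def \<kappa>_def L_def by (simp add: case_prod_unfold)
  hence IF: "(\<lambda>k. I (F k)) \<longlonglongrightarrow> L" by (subst add.commute) (rule LIMSEQ_ignore_initial_segment)
  have 1: "(\<lambda>n. I (G n)) \<longlonglongrightarrow> L"
  proof (rule LIMSEQ_I)
    fix e :: real assume "e > 0"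
    then obtain n1 where n1: "\<And>k. k \<ge> n1 \<Longrightarrow> \<bar>I (F k) - L\<bar> \<le> e / 2"
      using LIMSEQ_D[OF IF, of "e / 2"] by (auto intro: less_imp_le)
    have *: "\<bar>I u - L\<bar> \<le> e / 2" if "u \<in> midconv F n1" for u
      using that
    proof induction
      case (base k)
      then show ?case by (rule n1)
    next
      case (mid u v)
      have "I (\<lambda>z. (u z + v z) / 2) = (\<integral>z. (\<kappa> (fst z) (snd z) * u z + \<kappa> (fst z) (snd z) * v z) / 2 \<partial>PM)"
        unfolding I_def by (simp add: distrib_left)
      also have "\<dots> = (I u + I v) / 2"
        unfolding I_def using int[OF mid(1)] int[OF mid(2)] by simp
      finally have eq: "I (\<lambda>z. (u z + v z) / 2) = (I u + I v) / 2" .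
      show ?case unfolding eq using mid(3,4) unfolding abs_le_iff by (auto simp: field_simps)
    qed
    have "norm (I (G n) - L) < e" if "n \<ge> n1" for n
      using *[OF midconv_mono[OF that G]] \<open>e > 0\<close> by simp
    thus "\<exists>no. \<forall>n\<ge>no. norm (I (G n) - L) < e" by blast
  qed
  obtain B' where B': "B' > 0" "\<And>t x. t \<in> {0..T} \<Longrightarrow> x \<in> cubeN N R \<Longrightarrow> \<bar>\<kappa> t x\<bar> \<le> B'"
    using cubeN_bounded[OF kc, of R] by metis
  have "(\<lambda>n. I (G n)) \<longlonglongrightarrow> I P"
    unfolding I_def
  proof (rule integral_dominated_convergence[where w="\<lambda>z. (B' * (b * exp (c * T * real N))) * icube N R (snd z)"])
    note [measurable] = G_meas
    show "(\<lambda>z. \<kappa> (fst z) (snd z) * P z) \<in> borel_measurable PM" "(\<lambda>z. \<kappa> (fst z) (snd z) * G n z) \<in> borel_measurable PM" for n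
      by measurable
    show "integrable PM (\<lambda>z. (B' * (b * exp (c * T * real N))) * icube N R (snd z))"
      by (rule integrable_PM[where B="\<bar>B' * (b * exp (c * T * real N))\<bar>" and r=R]) (auto simp: indicator_def split: if_splits)
    show "AE z in PM. (\<lambda>n. \<kappa> (fst z) (snd z) * G n z) \<longlonglongrightarrow> \<kappa> (fst z) (snd z) * P z"
      using lim by eventually_elim (intro tendsto_intros)
    show "AE z in PM. norm (\<kappa> (fst z) (snd z) * G n z) \<le> B' * (b * exp (c * T * real N)) * icube N R (snd z)" for n
    proof (rule AE_I2)
      fix z assume z: "z \<in> space PM"
      show "norm (\<kappa> (fst z) (snd z) * G n z) \<le> B' * (b * exp (c * T * real N)) * icube N R (snd z)"
      proof (cases "snd z \<in> cubeN N R")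
        case True
        have "\<bar>\<kappa> (fst z) (snd z)\<bar> * \<bar>G n z\<bar> \<le> B' * (b * exp (c * T * real N))"
          using B'(2)[OF _ True, of "fst z"] z G_bounds(1,2)[OF z, of n] B'(1)
          by (intro mult_mono) (auto simp: space_pair_measure)
        thus ?thesis using True by (simp add: abs_mult)
      qed (use G_bounds(3)[OF z] in simp)
    qed
  qed
  from LIMSEQ_unique[OF this 1] show ?thesis unfolding I_def \<kappa>_def L_def .
qed

text \<open>The bound for the scheme holds up to any \<open>e > 0\<close> from some index on.
  Convexity transfers it to the combinations and Fatou's lemma to \<open>P\<close>; then
  \<open>e\<close> tends to 0.\<close>

lemma slice_entropy:
  assumes w: "C1N N w w'" and wpos: "\<And>x. x \<in> RN N \<Longrightarrow> w x > 0" and \<delta>: "\<delta> > 0"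
  shows "(\<integral>\<^sup>+z. icube N R (snd z) * ennreal (w (snd z) * hfun (P z / w (snd z))) \<partial>PM)
     \<le> ennreal (T * (exp (2 * T / \<delta>) * (relent w p + (\<integral>z. ecost w w' \<delta> (fst z) (snd z) * icube N R (snd z) \<partial>PM) / \<delta>)))"
proof -
  define Bd where "Bd = T * (exp (2 * T / \<delta>) * (relent w p + (\<integral>z. ecost w w' \<delta> (fst z) (snd z) * icube N R (snd z) \<partial>PM) / \<delta>))"
  define \<Phi> where "\<Phi> z r = icube N R (snd z) * (w (snd z) * hfun (r / w (snd z)))" for z :: "real \<times> (nat \<Rightarrow> real)" and r
  have [measurable]: "w \<in> borel_measurable leb" by (rule borel_measurable_lebN_continuous[OF C1N_D(1)[OF w]])
  have sp: "snd z \<in> RN N" if "z \<in> space PM" for z using that by (auto simp: space_pair_measure)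
  have \<Phi>m [measurable]: "(\<lambda>(z, r). \<Phi> z r) \<in> borel_measurable (PM \<Otimes>\<^sub>M borel)"
    unfolding \<Phi>_def case_prod_unfold by measurable
  have \<Phi>0: "\<Phi> z r \<ge> 0" if "z \<in> space PM" "r \<ge> 0" for z r
    unfolding \<Phi>_def using wpos[OF sp[OF that(1)]] that(2) by (intro mult_nonneg_nonneg perspective_nonneg) auto
  have \<Phi>c: "\<Phi> z ((a + a') / 2) \<le> (\<Phi> z a + \<Phi> z a') / 2" if "z \<in> space PM" "a \<ge> 0" "a' \<ge> 0" for z a a'
  proof (cases "snd z \<in> cubeN N R")
    case True
    have w0: "w (snd z) > 0" by (rule wpos[OF sp[OF that(1)]])
    have "hfun ((a + a') / 2 / w (snd z)) = hfun ((a / w (snd z) + a' / w (snd z)) / 2)" by (simp add: add_divide_distrib mult.commute)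
    also have "\<dots> \<le> (hfun (a / w (snd z)) + hfun (a' / w (snd z))) / 2"
      using that w0 by (intro hfun_midpoint) auto
    finally have "w (snd z) * hfun ((a + a') / 2 / w (snd z)) \<le> w (snd z) * ((hfun (a / w (snd z)) + hfun (a' / w (snd z))) / 2)"
      using w0 by (intro mult_left_mono) auto
    thus ?thesis using True by (simp add: \<Phi>_def algebra_simps)
  qed (simp add: \<Phi>_def)
  have "(\<integral>\<^sup>+z. ennreal (\<Phi> z (P z)) \<partial>PM) \<le> ennreal Bd"
  proof (rule ennreal_le_epsilon)
    fix e :: real assume e: "e > 0"
    have "\<forall>\<^sub>F n in sequentially. (\<integral>\<^sup>+z. ennreal (\<Phi> z (path n p (fst z) (snd z))) \<partial>PM) \<le> ennreal (Bd + e)"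
      using path_entropy[OF w wpos \<delta> p R e] unfolding \<Phi>_def Bd_def by (simp add: case_prod_unfold)
    then obtain n1 where n1: "\<And>n. n \<ge> n1 \<Longrightarrow> (\<integral>\<^sup>+z. ennreal (\<Phi> z (path n p (fst z) (snd z))) \<partial>PM) \<le> ennreal (Bd + e)"
      by (auto simp: eventually_sequentially)
    have Gb: "(\<integral>\<^sup>+z. ennreal (\<Phi> z (G n z)) \<partial>PM) \<le> ennreal (Bd + e)" if "n \<ge> n1" for n
    proof -
      have "G n \<in> borel_measurable PM \<and> (\<forall>z\<in>space PM. 0 \<le> G n z) \<and> (\<integral>\<^sup>+z. ennreal (\<Phi> z (G n z)) \<partial>PM) \<le> ennreal (Bd + e)"
        by (rule nn_integral_midconv_le[OF G F_meas _ \<Phi>m \<Phi>0 \<Phi>c]) (use F_bounds n1 that in auto)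
      thus ?thesis by blast
    qed
    have "(\<integral>\<^sup>+z. ennreal (\<Phi> z (P z)) \<partial>PM) = (\<integral>\<^sup>+z. liminf (\<lambda>n. ennreal (\<Phi> z (G n z))) \<partial>PM)"
    proof (rule nn_integral_cong_AE)
      show "AE z in PM. ennreal (\<Phi> z (P z)) = liminf (\<lambda>n. ennreal (\<Phi> z (G n z)))"
        using lim AE_space
      proof eventually_elim
        case (elim z)
        have "(\<lambda>n. w (snd z) * hfun (G n z / w (snd z))) \<longlonglongrightarrow> w (snd z) * hfun (P z / w (snd z))"
          using wpos[OF sp[OF elim(2)]] G_bounds(1)[OF elim(2)] P0 elim(1)
          by (intro perspective_continuous[where w="\<lambda>_. w (snd z)"]) auto
        hence "(\<lambda>n. ennreal (\<Phi> z (G n z))) \<longlonglongrightarrow> ennreal (\<Phi> z (P z))"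
          unfolding \<Phi>_def by (rule tendsto_ennrealI[OF tendsto_mult[OF tendsto_const]])
        thus ?case by (intro lim_imp_Liminf[symmetric]) auto
      qed
    qed
    also have "\<dots> \<le> liminf (\<lambda>n. \<integral>\<^sup>+z. ennreal (\<Phi> z (G n z)) \<partial>PM)"
    proof (rule nn_integral_liminf)
      note [measurable] = G_meas
      show "(\<lambda>z. ennreal (\<Phi> z (G n z))) \<in> borel_measurable PM" for n unfolding \<Phi>_def by measurable
    qed
    also have "\<dots> \<le> liminf (\<lambda>n::nat. ennreal (Bd + e))"
      using Gb by (intro Liminf_mono) (auto simp: eventually_sequentially)
    also have "\<dots> = ennreal (Bd + e)" by (simp add: Liminf_const)
    also have "\<dots> \<le> ennreal Bd + ennreal e" 
      using e by (cases "Bd \<ge> 0") (auto simp: ennreal_neg intro!: ennreal_leI)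
    finally show "(\<integral>\<^sup>+z. ennreal (\<Phi> z (P z)) \<partial>PM) \<le> ennreal Bd + ennreal e" .
  qed
  moreover have "(\<integral>\<^sup>+z. icube N R (snd z) * ennreal (w (snd z) * hfun (P z / w (snd z))) \<partial>PM) = (\<integral>\<^sup>+z. ennreal (\<Phi> z (P z)) \<partial>PM)"
    by (intro nn_integral_cong) (auto simp: \<Phi>_def indicator_def)
  ultimately show ?thesis unfolding Bd_def by simp
qed

end

end

section \<open>Removing the regularisation of the weight\<close>

lemma psi_clip_bounds:
  assumes "M \<ge> 1" shows "1 / real M \<le> psi_clip \<Psi> N M y x" "psi_clip \<Psi> N M y x \<le> real M" "psi_clip \<Psi> N M y x > 0"
    "psi_clip \<Psi> N M y x \<le> (\<Psi> N x y)\<^sup>2 + 1 / real M"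
proof -
  have "1 / real M \<le> 1" "1 \<le> real M" using assms by (auto simp: divide_le_eq)
  hence "1 / real M \<le> real M" by (rule order_trans)
  thus 1: "1 / real M \<le> psi_clip \<Psi> N M y x" and "psi_clip \<Psi> N M y x \<le> real M" by (auto simp: psi_clip_def)
  have "0 < 1 / real M" using assms by simp
  thus "psi_clip \<Psi> N M y x > 0" using 1 by (rule less_le_trans)
  show "psi_clip \<Psi> N M y x \<le> (\<Psi> N x y)\<^sup>2 + 1 / real M" unfolding psi_clip_def by (auto intro: min.coboundedI1 add_increasing2)
qed

lemma psi_clip_tendsto: "(\<lambda>n. psi_clip \<Psi> N (n + k) y x) \<longlonglongrightarrow> (\<Psi> N x y)\<^sup>2"
proof -
  have "\<forall>\<^sub>F n in sequentially. max (1 / real n) ((\<Psi> N x y)\<^sup>2) = psi_clip \<Psi> N n y x"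
  proof -
    obtain n0 where "(\<Psi> N x y)\<^sup>2 \<le> real n0" using real_arch_simple by blast
    hence "\<forall>n\<ge>n0. max (1 / real n) ((\<Psi> N x y)\<^sup>2) = psi_clip \<Psi> N n y x"
      by (auto simp: psi_clip_def min_absorb1)
    thus ?thesis unfolding eventually_sequentially by blast
  qed
  moreover have "(\<lambda>n. max (1 / real n) ((\<Psi> N x y)\<^sup>2)) \<longlonglongrightarrow> max 0 ((\<Psi> N x y)\<^sup>2)"
    by (intro tendsto_max lim_1_over_n tendsto_const)
  ultimately have "(\<lambda>n. psi_clip \<Psi> N n y x) \<longlonglongrightarrow> max 0 ((\<Psi> N x y)\<^sup>2)"
    by (rule Lim_transform_eventually[rotated])
  hence "(\<lambda>n. psi_clip \<Psi> N n y x) \<longlonglongrightarrow> (\<Psi> N x y)\<^sup>2" by simp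
  thus ?thesis by (rule LIMSEQ_ignore_initial_segment)
qed

context euler_scheme
begin

lemma AE_PM_snd:
  assumes "AE x in leb. Q x" shows "AE z in PM. Q (snd z)"
proof -
  interpret leb: sigma_finite_measure leb by (rule sigma_finite_lebN)
  obtain A where A: "A \<in> null_sets leb" "{x \<in> RN N. \<not> Q x} \<subseteq> A"
    using AE_E2[OF assms] assms by (metis AE_E3 DiffE mem_Collect_eq null_setsI space_lebN subsetI eventually_ae_filter)
  have "emeasure PM (space (lebT T) \<times> A) = emeasure (lebT T) (space (lebT T)) * emeasure leb A"
    using A by (intro leb.emeasure_pair_measure_Times sets.top) auto
  hence "space (lebT T) \<times> A \<in> null_sets PM" using A by (auto intro!: null_setsI pair_measureI sets.top simp del: space_lebT)
  moreover have "{z \<in> space PM. \<not> Q (snd z)} \<subseteq> space (lebT T) \<times> A" using A(2) by (auto simp: space_pair_measure)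
  ultimately show ?thesis by (rule AE_I')
qed

text \<open>Here \<open>P\<close> is fixed and only the weights vary: lower semicontinuity
  pointwise, then Fatou's lemma, with the right-hand sides converging along
  \<open>s\<close>.\<close>

lemma entL_limit:
  assumes P [measurable]: "P \<in> borel_measurable PM" and P0: "\<And>z. P z \<ge> 0"
    and wm [measurable]: "\<And>n. w n \<in> borel_measurable leb" and wpos: "\<And>n x. x \<in> RN N \<Longrightarrow> w n x > 0"
    and wl: "\<And>x. wl x \<ge> 0"
    and lim: "AE x in leb. x \<in> cubeN N R \<longrightarrow> (\<lambda>n. w n x) \<longlonglongrightarrow> wl x"
    and bd: "\<And>n. (\<integral>\<^sup>+z. icube N R (snd z) * ennreal (w n (snd z) * hfun (P z / w n (snd z))) \<partial>PM) \<le> ennreal (a * (s n + d))"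
    and s: "s \<longlonglongrightarrow> s'"
  shows "(\<integral>\<^sup>+z. icube N R (snd z) * entL (P z) (wl (snd z)) \<partial>PM) \<le> ennreal (a * (s' + d))"
proof -
  have "(\<integral>\<^sup>+z. icube N R (snd z) * entL (P z) (wl (snd z)) \<partial>PM)
    \<le> (\<integral>\<^sup>+z. liminf (\<lambda>n. icube N R (snd z) * ennreal (w n (snd z) * hfun (P z / w n (snd z)))) \<partial>PM)"
  proof (rule nn_integral_mono_AE)
    show "AE z in PM. icube N R (snd z) * entL (P z) (wl (snd z))
      \<le> liminf (\<lambda>n. icube N R (snd z) * ennreal (w n (snd z) * hfun (P z / w n (snd z))))"
      using AE_PM_snd[OF lim]
    proof eventually_elim
      case (elim z)
      show ?case
      proof (cases "snd z \<in> cubeN N R")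
        case True
        hence "snd z \<in> RN N" using cubeN_subset by blast
        thus ?thesis using True elim entL_liminf[of "\<lambda>n. w n (snd z)" "wl (snd z)" "P z"] wpos wl P0 by simp
      qed simp
    qed
  qed
  also have "\<dots> \<le> liminf (\<lambda>n. \<integral>\<^sup>+z. icube N R (snd z) * ennreal (w n (snd z) * hfun (P z / w n (snd z))) \<partial>PM)"
    by (intro nn_integral_liminf) measurable
  also have "\<dots> \<le> liminf (\<lambda>n. ennreal (a * (s n + d)))"
    by (intro Liminf_mono always_eventually allI bd)
  also have "\<dots> = ennreal (a * (s' + d))"
    by (intro lim_imp_Liminf tendsto_ennrealI tendsto_intros s) auto
  finally show ?thesis .
qed

text \<open>The two-sided bound on the weights keeps the quotient of density and weight in a compact
  interval, so the integrands are bounded on the cube and dominated convergence applies.\<close>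

lemma relent_tendsto:
  assumes p: "dens N R b m p" and M: "M \<ge> (1::nat)"
    and wm [measurable]: "\<And>n. w n \<in> borel_measurable leb" and wb: "\<And>n x. x \<in> RN N \<Longrightarrow> 1 / real M \<le> w n x \<and> w n x \<le> real M"
    and wlm [measurable]: "wl \<in> borel_measurable leb" and wl: "\<And>x. wl x > 0"
    and lim: "AE x in leb. x \<in> cubeN N R \<longrightarrow> (\<lambda>n. w n x) \<longlonglongrightarrow> wl x"
  shows "(\<lambda>n. relent (w n) p) \<longlonglongrightarrow> relent wl p"
proof -
  have M0: "0 < 1 / real M" using M by simp
  have wpos: "w n x > 0" if "x \<in> RN N" for n x using wb[OF that, of n] M0 by linarith
  note [measurable] = dens_D(1)[OF p]
  have "compact (hfun ` {0..b * real M})"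
    by (intro compact_continuous_image continuous_on_subset[OF continuous_on_hfun]) auto
  then obtain H where H: "\<And>r. r \<in> {0..b * real M} \<Longrightarrow> \<bar>hfun r\<bar> \<le> H"
    using compact_imp_bounded bounded_iff by (metis (no_types, lifting) image_eqI real_norm_def)
  show ?thesis unfolding relent_def
  proof (rule integral_dominated_convergence[where w="\<lambda>x. (real M * H) * icube N R x"])
    show "integrable leb (\<lambda>x. (real M * H) * icube N R x)"
      using emeasure_cubeN by (intro integrable_mult_right integrable_real_indicator) auto
    show "AE x in leb. (\<lambda>n. icube N R x * (w n x * hfun (p x / w n x))) \<longlonglongrightarrow> icube N R x * (wl x * hfun (p x / wl x))"
      using lim AE_space
    proof eventually_elim
      case (elim x)
      hence x: "x \<in> RN N" by simp
      show ?case
      proof (cases "x \<in> cubeN N R")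
        case True
        have "(\<lambda>n. w n x * hfun (p x / w n x)) \<longlonglongrightarrow> wl x * hfun (p x / wl x)"
          using elim True wpos[OF x] wl dens_D(2)[OF p x] by (intro perspective_continuous[where p="\<lambda>_. p x"]) auto
        thus ?thesis using True by simp
      qed simp
    qed
    show "AE x in leb. norm (icube N R x * (w n x * hfun (p x / w n x))) \<le> real M * H * icube N R x" for n
    proof (rule AE_I2)
      fix x assume "x \<in> space leb"
      hence x: "x \<in> RN N" by simp
      have "1 / w n x \<le> real M" using wb[OF x, of n] wpos[OF x, of n] M by (simp add: field_simps)
      hence "p x * (1 / w n x) \<le> b * real M"
        using dens_D(2,3)[OF p x] wpos[OF x, of n] by (intro mult_mono) auto
      hence "p x / w n x \<in> {0..b * real M}" using dens_D(2)[OF p x] wpos[OF x, of n] by simp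
      hence "w n x * \<bar>hfun (p x / w n x)\<bar> \<le> real M * H"
        using wb[OF x, of n] wpos[OF x, of n] H by (intro mult_mono) auto
      thus "norm (icube N R x * (w n x * hfun (p x / w n x))) \<le> real M * H * icube N R x"
        using wpos[OF x, of n] by (auto simp: indicator_def abs_mult)
    qed
  qed measurable
qed

text \<open>The order of the limits matters. For fixed \<open>M\<close> the two-sided bounds make
  the initial relative entropies converge as \<open>l\<close> grows; afterwards, as \<open>M\<close>
  grows, an upper bound for them suffices. The solution \<open>P\<close> does not depend on the
  weight, and \<open>c0\<close> bounds the cost for all \<open>M\<close> and
  \<open>l\<close>.\<close>

lemma slice_psi:
  fixes \<Psi> :: "nat \<Rightarrow> (nat \<Rightarrow> real) \<Rightarrow> 'h \<Rightarrow> real"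
  assumes S: "\<And>w w'. C1N N w w' \<Longrightarrow> (\<And>x. x \<in> RN N \<Longrightarrow> w x > 0) \<Longrightarrow>
      (\<integral>\<^sup>+z. icube N R (snd z) * ennreal (w (snd z) * hfun (P z / w (snd z))) \<partial>PM)
     \<le> ennreal (T * (exp (2 * T / \<delta>) * (relent w p + (\<integral>z. ecost w w' \<delta> (fst z) (snd z) * icube N R (snd z) \<partial>PM) / \<delta>)))"
    and \<delta>: "\<delta> > 0" and P [measurable]: "P \<in> borel_measurable PM" and P0: "\<And>z. P z \<ge> 0"
    and p: "dens N R b m p"
    and \<eta>: "mollifier N (\<eta> N)" and Psi [measurable]: "(\<lambda>x. \<Psi> N x y) \<in> borel_measurable leb"
    and cost: "\<And>M l. M \<ge> 1 \<Longrightarrow> l \<ge> 1 \<Longrightarrow> (\<integral>\<^sup>+t. (\<integral>\<^sup>+x. ennreal ((exp (\<delta> * max 0 (- (\<Sum>i<N. f' i t x +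
          f i t x * qdiv (pderiv i (\<lambda>x'. PsiSq \<Psi> \<eta> N M l x' y) x) (PsiSq \<Psi> \<eta> N M l x y)))) - 1)
             * PsiSq \<Psi> \<eta> N M l x y) \<partial>leb) \<partial>lebT T) \<le> c0"
    and r [measurable]: "r \<in> borel_measurable leb" and r0: "\<And>x. r x \<ge> 0"
    and pr: "\<And>x. x \<in> RN N \<Longrightarrow> p x \<noteq> 0 \<Longrightarrow> p x = r x * (\<Psi> N x y)\<^sup>2 \<and> (\<Psi> N x y)\<^sup>2 \<le> real k0"
  shows "(\<integral>\<^sup>+z. icube N R (snd z) * entL (P z) ((\<Psi> N (snd z) y)\<^sup>2) \<partial>PM)
     \<le> ennreal (T * exp (2 * T / \<delta>)) * ((\<integral>\<^sup>+x. ennreal ((max 0 (r x * ln (r x)) + 1) * (\<Psi> N x y)\<^sup>2) \<partial>leb) + c0 * ennreal (1 / \<delta>))"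
proof -
  define E where "E = T * exp (2 * T / \<delta>)"
  have E0: "E > 0" using T_pos by (simp add: E_def)
  define q where "q x = (max 0 (r x * ln (r x)) + 1) * (\<Psi> N x y)\<^sup>2" for x
  have q0: "q x \<ge> 0" for x by (simp add: q_def add_nonneg_nonneg)
  have qm [measurable]: "q \<in> borel_measurable leb" unfolding q_def by measurable
  define Q where "Q = (\<integral>\<^sup>+x. ennreal (q x) \<partial>leb)"
  show ?thesis
  \<comment> \<open>An infinite right-hand side leaves nothing to prove; otherwise all estimates can
    be made with real numbers.\<close>
  proof (cases "c0 = \<infinity> \<or> Q = \<infinity>")
    case True
    hence "Q + c0 * ennreal (1 / \<delta>) = \<infinity>" using \<delta> by (auto simp: ennreal_top_mult)
    hence "ennreal E * (Q + c0 * ennreal (1 / \<delta>)) = \<infinity>" using E0 by (simp add: ennreal_mult_eq_top_iff)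
    thus ?thesis unfolding E_def Q_def q_def by simp
  next
    case False
    hence c0f: "c0 < \<infinity>" "Q < \<infinity>" by (simp_all add: less_top[symmetric])
    define c1 where "c1 = enn2real c0"
    have c1: "ennreal c1 = c0" "c1 \<ge> 0" using c0f by (simp_all add: c1_def)
    have qi: "integrable leb q" using c0f q0 unfolding Q_def by (intro integrableI_nonneg) auto
    define Q1 where "Q1 = (\<integral>x. q x \<partial>leb)"
    have Q1: "Q = ennreal Q1" "Q1 \<ge> 0" unfolding Q_def Q1_def using qi q0 by (auto intro!: nn_integral_eq_integral Bochner_Integration.integral_nonneg)
    let ?L = "\<lambda>w. \<integral>\<^sup>+z. icube N R (snd z) * ennreal (w (snd z) * hfun (P z / w (snd z))) \<partial>PM"
    have SM: "?L (\<lambda>x. PsiSq \<Psi> \<eta> N M l x y) \<le> ennreal (E * (relent (\<lambda>x. PsiSq \<Psi> \<eta> N M l x y) p + c1 / \<delta>))"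
      if M: "M \<ge> 1" and l: "l \<ge> 1" for M l
    proof -
      let ?w = "\<lambda>x. PsiSq \<Psi> \<eta> N M l x y"
      note pf = PsiSq_facts[where \<eta>=\<eta> and N=N and \<Psi>=\<Psi> and y=y, OF \<eta> Psi M]
      obtain w' where w': "C1N N ?w w'" using pf(1)[OF l] by blast
      have wpos: "\<And>x. x \<in> RN N \<Longrightarrow> ?w x > 0" using pf(3)[OF l] by blast
      let ?e = "\<lambda>z. ecost ?w w' \<delta> (fst z) (snd z) * icube N R (snd z)"
      interpret leb: sigma_finite_measure leb by (rule sigma_finite_lebN)
      have ec: "continuous_on ({0..T} \<times> RN N) (\<lambda>(t, x). ecost ?w w' \<delta> t x)" by (rule ecost_continuous[OF w' wpos \<delta>])
      have [measurable]: "(\<lambda>z. ecost ?w w' \<delta> (fst z) (snd z)) \<in> borel_measurable PM"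
        using borel_measurable_lebT_lebN_continuous[OF ec] by (simp add: case_prod_unfold)
      have "ennreal (\<integral>z. ?e z \<partial>PM) \<le> (\<integral>\<^sup>+z. ennreal (?e z) \<partial>PM)"
      proof (cases "integrable PM ?e")
        case True
        have "AE z in PM. 0 \<le> ?e z"
          using ecost_nonneg[OF w' wpos \<delta>] by (intro AE_I2) (auto simp: space_pair_measure indicator_def)
        thus ?thesis using True by (simp add: nn_integral_eq_integral)
      qed (simp add: not_integrable_integral_eq)
      also have "\<dots> = (\<integral>\<^sup>+t. (\<integral>\<^sup>+x. ennreal (?e (t, x)) \<partial>leb) \<partial>lebT T)"
        by (rule leb.nn_integral_fst[symmetric]) measurable
      also have "\<dots> \<le> (\<integral>\<^sup>+t. (\<integral>\<^sup>+x. ennreal ((exp (\<delta> * max 0 (- (\<Sum>i<N. f' i t x +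
          f i t x * qdiv (pderiv i ?w x) (?w x)))) - 1) * ?w x) \<partial>leb) \<partial>lebT T)"
      proof (intro nn_integral_mono ennreal_leI)
        fix t x assume "x \<in> space leb"
        hence x: "x \<in> RN N" by simp
        have "- (\<Sum>i<N. f' i t x + f i t x * qdiv (pderiv i ?w x) (?w x)) = Dst ?w w' t x"
          unfolding Dst_def using wpos[OF x] pderiv_C1N[OF w' _ x] by (auto simp: qdiv_def intro!: sum.cong)
        moreover have "ecost ?w w' \<delta> t x \<ge> 0" by (rule ecost_nonneg[OF w' wpos \<delta> x])
        ultimately show "?e (t, x) \<le> (exp (\<delta> * max 0 (- (\<Sum>i<N. f' i t x + f i t x * qdiv (pderiv i ?w x) (?w x)))) - 1) * ?w x"
          by (auto simp: ecost_def[OF w' wpos \<delta>] indicator_def)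
      qed
      also have "\<dots> \<le> c0" by (rule cost[OF M l])
      finally have A: "(\<integral>z. ?e z \<partial>PM) \<le> c1" unfolding c1(1)[symmetric] using c1(2) by (simp add: ennreal_le_iff)
      have "?L ?w \<le> ennreal (T * (exp (2 * T / \<delta>) * (relent ?w p + (\<integral>z. ?e z \<partial>PM) / \<delta>)))"
        by (rule S[OF w' wpos])
      also have "\<dots> \<le> ennreal (E * (relent ?w p + c1 / \<delta>))"
        unfolding E_def mult.assoc using A \<delta> T_pos by (intro ennreal_leI mult_left_mono add_left_mono divide_right_mono) auto
      finally show ?thesis .
    qed
    define V where "V = measure leb (cubeN N R)"
    \<comment> \<open>Where \<open>p\<close> is nonzero, \<open>\<Psi>\<close>^2 is at most
      \<open>k0\<close> and the weight is at least \<open>\<Psi>\<close>^2, so the logarithmic part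
      is at most that relative to \<open>\<Psi>\<close>^2. Where \<open>p\<close> vanishes, the
      integrand is the weight, at most \<open>\<Psi>\<close>^2 plus \<open>d\<close>; over the cube
      this surplus contributes \<open>d * V\<close>.\<close>
    have rel_bound: "relent w p \<le> Q1 + d * V"
      if [measurable]: "w \<in> borel_measurable leb" and wpos: "\<And>x. x \<in> RN N \<Longrightarrow> w x > 0" and d: "d \<ge> 0"
        and wle: "\<And>x. x \<in> RN N \<Longrightarrow> w x \<le> (\<Psi> N x y)\<^sup>2 + d"
        and wge: "\<And>x. x \<in> RN N \<Longrightarrow> (\<Psi> N x y)\<^sup>2 \<le> real k0 \<Longrightarrow> (\<Psi> N x y)\<^sup>2 \<le> w x" for w d
    proof -
      note [measurable] = dens_D(1)[OF p]
      have pt: "icube N R x * (w x * hfun (p x / w x)) \<le> q x + d * icube N R x" 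
        and pt0: "0 \<le> icube N R x * (w x * hfun (p x / w x))" if x: "x \<in> RN N" for x
      proof -
        show "0 \<le> icube N R x * (w x * hfun (p x / w x))"
          using wpos[OF x] dens_D(2)[OF p x] by (intro mult_nonneg_nonneg perspective_nonneg) auto
        have "w x * hfun (p x / w x) \<le> q x + d"
        proof (cases "p x = 0")
          case True
          have "1 * (\<Psi> N x y)\<^sup>2 \<le> q x" unfolding q_def by (intro mult_right_mono) auto
          thus ?thesis using True wle[OF x] by simp
        next
          case False
          with dens_D(2)[OF p x] have p0: "p x > 0" by simp
          have pe: "p x = r x * (\<Psi> N x y)\<^sup>2" and k0: "(\<Psi> N x y)\<^sup>2 \<le> real k0" using pr[OF x False] by auto
          have ps1: "r x * (\<Psi> N x y)\<^sup>2 > 0" using p0 pe by simp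
          have ps: "(\<Psi> N x y)\<^sup>2 > 0" "r x > 0" using ps1 r0[of x] by (auto simp: zero_less_mult_iff)
          have ln: "ln (p x) = ln (r x) + ln ((\<Psi> N x y)\<^sup>2)" unfolding pe using ps by (intro ln_mult_pos)
          have "ln ((\<Psi> N x y)\<^sup>2) \<le> ln (w x)" using ps wge[OF x k0] by (intro ln_mono) auto
          hence "p x * ln (p x) - p x * ln (w x) \<le> p x * ln (r x)"
            unfolding right_diff_distrib[symmetric] ln using p0 by (intro mult_left_mono) auto
          also have "\<dots> = (r x * ln (r x)) * (\<Psi> N x y)\<^sup>2" by (simp add: pe)
          also have "\<dots> \<le> max 0 (r x * ln (r x)) * (\<Psi> N x y)\<^sup>2" by (intro mult_right_mono) auto
          finally have "p x * ln (p x) - p x * ln (w x) \<le> max 0 (r x * ln (r x)) * (\<Psi> N x y)\<^sup>2" .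
          moreover have "w x * hfun (p x / w x) = p x * ln (p x) - p x * ln (w x) - p x + w x"
            by (rule perspective_eq[OF wpos[OF x] p0])
          moreover have "q x = max 0 (r x * ln (r x)) * (\<Psi> N x y)\<^sup>2 + (\<Psi> N x y)\<^sup>2" by (simp add: q_def distrib_right)
          ultimately show ?thesis using wle[OF x] p0 by linarith
        qed
        thus "icube N R x * (w x * hfun (p x / w x)) \<le> q x + d * icube N R x"
          using q0[of x] by (auto simp: indicator_def)
      qed
      have i2: "integrable leb (\<lambda>x. q x + d * icube N R x)"
        using emeasure_cubeN by (intro Bochner_Integration.integrable_add qi integrable_mult_right integrable_real_indicator) auto
      have "relent w p \<le> (\<integral>x. q x + d * icube N R x \<partial>leb)"
        unfolding relent_def
      proof (rule integral_mono[OF _ i2])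
        show "integrable leb (\<lambda>x. icube N R x * (w x * hfun (p x / w x)))"
        proof (rule Bochner_Integration.integrable_bound[OF i2])
          show "(\<lambda>x. icube N R x * (w x * hfun (p x / w x))) \<in> borel_measurable leb" by measurable
          show "AE x in leb. norm (icube N R x * (w x * hfun (p x / w x))) \<le> norm (q x + d * icube N R x)"
          proof (rule AE_I2)
            fix x assume "x \<in> space leb"
            hence "x \<in> RN N" by simp
            from pt[OF this] pt0[OF this]
            show "norm (icube N R x * (w x * hfun (p x / w x))) \<le> norm (q x + d * icube N R x)"
              unfolding real_norm_def by linarith
          qed
        qed
      qed (use pt in auto)
      also have "\<dots> = Q1 + d * (\<integral>x. icube N R x \<partial>leb)"
        using qi emeasure_cubeN[of N R] unfolding Q1_def by (subst Bochner_Integration.integral_add) (auto intro!: integrable_mult_right integrable_real_indicator)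
      also have "(\<integral>x. icube N R x \<partial>leb) = V" using cubeN_subset[of N R] by (simp add: V_def Int_absorb2)
      finally show ?thesis .
    qed
    have "(\<integral>\<^sup>+z. icube N R (snd z) * entL (P z) ((\<Psi> N (snd z) y)\<^sup>2) \<partial>PM) \<le> ennreal (E * (Q1 + c1 / \<delta>))"
    proof (cases "psi_regular \<Psi> N y")
      \<comment> \<open>The weight is already \<open>\<Psi>\<close>^2, so a constant sequence of
        weights serves.\<close>
      case True
      have psi0: "(\<Psi> N x y)\<^sup>2 > 0" if "x \<in> RN N" for x using True that by (simp add: psi_regular_def)
      have "relent (\<lambda>x. (\<Psi> N x y)\<^sup>2) p \<le> Q1 + 0 * V" by (rule rel_bound) (use psi0 in auto)
      hence "E * (relent (\<lambda>x. (\<Psi> N x y)\<^sup>2) p + c1 / \<delta>) \<le> E * (Q1 + c1 / \<delta>)" using E0 by (intro mult_left_mono) auto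
      hence L: "?L (\<lambda>x. (\<Psi> N x y)\<^sup>2) \<le> ennreal (E * (Q1 + c1 / \<delta>))"
        using SM[of 1 1] unfolding PsiSq_regular[OF True] by (auto intro: order_trans[OF _ ennreal_leI])
      show ?thesis
        by (rule entL_limit[OF P P0, where w="\<lambda>_ x. (\<Psi> N x y)\<^sup>2" and s="\<lambda>_. Q1"]) (use psi0 L in auto)
    next
      case False
      have clip: "?L (psi_clip \<Psi> N M y) \<le> ennreal (E * (relent (psi_clip \<Psi> N M y) p + c1 / \<delta>))" if M: "M \<ge> 1" for M
      proof -
        note pf = PsiSq_facts[where \<eta>=\<eta> and N=N and \<Psi>=\<Psi> and y=y, OF \<eta> Psi M]
        obtain \<sigma> where \<sigma>: "AE x in leb. x \<in> cubeN N R \<longrightarrow> (\<lambda>n. PsiSq \<Psi> \<eta> N M (Suc (\<sigma> n)) x y) \<longlonglongrightarrow> psi_clip \<Psi> N M y x"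
          using pf(4)[OF False, of R] by blast
        have wm: "(\<lambda>x. PsiSq \<Psi> \<eta> N M (Suc (\<sigma> n)) x y) \<in> borel_measurable leb" for n
        proof -
          obtain w' where "C1N N (\<lambda>x. PsiSq \<Psi> \<eta> N M (Suc (\<sigma> n)) x y) w'" using pf(1)[of "Suc (\<sigma> n)"] by auto
          from borel_measurable_lebN_continuous[OF C1N_D(1)[OF this]] show ?thesis .
        qed
        have cm: "psi_clip \<Psi> N M y \<in> borel_measurable leb" unfolding psi_clip_def by measurable
        have cpos: "psi_clip \<Psi> N M y x > 0" for x by (rule psi_clip_bounds(3)[OF M])
        have rt: "(\<lambda>n. relent (\<lambda>x. PsiSq \<Psi> \<eta> N M (Suc (\<sigma> n)) x y) p) \<longlonglongrightarrow> relent (psi_clip \<Psi> N M y) p"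
          by (rule relent_tendsto[OF p M wm _ cm cpos \<sigma>]) (use pf(2)[OF False] in auto)
        have "(\<integral>\<^sup>+z. icube N R (snd z) * entL (P z) (psi_clip \<Psi> N M y (snd z)) \<partial>PM) \<le> ennreal (E * (relent (psi_clip \<Psi> N M y) p + c1 / \<delta>))"
          by (rule entL_limit[OF P P0 wm _ less_imp_le[OF cpos] \<sigma> SM[OF M] rt]) (use pf(3) in auto)
        moreover have "entL (P z) (psi_clip \<Psi> N M y (snd z)) = ennreal (psi_clip \<Psi> N M y (snd z) * hfun (P z / psi_clip \<Psi> N M y (snd z)))" for z
          using cpos[of "snd z"] by (simp add: entL_def)
        ultimately show ?thesis by simp
      qed
      \<comment> \<open>From this level on clipping does not lower \<open>\<Psi>\<close>^2 on the
        support of \<open>p\<close>; the added 1 keeps the level positive.\<close>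
      define k1 where "k1 = k0 + 1"
      have lim0: "(\<lambda>n. Q1 + 1 / real (n + k1) * V) \<longlonglongrightarrow> Q1 + 0 * V"
        by (intro tendsto_intros LIMSEQ_ignore_initial_segment[OF lim_1_over_n])
      show ?thesis
      proof (rule entL_limit[OF P P0, where w="\<lambda>n. psi_clip \<Psi> N (n + k1) y" and s="\<lambda>n. Q1 + 1 / real (n + k1) * V"])
        have k1: "n + k1 \<ge> 1" for n by (simp add: k1_def)
        show cm: "psi_clip \<Psi> N (n + k1) y \<in> borel_measurable leb" for n unfolding psi_clip_def by measurable
        show "psi_clip \<Psi> N (n + k1) y x > 0" for n x by (rule psi_clip_bounds(3)[OF k1])
        show "AE x in leb. x \<in> cubeN N R \<longrightarrow> (\<lambda>n. psi_clip \<Psi> N (n + k1) y x) \<longlonglongrightarrow> (\<Psi> N x y)\<^sup>2"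
          by (intro AE_I2 impI psi_clip_tendsto)
        show "?L (psi_clip \<Psi> N (n + k1) y) \<le> ennreal (E * (Q1 + 1 / real (n + k1) * V + c1 / \<delta>))" for n
        proof -
          have "relent (psi_clip \<Psi> N (n + k1) y) p \<le> Q1 + 1 / real (n + k1) * V"
          proof (rule rel_bound[OF cm psi_clip_bounds(3)[OF k1] _ psi_clip_bounds(4)[OF k1]])
            fix x assume "(\<Psi> N x y)\<^sup>2 \<le> real k0"
            hence "(\<Psi> N x y)\<^sup>2 \<le> real (n + k1)" by (simp add: k1_def)
            thus "(\<Psi> N x y)\<^sup>2 \<le> psi_clip \<Psi> N (n + k1) y x" by (simp add: psi_clip_def)
          qed simp
          hence "E * (relent (psi_clip \<Psi> N (n + k1) y) p + c1 / \<delta>) \<le> E * (Q1 + 1 / real (n + k1) * V + c1 / \<delta>)"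
            using E0 by (intro mult_left_mono) auto
          from order_trans[OF clip[OF k1] ennreal_leI[OF this]] show ?thesis .
        qed
        show "(\<lambda>n. Q1 + 1 / real (n + k1) * V) \<longlonglongrightarrow> Q1" using lim0 by simp
      qed auto
    qed
    also have "ennreal (E * (Q1 + c1 / \<delta>)) = ennreal E * (Q + c0 * ennreal (1 / \<delta>))"
    proof -
      have "c0 * ennreal (1 / \<delta>) = ennreal (c1 / \<delta>)"
        unfolding c1(1)[symmetric] using c1(2) \<delta> by (subst ennreal_mult[symmetric]) auto
      moreover have "Q + ennreal (c1 / \<delta>) = ennreal (Q1 + c1 / \<delta>)"
        unfolding Q1(1) using Q1(2) c1(2) \<delta> by (intro ennreal_plus[symmetric]) auto
      ultimately show ?thesis using E0 Q1(2) c1(2) \<delta> by (simp only:) (intro ennreal_mult, auto)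
    qed
    finally show ?thesis unfolding E_def Q_def q_def .
  qed
qed

end

section \<open>Test functions and orthogonal coordinates\<close>

text \<open>The properties of cylinder functions that the proof works with: bounded, with a bounded
  continuous gradient \<open>D\<close>. Constants qualify as well, which later gives the
  conservation of mass.\<close>

definition cyl :: "('h::real_inner \<Rightarrow> real) \<Rightarrow> ('h \<Rightarrow> 'h) \<Rightarrow> bool" where
  "cyl f D \<longleftrightarrow> continuous_on UNIV f \<and> continuous_on UNIV D \<and> bounded (range f) \<and> bounded (range D) \<and>
     (\<forall>x v. ((\<lambda>s. f (x + s *\<^sub>R v)) has_real_derivative inner (D x) v) (at 0))"

lemma embN_measurable [measurable]: "embN (e :: nat \<Rightarrow> 'h::{real_inner, second_countable_topology}) N \<in> borel_measurable (lebN N)"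
  unfolding embN_def[abs_def] by (intro borel_measurable_sum borel_measurable_scaleR measurable_lebN_component) auto

lemma coordN_measurable [measurable]: "coordN (e :: nat \<Rightarrow> 'h::{real_inner, second_countable_topology}) N \<in> borel \<rightarrow>\<^sub>M lebN N"
  unfolding coordN_def[abs_def] lebN_def by (rule measurable_restrict) measurable

lemma projE_measurable [measurable]: "projE (e :: nat \<Rightarrow> 'h::{real_inner, second_countable_topology}) N \<in> borel_measurable borel"
proof -
  have "(\<lambda>z. embN e N (coordN e N z)) \<in> borel_measurable borel"
    by (rule measurable_compose[OF coordN_measurable embN_measurable])
  thus ?thesis unfolding projE_def[abs_def] by measurable
qed

context
  fixes e :: "nat \<Rightarrow> 'h::{real_inner, complete_space, second_countable_topology}"
  assumes on: "orthonormal_basis e"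
begin

lemma inner_embN: "k < N \<Longrightarrow> inner (embN e N x) (e k) = x k"
  using on unfolding embN_def orthonormal_basis_def
  by (auto simp: inner_sum_left if_distrib[of "(*) _"] cong: if_cong)

lemma coordN_embN: "x \<in> RN N \<Longrightarrow> y \<in> EN e N \<Longrightarrow> coordN e N (embN e N x + y) = x"
  by (rule RN_eqI[of _ N]) (auto simp: coordN_def inner_add_left inner_embN EN_def)

lemma projE_embN: "x \<in> RN N \<Longrightarrow> y \<in> EN e N \<Longrightarrow> projE e N (embN e N x + y) = y"
  by (simp add: projE_def coordN_embN)

lemma projE_EN: "projE e N z \<in> EN e N"
  by (auto simp: EN_def projE_def inner_diff_left inner_embN coordN_def)

lemma embN_upd: "i < N \<Longrightarrow> embN e N (x(i := s)) = embN e N x + (s - x i) *\<^sub>R e i"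
proof -
  assume i: "i < N"
  have "embN e N (x(i := s)) - embN e N x = (\<Sum>k<N. ((x(i := s)) k - x k) *\<^sub>R e k)"
    by (simp add: embN_def sum_subtractf[symmetric] scaleR_diff_left)
  also have "\<dots> = (\<Sum>k<N. if k = i then (s - x i) *\<^sub>R e i else 0)" by (intro sum.cong) auto
  also have "\<dots> = (s - x i) *\<^sub>R e i" using i by simp
  finally show ?thesis by (simp add: algebra_simps)
qed

lemma continuous_on_embN: "continuous_on S (embN e N)"
  unfolding embN_def[abs_def] by (intro continuous_intros continuous_on_subset[OF continuous_on_product_coordinates]) auto

text \<open>Restriction to a slice turns a test function on \<open>H\<close> into one on R^N; its
  partial derivatives are the gradient components along the first \<open>N\<close> basis
  vectors.\<close>

lemma cyl_slice:
  assumes "cyl f D" shows "C1N N (\<lambda>x. f (embN e N x + y)) (\<lambda>i x. inner (D (embN e N x + y)) (e i))"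
  unfolding C1N_def
proof (intro conjI allI impI ballI)
  have f: "continuous_on UNIV f" and D: "continuous_on UNIV D" using assms by (auto simp: cyl_def)
  show "continuous_on (RN N) (\<lambda>x. f (embN e N x + y))"
    by (intro continuous_on_compose2[OF f] continuous_intros continuous_on_embN) auto
  fix i assume i: "i < N"
  show "continuous_on (RN N) (\<lambda>x. inner (D (embN e N x + y)) (e i))"
    by (intro continuous_on_compose2[OF D] continuous_intros continuous_on_embN) auto
  fix x
  have "((\<lambda>s. f ((embN e N x + y) + s *\<^sub>R e i)) has_real_derivative inner (D (embN e N x + y)) (e i)) (at (x i - x i))"
    using assms by (simp add: cyl_def)
  moreover have "((\<lambda>s. s - x i) has_real_derivative 1) (at (x i))" by (auto intro!: derivative_eq_intros)
  ultimately have "((\<lambda>s. f ((embN e N x + y) + (s - x i) *\<^sub>R e i)) has_real_derivative inner (D (embN e N x + y)) (e i) * 1) (at (x i))"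
    by (rule DERIV_chain2[where g="\<lambda>s. s - x i"])
  thus "((\<lambda>s. f (embN e N (x(i := s)) + y)) has_real_derivative inner (D (embN e N x + y)) (e i)) (at (x i))"
    by (simp add: embN_upd[OF i] add_ac)
qed

end

section \<open>Constants of the scheme and joint measurability\<close>

text \<open>The order of choice matters: the speed \<open>C\<close> first, then a radius
  \<open>R\<close> that mass starting within \<open>K\<close> cannot exceed by time
  \<open>T\<close>, and finally the derivative bound \<open>c\<close> on the cube of that
  radius.\<close>

lemma coeff_scheme:
  assumes T: "T > 0" and co: "\<And>i. i < N \<Longrightarrow> coeff_regular T N (f i)" and K: "K \<ge> 0"
  obtains C R c where "euler_scheme N T C R c f (\<lambda>i t x. pderiv i (f i t) x)" "K + real N * (C * T) \<le> R"
proof -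
  have "\<exists>B>0. \<forall>t\<in>{0..T}. \<forall>x\<in>RN N. \<bar>f i t x\<bar> \<le> B" if "i < N" for i
    using co[OF that] unfolding coeff_regular_def bounded_pos by (auto simp: image_iff)
  then obtain B where B: "\<And>i. i < N \<Longrightarrow> B i > 0" "\<And>i t x. i < N \<Longrightarrow> t \<in> {0..T} \<Longrightarrow> x \<in> RN N \<Longrightarrow> \<bar>f i t x\<bar> \<le> B i" by metis
  define C where "C = sum B {..<N} + 1"
  have "B i \<le> sum B {..<N}" if "i < N" for i using that B(1) by (intro member_le_sum) (auto intro: less_imp_le)
  hence fC: "\<bar>f i t x\<bar> \<le> C" if "i < N" "t \<in> {0..T}" "x \<in> RN N" for i t x
    using order_trans[OF B(2)[OF that], of "sum B {..<N}"] that(1) unfolding C_def by simp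
  have C: "C > 0" unfolding C_def using B(1) by (intro add_nonneg_pos sum_nonneg) (auto intro: less_imp_le)
  define R where "R = K + real N * (C * T) + 1"
  have R: "R > 0" "K + real N * (C * T) \<le> R" using K C T by (auto simp: R_def intro!: add_nonneg_pos)
  have c': "continuous_on ({0..T} \<times> RN N) (\<lambda>(t, x). pderiv i (f i t) x)" if "i < N" for i
    using co[OF that] that unfolding coeff_regular_def by blast
  have "\<exists>B>0. \<forall>t\<in>{0..T}. \<forall>x\<in>cubeN N R. \<bar>pderiv i (f i t) x\<bar> \<le> B" if "i < N" for i
    using cubeN_bounded[OF c'[OF that], of R] by metis
  then obtain B' where B': "\<And>i. i < N \<Longrightarrow> B' i > 0" "\<And>i t x. i < N \<Longrightarrow> t \<in> {0..T} \<Longrightarrow> x \<in> cubeN N R \<Longrightarrow> \<bar>pderiv i (f i t) x\<bar> \<le> B' i" by metis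
  define c where "c = sum B' {..<N} + 1"
  have "B' i \<le> sum B' {..<N}" if "i < N" for i using that B'(1) by (intro member_le_sum) (auto intro: less_imp_le)
  hence fc: "\<bar>pderiv i (f i t) x\<bar> \<le> c" if "i < N" "t \<in> {0..T}" "x \<in> cubeN N R" for i t x
    using order_trans[OF B'(2)[OF that], of "sum B' {..<N}"] that(1) unfolding c_def by simp
  have c: "c > 0" unfolding c_def using B'(1) by (intro add_nonneg_pos sum_nonneg) (auto intro: less_imp_le)
  have "euler_scheme N T C R c f (\<lambda>i t x. pderiv i (f i t) x)"
  proof
    fix i t x assume i: "i < N" and t: "t \<in> {0..T}" and x: "x \<in> RN N"
    have "Ckb N (Suc (Suc 0)) (f i t)" using co[OF i] t unfolding coeff_regular_def numeral_2_eq_2 by blast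
    hence "(\<lambda>s. f i t (x(i := s))) differentiable (at (x i))" using i x by (auto simp: has_partials_def)
    thus "((\<lambda>s. f i t (x(i := s))) has_real_derivative pderiv i (f i t) x) (at (x i))"
      unfolding pderiv_def by (simp add: DERIV_deriv_iff_real_differentiable)
  next
    show "i < N \<Longrightarrow> continuous_on ({0..T} \<times> RN N) (\<lambda>(t, x). f i t x)" for i using co[of i] by (simp add: coeff_regular_def)
  qed (use T C R c c' fC fc in auto)
  with R(2) that show thesis by blast
qed

context euler_scheme
begin

lemma substep_joint:
  assumes i: "i < N" and t: "t \<in> {0..T}" and q [measurable]: "q \<in> borel_measurable (M \<Otimes>\<^sub>M leb)"
  shows "(\<lambda>v. substep \<tau> t i (\<lambda>x. q (fst v, x)) (snd v)) \<in> borel_measurable (M \<Otimes>\<^sub>M leb)"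
proof -
  note [measurable] = f_measurable[OF i t] shift_measurable[OF i t]
  show ?thesis unfolding substep_def by measurable
qed

lemma substeps_joint:
  assumes t: "t \<in> {0..T}" and q: "q \<in> borel_measurable (M \<Otimes>\<^sub>M leb)" and i: "i \<le> N"
  shows "(\<lambda>v. substeps \<tau> t i (\<lambda>x. q (fst v, x)) (snd v)) \<in> borel_measurable (M \<Otimes>\<^sub>M leb)"
  using i
proof (induction i)
  case 0
  then show ?case using q by simp
next
  case (Suc i)
  hence "(\<lambda>v. substeps \<tau> t i (\<lambda>x. q (fst v, x)) (snd v)) \<in> borel_measurable (M \<Otimes>\<^sub>M leb)" "i < N" by auto
  from substep_joint[OF this(2) t this(1), of \<tau>] show ?case by simp
qed

lemma evol_joint:
  assumes \<tau>: "\<tau> > 0" and q: "q \<in> borel_measurable (M \<Otimes>\<^sub>M leb)" and k: "real k * \<tau> \<le> T"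
  shows "(\<lambda>v. evol \<tau> (\<lambda>x. q (fst v, x)) k (snd v)) \<in> borel_measurable (M \<Otimes>\<^sub>M leb)"
  using k
proof (induction k)
  case 0
  then show ?case using q by simp
next
  case (Suc k)
  hence kT: "real k * \<tau> \<le> T" using \<tau> by (simp add: algebra_simps)
  have t: "real k * \<tau> \<in> {0..T}" using kT \<tau> by simp
  from substeps_joint[OF t Suc.IH[OF kT] order_refl, of \<tau>] show ?case by simp
qed

text \<open>Shifts, products and indicators preserve measurability in a parameter, so measurable
  dependence of the initial density on the slice passes to the whole path.\<close>

lemma path_joint:
  assumes n: "n > 0" and q: "q \<in> borel_measurable (M \<Otimes>\<^sub>M leb)"
  shows "(\<lambda>v. path n (\<lambda>x. q (fst v, x)) (fst (snd v)) (snd (snd v))) \<in> borel_measurable (M \<Otimes>\<^sub>M PM)"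
  unfolding path_def pw_def
proof (rule borel_measurable_sum)
  fix k assume "k \<in> {..<n}"
  hence k: "k < n" by simp
  have "real (Suc k) * (T / n) \<le> real n * (T / n)" using k T_pos by (intro mult_right_mono) auto
  hence kT: "real (Suc k) * (T / n) \<le> T" using n by simp
  have E: "(\<lambda>v. evol (T / n) (\<lambda>x. q (fst v, x)) (Suc k) (snd v)) \<in> borel_measurable (M \<Otimes>\<^sub>M leb)"
    by (rule evol_joint[OF _ q kT]) (use T_pos n in simp)
  have "(\<lambda>v. (fst v, snd (snd v))) \<in> M \<Otimes>\<^sub>M PM \<rightarrow>\<^sub>M M \<Otimes>\<^sub>M leb" by measurable
  from measurable_compose[OF this E]
  have [measurable]: "(\<lambda>v. evol (T / n) (\<lambda>x. q (fst v, x)) (Suc k) (snd (snd v))) \<in> borel_measurable (M \<Otimes>\<^sub>M PM)"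
    by (simp del: evol.simps)
  have [measurable]: "(\<lambda>t. t) \<in> borel_measurable (lebT T)"
    unfolding lebT_def by (rule measurable_restrict_space1) simp
  show "(\<lambda>v. indicator {real k * (T / n)<..real (Suc k) * (T / n)} (fst (snd v)) *
     evol (T / n) (\<lambda>x. q (fst v, x)) (Suc k) (snd (snd v))) \<in> borel_measurable (M \<Otimes>\<^sub>M PM)"
    by measurable
qed

end

section \<open>Disintegration and the equation driven by one approximating field\<close>

context
  fixes \<gamma> :: "'h::{real_inner, complete_space, second_countable_topology} measure" and e :: "nat \<Rightarrow> 'h"
    and \<Psi> :: "nat \<Rightarrow> (nat \<Rightarrow> real) \<Rightarrow> 'h \<Rightarrow> real" and N :: nat
  assumes \<gamma>: "finite_measure \<gamma>" "sets \<gamma> = sets borel" and on: "orthonormal_basis e" and dd: "disint_density \<gamma> e \<Psi>"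
begin

abbreviation "\<nu> \<equiv> nuN \<gamma> e N"

lemma sets_nu [simp, measurable_cong]: "sets \<nu> = sets borel" by (simp add: nuN_def)

lemma space_nu [simp]: "space \<nu> = UNIV" by (simp add: nuN_def)

lemma space_gamma: "space \<gamma> = UNIV" using sets_eq_imp_space_eq[OF \<gamma>(2)] by simp

lemma finite_nu: "finite_measure \<nu>"
proof -
  interpret finite_measure \<gamma> by (rule \<gamma>(1))
  have "projE e N \<in> \<gamma> \<rightarrow>\<^sub>M borel" by (subst measurable_cong_sets[OF \<gamma>(2) refl]) (rule projE_measurable)
  thus ?thesis unfolding nuN_def by (rule finite_measure_distr)
qed

lemma AE_nu_EN: "AE y in \<nu>. y \<in> EN e N"
proof -
  have "projE e N \<in> \<gamma> \<rightarrow>\<^sub>M borel" by (subst measurable_cong_sets[OF \<gamma>(2) refl]) (rule projE_measurable)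
  moreover have "{y \<in> space borel. y \<in> EN e N} \<in> sets borel" unfolding EN_def by measurable
  ultimately show ?thesis unfolding nuN_def by (subst AE_distr_iff) (auto simp: projE_EN[OF on])
qed

lemma Psi_measurable:
  shows "(\<lambda>v. \<Psi> N (snd v) (fst v)) \<in> borel_measurable (borel \<Otimes>\<^sub>M lebN N)"
    and "(\<lambda>x. \<Psi> N x y) \<in> borel_measurable (lebN N)"
    and "(\<lambda>z. \<Psi> N (coordN e N z) (projE e N z)) \<in> borel_measurable borel"
proof -
  have m: "(\<lambda>(x, y). \<Psi> N x y) \<in> borel_measurable (lebN N \<Otimes>\<^sub>M borel)" using dd unfolding disint_density_def by blast
  have "(\<lambda>v. (snd v, fst v)) \<in> borel \<Otimes>\<^sub>M lebN N \<rightarrow>\<^sub>M lebN N \<Otimes>\<^sub>M borel" by measurable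
  from measurable_compose[OF this m] show "(\<lambda>v. \<Psi> N (snd v) (fst v)) \<in> borel_measurable (borel \<Otimes>\<^sub>M lebN N)" by simp
  have "(\<lambda>x. (x, y)) \<in> lebN N \<rightarrow>\<^sub>M lebN N \<Otimes>\<^sub>M borel" by measurable
  from measurable_compose[OF this m] show "(\<lambda>x. \<Psi> N x y) \<in> borel_measurable (lebN N)" by simp
  have "(\<lambda>z. (coordN e N z, projE e N z)) \<in> borel \<rightarrow>\<^sub>M lebN N \<Otimes>\<^sub>M borel" by measurable
  from measurable_compose[OF this m] show "(\<lambda>z. \<Psi> N (coordN e N z) (projE e N z)) \<in> borel_measurable borel" by simp
qed

text \<open>As an image measure the disintegration serves nonnegative and signed integrals
  alike.\<close>

lemma gamma_distr:
  "\<gamma> = distr (density (\<nu> \<Otimes>\<^sub>M lebN N) (\<lambda>v. ennreal ((\<Psi> N (snd v) (fst v))\<^sup>2))) borel (\<lambda>v. embN e N (snd v) + fst v)"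
  (is "\<gamma> = ?R")
proof (rule measure_eqI)
  interpret leb: sigma_finite_measure "lebN N" by (rule sigma_finite_lebN)
  note [measurable] = Psi_measurable(1)
  show "sets \<gamma> = sets ?R" using \<gamma>(2) by simp
  fix A assume "A \<in> sets \<gamma>"
  hence A [measurable]: "A \<in> sets borel" using \<gamma>(2) by simp
  have am [measurable]: "(\<lambda>v. embN e N (snd v) + fst v) \<in> borel_measurable (\<nu> \<Otimes>\<^sub>M lebN N)" by measurable
  have "emeasure ?R A = (\<integral>\<^sup>+v. indicator A v \<partial>?R)" by (simp add: nn_integral_indicator)
  also have "\<dots> = (\<integral>\<^sup>+v. indicator A (embN e N (snd v) + fst v) * ennreal ((\<Psi> N (snd v) (fst v))\<^sup>2) \<partial>(\<nu> \<Otimes>\<^sub>M lebN N))"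
    by (subst nn_integral_distr, measurable, subst nn_integral_density) (auto simp: mult.commute)
  also have "\<dots> = (\<integral>\<^sup>+y. (\<integral>\<^sup>+x. indicator A (embN e N x + y) * ennreal ((\<Psi> N x y)\<^sup>2) \<partial>lebN N) \<partial>\<nu>)"
    by (subst leb.nn_integral_fst[symmetric]) auto
  also have "\<dots> = emeasure \<gamma> A"
  proof -
    have "\<forall>A\<in>sets borel. emeasure \<gamma> A = (\<integral>\<^sup>+ y. (\<integral>\<^sup>+ x. indicator A (embN e N x + y) * ennreal ((\<Psi> N x y)\<^sup>2) \<partial>lebN N) \<partial>\<nu>)"
      using dd unfolding disint_density_def by blast
    thus ?thesis using A by simp
  qed
  finally show "emeasure \<gamma> A = emeasure ?R A" by simp
qed

lemma nn_integral_gamma: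
  assumes [measurable]: "h \<in> borel_measurable borel"
  shows "(\<integral>\<^sup>+z. h z \<partial>\<gamma>) = (\<integral>\<^sup>+y. (\<integral>\<^sup>+x. h (embN e N x + y) * ennreal ((\<Psi> N x y)\<^sup>2) \<partial>lebN N) \<partial>\<nu>)"
proof -
  interpret leb: sigma_finite_measure "lebN N" by (rule sigma_finite_lebN)
  note [measurable] = Psi_measurable(1)
  have "(\<integral>\<^sup>+z. h z \<partial>\<gamma>) = (\<integral>\<^sup>+v. h (embN e N (snd v) + fst v) * ennreal ((\<Psi> N (snd v) (fst v))\<^sup>2) \<partial>(\<nu> \<Otimes>\<^sub>M lebN N))"
    by (subst gamma_distr, subst nn_integral_distr, measurable, subst nn_integral_density) (auto simp: mult.commute)
  also have "\<dots> = (\<integral>\<^sup>+y. (\<integral>\<^sup>+x. h (embN e N x + y) * ennreal ((\<Psi> N x y)\<^sup>2) \<partial>lebN N) \<partial>\<nu>)"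
    by (subst leb.nn_integral_fst[symmetric]) auto
  finally show ?thesis .
qed

lemma integral_gamma:
  fixes h :: "'h \<Rightarrow> real"
  assumes [measurable]: "h \<in> borel_measurable borel"
  shows "(\<integral>z. h z \<partial>\<gamma>) = (\<integral>v. h (embN e N (snd v) + fst v) * (\<Psi> N (snd v) (fst v))\<^sup>2 \<partial>(\<nu> \<Otimes>\<^sub>M lebN N))"
proof -
  note [measurable] = Psi_measurable(1)
  show ?thesis
    by (subst gamma_distr, subst integral_distr, measurable, subst integral_density) (auto simp: mult.commute)
qed

text \<open>Time is placed inside the slice variable, so that a slice integral is an integral over
  the space-time measure of the scheme; exchanging time and \<open>y\<close> is Tonelli's
  theorem.\<close>

lemma lebT_gamma_distr:
  "lebT T \<Otimes>\<^sub>M \<gamma> = distr (density (\<nu> \<Otimes>\<^sub>M (lebT T \<Otimes>\<^sub>M lebN N)) (\<lambda>v. ennreal ((\<Psi> N (snd (snd v)) (fst v))\<^sup>2)))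
     (lebT T \<Otimes>\<^sub>M borel) (\<lambda>v. (fst (snd v), embN e N (snd (snd v)) + fst v))" (is "_ = ?R")
proof (rule measure_eqI)
  interpret leb: sigma_finite_measure "lebN N" by (rule sigma_finite_lebN)
  interpret nu: finite_measure \<nu> by (rule finite_nu)
  interpret ga: finite_measure \<gamma> by (rule \<gamma>(1))
  interpret lT: finite_measure "lebT T" by (rule finite_measure_lebT)
  interpret P1: pair_sigma_finite "lebT T" "\<nu>" ..
  interpret P2: pair_sigma_finite "lebT T" "lebN N" ..
  note [measurable_cong] = \<gamma>(2)
  have [measurable]: "(\<lambda>v. \<Psi> N (snd (snd v)) (fst v)) \<in> borel_measurable (borel \<Otimes>\<^sub>M (lebT T \<Otimes>\<^sub>M lebN N))"
  proof -
    have "(\<lambda>v. (fst v, snd (snd v))) \<in> borel \<Otimes>\<^sub>M (lebT T \<Otimes>\<^sub>M lebN N) \<rightarrow>\<^sub>M borel \<Otimes>\<^sub>M lebN N" by measurable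
    from measurable_compose[OF this Psi_measurable(1)] show ?thesis by simp
  qed
  have [measurable]: "(\<lambda>v. \<Psi> N (snd v) (snd (fst v))) \<in> borel_measurable ((lebT T \<Otimes>\<^sub>M borel) \<Otimes>\<^sub>M lebN N)"
  proof -
    have "(\<lambda>v. (snd (fst v), snd v)) \<in> (lebT T \<Otimes>\<^sub>M borel) \<Otimes>\<^sub>M lebN N \<rightarrow>\<^sub>M borel \<Otimes>\<^sub>M lebN N" by measurable
    from measurable_compose[OF this Psi_measurable(1)] show ?thesis by simp
  qed
  show s: "sets (lebT T \<Otimes>\<^sub>M \<gamma>) = sets ?R" using \<gamma>(2) by (simp cong: sets_pair_measure_cong)
  fix A assume "A \<in> sets (lebT T \<Otimes>\<^sub>M \<gamma>)"
  hence A [measurable]: "A \<in> sets (lebT T \<Otimes>\<^sub>M borel)" using s by simp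
  have "emeasure ?R A = (\<integral>\<^sup>+v. indicator A v \<partial>?R)" by (simp add: nn_integral_indicator)
  also have "\<dots> = (\<integral>\<^sup>+v. indicator A (fst (snd v), embN e N (snd (snd v)) + fst v) * ennreal ((\<Psi> N (snd (snd v)) (fst v))\<^sup>2) \<partial>(\<nu> \<Otimes>\<^sub>M (lebT T \<Otimes>\<^sub>M lebN N)))"
    by (subst nn_integral_distr, measurable, subst nn_integral_density) (auto simp: mult.commute)
  also have "\<dots> = (\<integral>\<^sup>+y. (\<integral>\<^sup>+z. indicator A (fst z, embN e N (snd z) + y) * ennreal ((\<Psi> N (snd z) y)\<^sup>2) \<partial>(lebT T \<Otimes>\<^sub>M lebN N)) \<partial>\<nu>)"
    by (subst P2.nn_integral_fst[symmetric]) auto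
  also have "\<dots> = (\<integral>\<^sup>+y. (\<integral>\<^sup>+t. (\<integral>\<^sup>+x. indicator A (t, embN e N x + y) * ennreal ((\<Psi> N x y)\<^sup>2) \<partial>lebN N) \<partial>lebT T) \<partial>\<nu>)"
  proof (intro nn_integral_cong)
    fix y :: 'h
    have [measurable]: "(\<lambda>z. \<Psi> N (snd z) y) \<in> borel_measurable (lebT T \<Otimes>\<^sub>M lebN N)"
      by (rule measurable_compose[OF measurable_snd Psi_measurable(2)])
    have "(\<lambda>z. indicator A (fst z, embN e N (snd z) + y) * ennreal ((\<Psi> N (snd z) y)\<^sup>2)) \<in> borel_measurable (lebT T \<Otimes>\<^sub>M lebN N)"
      by measurable
    from leb.nn_integral_fst[OF this]
    show "(\<integral>\<^sup>+z. indicator A (fst z, embN e N (snd z) + y) * ennreal ((\<Psi> N (snd z) y)\<^sup>2) \<partial>(lebT T \<Otimes>\<^sub>M lebN N)) =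
      (\<integral>\<^sup>+t. (\<integral>\<^sup>+x. indicator A (t, embN e N x + y) * ennreal ((\<Psi> N x y)\<^sup>2) \<partial>lebN N) \<partial>lebT T)" by simp
  qed
  also have "\<dots> = (\<integral>\<^sup>+t. (\<integral>\<^sup>+y. (\<integral>\<^sup>+x. indicator A (t, embN e N x + y) * ennreal ((\<Psi> N x y)\<^sup>2) \<partial>lebN N) \<partial>\<nu>) \<partial>lebT T)"
    by (rule P1.Fubini') measurable
  also have "\<dots> = (\<integral>\<^sup>+t. (\<integral>\<^sup>+z. indicator A (t, z) \<partial>\<gamma>) \<partial>lebT T)"
    by (intro nn_integral_cong, subst nn_integral_gamma) auto
  also have "\<dots> = emeasure (lebT T \<Otimes>\<^sub>M \<gamma>) A"
    by (subst ga.nn_integral_fst) (auto simp: nn_integral_indicator)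
  finally show "emeasure (lebT T \<Otimes>\<^sub>M \<gamma>) A = emeasure ?R A" by simp
qed

text \<open>On \<open>A\<close> the slice density is bounded by the square of \<open>K\<close> and
  sits in a cube, as the scheme requires. The entropy bound is independent of \<open>K\<close>, so
  the cut-off can be released later. Its last summand pays for the points outside the cube of the
  scheme, where the density is 0 and \<open>hfun\<close> is 1.\<close>

lemma approx_solution:
  fixes f :: "nat \<Rightarrow> real \<Rightarrow> (nat \<Rightarrow> real) \<Rightarrow> real" and K :: nat
  assumes T: "T > 0" and \<delta>: "\<delta> > 0" and \<eta>: "mollifier N (\<eta> N)"
    and co: "\<And>i. i < N \<Longrightarrow> coeff_regular T N (f i)"
    and \<rho>m [measurable]: "\<rho>0 \<in> borel_measurable borel" and \<rho>0: "\<And>z. \<rho>0 z \<ge> 0"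
    and ent: "(\<integral>\<^sup>+z. ennreal (\<rho>0 z * ln (\<rho>0 z)) \<partial>\<gamma>) < \<infinity>"
    and cost: "\<And>M l y. M \<ge> 1 \<Longrightarrow> l \<ge> 1 \<Longrightarrow> (\<integral>\<^sup>+t. (\<integral>\<^sup>+x. ennreal ((exp (\<delta> * max 0 (- (\<Sum>i<N. pderiv i (f i t) x +
          f i t x * qdiv (pderiv i (\<lambda>x'. PsiSq \<Psi> \<eta> N M l x' y) x) (PsiSq \<Psi> \<eta> N M l x y)))) - 1)
             * PsiSq \<Psi> \<eta> N M l x y) \<partial>lebN N) \<partial>lebT T) \<le> c0 y"
    and c0: "(\<integral>\<^sup>+y. c0 y \<partial>\<nu>) \<le> C0" and C0: "C0 < \<infinity>"
  defines "A \<equiv> {z. \<rho>0 z \<le> real K \<and> (\<Psi> N (coordN e N z) (projE e N z))\<^sup>2 \<le> real K \<and> coordN e N z \<in> cubeN N (real K)}"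
  obtains \<rho> :: "real \<times> 'h \<Rightarrow> real" where "\<rho> \<in> borel_measurable (lebT T \<Otimes>\<^sub>M borel)" "\<And>v. \<rho> v \<ge> 0"
    "\<And>h D g g'. cyl h D \<Longrightarrow> (\<And>t. t \<in> {0..T} \<Longrightarrow> (g has_real_derivative g' t) (at t within {0..T})) \<Longrightarrow>
       continuous_on {0..T} g' \<Longrightarrow> g T = 0 \<Longrightarrow>
       (\<integral>v. (g' (fst v) * h (snd v) + g (fst v) * inner (D (snd v)) (\<Sum>i<N. f i (fst v) (coordN e N (snd v)) *\<^sub>R e i)) * \<rho> v \<partial>(lebT T \<Otimes>\<^sub>M \<gamma>))
         = - g 0 * (\<integral>z. h z * (\<rho>0 z * indicator A z) \<partial>\<gamma>)"
    "(\<integral>\<^sup>+v. ennreal (hfun (\<rho> v)) \<partial>(lebT T \<Otimes>\<^sub>M \<gamma>)) \<le>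
       ennreal (T * exp (2 * T / \<delta>)) * ((\<integral>\<^sup>+z. ennreal (\<rho>0 z * ln (\<rho>0 z)) \<partial>\<gamma>) + emeasure \<gamma> UNIV + C0 * ennreal (1 / \<delta>))
       + ennreal T * emeasure \<gamma> UNIV"
proof -
  obtain C R c where ES: "euler_scheme N T C R c f (\<lambda>i t x. pderiv i (f i t) x)" and R: "real K + real N * (C * T) \<le> R"
    using coeff_scheme[where f=f and K="real K", OF T co] by auto
  interpret euler_scheme N T C R c f "\<lambda>i t x. pderiv i (f i t) x" by (rule ES)
  interpret leb: sigma_finite_measure leb by (rule sigma_finite_lebN)
  interpret nu: finite_measure \<nu> by (rule finite_nu)
  interpret PMs: pair_sigma_finite "lebT T" leb by (rule pair_sigma_finite_PM)
  interpret NP: pair_sigma_finite \<nu> PM ..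
  interpret NL: pair_sigma_finite \<nu> leb ..
  let ?NP = "\<nu> \<Otimes>\<^sub>M PM"
  have nuf: "emeasure \<nu> UNIV < \<infinity>" using nu.emeasure_finite[of UNIV] by (simp only: less_top infinity_ennreal_def not_False_eq_True)
  have "0 \<le> real N * (C * T)" using C_pos T by simp
  with R have KR: "real K \<le> R" by linarith
  note [measurable_cong] = \<gamma>(2)
  note Pm1 [measurable] = Psi_measurable(1) and Pm2 [measurable] = Psi_measurable(2) and Pm3 [measurable] = Psi_measurable(3)
  have Pm4 [measurable]: "(\<lambda>v. \<Psi> N (snd (snd v)) (fst v)) \<in> borel_measurable (borel \<Otimes>\<^sub>M PM)"
  proof -
    have "(\<lambda>v. (fst v, snd (snd v))) \<in> borel \<Otimes>\<^sub>M PM \<rightarrow>\<^sub>M borel \<Otimes>\<^sub>M leb" by measurable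
    from measurable_compose[OF this Pm1] show ?thesis by simp
  qed
  have Pm5 [measurable]: "(\<lambda>z. \<Psi> N (snd z) y) \<in> borel_measurable PM" for y
    by (rule measurable_compose[OF measurable_snd Pm2])
  \<comment> \<open>The slice density with respect to Lebesgue measure, hence with the factor
    \<open>\<Psi>\<close>^2; both factors are cut at \<open>K\<close>.\<close>
  define p0 where "p0 v = (if snd v \<in> cubeN N (real K) \<and> \<rho>0 (embN e N (snd v) + fst v) \<le> real K \<and> (\<Psi> N (snd v) (fst v))\<^sup>2 \<le> real K
     then \<rho>0 (embN e N (snd v) + fst v) * (\<Psi> N (snd v) (fst v))\<^sup>2 else 0)" for v
  have p0m [measurable]: "p0 \<in> borel_measurable (borel \<Otimes>\<^sub>M leb)"
    unfolding p0_def by measurable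
  have p0b: "0 \<le> p0 v" "p0 v \<le> real K * real K" "p0 v \<noteq> 0 \<Longrightarrow> snd v \<in> cubeN N (real K)" for v
    using \<rho>0 by (auto simp: p0_def intro!: mult_mono split: if_splits)
  define my where "my y = (\<integral>x. p0 (y, x) \<partial>leb)" for y
  have p0y: "(\<lambda>x. p0 (y, x)) \<in> borel_measurable leb" for y
    using measurable_Pair2[OF p0m, of y] by simp
  have p0d: "dens N (real K) (real K * real K) (my y) (\<lambda>x. p0 (y, x))" for y
    unfolding dens_def using p0b[of "(y, _)"] p0y my_def by auto
  obtain n0 :: nat where n0: "n0 > 0" "2 * T * c \<le> real n0"
  proof -
    obtain n where "2 * T * c \<le> real n" using real_arch_simple by blast
    thus thesis by (intro that[of "Suc n"]) auto
  qed
  define F where "F k v = path (n0 + k) (\<lambda>x. p0 (fst v, x)) (fst (snd v)) (snd (snd v))" for k v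
  have Fm: "F k \<in> borel_measurable ?NP" for k
    unfolding F_def using n0 by (intro path_joint) (auto simp: p0m)
  define bd where "bd = real K * real K * exp (c * T * real N)"
  have bd0: "bd \<ge> 0" by (simp add: bd_def)
  have Fb: "0 \<le> F k v \<and> F k v \<le> bd \<and> (snd (snd v) \<notin> cubeN N R \<longrightarrow> F k v = 0)" if "v \<in> space ?NP" for k v
    unfolding F_def bd_def using that n0
    by (intro path_bounds(2)[OF p0d R]) (auto simp: space_pair_measure)
  define BB where "BB = space \<nu> \<times> (space (lebT T) \<times> cubeN N R)"
  have Bm [measurable]: "BB \<in> sets ?NP" unfolding BB_def by (intro pair_measureI sets.top sets_cubeN)
  have Bfin: "emeasure ?NP BB < \<infinity>"
  proof -
    have "emeasure ?NP BB = emeasure \<nu> (space \<nu>) * emeasure PM (space (lebT T) \<times> cubeN N R)"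
      unfolding BB_def by (intro PMs.emeasure_pair_measure_Times sets.top pair_measureI sets_cubeN)
    also have "emeasure PM (space (lebT T) \<times> cubeN N R) = emeasure (lebT T) (space (lebT T)) * emeasure leb (cubeN N R)"
      by (intro leb.emeasure_pair_measure_Times sets.top sets_cubeN)
    finally show ?thesis
      using emeasure_lebT[of T] T emeasure_cubeN[of N R] nuf by (simp add: ennreal_mult_less_top)
  qed
  have Bind: "indicator BB v = (icube N R (snd (snd v)) :: real)" "indicator BB v = (icube N R (snd (snd v)) :: ennreal)" if "v \<in> space ?NP" for v
    using that by (auto simp: BB_def space_pair_measure indicator_def)
  \<comment> \<open>The convergence theorem needs a finite measure. Restriction to this set loses
    nothing, because all approximations vanish outside it.\<close>
  let ?M = "density ?NP (indicator BB)"
  interpret M: finite_measure ?M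
  proof (rule finite_measureI)
    have "emeasure ?M (space ?NP) = emeasure ?NP (BB \<inter> space ?NP)" by (rule emeasure_restricted[OF Bm sets.top])
    also have "\<dots> = emeasure ?NP BB" by (simp only: sets.Int_space_eq2[OF Bm])
    finally show "emeasure ?M (space ?M) \<noteq> \<infinity>" using Bfin by simp
  qed
  have FM: "F k \<in> borel_measurable ?M" for k using Fm by simp
  have Fint: "(\<integral>\<^sup>+v. ennreal (F k v) \<partial>?M) \<le> ennreal bd * emeasure ?NP BB" for k
  proof -
    have "(\<integral>\<^sup>+v. ennreal (F k v) \<partial>?M) = (\<integral>\<^sup>+v. indicator BB v * ennreal (F k v) \<partial>?NP)"
      using Fm by (subst nn_integral_density) auto
    also have "\<dots> \<le> (\<integral>\<^sup>+v. ennreal bd * indicator BB v \<partial>?NP)"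
      using Fb by (intro nn_integral_mono) (auto simp: indicator_def intro!: ennreal_leI)
    also have "\<dots> = ennreal bd * emeasure ?NP BB" by (rule nn_integral_cmult_indicator) measurable
    finally show ?thesis .
  qed
  obtain gk G where gk: "\<And>n. gk n \<in> midconv F n" and GM: "G \<in> borel_measurable ?M" and G0: "\<And>v. G v \<ge> 0"
    and glim: "AE v in ?M. (\<lambda>n. gk n v) \<longlonglongrightarrow> G v"
  proof (rule M.komlos_midconv[of F, OF FM _ Fint])
    show "ennreal bd * emeasure ?NP BB < \<infinity>" using Bfin by (simp add: ennreal_mult_less_top)
    show "F k v \<ge> 0" if "v \<in> space ?M" for k v using Fb[of v k] that by simp
  qed (rule that)
  have Gm [measurable]: "G \<in> borel_measurable ?NP" using GM by simp
  \<comment> \<open>\<open>G\<close> is the limit on \<open>BB\<close> only; the indicator extends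
    it by 0, the value of all combinations off the cube.\<close>
  define P where "P v = icube N R (snd (snd v)) * G v" for v
  have Pm [measurable]: "P \<in> borel_measurable ?NP" unfolding P_def by measurable
  have P0: "P v \<ge> 0" for v using G0 by (simp add: P_def)
  have gF: "(0 \<le> u v \<and> u v \<le> bd) \<and> (snd (snd v) \<notin> cubeN N R \<longrightarrow> u v = 0)" if "u \<in> midconv F n" "v \<in> space ?NP" for u n v
    using that(1)
  proof induction
    case (base k)
    then show ?case using Fb[OF that(2), of k] by auto
  next
    case (mid u u')
    then show ?case by auto
  qed
  have glim': "AE v in ?NP. (\<lambda>n. gk n v) \<longlonglongrightarrow> P v"
  proof -
    have "AE v in ?NP. 0 < (indicator BB v :: ennreal) \<longrightarrow> (\<lambda>n. gk n v) \<longlonglongrightarrow> G v"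
      using glim by (subst (asm) AE_density) auto
    thus ?thesis using AE_space
    proof eventually_elim
      case (elim v)
      show ?case
      proof (cases "snd (snd v) \<in> cubeN N R")
        case True
        thus ?thesis using elim Bind(2)[OF elim(2)] by (simp add: P_def)
      next
        case False
        hence "gk n v = 0" for n using gF[OF gk elim(2)] by blast
        thus ?thesis using False by (simp add: P_def)
      qed
    qed
  qed
  have AEy: "AE y in \<nu>. AE z in PM. (\<lambda>n. gk n (y, z)) \<longlonglongrightarrow> P (y, z)"
    using NP.AE_pair[OF glim'] .
  \<comment> \<open>Taking midpoints commutes with taking sections, so the joint sequence restricts
    to combinations of the scheme of each slice.\<close>
  have sec: "(\<lambda>z. u (y, z)) \<in> midconv (\<lambda>k z. path (n0 + k) (\<lambda>x. p0 (y, x)) (fst z) (snd z)) n" if "u \<in> midconv F n" for u y n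
    using that
  proof induction
    case (base k)
    have "(\<lambda>z. F k (y, z)) = (\<lambda>z. path (n0 + k) (\<lambda>x. p0 (y, x)) (fst z) (snd z))" by (simp add: F_def)
    then show ?case using midconv.base[OF base, of "\<lambda>k z. path (n0 + k) (\<lambda>x. p0 (y, x)) (fst z) (snd z)"] by simp
  next
    case (mid u v)
    then show ?case by (intro midconv.mid)
  qed
  have Pym [measurable]: "(\<lambda>z. P (y, z)) \<in> borel_measurable PM" for y
    using measurable_Pair2[OF Pm, of y] by simp
  define Q where "Q y = (\<integral>\<^sup>+x. ennreal ((max 0 (\<rho>0 (embN e N x + y) * ln (\<rho>0 (embN e N x + y))) + 1) * (\<Psi> N x y)\<^sup>2) \<partial>leb)" for y
  define a where "a = T * exp (2 * T / \<delta>)"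
  have a0: "a > 0" using T by (simp add: a_def)
  have slices: "AE y in \<nu>. y \<in> EN e N \<and>
      (\<integral>\<^sup>+z. icube N R (snd z) * entL (P (y, z)) ((\<Psi> N (snd z) y)\<^sup>2) \<partial>PM) \<le> ennreal a * (Q y + c0 y * ennreal (1 / \<delta>)) \<and>
      (\<forall>\<phi> \<phi>' g g'. C1N N \<phi> \<phi>' \<longrightarrow> (\<forall>t\<in>{0..T}. (g has_real_derivative g' t) (at t within {0..T})) \<longrightarrow> continuous_on {0..T} g' \<longrightarrow> g T = 0 \<longrightarrow>
        (\<integral>z. (g' (fst z) * \<phi> (snd z) + g (fst z) * (\<Sum>i<N. f i (fst z) (snd z) * \<phi>' i (snd z))) * P (y, z) \<partial>PM) = - g 0 * (\<integral>x. \<phi> x * p0 (y, x) \<partial>leb))"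
    using AEy AE_nu_EN
  proof eventually_elim
    case (elim y)
    note H = p0d[of y] R n0 sec[OF gk, of _ y] Pym[of y] P0 elim(1)
    have S: "(\<integral>\<^sup>+z. icube N R (snd z) * ennreal (w (snd z) * hfun (P (y, z) / w (snd z))) \<partial>PM)
     \<le> ennreal (T * (exp (2 * T / \<delta>) * (relent w (\<lambda>x. p0 (y, x)) + (\<integral>z. ecost w w' \<delta> (fst z) (snd z) * icube N R (snd z) \<partial>PM) / \<delta>)))"
      if "C1N N w w'" "\<And>x. x \<in> RN N \<Longrightarrow> w x > 0" for w w'
      by (rule slice_entropy[where K="real K" and b="real K * real K" and m="my y" and p="\<lambda>x. p0 (y, x)" and ?n0.0=n0 and G="\<lambda>n z. gk n (y, z)" and P="\<lambda>z. P (y, z)", OF H that \<delta>])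
    have "(\<integral>\<^sup>+z. icube N R (snd z) * entL (P (y, z)) ((\<Psi> N (snd z) y)\<^sup>2) \<partial>PM)
       \<le> ennreal (T * exp (2 * T / \<delta>)) * ((\<integral>\<^sup>+x. ennreal ((max 0 (\<rho>0 (embN e N x + y) * ln (\<rho>0 (embN e N x + y))) + 1) * (\<Psi> N x y)\<^sup>2) \<partial>leb) + c0 y * ennreal (1 / \<delta>))"
    proof (rule slice_psi[OF S \<delta> Pym P0 dens_mono[OF p0d KR order_refl] \<eta> Pm2 cost])
      show "(\<lambda>x. \<rho>0 (embN e N x + y)) \<in> borel_measurable leb" by measurable
      show "p0 (y, x) = \<rho>0 (embN e N x + y) * (\<Psi> N x y)\<^sup>2 \<and> (\<Psi> N x y)\<^sup>2 \<le> real K" if "p0 (y, x) \<noteq> 0" for x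
        using that by (auto simp: p0_def split: if_splits)
    qed (auto simp: \<rho>0)
    moreover have "(\<integral>z. (g' (fst z) * \<phi> (snd z) + g (fst z) * (\<Sum>i<N. f i (fst z) (snd z) * \<phi>' i (snd z))) * P (y, z) \<partial>PM) = - g 0 * (\<integral>x. \<phi> x * p0 (y, x) \<partial>leb)"
      if "C1N N \<phi> \<phi>'" "\<forall>t\<in>{0..T}. (g has_real_derivative g' t) (at t within {0..T})" "continuous_on {0..T} g'" "g T = 0" for \<phi> \<phi>' g g'
    proof -
      note gD = that(2)
      have gd: "(g has_real_derivative g' t) (at t within {0..T})" if t: "t \<in> {0..T}" for t using gD t by blast
      show ?thesis by (rule slice_weak[where K="real K" and b="real K * real K" and m="my y" and p="\<lambda>x. p0 (y, x)" and ?n0.0=n0 and G="\<lambda>n z. gk n (y, z)" and P="\<lambda>z. P (y, z)", OF H that(1) gd that(3,4)])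
    qed
    ultimately show ?case using elim(2) unfolding Q_def a_def by blast
  qed
  interpret ga: finite_measure \<gamma> by (rule \<gamma>(1))
  define \<kappa> where "\<kappa> = ennreal (a / \<delta>)"
  define Em where "Em = (\<integral>\<^sup>+z. ennreal (\<rho>0 z * ln (\<rho>0 z)) \<partial>\<gamma>) + emeasure \<gamma> UNIV"
  have Qm [measurable]: "Q \<in> borel_measurable borel" unfolding Q_def by measurable
  have Qint: "(\<integral>\<^sup>+y. Q y \<partial>\<nu>) = Em"
  proof -
    have "(\<integral>\<^sup>+y. Q y \<partial>\<nu>) = (\<integral>\<^sup>+z. ennreal (max 0 (\<rho>0 z * ln (\<rho>0 z)) + 1) \<partial>\<gamma>)"
      unfolding Q_def by (subst nn_integral_gamma) (auto simp: ennreal_mult' intro!: nn_integral_cong)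
    also have "\<dots> = (\<integral>\<^sup>+z. ennreal (\<rho>0 z * ln (\<rho>0 z)) + 1 \<partial>\<gamma>)"
      by (intro nn_integral_cong) (auto simp: max_def ennreal_neg simp flip: ennreal_plus ennreal_1)
    also have "\<dots> = Em" unfolding Em_def using space_gamma by (subst nn_integral_add) auto
    finally show ?thesis .
  qed
  have Emf: "Em < \<infinity>" unfolding Em_def using ent ga.emeasure_finite[of UNIV] by (simp add: less_top[symmetric])
  have entLm [measurable]: "(\<lambda>v. icube N R (snd (snd v)) * entL (P v) ((\<Psi> N (snd (snd v)) (fst v))\<^sup>2)) \<in> borel_measurable ?NP"
    by measurable
  define X where "X y = (\<integral>\<^sup>+z. icube N R (snd z) * entL (P (y, z)) ((\<Psi> N (snd z) y)\<^sup>2) \<partial>PM)" for y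
  have Xm [measurable]: "X \<in> borel_measurable borel"
    using PMs.borel_measurable_nn_integral_fst[OF entLm] unfolding X_def by (simp add: measurable_cong_sets[OF sets_nu refl])
  have Xint: "(\<integral>\<^sup>+y. X y \<partial>\<nu>) \<le> ennreal a * Em + \<kappa> * C0"
  proof -
    have "(\<integral>\<^sup>+y. ennreal a * Q y \<partial>\<nu>) = ennreal a * Em" using Qint by (simp add: nn_integral_cmult)
    hence "(\<integral>\<^sup>+y. ennreal a * Q y \<partial>\<nu>) \<noteq> \<infinity>" using Emf by (simp add: ennreal_mult_eq_top_iff)
    hence "AE y in \<nu>. ennreal a * Q y \<noteq> \<infinity>" by (intro nn_integral_PInf_AE) auto
    \<comment> \<open>No measurability of \<open>c0\<close> is available, so the integral of the sum
      cannot be split. The inequality is solved for \<open>c0\<close>: the left side is measurable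
      and its integral is at most that of \<open>c0\<close>.\<close>
    hence le: "AE y in \<nu>. ennreal (\<delta> / a) * (X y - ennreal a * Q y) \<le> c0 y"
      using slices
    proof eventually_elim
      case (elim y)
      have "X y \<le> ennreal a * (Q y + c0 y * ennreal (1 / \<delta>))" using elim(2) unfolding X_def by blast
      also have "\<dots> = ennreal a * Q y + \<kappa> * c0 y"
      proof -
        have "ennreal a * ennreal (1 / \<delta>) = \<kappa>" unfolding \<kappa>_def using a0 \<delta> by (subst ennreal_mult[symmetric]) auto
        thus ?thesis by (metis distrib_left mult.assoc mult.commute)
      qed
      finally have "X y - ennreal a * Q y \<le> \<kappa> * c0 y" using elim(1) by (simp add: ennreal_minus_le_iff)
      hence "ennreal (\<delta> / a) * (X y - ennreal a * Q y) \<le> ennreal (\<delta> / a) * (\<kappa> * c0 y)" by (rule mult_left_mono) simp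
      also have "\<dots> = c0 y"
      proof -
        have "ennreal (\<delta> / a) * \<kappa> = 1" unfolding \<kappa>_def using a0 \<delta> by (subst ennreal_mult[symmetric]) auto
        thus ?thesis by (metis mult.assoc mult_1)
      qed
      finally show ?case .
    qed
    \<comment> \<open>With truncated subtraction this holds pointwise, and both summands on the
      right are measurable.\<close>
    have "(\<integral>\<^sup>+y. X y \<partial>\<nu>) \<le> (\<integral>\<^sup>+y. ennreal a * Q y + (X y - ennreal a * Q y) \<partial>\<nu>)"
      by (intro nn_integral_mono) (metis add_diff_inverse_ennreal diff_add_cancel_ennreal le_cases add.commute le_add2 add_increasing2 zero_le)
    also have "\<dots> = ennreal a * Em + (\<integral>\<^sup>+y. X y - ennreal a * Q y \<partial>\<nu>)"
      using Qint by (subst nn_integral_add) (auto simp: nn_integral_cmult)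
    also have "(\<integral>\<^sup>+y. X y - ennreal a * Q y \<partial>\<nu>) = (\<integral>\<^sup>+y. \<kappa> * (ennreal (\<delta> / a) * (X y - ennreal a * Q y)) \<partial>\<nu>)"
    proof -
      have "\<kappa> * ennreal (\<delta> / a) = 1" unfolding \<kappa>_def using a0 \<delta> by (subst ennreal_mult[symmetric]) auto
      thus ?thesis by (intro nn_integral_cong) (metis mult.assoc mult_1)
    qed
    also have "\<dots> = \<kappa> * (\<integral>\<^sup>+y. ennreal (\<delta> / a) * (X y - ennreal a * Q y) \<partial>\<nu>)" by (rule nn_integral_cmult) measurable
    also have "(\<integral>\<^sup>+y. ennreal (\<delta> / a) * (X y - ennreal a * Q y) \<partial>\<nu>) \<le> C0"
      using nn_integral_mono_AE[OF le] c0 by (rule order_trans)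
    finally show ?thesis by (simp add: mult_left_mono add_left_mono)
  qed
  have "ennreal a * Em + \<kappa> * C0 < \<infinity>" using Emf C0 by (simp add: \<kappa>_def ennreal_mult_less_top)
  hence "(\<integral>\<^sup>+y. X y \<partial>\<nu>) \<noteq> \<infinity>" using Xint by (auto simp: top_unique)
  hence Xfin: "AE y in \<nu>. X y \<noteq> \<infinity>" by (intro nn_integral_PInf_AE) auto
  \<comment> \<open>For almost every slice the extended entropy is finite almost everywhere, which
    excludes a positive density where the weight is 0.\<close>
  have Pzero: "AE v in ?NP. (\<Psi> N (snd (snd v)) (fst v))\<^sup>2 = 0 \<longrightarrow> P v = 0"
  proof (rule NP.AE_pair_measure)
    show "{v \<in> space ?NP. (\<Psi> N (snd (snd v)) (fst v))\<^sup>2 = 0 \<longrightarrow> P v = 0} \<in> sets ?NP" by measurable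
    show "AE y in \<nu>. AE z in PM. (\<Psi> N (snd (snd (y, z))) (fst (y, z)))\<^sup>2 = 0 \<longrightarrow> P (y, z) = 0"
      using Xfin
    proof eventually_elim
      case (elim y)
      have m: "(\<lambda>z. icube N R (snd z) * entL (P (y, z)) ((\<Psi> N (snd z) y)\<^sup>2)) \<in> borel_measurable PM" by measurable
      have "AE z in PM. icube N R (snd z) * entL (P (y, z)) ((\<Psi> N (snd z) y)\<^sup>2) \<noteq> \<infinity>"
        by (rule nn_integral_PInf_AE[OF m]) (use elim in \<open>simp add: X_def\<close>)
      thus ?case by eventually_elim (auto simp: entL_def P_def indicator_def split: if_splits)
    qed
  qed
  have EN_NP: "AE v in ?NP. fst v \<in> EN e N"
  proof (rule NP.AE_pair_measure)
    have "{y. y \<in> EN e N} \<in> sets borel" unfolding EN_def by measurable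
    hence [measurable]: "EN e N \<in> sets borel" by simp
    show "{v \<in> space ?NP. fst v \<in> EN e N} \<in> sets ?NP" by measurable
    show "AE y in \<nu>. AE z in PM. fst (y, z) \<in> EN e N" using AE_nu_EN by eventually_elim auto
  qed
  have Pbd: "AE v in ?NP. P v \<le> bd"
    using glim' AE_space
  proof eventually_elim
    case (elim v)
    show ?case by (rule LIMSEQ_le_const2[OF elim(1)]) (use gF[OF gk elim(2)] in auto)
  qed
  let ?W = "\<lambda>v. (\<Psi> N (snd (snd v)) (fst v))\<^sup>2"
  \<comment> \<open>Coordinates and projection invert the splitting of \<open>H\<close>; dividing by
    the weight passes from Lebesgue measure on slices to a density for \<gamma>.\<close>
  define \<rho> where "\<rho> v = (if (\<Psi> N (coordN e N (snd v)) (projE e N (snd v)))\<^sup>2 = 0 then 0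
     else P (projE e N (snd v), (fst v, coordN e N (snd v))) / (\<Psi> N (coordN e N (snd v)) (projE e N (snd v)))\<^sup>2)" for v
  have \<rho>meas [measurable]: "\<rho> \<in> borel_measurable (lebT T \<Otimes>\<^sub>M borel)"
  proof -
    have mm: "(\<lambda>v. (projE e N (snd v), (fst v, coordN e N (snd v)))) \<in> lebT T \<Otimes>\<^sub>M borel \<rightarrow>\<^sub>M ?NP" by measurable
    have [measurable]: "(\<lambda>v. P (projE e N (snd v), (fst v, coordN e N (snd v)))) \<in> borel_measurable (lebT T \<Otimes>\<^sub>M borel)"
      by (rule measurable_compose[OF mm Pm])
    have [measurable]: "(\<lambda>v. \<Psi> N (coordN e N (snd v)) (projE e N (snd v))) \<in> borel_measurable (lebT T \<Otimes>\<^sub>M borel)"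
      by (rule measurable_compose[OF measurable_snd Pm3])
    show ?thesis unfolding \<rho>_def by measurable
  qed
  have \<rho>nn: "\<rho> v \<ge> 0" for v using P0 by (simp add: \<rho>_def)
  let ?S = "\<lambda>v. (fst (snd v), embN e N (snd (snd v)) + fst v)"
  have Sm [measurable]: "?S \<in> ?NP \<rightarrow>\<^sub>M lebT T \<Otimes>\<^sub>M borel" by measurable
  have \<rho>S: "\<rho> (?S v) = (if ?W v = 0 then 0 else P v / ?W v)"
    if "v \<in> space ?NP" "fst v \<in> EN e N" for v
  proof -
    have "snd (snd v) \<in> RN N" using that by (auto simp: space_pair_measure)
    from coordN_embN[OF on this that(2)] projE_embN[OF on this that(2)] show ?thesis by (simp add: \<rho>_def)
  qed
  show thesis
  proof (rule that[OF \<rho>meas \<rho>nn])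
    fix h :: "'h \<Rightarrow> real" and D :: "'h \<Rightarrow> 'h" and g g' :: "real \<Rightarrow> real" assume cy: "cyl h D" and gd: "\<And>t. t \<in> {0..T} \<Longrightarrow> (g has_real_derivative g' t) (at t within {0..T})"
      and g'c: "continuous_on {0..T} g'" and gT: "g T = 0"
    have gc: "continuous_on {0..T} g" using gd by (intro DERIV_continuous_on) auto
    have mT: "u \<in> borel_measurable (lebT T)" if "continuous_on {0..T} u" for u :: "real \<Rightarrow> real"
      using borel_measurable_continuous_on_restrict[OF that] measurable_cong_sets[of "lebT T" "restrict_space borel {0..T}"]
      by (simp add: lebT_def sets_restrict_space)
    note [measurable] = mT[OF gc] mT[OF g'c]
    have hD [measurable]: "h \<in> borel_measurable borel" "D \<in> borel_measurable borel"
      using cy by (auto simp: cyl_def intro: borel_measurable_continuous_onI)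
    have [measurable]: "(\<lambda>v. f i (fst v) (coordN e N (snd v))) \<in> borel_measurable (lebT T \<Otimes>\<^sub>M borel)" if "i < N" for i
    proof -
      have "(\<lambda>v. (fst v, coordN e N (snd v))) \<in> lebT T \<Otimes>\<^sub>M borel \<rightarrow>\<^sub>M PM" by measurable
      from measurable_compose[OF this borel_measurable_lebT_lebN_continuous[OF f_cont[OF that]]] show ?thesis by simp
    qed
    define FF where "FF v = (\<Sum>i<N. f i (fst v) (coordN e N (snd v)) *\<^sub>R e i)" for v :: "real \<times> 'h"
    have [measurable]: "FF \<in> borel_measurable (lebT T \<Otimes>\<^sub>M borel)" unfolding FF_def
      by (intro borel_measurable_sum borel_measurable_scaleR) auto
    define V where "V v = g' (fst v) * h (snd v) + g (fst v) * inner (D (snd v)) (FF v)" for v :: "real \<times> 'h"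
    have Vm [measurable]: "V \<in> borel_measurable (lebT T \<Otimes>\<^sub>M borel)" unfolding V_def by measurable
    obtain Bg Bg' Bh BD where Bb: "\<And>t. t \<in> {0..T} \<Longrightarrow> \<bar>g t\<bar> \<le> Bg" "\<And>t. t \<in> {0..T} \<Longrightarrow> \<bar>g' t\<bar> \<le> Bg'"
      "\<And>z. \<bar>h z\<bar> \<le> Bh" "\<And>z. norm (D z) \<le> BD"
    proof -
      have "bounded (g ` {0..T})" "bounded (g' ` {0..T})" using gc g'c by (auto intro!: compact_imp_bounded compact_continuous_image)
      moreover have "bounded (range h)" "bounded (range D)" using cy by (auto simp: cyl_def)
      ultimately show thesis unfolding bounded_iff using that by (metis image_eqI rangeI real_norm_def)
    qed
    have FFb: "norm (FF v) \<le> real N * C" if "fst v \<in> {0..T}" for v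
    proof -
      have "norm (FF v) \<le> (\<Sum>i<N. norm (f i (fst v) (coordN e N (snd v)) *\<^sub>R e i))" unfolding FF_def by (rule norm_sum)
      also have "\<dots> \<le> (\<Sum>i<N. C)"
      proof (rule sum_mono)
        fix i assume "i \<in> {..<N}"
        hence i: "i < N" by simp
        have "norm (e i) = 1" using on by (simp add: orthonormal_basis_def norm_eq_sqrt_inner)
        thus "norm (f i (fst v) (coordN e N (snd v)) *\<^sub>R e i) \<le> C" using f_bound[OF i that, of "coordN e N (snd v)"] by (simp add: coordN_def)
      qed
      finally show ?thesis by simp
    qed
    define BV where "BV = Bg' * Bh + Bg * (BD * (real N * C))"
    have Vb: "\<bar>V v\<bar> \<le> BV" if t: "fst v \<in> {0..T}" for v
    proof -
      have "\<bar>g' (fst v) * h (snd v)\<bar> \<le> Bg' * Bh" unfolding abs_mult using Bb(2)[OF t] Bb(3)[of "snd v"] by (intro mult_mono) auto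
      moreover have "\<bar>inner (D (snd v)) (FF v)\<bar> \<le> BD * (real N * C)"
        using Bb(4)[of "snd v"] FFb[OF t] by (intro order_trans[OF Cauchy_Schwarz_ineq2] mult_mono) (auto intro: order_trans[OF norm_ge_zero])
      hence "\<bar>g (fst v) * inner (D (snd v)) (FF v)\<bar> \<le> Bg * (BD * (real N * C))"
        unfolding abs_mult using Bb(1)[OF t] by (intro mult_mono) auto
      ultimately show ?thesis unfolding V_def BV_def by linarith
    qed
    have VSm [measurable]: "(\<lambda>v. V (?S v)) \<in> borel_measurable ?NP" by (rule measurable_compose[OF Sm Vm])
    have iVP: "integrable ?NP (\<lambda>v. V (?S v) * P v)"
    proof (rule Bochner_Integration.integrable_bound[where f="\<lambda>v. (BV * bd) * indicator BB v"])
      show "integrable ?NP (\<lambda>v. (BV * bd) * indicator BB v)"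
        using Bfin Bm by (intro integrable_mult_right integrable_real_indicator)
      show "AE v in ?NP. norm (V (?S v) * P v) \<le> norm (BV * bd * indicator BB v)"
        using Pbd AE_space
      proof eventually_elim
        case (elim v)
        have t: "fst (?S v) \<in> {0..T}" using elim by (auto simp: space_pair_measure)
        show ?case
        proof (cases "snd (snd v) \<in> cubeN N R")
          case True
          have "\<bar>V (?S v)\<bar> * \<bar>P v\<bar> \<le> BV * bd" using Vb[OF t] elim(1) P0[of v] by (intro mult_mono) auto
          also have "\<dots> \<le> \<bar>BV * bd\<bar>" by simp
          finally show ?thesis using True Bind(1)[OF elim(2)] by (simp add: abs_mult)
        qed (simp add: P_def)
      qed
    qed measurable
    have "(\<integral>v. V v * \<rho> v \<partial>(lebT T \<Otimes>\<^sub>M \<gamma>)) = (\<integral>v. V (?S v) * \<rho> (?S v) * ?W v \<partial>?NP)"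
      by (subst lebT_gamma_distr, subst integral_distr, measurable, subst integral_density) (auto simp: mult_ac)
    also have "\<dots> = (\<integral>v. V (?S v) * P v \<partial>?NP)"
    proof (rule integral_cong_AE)
      show "AE v in ?NP. V (?S v) * \<rho> (?S v) * ?W v = V (?S v) * P v"
        using Pzero EN_NP AE_space by eventually_elim (auto simp: \<rho>S)
      show "(\<lambda>v. V (?S v) * \<rho> (?S v) * ?W v) \<in> borel_measurable ?NP"
        using measurable_compose[OF Sm \<rho>meas] by measurable
    qed measurable
    also have "\<dots> = (\<integral>y. (\<integral>z. V (?S (y, z)) * P (y, z) \<partial>PM) \<partial>\<nu>)"
      by (rule NP.integral_fst'[OF iVP, symmetric])
    also have "\<dots> = (\<integral>y. - g 0 * (\<integral>x. h (embN e N x + y) * p0 (y, x) \<partial>leb) \<partial>\<nu>)"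
    proof (rule integral_cong_AE)
      show "(\<lambda>y. \<integral>z. V (?S (y, z)) * P (y, z) \<partial>PM) \<in> borel_measurable \<nu>"
        using NP.integrable_fst'[OF iVP] by (rule borel_measurable_integrable)
      show "(\<lambda>y. - g 0 * (\<integral>x. h (embN e N x + y) * p0 (y, x) \<partial>leb)) \<in> borel_measurable \<nu>"
        by measurable
      show "AE y in \<nu>. (\<integral>z. V (?S (y, z)) * P (y, z) \<partial>PM) = - g 0 * (\<integral>x. h (embN e N x + y) * p0 (y, x) \<partial>leb)"
        using slices
      proof eventually_elim
        case (elim y)
        hence y: "y \<in> EN e N" by blast
        have "(\<integral>z. V (?S (y, z)) * P (y, z) \<partial>PM) = (\<integral>z. (g' (fst z) * h (embN e N (snd z) + y) + g (fst z) * (\<Sum>i<N. f i (fst z) (snd z) * inner (D (embN e N (snd z) + y)) (e i))) * P (y, z) \<partial>PM)"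
        proof (intro Bochner_Integration.integral_cong refl)
          fix z assume "z \<in> space PM"
          hence "snd z \<in> RN N" by (auto simp: space_pair_measure)
          from coordN_embN[OF on this y]
          show "V (?S (y, z)) * P (y, z) = (g' (fst z) * h (embN e N (snd z) + y) + g (fst z) * (\<Sum>i<N. f i (fst z) (snd z) * inner (D (embN e N (snd z) + y)) (e i))) * P (y, z)"
            by (simp add: V_def FF_def inner_sum_right)
        qed
        also have "\<dots> = - g 0 * (\<integral>x. h (embN e N x + y) * p0 (y, x) \<partial>leb)"
          using elim cyl_slice[OF on cy, of N y] gd g'c gT by blast
        finally show ?case .
      qed
    qed
    also have "\<dots> = - g 0 * (\<integral>y. (\<integral>x. h (embN e N x + y) * p0 (y, x) \<partial>leb) \<partial>\<nu>)" by simp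
    also have "(\<integral>y. (\<integral>x. h (embN e N x + y) * p0 (y, x) \<partial>leb) \<partial>\<nu>) = (\<integral>v. h (embN e N (snd v) + fst v) * p0 v \<partial>(\<nu> \<Otimes>\<^sub>M leb))"
    proof -
      have "integrable (\<nu> \<Otimes>\<^sub>M leb) (\<lambda>v. h (embN e N (snd v) + fst v) * p0 v)"
      proof (rule Bochner_Integration.integrable_bound[where f="\<lambda>v. (Bh * (real K * real K)) * indicator (space \<nu> \<times> cubeN N (real K)) v"])
        have "emeasure (\<nu> \<Otimes>\<^sub>M leb) (space \<nu> \<times> cubeN N (real K)) = emeasure \<nu> (space \<nu>) * emeasure leb (cubeN N (real K))"
          by (intro leb.emeasure_pair_measure_Times sets.top sets_cubeN)
        also have "\<dots> < \<infinity>" using emeasure_cubeN[of N "real K"] nuf by (simp add: ennreal_mult_less_top)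
        finally show "integrable (\<nu> \<Otimes>\<^sub>M leb) (\<lambda>v. (Bh * (real K * real K)) * indicator (space \<nu> \<times> cubeN N (real K)) v)"
          by (intro integrable_mult_right integrable_real_indicator pair_measureI sets.top sets_cubeN)
        show "(\<lambda>v. h (embN e N (snd v) + fst v) * p0 v) \<in> borel_measurable (\<nu> \<Otimes>\<^sub>M leb)" by measurable
        show "AE v in \<nu> \<Otimes>\<^sub>M leb. norm (h (embN e N (snd v) + fst v) * p0 v) \<le> norm (Bh * (real K * real K) * indicator (space \<nu> \<times> cubeN N (real K)) v)"
        proof (rule AE_I2)
          fix v
          show "norm (h (embN e N (snd v) + fst v) * p0 v) \<le> norm (Bh * (real K * real K) * indicator (space \<nu> \<times> cubeN N (real K)) v)"
          proof (cases "p0 v = 0")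
            case False
            have "v \<in> space \<nu> \<times> cubeN N (real K)" using p0b(3)[OF False] by (cases v) auto
            moreover have "\<bar>h (embN e N (snd v) + fst v)\<bar> * \<bar>p0 v\<bar> \<le> Bh * (real K * real K)"
              using Bb(3)[of "embN e N (snd v) + fst v"] p0b(1,2)[of v] by (intro mult_mono) auto
            moreover have "\<dots> \<le> \<bar>Bh\<bar> * (real K * real K)" by (intro mult_right_mono) auto
            ultimately show ?thesis by (simp add: abs_mult)
          qed simp
        qed
      qed
      from NL.integral_fst'[OF this] show ?thesis by simp
    qed
    also have "\<dots> = (\<integral>v. h (embN e N (snd v) + fst v) * (\<rho>0 (embN e N (snd v) + fst v) * indicator A (embN e N (snd v) + fst v)) * (\<Psi> N (snd v) (fst v))\<^sup>2 \<partial>(\<nu> \<Otimes>\<^sub>M leb))"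
    proof (rule integral_cong_AE)
      have Am [measurable]: "A \<in> sets borel" unfolding A_def by measurable
      show "(\<lambda>v. h (embN e N (snd v) + fst v) * (\<rho>0 (embN e N (snd v) + fst v) * indicator A (embN e N (snd v) + fst v)) * (\<Psi> N (snd v) (fst v))\<^sup>2) \<in> borel_measurable (\<nu> \<Otimes>\<^sub>M leb)"
        by measurable
      have "AE v in \<nu> \<Otimes>\<^sub>M leb. fst v \<in> EN e N"
      proof (rule NL.AE_pair_measure)
        have "{y. y \<in> EN e N} \<in> sets borel" unfolding EN_def by measurable
        hence [measurable]: "EN e N \<in> sets borel" by simp
        show "{v \<in> space (\<nu> \<Otimes>\<^sub>M leb). fst v \<in> EN e N} \<in> sets (\<nu> \<Otimes>\<^sub>M leb)" by measurable
        show "AE y in \<nu>. AE z in leb. fst (y, z) \<in> EN e N" using AE_nu_EN by eventually_elim auto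
      qed
      thus "AE v in \<nu> \<Otimes>\<^sub>M leb. h (embN e N (snd v) + fst v) * p0 v = h (embN e N (snd v) + fst v) * (\<rho>0 (embN e N (snd v) + fst v) * indicator A (embN e N (snd v) + fst v)) * (\<Psi> N (snd v) (fst v))\<^sup>2"
        using AE_space
      proof eventually_elim
        case (elim v)
        hence "snd v \<in> RN N" by (auto simp: space_pair_measure)
        from coordN_embN[OF on this elim(1)] projE_embN[OF on this elim(1)] show ?case
          by (auto simp: p0_def A_def indicator_def)
      qed
    qed measurable
    also have "\<dots> = (\<integral>z. h z * (\<rho>0 z * indicator A z) \<partial>\<gamma>)"
    proof -
      have [measurable]: "A \<in> sets borel" unfolding A_def by measurable
      show ?thesis by (rule integral_gamma[symmetric]) measurable
    qed
    finally show "(\<integral>v. (g' (fst v) * h (snd v) + g (fst v) * inner (D (snd v)) (\<Sum>i<N. f i (fst v) (coordN e N (snd v)) *\<^sub>R e i)) * \<rho> v \<partial>(lebT T \<Otimes>\<^sub>M \<gamma>))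
         = - g 0 * (\<integral>z. h z * (\<rho>0 z * indicator A z) \<partial>\<gamma>)"
      unfolding V_def FF_def .
  next
    \<comment> \<open>The second summand covers the points off the cube: there the density is 0 and
      \<open>hfun 0 = 1\<close> leaves the bare weight.\<close>
    have hS: "ennreal (hfun (\<rho> (?S v))) * ennreal (?W v)
       \<le> icube N R (snd (snd v)) * entL (P v) (?W v) + ennreal (?W v)"
      if v: "v \<in> space ?NP" "fst v \<in> EN e N" for v
    proof (cases "?W v = 0")
      case False
      let ?w = "?W v"
      have "ennreal (hfun (\<rho> (?S v))) * ennreal ?w = ennreal (?w * hfun (P v / ?w))"
        unfolding \<rho>S[OF v] using False hfun_nonneg[of "P v / ?w"] P0[of v] by (simp add: ennreal_mult mult.commute)
      thus ?thesis using False by (cases "snd (snd v) \<in> cubeN N R") (auto simp: entL_def P_def)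
    qed simp
    have "(\<integral>\<^sup>+v. ennreal (hfun (\<rho> v)) \<partial>(lebT T \<Otimes>\<^sub>M \<gamma>)) = (\<integral>\<^sup>+v. ennreal (hfun (\<rho> (?S v))) * ennreal (?W v) \<partial>?NP)"
      by (subst lebT_gamma_distr, subst nn_integral_distr, measurable, subst nn_integral_density) (auto simp: mult_ac)
    also have "\<dots> \<le> (\<integral>\<^sup>+v. icube N R (snd (snd v)) * entL (P v) (?W v) + ennreal (?W v) \<partial>?NP)"
    proof (rule nn_integral_mono_AE)
      show "AE v in ?NP. ennreal (hfun (\<rho> (?S v))) * ennreal (?W v)
       \<le> icube N R (snd (snd v)) * entL (P v) (?W v) + ennreal (?W v)"
        using EN_NP AE_space by eventually_elim (rule hS)
    qed
    also have "\<dots> = (\<integral>\<^sup>+v. icube N R (snd (snd v)) * entL (P v) (?W v) \<partial>?NP) + (\<integral>\<^sup>+v. ennreal (?W v) \<partial>?NP)"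
      by (rule nn_integral_add) measurable
    also have "(\<integral>\<^sup>+v. icube N R (snd (snd v)) * entL (P v) (?W v) \<partial>?NP) = (\<integral>\<^sup>+y. X y \<partial>\<nu>)"
      unfolding X_def by (subst PMs.nn_integral_fst[symmetric]) (auto intro: entLm)
    also have "(\<integral>\<^sup>+v. ennreal (?W v) \<partial>?NP) = emeasure (lebT T \<Otimes>\<^sub>M \<gamma>) (space (lebT T \<Otimes>\<^sub>M \<gamma>))"
    proof -
      have "emeasure (lebT T \<Otimes>\<^sub>M \<gamma>) (space (lebT T \<Otimes>\<^sub>M \<gamma>)) = (\<integral>\<^sup>+v. 1 \<partial>(lebT T \<Otimes>\<^sub>M \<gamma>))" by simp
      also have "\<dots> = (\<integral>\<^sup>+v. ennreal (?W v) \<partial>?NP)"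
        by (subst lebT_gamma_distr, subst nn_integral_distr, measurable, subst nn_integral_density) auto
      finally show ?thesis by simp
    qed
    also have "\<dots> = ennreal T * emeasure \<gamma> UNIV"
      using ga.emeasure_pair_measure_Times[OF sets.top[of "lebT T"] sets.top[of \<gamma>]] emeasure_lebT[of T] T space_gamma
      by (simp add: space_pair_measure)
    also have "(\<integral>\<^sup>+y. X y \<partial>\<nu>) \<le> ennreal a * Em + \<kappa> * C0" by (rule Xint)
    also have "\<dots> = ennreal a * (Em + C0 * ennreal (1 / \<delta>))"
    proof -
      have "ennreal a * ennreal (1 / \<delta>) = \<kappa>" unfolding \<kappa>_def using a0 \<delta> by (subst ennreal_mult[symmetric]) auto
      thus ?thesis by (metis distrib_left mult.assoc mult.commute)
    qed
    finally show "(\<integral>\<^sup>+v. ennreal (hfun (\<rho> v)) \<partial>(lebT T \<Otimes>\<^sub>M \<gamma>)) \<le>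
       ennreal (T * exp (2 * T / \<delta>)) * ((\<integral>\<^sup>+z. ennreal (\<rho>0 z * ln (\<rho>0 z)) \<partial>\<gamma>) + emeasure \<gamma> UNIV + C0 * ennreal (1 / \<delta>))
       + ennreal T * emeasure \<gamma> UNIV"
      unfolding Em_def a_def by (simp add: add_right_mono)
  qed
qed

end

section \<open>The chain rule for cylinder functions\<close>

lemma MVT_abs:
  fixes u :: "real \<Rightarrow> real"
  assumes "\<And>s. (u has_real_derivative u' s) (at s)"
  obtains \<xi> where "\<bar>\<xi> - a\<bar> \<le> \<bar>b - a\<bar>" "u b - u a = (b - a) * u' \<xi>"
proof (cases a b rule: linorder_cases)
  case less
  from MVT2[OF this, of u u'] assms obtain z where "a < z" "z < b" "u b - u a = (b - a) * u' z" by auto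
  thus thesis by (intro that[of z]) auto
next
  case equal
  thus thesis by (intro that[of a]) auto
next
  case greater
  from MVT2[OF this, of u u'] assms obtain z where "b < z" "z < a" "u a - u b = (a - b) * u' z" by auto
  thus thesis by (intro that[of z]) (auto simp: algebra_simps)
qed

text \<open>Continuous partial derivatives give directional ones. The increment runs along a
  staircase that changes one coordinate at a time; each stair is a mean value, and the intermediate
  points tend to \<open>x\<close>.\<close>

lemma C1N_line_derivative:
  assumes \<phi>: "C1N N \<phi> \<phi>'" and x: "x \<in> RN N"
  shows "((\<lambda>s. \<phi> (restrict (\<lambda>i. x i + s * v i) {..<N})) has_real_derivative (\<Sum>i<N. v i * \<phi>' i x)) (at 0)"
proof -
  define p where "p k s = restrict (\<lambda>i. if i < k then x i + s * v i else x i) {..<N}" for k s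
  have pR: "p k s \<in> RN N" for k s by (simp add: p_def)
  have p0: "p 0 s = x" for s using x by (simp add: p_def restrict_RN_id)
  have pN: "p N s = restrict (\<lambda>i. x i + s * v i) {..<N}" for s by (auto simp: p_def restrict_def)
  have pS: "p (Suc k) s = (p k s)(k := x k + s * v k)" if "k < N" for k s
    using that by (auto simp: p_def restrict_def less_Suc_eq)
  have pk: "p k s = (p k s)(k := x k)" if "k < N" for k s
    using that by (auto simp: p_def restrict_def)
  have "(\<lambda>n. (\<phi> (p N (s n)) - \<phi> x) / s n) \<longlonglongrightarrow> (\<Sum>i<N. v i * \<phi>' i x)"
    if s: "\<And>n. s n \<noteq> 0" "s \<longlonglongrightarrow> 0" for s :: "nat \<Rightarrow> real"
  proof -
    have "(\<lambda>n. (\<phi> (p (Suc k) (s n)) - \<phi> (p k (s n))) / s n) \<longlonglongrightarrow> v k * \<phi>' k x" if k: "k < N" for k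
    proof -
      have "\<exists>\<xi>. \<bar>\<xi> - x k\<bar> \<le> \<bar>s n * v k\<bar> \<and> \<phi> (p (Suc k) (s n)) - \<phi> (p k (s n)) = (s n * v k) * \<phi>' k ((p k (s n))(k := \<xi>))" for n
      proof -
        obtain \<xi> where "\<bar>\<xi> - x k\<bar> \<le> \<bar>(x k + s n * v k) - x k\<bar>"
          "\<phi> ((p k (s n))(k := x k + s n * v k)) - \<phi> ((p k (s n))(k := x k)) = ((x k + s n * v k) - x k) * \<phi>' k ((p k (s n))(k := \<xi>))"
          by (rule MVT_abs[of "\<lambda>r. \<phi> ((p k (s n))(k := r))" "\<lambda>r. \<phi>' k ((p k (s n))(k := r))", OF C1N_D(3)[OF \<phi> k pR]])
        thus ?thesis using pS[OF k, of "s n"] pk[OF k, of "s n"] by (intro exI[of _ \<xi>]) simp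
      qed
      then obtain \<xi> where \<xi>: "\<And>n. \<bar>\<xi> n - x k\<bar> \<le> \<bar>s n * v k\<bar>"
        "\<And>n. \<phi> (p (Suc k) (s n)) - \<phi> (p k (s n)) = (s n * v k) * \<phi>' k ((p k (s n))(k := \<xi> n))" by metis
      have sv: "(\<lambda>n. s n * c) \<longlonglongrightarrow> 0" for c using tendsto_mult_right[OF s(2), of c] by simp
      have "(\<lambda>n. \<bar>s n * v k\<bar>) \<longlonglongrightarrow> 0" using tendsto_rabs[OF sv, of "v k"] by simp
      hence "(\<lambda>n. \<xi> n - x k) \<longlonglongrightarrow> 0" by (rule Lim_null_comparison[rotated]) (use \<xi>(1) in auto)
      hence \<xi>l: "\<xi> \<longlonglongrightarrow> x k" by (simp add: LIM_zero_iff)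
      have "(\<lambda>n. \<phi>' k ((p k (s n))(k := \<xi> n))) \<longlonglongrightarrow> \<phi>' k x"
      proof (rule continuous_on_RN_sequentially[OF C1N_D(2)[OF \<phi> k] _ x])
        show "(p k (s n))(k := \<xi> n) \<in> RN N" for n using pR k by simp
        show "(\<lambda>n. (p k (s n))(k := \<xi> n)) \<longlonglongrightarrow> x"
        proof (rule tendsto_RN[OF _ x])
          show "(p k (s n))(k := \<xi> n) \<in> RN N" for n using pR k by simp
          fix i assume i: "i < N"
          have "(\<lambda>n. x i + s n * v i) \<longlonglongrightarrow> x i" using tendsto_add[OF tendsto_const sv] by simp
          thus "(\<lambda>n. ((p k (s n))(k := \<xi> n)) i) \<longlonglongrightarrow> x i" using i \<xi>l by (cases "i = k"; cases "i < k") (simp_all add: p_def)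
        qed
      qed
      hence "(\<lambda>n. v k * \<phi>' k ((p k (s n))(k := \<xi> n))) \<longlonglongrightarrow> v k * \<phi>' k x" by (rule tendsto_mult_left)
      thus ?thesis using s(1) \<xi>(2) by simp
    qed
    hence "(\<lambda>n. \<Sum>k<N. (\<phi> (p (Suc k) (s n)) - \<phi> (p k (s n))) / s n) \<longlonglongrightarrow> (\<Sum>i<N. v i * \<phi>' i x)"
      by (intro tendsto_sum) auto
    moreover have "(\<Sum>k<N. (\<phi> (p (Suc k) (s n)) - \<phi> (p k (s n))) / s n) = (\<phi> (p N (s n)) - \<phi> x) / s n" for n
      unfolding sum_divide_distrib[symmetric] sum_lessThan_telescope[of "\<lambda>k. \<phi> (p k (s n))"] p0 by simp
    ultimately show ?thesis by simp
  qed
  hence "((\<lambda>h. (\<phi> (p N h) - \<phi> x) / h) \<longlongrightarrow> (\<Sum>i<N. v i * \<phi>' i x)) (at 0)"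
    unfolding tendsto_at_iff_sequentially by (auto simp: o_def)
  moreover have "p N 0 = x" using x by (simp add: pN restrict_RN_id)
  ultimately show ?thesis unfolding DERIV_def pN[symmetric] by simp
qed

lemma FCb_cyl:
  assumes "f \<in> FCb Y 1"
  obtains D where "cyl f D"
proof -
  obtain N h g where g: "Ckb N (Suc 0) g" and f: "f = (\<lambda>x. g (restrict (\<lambda>i. inner (h i) x) {..<N}))"
    using assms by (auto simp: FCb_def)
  have C: "C1N N g (\<lambda>i. pderiv i g)" using g by (intro C1N_pderiv) auto
  let ?P = "\<lambda>x. restrict (\<lambda>i. inner (h i) x) {..<N}"
  have Pc: "continuous_on UNIV ?P"
  proof (rule continuous_on_coordinatewise_then_product)
    fix i show "continuous_on UNIV (\<lambda>x. ?P x i)" by (cases "i < N") (auto intro!: continuous_intros)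
  qed
  define D where "D x = (\<Sum>i<N. pderiv i g (?P x) *\<^sub>R h i)" for x
  have "cyl f D" unfolding cyl_def
  proof (intro conjI allI)
    show "continuous_on UNIV f" unfolding f using g by (intro continuous_on_compose2[OF _ Pc, of "RN N" g]) auto
    show "continuous_on UNIV D" unfolding D_def
      by (intro continuous_intros continuous_on_compose2[OF C1N_D(2)[OF C] Pc]) auto
    have "bounded (g ` RN N)" using g by simp
    thus "bounded (range f)" unfolding f by (rule bounded_subset) auto
    have "\<exists>B. \<forall>x\<in>RN N. \<bar>pderiv i g x\<bar> \<le> B" if "i < N" for i using g that by (auto simp: bounded_iff)
    then obtain B where B: "\<And>i x. i < N \<Longrightarrow> x \<in> RN N \<Longrightarrow> \<bar>pderiv i g x\<bar> \<le> B i" by metis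
    have "norm (D x) \<le> (\<Sum>i<N. B i * norm (h i))" for x unfolding D_def
      using B by (intro sum_norm_le) (auto intro!: mult_right_mono)
    thus "bounded (range D)" unfolding bounded_iff by blast
    fix x v
    have "?P (x + s *\<^sub>R v) = restrict (\<lambda>i. ?P x i + s * inner (h i) v) {..<N}" for s
      by (auto simp: inner_add_right restrict_def)
    thus "((\<lambda>s. f (x + s *\<^sub>R v)) has_real_derivative inner (D x) v) (at 0)"
      using C1N_line_derivative[OF C, of "?P x" "\<lambda>i. inner (h i) v"] by (simp add: f D_def inner_sum_left mult.commute)
  qed
  thus thesis by (rule that)
qed

section \<open>Compactness from entropy bounds\<close>

context finite_measure
begin

text \<open>Uniform integrability with an explicit rate. Young's inequality with exponent
  \<open>k\<close> gives \<open>k * (u - exp k) \<le> hfun u\<close>, as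
  \<open>exp k - 1 \<le> k * exp k\<close> for \<open>k \<ge> 1\<close>; exponent 1 already gives
  integrability.\<close>

lemma hfun_tail:
  assumes [measurable]: "u \<in> borel_measurable M" and u: "\<And>x. x \<in> space M \<Longrightarrow> u x \<ge> 0"
    and h: "(\<integral>\<^sup>+x. ennreal (hfun (u x)) \<partial>M) \<le> ennreal c" and c: "c \<ge> 0"
  shows "integrable M u" "k \<ge> 1 \<Longrightarrow> integrable M (\<lambda>x. max 0 (u x - exp k))"
    "k \<ge> 1 \<Longrightarrow> (\<integral>x. max 0 (u x - exp k) \<partial>M) \<le> c / k"
proof -
  have nn: "hfun (u x) \<ge> 0" if "x \<in> space M" for x using u[OF that] by (rule hfun_nonneg)
  have hi: "integrable M (\<lambda>x. hfun (u x))"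
    using h nn by (intro integrableI_nonneg) (auto simp: less_top[symmetric] top_unique intro: le_less_trans)
  have hc: "(\<integral>x. hfun (u x) \<partial>M) \<le> c"
    using h nn_integral_eq_integral[OF hi] nn c by (auto simp: AE_I2)
  show i: "integrable M u"
  proof (rule Bochner_Integration.integrable_bound[where f="\<lambda>x. hfun (u x) + (exp 1 - 1)"])
    show "integrable M (\<lambda>x. hfun (u x) + (exp 1 - 1))" using hi by (intro Bochner_Integration.integrable_add) auto
    show "AE x in M. norm (u x) \<le> norm (hfun (u x) + (exp 1 - 1))"
    proof (rule AE_I2)
      fix x assume x: "x \<in> space M"
      show "norm (u x) \<le> norm (hfun (u x) + (exp 1 - 1))" using hfun_young[OF u[OF x], of 1] u[OF x] by simp
    qed
  qed measurable
  assume k: "k \<ge> 1"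
  show i2: "integrable M (\<lambda>x. max 0 (u x - exp k))" using i by (intro integrable_max Bochner_Integration.integrable_diff) auto
  have "k * max 0 (u x - exp k) \<le> hfun (u x)" if x: "x \<in> space M" for x
  proof -
    have "k * (u x - exp k) \<le> hfun (u x)"
    proof -
      have "1 * exp k \<le> k * exp k" using k by (intro mult_right_mono) auto
      hence "exp k - 1 \<le> k * exp k" by linarith
      thus ?thesis using hfun_young[OF u[OF x], of k] unfolding right_diff_distrib mult.commute[of k "u x"] by linarith
    qed
    thus ?thesis using nn[OF x] by (simp add: max_def)
  qed
  hence "(\<integral>x. k * max 0 (u x - exp k) \<partial>M) \<le> (\<integral>x. hfun (u x) \<partial>M)"
    using i2 hi by (intro integral_mono) auto
  hence "k * (\<integral>x. max 0 (u x - exp k) \<partial>M) \<le> c" using hc by simp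
  thus "(\<integral>x. max 0 (u x - exp k) \<partial>M) \<le> c / k" using k by (simp add: field_simps)
qed

lemma tendsto_0_by_truncation:
  fixes w :: "nat \<Rightarrow> real"
  assumes "\<And>n. 0 \<le> w n" "\<And>k. k \<ge> 1 \<Longrightarrow> q k \<longlonglongrightarrow> 0" "\<And>k n. k \<ge> (1::real) \<Longrightarrow> w n \<le> q k n + a / k"
  shows "w \<longlonglongrightarrow> 0"
proof (rule metric_LIMSEQ_I)
  fix \<epsilon> :: real assume \<epsilon>: "\<epsilon> > 0"
  define k where "k = max 1 (2 * \<bar>a\<bar> / \<epsilon>)"
  have k: "k \<ge> 1" "2 * \<bar>a\<bar> / \<epsilon> \<le> k" by (auto simp: k_def)
  have ak: "a / k \<le> \<epsilon> / 2" using k \<epsilon> by (simp add: field_simps)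
  obtain n0 where n0: "\<And>n. n \<ge> n0 \<Longrightarrow> \<bar>q k n\<bar> < \<epsilon> / 2"
    using LIMSEQ_D[OF assms(2)[OF k(1)], of "\<epsilon> / 2"] \<epsilon> by auto
  have "\<bar>w n\<bar> < \<epsilon>" if "n \<ge> n0" for n
  proof -
    show ?thesis using n0[OF that] ak assms(1)[of n] assms(3)[OF k(1), of n] by linarith
  qed
  thus "\<exists>n0. \<forall>n\<ge>n0. dist (w n) 0 < \<epsilon>" by auto
qed

text \<open>The factors \<open>V j\<close> vary together with \<open>r j\<close>, and a convex
  combination of the \<open>r j\<close> alone does not see them. So \<open>V j\<close> is first
  replaced by its limit, at a cost that uniform integrability makes vanish. The functional is then
  the same for all indices and passes to combinations and to their limit.\<close>

lemma entropy_komlos: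
  assumes rm [measurable]: "\<And>j. r j \<in> borel_measurable M" and r: "\<And>j x. r j x \<ge> 0"
    and h: "\<And>j. (\<integral>\<^sup>+x. ennreal (hfun (r j x)) \<partial>M) \<le> ennreal c" and c: "c \<ge> 0"
  obtains \<rho> where "\<rho> \<in> borel_measurable M" "\<And>x. \<rho> x \<ge> 0" "(\<integral>\<^sup>+x. ennreal (hfun (\<rho> x)) \<partial>M) \<le> ennreal c"
    "\<And>V V' a B. B \<ge> 0 \<Longrightarrow> V' \<in> borel_measurable M \<Longrightarrow> (\<And>j. V j \<in> borel_measurable M) \<Longrightarrow>
      (\<And>j x. x \<in> space M \<Longrightarrow> \<bar>V j x\<bar> \<le> B) \<Longrightarrow> AE x in M. (\<lambda>j. V j x) \<longlonglongrightarrow> V' x \<Longrightarrow>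
      (\<lambda>j. \<integral>x. V j x * r j x \<partial>M) \<longlonglongrightarrow> a \<Longrightarrow> (\<integral>x. V' x * \<rho> x \<partial>M) = a"
proof -
  have ri: "integrable M (r j)" for j by (rule hfun_tail(1)[OF rm r h c])
  have rb: "(\<integral>\<^sup>+x. ennreal (r j x) \<partial>M) \<le> ennreal c + ennreal (exp 1 - 1) * emeasure M (space M)" for j
  proof -
    have "(\<integral>\<^sup>+x. ennreal (r j x) \<partial>M) \<le> (\<integral>\<^sup>+x. ennreal (hfun (r j x)) + ennreal (exp 1 - 1) \<partial>M)"
    proof (rule nn_integral_mono)
      fix x
      have "ennreal (r j x) \<le> ennreal (hfun (r j x) + (exp 1 - 1))"
        using hfun_young[OF r, of j x 1] by (intro ennreal_leI) simp
      thus "ennreal (r j x) \<le> ennreal (hfun (r j x)) + ennreal (exp 1 - 1)" using hfun_nonneg[OF r] by simp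
    qed
    also have "\<dots> = (\<integral>\<^sup>+x. ennreal (hfun (r j x)) \<partial>M) + ennreal (exp 1 - 1) * emeasure M (space M)"
      by (subst nn_integral_add) auto
    finally show ?thesis using add_right_mono[OF h[of j]] by (rule order_trans)
  qed
  obtain g \<rho> where g: "\<And>n. g n \<in> midconv r n" and \<rho>m [measurable]: "\<rho> \<in> borel_measurable M" and \<rho>0: "\<And>x. \<rho> x \<ge> 0"
    and lim: "AE x in M. (\<lambda>n. g n x) \<longlonglongrightarrow> \<rho> x"
  proof (rule komlos_midconv[of r, OF rm r rb])
    show "ennreal c + ennreal (exp 1 - 1) * emeasure M (space M) < \<infinity>"
      using emeasure_finite[of "space M"] by (simp add: ennreal_mult_less_top less_top infinity_ennreal_def del: emeasure_finite)
  qed (rule that)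
  have G: "u \<in> borel_measurable M" "\<And>x. x \<in> space M \<Longrightarrow> u x \<ge> 0" "(\<integral>\<^sup>+x. ennreal (hfun (u x)) \<partial>M) \<le> ennreal c"
    if "u \<in> midconv r n" for u n
    using nn_integral_midconv_le[OF that rm r, where \<Phi>="\<lambda>x. hfun" and C="ennreal c"] h hfun_nonneg hfun_midpoint by auto
  note gm [measurable] = G(1)[OF g] and g0 = G(2)[OF g]
  have \<rho>h: "(\<integral>\<^sup>+x. ennreal (hfun (\<rho> x)) \<partial>M) \<le> ennreal c"
  proof -
    have "AE x in M. ennreal (hfun (\<rho> x)) = liminf (\<lambda>n. ennreal (hfun (g n x)))"
      using lim AE_space
    proof eventually_elim
      case (elim x)
      have "(\<lambda>n. hfun (g n x)) \<longlonglongrightarrow> hfun (\<rho> x)"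
        using continuous_on_hfun elim(1) \<rho>0[of x] g0[OF elim(2)]
        by (auto simp: continuous_on_sequentially o_def)
      hence "(\<lambda>n. ennreal (hfun (g n x))) \<longlonglongrightarrow> ennreal (hfun (\<rho> x))" by (rule tendsto_ennrealI)
      thus ?case by (simp add: lim_imp_Liminf)
    qed
    hence "(\<integral>\<^sup>+x. ennreal (hfun (\<rho> x)) \<partial>M) = (\<integral>\<^sup>+x. liminf (\<lambda>n. ennreal (hfun (g n x))) \<partial>M)" by (rule nn_integral_cong_AE)
    also have "\<dots> \<le> liminf (\<lambda>n. \<integral>\<^sup>+x. ennreal (hfun (g n x)) \<partial>M)" by (rule nn_integral_liminf) measurable
    also have "\<dots> \<le> ennreal c"
      using Liminf_mono[of "\<lambda>n. \<integral>\<^sup>+x. ennreal (hfun (g n x)) \<partial>M" "\<lambda>_. ennreal c" sequentially] G(3)[OF g] by (simp add: Liminf_const)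
    finally show ?thesis .
  qed
  have gi: "integrable M u" if "u \<in> midconv r n" for u n by (rule hfun_tail(1)[OF G[OF that] c])
  have \<rho>i: "integrable M \<rho>" by (rule hfun_tail(1)[OF \<rho>m \<rho>0 \<rho>h c])
  \<comment> \<open>Almost everywhere convergence improves to the mean: below the level
    \<open>exp k\<close> by domination, above it by the tail estimate for both functions.\<close>
  have L1: "(\<lambda>n. \<integral>x. \<bar>g n x - \<rho> x\<bar> \<partial>M) \<longlonglongrightarrow> 0"
  proof (rule tendsto_0_by_truncation[where q="\<lambda>k n. \<integral>x. \<bar>min (g n x) (exp k) - min (\<rho> x) (exp k)\<bar> \<partial>M" and a="2 * c"])
    fix k :: real assume k: "k \<ge> 1"
    have lt: "(\<lambda>n. \<integral>x. \<bar>min (g n x) (exp k) - min (\<rho> x) (exp k)\<bar> \<partial>M) \<longlonglongrightarrow> (\<integral>x. 0 \<partial>M)"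
    proof (rule integral_dominated_convergence[where w="\<lambda>_. exp k"])
      show "AE x in M. (\<lambda>n. \<bar>min (g n x) (exp k) - min (\<rho> x) (exp k)\<bar>) \<longlonglongrightarrow> 0"
        using lim
      proof eventually_elim
        case (elim x)
        have "(\<lambda>n. \<bar>min (g n x) (exp k) - min (\<rho> x) (exp k)\<bar>) \<longlonglongrightarrow> \<bar>min (\<rho> x) (exp k) - min (\<rho> x) (exp k)\<bar>"
          by (intro tendsto_intros elim)
        thus ?case by simp
      qed
      show "AE x in M. norm \<bar>min (g n x) (exp k) - min (\<rho> x) (exp k)\<bar> \<le> exp k" for n
      proof (rule AE_I2)
        fix x assume x: "x \<in> space M"
        have "0 \<le> min (g n x) (exp k)" "min (g n x) (exp k) \<le> exp k" "0 \<le> min (\<rho> x) (exp k)" "min (\<rho> x) (exp k) \<le> exp k"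
          using g0[OF x] \<rho>0 by auto
        thus "norm \<bar>min (g n x) (exp k) - min (\<rho> x) (exp k)\<bar> \<le> exp k" unfolding real_norm_def by linarith
      qed
    qed auto
    thus "(\<lambda>n. \<integral>x. \<bar>min (g n x) (exp k) - min (\<rho> x) (exp k)\<bar> \<partial>M) \<longlonglongrightarrow> 0" by simp
    fix n
    have mi: "integrable M (\<lambda>x. \<bar>min (g n x) (exp k) - min (\<rho> x) (exp k)\<bar>)"
      using gi[OF g] \<rho>i by (intro integrable_abs Bochner_Integration.integrable_diff integrable_min) auto
    note tg = hfun_tail(2,3)[OF G[OF g] c k, of n] and tr = hfun_tail(2,3)[OF \<rho>m \<rho>0 \<rho>h c k]
    have "(\<integral>x. \<bar>g n x - \<rho> x\<bar> \<partial>M) \<le> (\<integral>x. \<bar>min (g n x) (exp k) - min (\<rho> x) (exp k)\<bar> + (max 0 (g n x - exp k) + max 0 (\<rho> x - exp k)) \<partial>M)"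
    proof (rule integral_mono)
      show "integrable M (\<lambda>x. \<bar>g n x - \<rho> x\<bar>)" by (intro integrable_abs Bochner_Integration.integrable_diff gi[OF g] \<rho>i)
      show "integrable M (\<lambda>x. \<bar>min (g n x) (exp k) - min (\<rho> x) (exp k)\<bar> + (max 0 (g n x - exp k) + max 0 (\<rho> x - exp k)))"
        by (intro Bochner_Integration.integrable_add mi tg(1) tr(1))
      show "\<bar>g n x - \<rho> x\<bar> \<le> \<bar>min (g n x) (exp k) - min (\<rho> x) (exp k)\<bar> + (max 0 (g n x - exp k) + max 0 (\<rho> x - exp k))" for x
        by linarith
    qed
    also have "\<dots> = (\<integral>x. \<bar>min (g n x) (exp k) - min (\<rho> x) (exp k)\<bar> \<partial>M) + ((\<integral>x. max 0 (g n x - exp k) \<partial>M) + (\<integral>x. max 0 (\<rho> x - exp k) \<partial>M))"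
      using mi tg(1) tr(1) by simp
    finally show "(\<integral>x. \<bar>g n x - \<rho> x\<bar> \<partial>M) \<le> (\<integral>x. \<bar>min (g n x) (exp k) - min (\<rho> x) (exp k)\<bar> \<partial>M) + 2 * c / k"
      using tg(2) tr(2) by (simp add: add_divide_distrib)
  qed auto
  show thesis
  proof (rule that[OF \<rho>m \<rho>0 \<rho>h])
    fix V :: "nat \<Rightarrow> 'a \<Rightarrow> real" and V' :: "'a \<Rightarrow> real" and a B :: real
    assume B0: "B \<ge> 0" and V'm [measurable]: "V' \<in> borel_measurable M" and Vm [measurable]: "\<And>j. V j \<in> borel_measurable M"
      and VB: "\<And>j x. x \<in> space M \<Longrightarrow> \<bar>V j x\<bar> \<le> B" and Vl: "AE x in M. (\<lambda>j. V j x) \<longlonglongrightarrow> V' x"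
      and al: "(\<lambda>j. \<integral>x. V j x * r j x \<partial>M) \<longlonglongrightarrow> a"
    have V'B: "AE x in M. \<bar>V' x\<bar> \<le> B"
      using Vl AE_space
    proof eventually_elim
      case (elim x)
      show ?case by (rule LIMSEQ_le_const2[OF tendsto_rabs[OF elim(1)]]) (use VB[OF elim(2)] in auto)
    qed
    have V'i: "integrable M (\<lambda>x. V' x * u x)" if "integrable M u" for u
    proof (rule Bochner_Integration.integrable_bound[where f="\<lambda>x. B * u x"])
      show "AE x in M. norm (V' x * u x) \<le> norm (B * u x)"
        using V'B by eventually_elim (auto simp: abs_mult intro!: mult_right_mono)
      show "(\<lambda>x. V' x * u x) \<in> borel_measurable M" using borel_measurable_integrable[OF that] by measurable
    qed (use that in simp)
    have Vi: "integrable M (\<lambda>x. V j x * u x)" if "integrable M u" for u j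
    proof (rule Bochner_Integration.integrable_bound[where f="\<lambda>x. B * u x"])
      show "AE x in M. norm (V j x * u x) \<le> norm (B * u x)"
        using VB[of _ j] by (intro AE_I2) (auto simp: abs_mult intro!: mult_right_mono order_trans[of "\<bar>V j _\<bar>" B "\<bar>B\<bar>"])
      show "(\<lambda>x. V j x * u x) \<in> borel_measurable M" using borel_measurable_integrable[OF that] by measurable
    qed (use that in simp)
    \<comment> \<open>Up to the level \<open>exp k\<close> the density is bounded and
      \<open>V j\<close> converges boundedly; above it the difference is at most
      \<open>2 * B\<close> and the tail has mass at most \<open>c / k\<close>.\<close>
    have "(\<lambda>j. \<integral>x. \<bar>V' x - V j x\<bar> * r j x \<partial>M) \<longlonglongrightarrow> 0"
    proof (rule tendsto_0_by_truncation[where q="\<lambda>k j. exp k * (\<integral>x. \<bar>V' x - V j x\<bar> \<partial>M)" and a="2 * B * c"])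
      show "0 \<le> (\<integral>x. \<bar>V' x - V j x\<bar> * r j x \<partial>M)" for j using r by (intro integral_nonneg_AE) auto
      fix k :: real assume k: "k \<ge> 1"
      have lt: "(\<lambda>j. \<integral>x. \<bar>V' x - V j x\<bar> \<partial>M) \<longlonglongrightarrow> (\<integral>x. 0 \<partial>M)"
      proof (rule integral_dominated_convergence[where w="\<lambda>_. 2 * B"])
        show "AE x in M. (\<lambda>j. \<bar>V' x - V j x\<bar>) \<longlonglongrightarrow> 0"
          using Vl
        proof eventually_elim
          case (elim x)
          have "(\<lambda>j. \<bar>V' x - V j x\<bar>) \<longlonglongrightarrow> \<bar>V' x - V' x\<bar>" by (intro tendsto_intros elim)
          thus ?case by simp
        qed
        show "AE x in M. norm \<bar>V' x - V j x\<bar> \<le> 2 * B" for j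
          using V'B AE_space
        proof eventually_elim
          case (elim x)
          thus ?case using VB[OF elim(2), of j] by simp
        qed
      qed auto
      thus "(\<lambda>j. exp k * (\<integral>x. \<bar>V' x - V j x\<bar> \<partial>M)) \<longlonglongrightarrow> 0" using tendsto_mult_left[OF lt, of "exp k"] by simp
      fix j
      have di: "integrable M (\<lambda>x. \<bar>V' x - V j x\<bar>)"
      proof -
        have "integrable M (\<lambda>x. V' x * 1)" "integrable M (\<lambda>x. V j x * 1)" by (rule V'i Vi; simp)+
        thus ?thesis by (intro integrable_abs Bochner_Integration.integrable_diff) simp_all
      qed
      note tr = hfun_tail(2,3)[OF rm r h c k, of j]
      have "integrable M (\<lambda>x. \<bar>V' x * r j x - V j x * r j x\<bar>)"
        by (intro integrable_abs Bochner_Integration.integrable_diff V'i Vi ri)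
      hence li: "integrable M (\<lambda>x. \<bar>V' x - V j x\<bar> * r j x)" using r[of j] by (simp add: left_diff_distrib[symmetric] abs_mult)
      have "(\<integral>x. \<bar>V' x - V j x\<bar> * r j x \<partial>M) \<le> (\<integral>x. exp k * \<bar>V' x - V j x\<bar> + 2 * B * max 0 (r j x - exp k) \<partial>M)"
      proof (rule integral_mono_AE[OF li])
        show "integrable M (\<lambda>x. exp k * \<bar>V' x - V j x\<bar> + 2 * B * max 0 (r j x - exp k))"
          using di tr(1) by (intro Bochner_Integration.integrable_add integrable_mult_right)
        show "AE x in M. \<bar>V' x - V j x\<bar> * r j x \<le> exp k * \<bar>V' x - V j x\<bar> + 2 * B * max 0 (r j x - exp k)"
          using V'B AE_space
        proof eventually_elim
          case (elim x)
          have d: "\<bar>V' x - V j x\<bar> \<le> 2 * B" using elim VB[OF elim(2), of j] by simp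
          have "\<bar>V' x - V j x\<bar> * r j x \<le> \<bar>V' x - V j x\<bar> * (exp k + max 0 (r j x - exp k))"
            by (intro mult_left_mono) auto
          moreover have "\<bar>V' x - V j x\<bar> * max 0 (r j x - exp k) \<le> 2 * B * max 0 (r j x - exp k)"
            using d by (intro mult_right_mono) auto
          ultimately show ?case by (simp add: algebra_simps)
        qed
      qed
      also have "\<dots> = exp k * (\<integral>x. \<bar>V' x - V j x\<bar> \<partial>M) + 2 * B * (\<integral>x. max 0 (r j x - exp k) \<partial>M)"
        using di tr(1) by simp
      also have "2 * B * (\<integral>x. max 0 (r j x - exp k) \<partial>M) \<le> 2 * B * c / k" using mult_left_mono[OF tr(2), of "2 * B"] B0 by simp
      finally show "(\<integral>x. \<bar>V' x - V j x\<bar> * r j x \<partial>M) \<le> exp k * (\<integral>x. \<bar>V' x - V j x\<bar> \<partial>M) + 2 * B * c / k" by simp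
    qed
    hence "(\<lambda>j. \<integral>x. (V' x - V j x) * r j x \<partial>M) \<longlonglongrightarrow> 0"
    proof (rule Lim_null_comparison[rotated], intro always_eventually allI)
      fix j
      have "norm (\<integral>x. (V' x - V j x) * r j x \<partial>M) \<le> (\<integral>x. norm ((V' x - V j x) * r j x) \<partial>M)" by (rule integral_norm_bound)
      thus "norm (\<integral>x. (V' x - V j x) * r j x \<partial>M) \<le> (\<integral>x. \<bar>V' x - V j x\<bar> * r j x \<partial>M)" using r[of j] by (simp add: abs_mult)
    qed
    moreover have "(\<integral>x. (V' x - V j x) * r j x \<partial>M) = (\<integral>x. V' x * r j x \<partial>M) - (\<integral>x. V j x * r j x \<partial>M)" for j
      unfolding left_diff_distrib by (rule Bochner_Integration.integral_diff[OF V'i[OF ri] Vi[OF ri]])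
    ultimately have b: "(\<lambda>j. \<integral>x. V' x * r j x \<partial>M) \<longlonglongrightarrow> a"
      using tendsto_add[OF _ al] by fastforce
    have "(\<lambda>n. \<integral>x. V' x * g n x \<partial>M) \<longlonglongrightarrow> a"
    proof (rule metric_LIMSEQ_I)
      fix \<epsilon> :: real assume "\<epsilon> > 0"
      then obtain n0 where n0: "\<And>j. j \<ge> n0 \<Longrightarrow> \<bar>(\<integral>x. V' x * r j x \<partial>M) - a\<bar> < \<epsilon>" using LIMSEQ_D[OF b] by auto
      have "\<bar>(\<integral>x. V' x * u x \<partial>M) - a\<bar> < \<epsilon>" if "u \<in> midconv r n" "n \<ge> n0" for u n
        using that(1)
      proof induction
        case (base k)
        then show ?case using n0[of k] that(2) by simp
      next
        case (mid u v)
        have "(\<integral>x. V' x * ((u x + v x) / 2) \<partial>M) = (\<integral>x. (V' x * u x) / 2 + (V' x * v x) / 2 \<partial>M)"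
          by (intro Bochner_Integration.integral_cong refl) (simp add: field_simps)
        also have "\<dots> = (\<integral>x. V' x * u x \<partial>M) / 2 + (\<integral>x. V' x * v x \<partial>M) / 2"
          using V'i[OF gi[OF mid(1)]] V'i[OF gi[OF mid(2)]] by simp
        finally show ?case using mid(3,4) unfolding abs_less_iff by linarith
      qed
      from this[OF g] show "\<exists>n0. \<forall>n\<ge>n0. dist (\<integral>x. V' x * g n x \<partial>M) a < \<epsilon>" by (auto simp: dist_real_def)
    qed
    moreover have "(\<lambda>n. \<integral>x. V' x * g n x \<partial>M) \<longlonglongrightarrow> (\<integral>x. V' x * \<rho> x \<partial>M)"
    proof -
      have "(\<lambda>n. (\<integral>x. V' x * g n x \<partial>M) - (\<integral>x. V' x * \<rho> x \<partial>M)) \<longlonglongrightarrow> 0"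
      proof (rule Lim_null_comparison[OF always_eventually, rule_format])
        show "(\<lambda>n. \<bar>B\<bar> * (\<integral>x. \<bar>g n x - \<rho> x\<bar> \<partial>M)) \<longlonglongrightarrow> 0" using tendsto_mult_left[OF L1, of "\<bar>B\<bar>"] by simp
        fix n
        have "(\<integral>x. V' x * g n x \<partial>M) - (\<integral>x. V' x * \<rho> x \<partial>M) = (\<integral>x. V' x * (g n x - \<rho> x) \<partial>M)"
          unfolding right_diff_distrib by (rule Bochner_Integration.integral_diff[symmetric, OF V'i[OF gi[OF g]] V'i[OF \<rho>i]])
        also have "norm \<dots> \<le> (\<integral>x. norm (V' x * (g n x - \<rho> x)) \<partial>M)" by (rule integral_norm_bound)
        also have "\<dots> \<le> (\<integral>x. \<bar>B\<bar> * \<bar>g n x - \<rho> x\<bar> \<partial>M)"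
        proof (rule integral_mono_AE)
          have d: "integrable M (\<lambda>x. g n x - \<rho> x)" using gi[OF g] \<rho>i by (rule Bochner_Integration.integrable_diff)
          show "integrable M (\<lambda>x. norm (V' x * (g n x - \<rho> x)))" by (rule integrable_norm[OF V'i[OF d]])
          show "integrable M (\<lambda>x. \<bar>B\<bar> * \<bar>g n x - \<rho> x\<bar>)" using d by (intro integrable_mult_right integrable_abs)
          show "AE x in M. norm (V' x * (g n x - \<rho> x)) \<le> \<bar>B\<bar> * \<bar>g n x - \<rho> x\<bar>"
            using V'B by eventually_elim (auto simp: abs_mult intro!: mult_right_mono)
        qed
        finally show "norm ((\<integral>x. V' x * g n x \<partial>M) - (\<integral>x. V' x * \<rho> x \<partial>M)) \<le> \<bar>B\<bar> * (\<integral>x. \<bar>g n x - \<rho> x\<bar> \<partial>M)" by simp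
      qed
      thus ?thesis by (simp add: LIM_zero_iff)
    qed
    ultimately show "(\<integral>x. V' x * \<rho> x \<partial>M) = a" by (intro LIMSEQ_unique)
  qed
qed

end

section \<open>Mass one at almost every time\<close>

text \<open>Continuous functions approximate indicators of half-lines, and finite measures on the
  line that agree on half-lines coincide; their densities are then equal almost everywhere.\<close>

lemma AE_lebT_eq_1:
  fixes m :: "real \<Rightarrow> real"
  assumes mi: "integrable (lebT T) m" and m0: "\<And>t. m t \<ge> 0"
    and eq: "\<And>k. continuous_on UNIV k \<Longrightarrow> (\<And>t. \<bar>k t\<bar> \<le> 1) \<Longrightarrow> (\<integral>t. k t * m t \<partial>lebT T) = (\<integral>t. k t \<partial>lebT T)"
  shows "AE t in lebT T. m t = 1"
proof -
  interpret finite_measure "lebT T" by (rule finite_measure_lebT)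
  have sT: "{0..T} \<in> sets lborel" by simp
  have bm: "k \<in> borel_measurable borel \<Longrightarrow> k \<in> borel_measurable (lebT T)" for k :: "real \<Rightarrow> 'b::topological_space"
    unfolding lebT_def by (rule measurable_restrict_space1) simp
  have mm: "m \<in> borel_measurable (lebT T)" using mi by (rule borel_measurable_integrable)
  let ?m = "\<lambda>t. indicator {0..T} t * ennreal (m t)"
  have m': "?m \<in> borel_measurable lborel"
  proof -
    have "(\<lambda>t. ennreal (m t)) \<in> borel_measurable (lebT T)" using mm by measurable
    thus ?thesis unfolding lebT_def by (subst (asm) borel_measurable_restrict_space_iff_ennreal) (auto simp: mult.commute)
  qed
  have int: "(\<integral>t. indicator {s<..} t * m t \<partial>lebT T) = (\<integral>t. indicator {s<..} t \<partial>lebT T)" for s :: real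
  proof -
    \<comment> \<open>Ramps of slope \<open>n\<close> that start at \<open>s\<close>: they vanish up
      to \<open>s\<close>, so their limit is the indicator of the open half-line.\<close>
    define k where "k n t = min 1 (max 0 (real n * (t - s)))" for n t
    have kc: "continuous_on UNIV (k n)" for n unfolding k_def by (intro continuous_intros)
    have kb: "\<bar>k n t\<bar> \<le> 1" for n t by (simp add: k_def)
    have kl: "(\<lambda>n. k n t) \<longlonglongrightarrow> indicator {s<..} t" for t
    proof (cases "t > s")
      case True
      obtain n0 :: nat where n0: "1 / (t - s) \<le> real n0" using real_arch_simple by blast
      have "k n t = 1" if "n \<ge> n0" for n
      proof -
        have "1 / (t - s) \<le> real n" using n0 that by linarith
        hence "1 \<le> real n * (t - s)" using True by (simp add: field_simps)
        thus ?thesis by (simp add: k_def)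
      qed
      hence "\<forall>\<^sub>F n in sequentially. k n t = indicator {s<..} t" using True by (auto simp: eventually_sequentially)
      thus ?thesis by (rule tendsto_eventually)
    next
      case False
      hence "k n t = 0" for n by (auto simp: k_def mult_nonneg_nonpos)
      thus ?thesis using False by simp
    qed
    have km: "k n \<in> borel_measurable (lebT T)" for n by (rule bm[OF borel_measurable_continuous_onI[OF kc]])
    have im: "(indicator {s<..} :: real \<Rightarrow> real) \<in> borel_measurable (lebT T)" by (rule bm) simp
    have "(\<lambda>n. \<integral>t. k n t * m t \<partial>lebT T) \<longlonglongrightarrow> (\<integral>t. indicator {s<..} t * m t \<partial>lebT T)"
    proof (rule integral_dominated_convergence[where w=m])
      show "AE t in lebT T. (\<lambda>n. k n t * m t) \<longlonglongrightarrow> indicator {s<..} t * m t" by (intro AE_I2 tendsto_mult_right kl)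
      show "AE t in lebT T. norm (k n t * m t) \<le> m t" for n
        using kb[of n] m0 by (intro AE_I2) (simp add: abs_mult mult_left_le_one_le)
    qed (use km im mm mi in auto)
    moreover have "(\<lambda>n. \<integral>t. k n t \<partial>lebT T) \<longlonglongrightarrow> (\<integral>t. indicator {s<..} t \<partial>lebT T)"
      by (rule integral_dominated_convergence[where w="\<lambda>_. 1"]) (use km im kb kl in auto)
    ultimately show ?thesis using eq[OF kc kb] by (auto intro: LIMSEQ_unique)
  qed
  have ii: "integrable (lebT T) (\<lambda>t. indicator {s<..} t * m t)" for s :: real
    by (rule Bochner_Integration.integrable_bound[OF mi]) (use borel_measurable_times[OF bm[of "indicator {s<..}"] mm] in \<open>auto split: split_indicator\<close>)
  have ii': "integrable (lebT T) (indicator {s<..} :: real \<Rightarrow> real)" for s :: real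
    by (rule Bochner_Integration.integrable_bound[where f="\<lambda>_. 1::real"]) (use bm[of "indicator {s<..}"] in \<open>auto simp: indicator_def\<close>)
  have e1: "emeasure (density lborel ?m) {s<..} = ennreal (\<integral>t. indicator {s<..} t * m t \<partial>lebT T)" for s :: real
  proof -
    have "emeasure (density lborel ?m) {s<..} = (\<integral>\<^sup>+t. ennreal (indicator {s<..} t * m t) * indicator {0..T} t \<partial>lborel)"
      using m' by (subst emeasure_density) (auto intro!: nn_integral_cong simp: indicator_def)
    also have "\<dots> = (\<integral>\<^sup>+t. ennreal (indicator {s<..} t * m t) \<partial>lebT T)"
      unfolding lebT_def by (subst nn_integral_restrict_space) auto
    also have "\<dots> = ennreal (\<integral>t. indicator {s<..} t * m t \<partial>lebT T)"
      using m0 by (intro nn_integral_eq_integral[OF ii]) auto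
    finally show ?thesis .
  qed
  have e2: "emeasure (density lborel (indicator {0..T})) {s<..} = ennreal (\<integral>t. indicator {s<..} t \<partial>lebT T)" for s :: real
  proof -
    have "emeasure (density lborel (indicator {0..T})) {s<..} = (\<integral>\<^sup>+t. ennreal (indicator {s<..} t) * indicator {0..T} t \<partial>lborel)"
      by (subst emeasure_density) (auto intro!: nn_integral_cong simp: indicator_def)
    also have "\<dots> = (\<integral>\<^sup>+t. ennreal (indicator {s<..} t) \<partial>lebT T)"
      unfolding lebT_def by (subst nn_integral_restrict_space) auto
    also have "\<dots> = ennreal (\<integral>t. indicator {s<..} t \<partial>lebT T)"
      by (intro nn_integral_eq_integral[OF ii']) auto
    finally show ?thesis .
  qed
  have "density lborel ?m = density lborel (indicator {0..T})"
    by (rule measure_eqI_lessThan) (auto simp: e1 e2 int)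
  hence "AE t in lborel. ?m t = indicator {0..T} t"
    by (intro sigma_finite_measure.density_unique[OF sigma_finite_lborel m']) auto
  hence "AE t in lborel. t \<in> {0..T} \<longrightarrow> m t = 1"
  proof eventually_elim
    case (elim t)
    show ?case
    proof
      assume "t \<in> {0..T}"
      with elim have "ennreal (m t) = 1" by simp
      thus "m t = 1" using m0[of t] by simp
    qed
  qed
  thus ?thesis unfolding lebT_def using AE_restrict_space_iff[of "{0..T}" lborel "\<lambda>t. m t = 1"] by simp
qed

section \<open>Measurability in space-time and the sequence of approximations\<close>

text \<open>Second countability makes the Borel sets of the product the product of the Borel sets,
  which connects the measurability in the hypothesis with that of product integration.\<close>

lemma borel_measurable_lebT_borel_iff:
  fixes f :: "real \<times> 'h::{second_countable_topology} \<Rightarrow> 'b::topological_space"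
  shows "f \<in> borel_measurable (restrict_space borel ({0..T} \<times> UNIV)) \<longleftrightarrow> f \<in> borel_measurable (lebT T \<Otimes>\<^sub>M borel)"
proof
  have "(\<lambda>v. v) \<in> lebT T \<Otimes>\<^sub>M borel \<rightarrow>\<^sub>M (borel :: (real \<times> 'h) measure)"
  proof -
    have "(\<lambda>t. t) \<in> lebT T \<rightarrow>\<^sub>M borel" unfolding lebT_def by (rule measurable_restrict_space1) simp
    hence [measurable]: "fst \<in> lebT T \<Otimes>\<^sub>M (borel :: 'h measure) \<rightarrow>\<^sub>M borel" by (rule measurable_compose[OF measurable_fst])
    have "(\<lambda>v. (fst v, snd v)) \<in> lebT T \<Otimes>\<^sub>M (borel :: 'h measure) \<rightarrow>\<^sub>M borel \<Otimes>\<^sub>M borel" by measurable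
    thus ?thesis by (simp add: borel_prod)
  qed
  hence 1: "(\<lambda>v. v) \<in> lebT T \<Otimes>\<^sub>M borel \<rightarrow>\<^sub>M restrict_space (borel :: (real \<times> 'h) measure) ({0..T} \<times> UNIV)"
    by (intro measurable_restrict_space2) (auto simp: space_pair_measure)
  show "f \<in> borel_measurable (lebT T \<Otimes>\<^sub>M borel)" if "f \<in> borel_measurable (restrict_space borel ({0..T} \<times> UNIV))"
    using measurable_compose[OF 1 that] by simp
  have "(\<lambda>v. (fst v, snd v)) \<in> restrict_space (borel :: (real \<times> 'h) measure) ({0..T} \<times> UNIV) \<rightarrow>\<^sub>M lebT T \<Otimes>\<^sub>M borel"
  proof (rule measurable_Pair)
    show "fst \<in> restrict_space (borel :: (real \<times> 'h) measure) ({0..T} \<times> UNIV) \<rightarrow>\<^sub>M lebT T"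
      unfolding lebT_def
    proof (intro measurable_restrict_space2 measurable_restrict_space1)
      have "fst \<in> borel_measurable (borel :: (real \<times> 'h) measure)" by (intro borel_measurable_continuous_onI continuous_intros)
      thus "fst \<in> (borel :: (real \<times> 'h) measure) \<rightarrow>\<^sub>M lborel" by simp
    qed (auto simp: space_restrict_space)
    show "snd \<in> restrict_space (borel :: (real \<times> 'h) measure) ({0..T} \<times> UNIV) \<rightarrow>\<^sub>M borel"
      by (intro measurable_restrict_space1 borel_measurable_continuous_onI continuous_intros)
  qed
  note 2 = this
  show "f \<in> borel_measurable (restrict_space borel ({0..T} \<times> UNIV))" if "f \<in> borel_measurable (lebT T \<Otimes>\<^sub>M borel)"
    using measurable_compose[OF 2 that] by simp
qed

text \<open>Every point satisfies the three bounds once \<open>K\<close> is large, so the lost mass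
  tends to 0 by dominated convergence with majorant \<open>\<rho>0\<close>.\<close>

lemma truncated_mass:
  fixes \<gamma> :: "'h::{real_inner, complete_space, second_countable_topology} measure"
  assumes \<gamma>: "sets \<gamma> = sets borel" and dd: "\<psi> \<in> borel_measurable borel"
    and m [measurable]: "\<rho>0 \<in> borel_measurable borel" and nn: "\<And>z. \<rho>0 z \<ge> 0" and i: "integrable \<gamma> \<rho>0" and \<epsilon>: "\<epsilon> > 0"
  obtains K :: nat where "(\<integral>z. \<rho>0 z * (1 - indicator {z. \<rho>0 z \<le> real K \<and> \<psi> z \<le> real K \<and> coordN e N z \<in> cubeN N (real K)} z) \<partial>\<gamma>) < \<epsilon>"
proof -
  note [measurable_cong] = \<gamma> and [measurable] = dd
  let ?A = "\<lambda>K::nat. {z. \<rho>0 z \<le> real K \<and> \<psi> z \<le> real K \<and> coordN e N z \<in> cubeN N (real K)}"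
  have [measurable]: "?A K \<in> sets borel" for K by measurable
  have "(\<lambda>K. \<integral>z. \<rho>0 z * (1 - indicator (?A K) z) \<partial>\<gamma>) \<longlonglongrightarrow> (\<integral>z. 0 \<partial>\<gamma>)"
  proof (rule integral_dominated_convergence[where w=\<rho>0])
    show "AE z in \<gamma>. (\<lambda>K. \<rho>0 z * (1 - indicator (?A K) z)) \<longlonglongrightarrow> 0"
    proof (rule AE_I2, rule tendsto_eventually)
      fix z
      obtain K0 :: nat where K0: "\<bar>\<rho>0 z\<bar> + \<bar>\<psi> z\<bar> + (\<Sum>i<N. \<bar>inner z (e i)\<bar>) \<le> real K0" using real_arch_simple by blast
      have s: "\<bar>inner z (e k)\<bar> \<le> (\<Sum>i<N. \<bar>inner z (e i)\<bar>)" if "k < N" for k using that by (intro member_le_sum) auto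
      have "0 \<le> (\<Sum>i<N. \<bar>inner z (e i)\<bar>)" by (intro sum_nonneg) auto
      hence AK: "z \<in> ?A K" if "K \<ge> K0" for K
      proof -
        have K: "real K0 \<le> real K" using that by simp
        have "\<bar>inner z (e k)\<bar> \<le> real K" if "k < N" for k using s[OF that] K0 K by linarith
        hence "coordN e N z \<in> cubeN N (real K)" by (simp add: cubeN_def coordN_def)
        moreover have "\<rho>0 z \<le> real K" "\<psi> z \<le> real K" using K0 K \<open>0 \<le> sum _ _\<close> by linarith+
        ultimately show ?thesis by simp
      qed
      have "\<rho>0 z * (1 - indicator (?A K) z) = 0" if "K \<ge> K0" for K
      proof -
        have "indicator (?A K) z = (1::real)" by (rule indicator_simps(1)[OF AK[OF that]])
        thus ?thesis by (simp only: diff_self mult_zero_right)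
      qed
      thus "\<forall>\<^sub>F K in sequentially. \<rho>0 z * (1 - indicator (?A K) z) = 0" unfolding eventually_sequentially by blast
    qed
    show "AE z in \<gamma>. norm (\<rho>0 z * (1 - indicator (?A K) z)) \<le> \<rho>0 z" for K
      using nn by (intro AE_I2) (auto simp: indicator_def)
  qed (use i in auto)
  from order_tendstoD(2)[OF this, of \<epsilon>] \<epsilon> have "\<forall>\<^sub>F K in sequentially. (\<integral>z. \<rho>0 z * (1 - indicator (?A K) z) \<partial>\<gamma>) < \<epsilon>" by simp
  then obtain K where "(\<integral>z. \<rho>0 z * (1 - indicator (?A K) z) \<partial>\<gamma>) < \<epsilon>" using eventually_happens'[OF sequentially_bot] by blast
  thus thesis by (rule that)
qed

lemma cyl_const: "cyl (\<lambda>_. c) (\<lambda>_. 0)"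
  by (simp add: cyl_def bounded_iff exI[of _ "\<bar>c\<bar>"])

lemma integral_lebT:
  assumes "continuous_on {0..T} k" shows "(\<integral>t. k t \<partial>lebT T) = integral {0..T} (k :: real \<Rightarrow> real)"
proof -
  have "set_integrable lborel {0..T} k" unfolding set_integrable_def
    using borel_integrable_compact[OF compact_Icc assms] by (simp add: indicator_scaleR_eq_if)
  from set_borel_integral_eq_integral(2)[OF this]
  show ?thesis unfolding lebT_def set_lebesgue_integral_def by (subst integral_restrict_space) auto
qed

text \<open>The cut-off depends on \<open>\<Psi>\<close> in dimension \<open>Nj j\<close>, so it is
  chosen anew for each \<open>j\<close>, with lost mass below \<open>1 / real (Suc j)\<close>.
  Bounded test functions then see the full initial density in the limit.\<close>

lemma approx_solution_sequence:
  fixes \<gamma> :: "'h::{real_inner, complete_space, second_countable_topology} measure"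
  assumes T: "T > 0" and \<gamma>: "finite_measure \<gamma>" "sets \<gamma> = sets borel" and on: "orthonormal_basis e"
    and Psi: "disint_density \<gamma> e \<Psi>" and eta: "\<forall>N. mollifier N (\<eta> N)"
    and co: "\<And>j i. i < Nj j \<Longrightarrow> coeff_regular T (Nj j) (ft j i)"
    and \<delta>: "\<delta> > 0" and CF: "(SUP j. CF \<gamma> e T \<Psi> \<eta> Nj ft j \<delta>) < \<infinity>"
    and m [measurable]: "\<rho>0 \<in> borel_measurable borel" and nn: "\<And>x. \<rho>0 x \<ge> 0" and int: "integrable \<gamma> \<rho>0"
    and ent: "(\<integral>\<^sup>+x. ennreal (\<rho>0 x * ln (\<rho>0 x)) \<partial>\<gamma>) < \<infinity>"
  obtains r c where "c \<ge> 0" "\<And>j. r j \<in> borel_measurable (lebT T \<Otimes>\<^sub>M \<gamma>)" "\<And>j v. r j v \<ge> 0"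
    "\<And>j. (\<integral>\<^sup>+v. ennreal (hfun (r j v)) \<partial>(lebT T \<Otimes>\<^sub>M \<gamma>)) \<le> ennreal c"
    "\<And>h D g g'. cyl h D \<Longrightarrow> (\<And>t. t \<in> {0..T} \<Longrightarrow> (g has_real_derivative g' t) (at t within {0..T})) \<Longrightarrow>
       continuous_on {0..T} g' \<Longrightarrow> g T = 0 \<Longrightarrow>
       (\<lambda>j. \<integral>v. (g' (fst v) * h (snd v) + g (fst v) * inner (D (snd v)) (Fj e Nj ft j (fst v) (snd v))) * r j v \<partial>(lebT T \<Otimes>\<^sub>M \<gamma>))
         \<longlonglongrightarrow> - g 0 * (\<integral>z. h z * \<rho>0 z \<partial>\<gamma>)"
proof -
  let ?M = "lebT T \<Otimes>\<^sub>M \<gamma>"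
  interpret ga: finite_measure \<gamma> by (rule \<gamma>(1))
  note [measurable_cong] = \<gamma>(2)
  have sM: "sets ?M = sets (lebT T \<Otimes>\<^sub>M borel)" by (rule sets_pair_measure_cong[OF refl \<gamma>(2)])
  define C0 where "C0 = (SUP j. CF \<gamma> e T \<Psi> \<eta> Nj ft j \<delta>)"
  \<comment> \<open>The entropy bound at full initial data and the supremum of the costs: finite and
    common to all \<open>j\<close>.\<close>
  define CR where "CR = ennreal (T * exp (2 * T / \<delta>)) * ((\<integral>\<^sup>+z. ennreal (\<rho>0 z * ln (\<rho>0 z)) \<partial>\<gamma>) + emeasure \<gamma> UNIV + C0 * ennreal (1 / \<delta>))
       + ennreal T * emeasure \<gamma> UNIV"
  have "emeasure \<gamma> UNIV < \<top>" using ga.emeasure_finite[of UNIV] by (simp only: less_top infinity_ennreal_def not_False_eq_True)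
  hence "CR < \<infinity>" using CF ent unfolding CR_def C0_def by (simp add: ennreal_mult_less_top)
  then obtain c where c: "c \<ge> 0" "CR = ennreal c" by (cases CR) auto
  define A where "A j K = {z. \<rho>0 z \<le> real K \<and> (\<Psi> (Nj j) (coordN e (Nj j) z) (projE e (Nj j) z))\<^sup>2 \<le> real K \<and> coordN e (Nj j) z \<in> cubeN (Nj j) (real K)}"
    for j and K :: nat
  have pm [measurable]: "(\<lambda>z. (\<Psi> (Nj j) (coordN e (Nj j) z) (projE e (Nj j) z))\<^sup>2) \<in> borel_measurable borel" for j
    using Psi_measurable(3)[OF \<gamma> on Psi] by measurable
  have Am [measurable]: "A j K \<in> sets borel" for j K unfolding A_def by measurable
  have "\<exists>K. (\<integral>z. \<rho>0 z * (1 - indicator (A j K) z) \<partial>\<gamma>) < 1 / real (Suc j)" for j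
    unfolding A_def by (rule truncated_mass[OF \<gamma>(2) pm m nn int, of "1 / real (Suc j)"]) auto
  then obtain K where K: "\<And>j. (\<integral>z. \<rho>0 z * (1 - indicator (A j (K j)) z) \<partial>\<gamma>) < 1 / real (Suc j)" by metis
  \<comment> \<open>All properties of one approximation are packed into a predicate so that a single
    choice yields the sequence.\<close>
  define Q where "Q j q \<longleftrightarrow> q \<in> borel_measurable (lebT T \<Otimes>\<^sub>M borel) \<and> (\<forall>v. q v \<ge> 0) \<and>
    (\<forall>h D g g'. cyl h D \<longrightarrow> (\<forall>t\<in>{0..T}. (g has_real_derivative g' t) (at t within {0..T})) \<longrightarrow>
       continuous_on {0..T} g' \<longrightarrow> g T = 0 \<longrightarrow>
       (\<integral>v. (g' (fst v) * h (snd v) + g (fst v) * inner (D (snd v)) (Fj e Nj ft j (fst v) (snd v))) * q v \<partial>?M)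
         = - g 0 * (\<integral>z. h z * (\<rho>0 z * indicator (A j (K j)) z) \<partial>\<gamma>)) \<and>
    (\<integral>\<^sup>+v. ennreal (hfun (q v)) \<partial>?M) \<le> ennreal c" for j q
  have "\<exists>q. Q j q" for j
  proof -
    have cost: "(\<integral>\<^sup>+t. (\<integral>\<^sup>+x. ennreal ((exp (\<delta> * max 0 (- (\<Sum>i<Nj j. pderiv i (ft j i t) x +
          ft j i t x * qdiv (pderiv i (\<lambda>x'. PsiSq \<Psi> \<eta> (Nj j) M l x' y) x) (PsiSq \<Psi> \<eta> (Nj j) M l x y)))) - 1)
             * PsiSq \<Psi> \<eta> (Nj j) M l x y) \<partial>lebN (Nj j)) \<partial>lebT T) \<le> CFy T \<Psi> \<eta> Nj ft j \<delta> y" if "M \<ge> 1" "l \<ge> 1" for M l y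
    proof -
      have "(M, l) \<in> {1..} \<times> {1..}" using that by simp
      from SUP_upper[OF this, of "\<lambda>(M, l). \<integral>\<^sup>+ t. (\<integral>\<^sup>+ x. ennreal ((exp (\<delta> * max 0 (Dstar \<Psi> \<eta> Nj ft j M l t x y)) - 1)
             * PsiSq \<Psi> \<eta> (Nj j) M l x y) \<partial>lebN (Nj j)) \<partial>lebT T"]
      show ?thesis unfolding CFy_def Dstar_def by simp
    qed
    have c0: "(\<integral>\<^sup>+y. CFy T \<Psi> \<eta> Nj ft j \<delta> y \<partial>nuN \<gamma> e (Nj j)) \<le> C0"
      unfolding C0_def CF_def[symmetric] by (rule SUP_upper) simp
    have C0: "C0 < \<infinity>" using CF by (simp add: C0_def)
    show ?thesis
    proof (rule approx_solution[where N="Nj j" and f="ft j" and K="K j" and ?c0.0="CFy T \<Psi> \<eta> Nj ft j \<delta>" and ?C0.0=C0, OF \<gamma> on Psi T \<delta> spec[OF eta] co m nn ent cost c0 C0], goal_cases)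
      case (4 q)
      note meas = 4(1) and nonneg = 4(2) and weak = 4(3) and ent' = 4(4)
      show ?case unfolding Q_def Fj_def A_def
      proof (intro exI[of _ q] conjI allI impI, goal_cases)
        case (3 h D g g')
        show ?case by (rule weak[of h D g g', OF 3(1) bspec[OF 3(2)] 3(3,4)])
      next
        case 4
        show ?case using ent' unfolding CR_def[symmetric] c(2) .
      qed (rule meas, rule nonneg)
    qed
  qed
  hence "\<exists>r. \<forall>j. Q j (r j)" by (intro choice allI)
  then obtain r where Q: "\<And>j. Q j (r j)" by blast
  have r: "r j \<in> borel_measurable (lebT T \<Otimes>\<^sub>M borel)" "r j v \<ge> 0"
    "(\<integral>\<^sup>+v. ennreal (hfun (r j v)) \<partial>?M) \<le> ennreal c" for j v
    using Q[of j, unfolded Q_def, THEN conjunct1] Q[of j, unfolded Q_def, THEN conjunct2, THEN conjunct1, THEN spec[of _ v]]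
      Q[of j, unfolded Q_def, THEN conjunct2, THEN conjunct2, THEN conjunct2] .
  have rw: "(\<integral>v. (g' (fst v) * h (snd v) + g (fst v) * inner (D (snd v)) (Fj e Nj ft j (fst v) (snd v))) * r j v \<partial>?M)
         = - g 0 * (\<integral>z. h z * (\<rho>0 z * indicator (A j (K j)) z) \<partial>\<gamma>)"
    if "cyl h D" "\<forall>t\<in>{0..T}. (g has_real_derivative g' t) (at t within {0..T})" "continuous_on {0..T} g'" "g T = 0" for j h D g g'
  proof -
    note * = Q[of j, unfolded Q_def, THEN conjunct2, THEN conjunct2, THEN conjunct1, THEN spec[of _ h], THEN spec[of _ D], THEN spec[of _ g], THEN spec[of _ g']]
    show ?thesis by (rule mp[OF mp[OF mp[OF mp[OF * that(1)] that(2)] that(3)] that(4)])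
  qed
  show thesis
  proof (rule that[of c r, OF c(1) _ r(2,3)])
    show "r j \<in> borel_measurable ?M" for j using r(1)[of j] by (simp cong: measurable_cong_sets add: sM)
    fix h :: "'h \<Rightarrow> real" and D :: "'h \<Rightarrow> 'h" and g g' :: "real \<Rightarrow> real"
    assume cy: "cyl h D" and gd: "\<And>t. t \<in> {0..T} \<Longrightarrow> (g has_real_derivative g' t) (at t within {0..T})"
      and g'c: "continuous_on {0..T} g'" and gT: "g T = 0"
    obtain B where B: "\<And>z. \<bar>h z\<bar> \<le> B" using cy unfolding cyl_def bounded_iff by auto
    have [measurable]: "h \<in> borel_measurable borel" using cy by (auto simp: cyl_def intro: borel_measurable_continuous_onI)
    have hi: "integrable \<gamma> (\<lambda>z. h z * (\<rho>0 z * q z))" if [measurable]: "q \<in> borel_measurable borel" and "\<And>z. \<bar>q z\<bar> \<le> 1" for q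
    proof (rule Bochner_Integration.integrable_bound[where f="\<lambda>z. B * \<rho>0 z"])
      show "AE z in \<gamma>. norm (h z * (\<rho>0 z * q z)) \<le> norm (B * \<rho>0 z)"
      proof (rule AE_I2)
        fix z
        have "\<bar>h z\<bar> * (\<bar>\<rho>0 z\<bar> * \<bar>q z\<bar>) \<le> \<bar>B\<bar> * (\<bar>\<rho>0 z\<bar> * 1)"
          using B[of z] that(2)[of z] by (intro mult_mono) auto
        thus "norm (h z * (\<rho>0 z * q z)) \<le> norm (B * \<rho>0 z)" by (simp add: abs_mult)
      qed
    qed (use int in auto)
    have "(\<lambda>j. \<integral>z. h z * (\<rho>0 z * (1 - indicator (A j (K j)) z)) \<partial>\<gamma>) \<longlonglongrightarrow> 0"
    proof (rule Lim_null_comparison[OF always_eventually, rule_format])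
      show "(\<lambda>j. B * (1 / real (Suc j))) \<longlonglongrightarrow> 0" using tendsto_mult_left[OF LIMSEQ_inverse_real_of_nat, of B] by (simp add: divide_inverse)
      fix j
      have qb: "\<bar>1 - indicator (A j (K j)) z :: real\<bar> \<le> 1" for z by (auto simp: indicator_def)
      have ri: "integrable \<gamma> (\<lambda>z. \<rho>0 z * (1 - indicator (A j (K j)) z))"
        by (rule Bochner_Integration.integrable_bound[OF int]) (auto simp: indicator_def)
      have B0: "B \<ge> 0" using B[of undefined] by linarith
      have "norm (\<integral>z. h z * (\<rho>0 z * (1 - indicator (A j (K j)) z)) \<partial>\<gamma>) \<le> (\<integral>z. norm (h z * (\<rho>0 z * (1 - indicator (A j (K j)) z))) \<partial>\<gamma>)"
        by (rule integral_norm_bound)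
      also have "\<dots> \<le> (\<integral>z. B * (\<rho>0 z * (1 - indicator (A j (K j)) z)) \<partial>\<gamma>)"
      proof (rule integral_mono)
        show "integrable \<gamma> (\<lambda>z. norm (h z * (\<rho>0 z * (1 - indicator (A j (K j)) z))))" by (intro integrable_norm hi qb) measurable
        show "integrable \<gamma> (\<lambda>z. B * (\<rho>0 z * (1 - indicator (A j (K j)) z)))" using ri by simp
        show "norm (h z * (\<rho>0 z * (1 - indicator (A j (K j)) z))) \<le> B * (\<rho>0 z * (1 - indicator (A j (K j)) z))" for z
          using mult_right_mono[OF B[of z] nn[of z]] nn[of z] by (auto simp: indicator_def abs_mult)
      qed
      also have "\<dots> = B * (\<integral>z. \<rho>0 z * (1 - indicator (A j (K j)) z) \<partial>\<gamma>)" by simp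
      also have "\<dots> \<le> B * (1 / real (Suc j))" using K[of j] B0 by (intro mult_left_mono) auto
      finally show "norm (\<integral>z. h z * (\<rho>0 z * (1 - indicator (A j (K j)) z)) \<partial>\<gamma>) \<le> B * (1 / real (Suc j))" .
    qed
    hence "(\<lambda>j. - g 0 * ((\<integral>z. h z * \<rho>0 z \<partial>\<gamma>) - (\<integral>z. h z * (\<rho>0 z * (1 - indicator (A j (K j)) z)) \<partial>\<gamma>))) \<longlonglongrightarrow> - g 0 * ((\<integral>z. h z * \<rho>0 z \<partial>\<gamma>) - 0)"
      by (intro tendsto_intros)
    moreover have "(\<integral>z. h z * \<rho>0 z \<partial>\<gamma>) - (\<integral>z. h z * (\<rho>0 z * (1 - indicator (A j (K j)) z)) \<partial>\<gamma>) = (\<integral>z. h z * (\<rho>0 z * indicator (A j (K j)) z) \<partial>\<gamma>)" for j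
    proof -
      have "(\<integral>z. h z * (\<rho>0 z * 1) \<partial>\<gamma>) - (\<integral>z. h z * (\<rho>0 z * (1 - indicator (A j (K j)) z)) \<partial>\<gamma>) = (\<integral>z. h z * (\<rho>0 z * 1) - h z * (\<rho>0 z * (1 - indicator (A j (K j)) z)) \<partial>\<gamma>)"
        by (intro Bochner_Integration.integral_diff[symmetric] hi) (auto simp: indicator_def)
      thus ?thesis by (simp add: algebra_simps)
    qed
    moreover have "(\<integral>v. (g' (fst v) * h (snd v) + g (fst v) * inner (D (snd v)) (Fj e Nj ft j (fst v) (snd v))) * r j v \<partial>?M)
         = - g 0 * (\<integral>z. h z * (\<rho>0 z * indicator (A j (K j)) z) \<partial>\<gamma>)" for j
      by (rule rw[OF cy ballI[OF gd] g'c gT])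
    ultimately show "(\<lambda>j. \<integral>v. (g' (fst v) * h (snd v) + g (fst v) * inner (D (snd v)) (Fj e Nj ft j (fst v) (snd v))) * r j v \<partial>?M)
         \<longlonglongrightarrow> - g 0 * (\<integral>z. h z * \<rho>0 z \<partial>\<gamma>)" by simp
  qed
qed

section \<open>Passage to the limit and the choice of a version\<close>

theorem theorem2p1:
  fixes \<gamma> :: "'h::{real_inner, complete_space, second_countable_topology} measure"
    and Y :: "'h set" and T :: real
    and F :: "real \<Rightarrow> 'h \<Rightarrow> 'h"
    and e :: "nat \<Rightarrow> 'h"
    and \<Psi> :: "nat \<Rightarrow> (nat \<Rightarrow> real) \<Rightarrow> 'h \<Rightarrow> real"
    and \<eta> :: "nat \<Rightarrow> (nat \<Rightarrow> real) \<Rightarrow> real"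
    and \<rho>0 :: "'h \<Rightarrow> real"
  assumes T_pos: "T > 0"
    and H1: "hyp1 \<gamma> Y"
    and Psi: "disint_density \<gamma> e \<Psi>"
    and eta: "\<forall>N. mollifier N (\<eta> N)"
    and H2: "hyp2 \<gamma> Y T F e \<Psi> \<eta>"
    and rho0_meas: "\<rho>0 \<in> borel_measurable borel"
    and rho0_nonneg: "\<forall>x. \<rho>0 x \<ge> 0"
    and rho0_norm: "(\<integral>\<^sup>+ x. ennreal (\<rho>0 x) \<partial>\<gamma>) = 1"
    and rho0_entropy: "(\<integral>\<^sup>+ x. ennreal (\<rho>0 x * ln (\<rho>0 x)) \<partial>\<gamma>) < \<infinity>"
  shows "\<exists>\<rho> :: real \<Rightarrow> 'h \<Rightarrow> real.
           (\<lambda>(t, x). \<rho> t x) \<in> borel_measurable (restrict_space borel ({0..T} \<times> UNIV)) \<and>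
           (\<forall>t\<in>{0..T}. \<forall>x. \<rho> t x \<ge> 0) \<and>
           (\<forall>t\<in>{0..T}. prob_space (density \<gamma> (\<lambda>x. ennreal (\<rho> t x)))) \<and>
           solves_CE \<gamma> Y T F \<rho>0 \<rho> \<and>
           (\<integral>\<^sup>+ t. (\<integral>\<^sup>+ x. ennreal (\<rho> t x * ln (\<rho> t x)) \<partial>\<gamma>) \<partial>lebT T) < \<infinity>"
proof -
  have \<gamma>: "finite_measure \<gamma>" "sets \<gamma> = sets borel" using H1 by (auto simp: hyp1_def)
  have FM: "(\<lambda>(t, x). F t x) \<in> borel_measurable (restrict_space borel ({0..T} \<times> UNIV))"
    using H2 unfolding hyp2_def by (elim conjE)
  have on: "orthonormal_basis e" using H2 unfolding hyp2_def by (elim conjE)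
  have "\<exists>C. \<forall>t\<in>{0..T}. \<forall>x. norm (F t x) \<le> C" using H2 unfolding hyp2_def by (elim conjE)
  then obtain CB where FB: "\<And>t x. t \<in> {0..T} \<Longrightarrow> norm (F t x) \<le> CB" by blast
  obtain Nj ft \<delta> CJ where P: "\<forall>j. \<forall>i<Nj j. coeff_regular T (Nj j) (ft j i)"
    "AE (t, x) in lebT T \<Otimes>\<^sub>M \<gamma>. (\<lambda>j. Fj e Nj ft j t x) \<longlonglongrightarrow> F t x"
    "\<forall>j. \<forall>t\<in>{0..T}. \<forall>x. norm (Fj e Nj ft j t x) \<le> CJ"
    "\<delta> > 0" "(SUP j. CF \<gamma> e T \<Psi> \<eta> Nj ft j \<delta>) < \<infinity>"
    using H2 unfolding hyp2_def by (elim exE conjE) (rule that; assumption)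
  note Fl = P(2) and \<delta> = P(4) and CF = P(5)
  have co: "coeff_regular T (Nj j) (ft j i)" if "i < Nj j" for i j using P(1) that by blast
  have FjB: "norm (Fj e Nj ft j t x) \<le> CJ" if "t \<in> {0..T}" for j t x using P(3) that by blast
  note [measurable_cong] = \<gamma>(2) and [measurable] = rho0_meas
  have nn: "\<And>x. \<rho>0 x \<ge> 0" using rho0_nonneg by blast
  let ?M = "lebT T \<Otimes>\<^sub>M \<gamma>"
  interpret ga: finite_measure \<gamma> by (rule \<gamma>(1))
  interpret lT: finite_measure "lebT T" by (rule finite_measure_lebT)
  interpret PS: pair_sigma_finite "lebT T" \<gamma> ..
  interpret M: finite_measure ?M by (rule finite_measure_pair_measure) (rule lT.finite_measure_axioms \<gamma>(1))+
  have sM: "sets ?M = sets (lebT T \<Otimes>\<^sub>M borel)" by (rule sets_pair_measure_cong[OF refl \<gamma>(2)])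
  have mM: "borel_measurable ?M = borel_measurable (lebT T \<Otimes>\<^sub>M borel)" by (rule measurable_cong_sets[OF sM refl])
  have spM: "fst v \<in> {0..T}" if "v \<in> space ?M" for v using that by (auto simp: space_pair_measure)
  have \<rho>i: "integrable \<gamma> \<rho>0" using rho0_norm nn by (intro integrableI_nonneg) auto
  have \<rho>1: "(\<integral>x. \<rho>0 x \<partial>\<gamma>) = 1" using rho0_norm nn by (simp add: integral_eq_nn_integral)
  obtain r c where c: "c \<ge> 0" and r: "\<And>j. r j \<in> borel_measurable ?M" "\<And>j v. r j v \<ge> 0"
    "\<And>j. (\<integral>\<^sup>+v. ennreal (hfun (r j v)) \<partial>?M) \<le> ennreal c"
    and rw: "\<And>h D g g'. cyl h D \<Longrightarrow> (\<And>t. t \<in> {0..T} \<Longrightarrow> (g has_real_derivative g' t) (at t within {0..T})) \<Longrightarrow>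
       continuous_on {0..T} g' \<Longrightarrow> g T = 0 \<Longrightarrow>
       (\<lambda>j. \<integral>v. (g' (fst v) * h (snd v) + g (fst v) * inner (D (snd v)) (Fj e Nj ft j (fst v) (snd v))) * r j v \<partial>?M)
         \<longlonglongrightarrow> - g 0 * (\<integral>z. h z * \<rho>0 z \<partial>\<gamma>)"
  proof (rule approx_solution_sequence[OF T_pos \<gamma> on Psi eta _ \<delta> CF rho0_meas nn \<rho>i rho0_entropy], goal_cases)
    case (1 j i)
    show ?case by (rule co[OF 1(2)])
  next
    case (2 r c)
    show ?case by (rule that[of c r, OF 2(2-)])
  qed
  \<comment> \<open>The limit property is kept for general factors \<open>V\<close>, since it will
    be used with the fields \<open>Fj\<close> converging to \<open>F\<close> inside the test
    expression.\<close>
  obtain \<rho> where \<rho>m [measurable]: "\<rho> \<in> borel_measurable ?M" and \<rho>0: "\<And>v. \<rho> v \<ge> 0"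
    and \<rho>h: "(\<integral>\<^sup>+v. ennreal (hfun (\<rho> v)) \<partial>?M) \<le> ennreal c"
    and lim: "\<And>V V' a B. B \<ge> 0 \<Longrightarrow> V' \<in> borel_measurable ?M \<Longrightarrow> (\<And>j. V j \<in> borel_measurable ?M) \<Longrightarrow>
      (\<And>j v. v \<in> space ?M \<Longrightarrow> \<bar>V j v\<bar> \<le> B) \<Longrightarrow> AE v in ?M. (\<lambda>j. V j v) \<longlonglongrightarrow> V' v \<Longrightarrow>
      (\<lambda>j. \<integral>v. V j v * r j v \<partial>?M) \<longlonglongrightarrow> a \<Longrightarrow> (\<integral>v. V' v * \<rho> v \<partial>?M) = a"
  proof (rule M.entropy_komlos[where r=r, OF r c], goal_cases)
    case (1 \<rho>)
    show ?case by (rule that[of \<rho>, OF 1(2-)])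
  qed
  have \<rho>int: "integrable ?M \<rho>" by (rule M.hfun_tail(1)[OF \<rho>m \<rho>0 \<rho>h c])
  have Fm [measurable]: "(\<lambda>v. F (fst v) (snd v)) \<in> borel_measurable ?M"
    using FM unfolding borel_measurable_lebT_borel_iff mM by (simp add: case_prod_unfold)
  have Fjm [measurable]: "(\<lambda>v. Fj e Nj ft j (fst v) (snd v)) \<in> borel_measurable ?M" for j
  proof -
    have "(\<lambda>v. ft j i (fst v) (coordN e (Nj j) (snd v))) \<in> borel_measurable (lebT T \<Otimes>\<^sub>M borel)" if i: "i < Nj j" for i
    proof -
      have 1: "(\<lambda>v. (fst v, coordN e (Nj j) (snd v))) \<in> lebT T \<Otimes>\<^sub>M borel \<rightarrow>\<^sub>M lebT T \<Otimes>\<^sub>M lebN (Nj j)" by measurable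
      have 2: "continuous_on ({0..T} \<times> RN (Nj j)) (\<lambda>(t, x). ft j i t x)" using co[OF i] by (simp add: coeff_regular_def)
      from measurable_compose[OF 1 borel_measurable_lebT_lebN_continuous[OF 2]] show ?thesis by simp
    qed
    thus ?thesis unfolding Fj_def mM by (intro borel_measurable_sum borel_measurable_scaleR) auto
  qed
  have mT: "u \<in> borel_measurable (lebT T)" if "continuous_on {0..T} u" for u :: "real \<Rightarrow> real"
    using borel_measurable_continuous_on_restrict[OF that] measurable_cong_sets[of "lebT T" "restrict_space borel {0..T}"]
    by (simp add: lebT_def sets_restrict_space)
  \<comment> \<open>The field is an argument so that the same expression, bound and measurability
    argument cover \<open>F\<close> and all \<open>Fj\<close>.\<close>
  define V where "V h D g g' G v = g' (fst v) * h (snd v) + g (fst v) * inner (D (snd v)) (G (fst v) (snd v))"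
    for h :: "'h \<Rightarrow> real" and D :: "'h \<Rightarrow> 'h" and g g' :: "real \<Rightarrow> real" and G :: "real \<Rightarrow> 'h \<Rightarrow> 'h" and v
  have weak: "integrable ?M (\<lambda>v. V h D g g' F v * \<rho> v) \<and> (\<integral>v. V h D g g' F v * \<rho> v \<partial>?M) = - g 0 * (\<integral>z. h z * \<rho>0 z \<partial>\<gamma>)"
    if cy: "cyl h D" and gd: "\<And>t. t \<in> {0..T} \<Longrightarrow> (g has_real_derivative g' t) (at t within {0..T})"
      and g'c: "continuous_on {0..T} g'" and gT: "g T = 0" for h D g g'
  proof -
    have gc: "continuous_on {0..T} g" using gd by (intro DERIV_continuous_on) auto
    note [measurable] = mT[OF gc] mT[OF g'c]
    have hD [measurable]: "h \<in> borel_measurable borel" "D \<in> borel_measurable borel"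
      using cy by (auto simp: cyl_def intro: borel_measurable_continuous_onI)
    obtain Bg Bg' Bh BD where Bb: "\<And>t. t \<in> {0..T} \<Longrightarrow> \<bar>g t\<bar> \<le> Bg" "\<And>t. t \<in> {0..T} \<Longrightarrow> \<bar>g' t\<bar> \<le> Bg'"
      "\<And>z. \<bar>h z\<bar> \<le> Bh" "\<And>z. norm (D z) \<le> BD"
    proof -
      have "bounded (g ` {0..T})" "bounded (g' ` {0..T})" using gc g'c by (auto intro!: compact_imp_bounded compact_continuous_image)
      moreover have "bounded (range h)" "bounded (range D)" using cy by (auto simp: cyl_def)
      ultimately show thesis unfolding bounded_iff using that by (metis image_eqI rangeI real_norm_def)
    qed
    define CM where "CM = \<bar>CB\<bar> + \<bar>CJ\<bar>"
    define B where "B = Bg' * Bh + Bg * (BD * CM)"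
    have Vb: "\<bar>V h D g g' G v\<bar> \<le> B" if v: "v \<in> space ?M" and G: "norm (G (fst v) (snd v)) \<le> CM" for G v
    proof -
      note t = spM[OF v]
      have "\<bar>g' (fst v) * h (snd v)\<bar> \<le> Bg' * Bh" unfolding abs_mult using Bb(2)[OF t] Bb(3)[of "snd v"] by (intro mult_mono) auto
      moreover have "norm (D (snd v)) * norm (G (fst v) (snd v)) \<le> BD * CM"
        using Bb(4)[of "snd v"] G order_trans[OF norm_ge_zero Bb(4)] by (intro mult_mono) auto
      hence "\<bar>inner (D (snd v)) (G (fst v) (snd v))\<bar> \<le> BD * CM" using Cauchy_Schwarz_ineq2 order_trans by blast
      hence "\<bar>g (fst v) * inner (D (snd v)) (G (fst v) (snd v))\<bar> \<le> Bg * (BD * CM)"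
        unfolding abs_mult using Bb(1)[OF t] by (intro mult_mono) auto
      ultimately show ?thesis unfolding V_def B_def by linarith
    qed
    have FC: "norm (F (fst v) (snd v)) \<le> CM" and FjC: "norm (Fj e Nj ft j (fst v) (snd v)) \<le> CM" if "v \<in> space ?M" for v j
      using FB[OF spM[OF that], of "snd v"] FjB[OF spM[OF that], of j "snd v"] unfolding CM_def by linarith+
    have B0: "B \<ge> 0"
    proof -
      have "(0, 0) \<in> space ?M" using T_pos sets_eq_imp_space_eq[OF \<gamma>(2)] by (simp add: space_pair_measure)
      from Vb[of "(0, 0)" F, OF this FC[OF this]] show ?thesis by linarith
    qed
    have VFm [measurable]: "V h D g g' F \<in> borel_measurable ?M" unfolding V_def by measurable
    have "integrable ?M (\<lambda>v. V h D g g' F v * \<rho> v)"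
    proof (rule Bochner_Integration.integrable_bound[where f="\<lambda>v. B * \<rho> v"])
      show "AE v in ?M. norm (V h D g g' F v * \<rho> v) \<le> norm (B * \<rho> v)"
        using Vb[of _ F, OF _ FC] \<rho>0 B0 by (intro AE_I2) (auto simp: abs_mult intro!: mult_right_mono)
    qed (use \<rho>int in auto)
    moreover have "(\<integral>v. V h D g g' F v * \<rho> v \<partial>?M) = - g 0 * (\<integral>z. h z * \<rho>0 z \<partial>\<gamma>)"
    proof (rule lim[OF B0 VFm, of "\<lambda>j. V h D g g' (Fj e Nj ft j)"])
      show "V h D g g' (Fj e Nj ft j) \<in> borel_measurable ?M" for j unfolding V_def by measurable
      show "\<bar>V h D g g' (Fj e Nj ft j) v\<bar> \<le> B" if "v \<in> space ?M" for j v by (rule Vb[of v "Fj e Nj ft j", OF that FjC[OF that]])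
      show "AE v in ?M. (\<lambda>j. V h D g g' (Fj e Nj ft j) v) \<longlonglongrightarrow> V h D g g' F v"
        using Fl
      proof eventually_elim
        case (elim v)
        hence "(\<lambda>j. Fj e Nj ft j (fst v) (snd v)) \<longlonglongrightarrow> F (fst v) (snd v)" by (simp add: case_prod_unfold)
        thus ?case unfolding V_def by (intro tendsto_intros)
      qed
      show "(\<lambda>j. \<integral>v. V h D g g' (Fj e Nj ft j) v * r j v \<partial>?M) \<longlonglongrightarrow> - g 0 * (\<integral>z. h z * \<rho>0 z \<partial>\<gamma>)"
        unfolding V_def by (rule rw[OF cy gd g'c gT])
    qed
    ultimately show ?thesis by blast
  qed
  have mass: "AE t in lebT T. (\<integral>x. \<rho> (t, x) \<partial>\<gamma>) = 1"
  proof (rule AE_lebT_eq_1)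
    show "integrable (lebT T) (\<lambda>t. \<integral>x. \<rho> (t, x) \<partial>\<gamma>)" by (rule PS.integrable_fst'[OF \<rho>int])
    show "(\<integral>x. \<rho> (t, x) \<partial>\<gamma>) \<ge> 0" for t using \<rho>0 by (intro integral_nonneg_AE) auto
    fix k :: "real \<Rightarrow> real" assume "continuous_on UNIV k"
    hence kc: "continuous_on {0..T} k" by (rule continuous_on_subset) auto
    \<comment> \<open>The primitive of \<open>k\<close> that vanishes at \<open>T\<close>. With the
      constant test function 1 the weak equation loses its drift term and reduces to the integral of
      \<open>k\<close> against the mass.\<close>
    define g where "g t = integral {0..t} k - integral {0..T} k" for t
    have w: "integrable ?M (\<lambda>v. V (\<lambda>_. 1) (\<lambda>_. 0) g k F v * \<rho> v) \<and> (\<integral>v. V (\<lambda>_. 1) (\<lambda>_. 0) g k F v * \<rho> v \<partial>?M) = - g 0 * (\<integral>z. 1 * \<rho>0 z \<partial>\<gamma>)"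
    proof (rule weak[OF cyl_const _ kc])
      show "(g has_real_derivative k t) (at t within {0..T})" if "t \<in> {0..T}" for t
        unfolding g_def using DERIV_diff[OF integral_has_real_derivative[OF kc that] DERIV_const] by simp
    qed (simp add: g_def)
    have w1: "integrable ?M (\<lambda>v. k (fst v) * \<rho> v)" and w2: "(\<integral>v. k (fst v) * \<rho> v \<partial>?M) = integral {0..T} k"
      using w \<rho>1 by (simp_all add: V_def g_def)
    have "(\<integral>t. k t * (\<integral>x. \<rho> (t, x) \<partial>\<gamma>) \<partial>lebT T) = (\<integral>t. (\<integral>x. k (fst (t, x)) * \<rho> (t, x) \<partial>\<gamma>) \<partial>lebT T)" by simp
    also have "\<dots> = (\<integral>v. k (fst v) * \<rho> v \<partial>?M)" by (rule PS.integral_fst'[OF w1])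
    also have "\<dots> = (\<integral>t. k t \<partial>lebT T)" unfolding w2 integral_lebT[OF kc] ..
    finally show "(\<integral>t. k t * (\<integral>x. \<rho> (t, x) \<partial>\<gamma>) \<partial>lebT T) = (\<integral>t. k t \<partial>lebT T)" .
  qed
  \<comment> \<open>The nonnegative integral decides mass 1 without a prior check of integrability,
    and makes the set of good times measurable.\<close>
  define G where "G = {t \<in> space (lebT T). (\<integral>\<^sup>+x. ennreal (\<rho> (t, x)) \<partial>\<gamma>) = 1}"
  have Gm [measurable]: "G \<in> sets (lebT T)" unfolding G_def by measurable
  have AEG: "AE t in lebT T. t \<in> G"
    using mass PS.AE_integrable_fst'[OF \<rho>int] AE_space
  proof eventually_elim
    case (elim t)
    have "(\<integral>\<^sup>+x. ennreal (\<rho> (t, x)) \<partial>\<gamma>) = ennreal (\<integral>x. \<rho> (t, x) \<partial>\<gamma>)"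
      using \<rho>0 by (intro nn_integral_eq_integral[OF elim(2)]) auto
    thus ?case using elim by (simp add: G_def)
  qed
  have AEG2: "AE v in ?M. fst v \<in> G"
  proof (rule PS.AE_pair_measure)
    show "{v \<in> space ?M. fst v \<in> G} \<in> sets ?M" by measurable
    show "AE t in lebT T. AE x in \<gamma>. fst (t, x) \<in> G" using AEG by eventually_elim auto
  qed
  \<comment> \<open>At the exceptional times, a null set, the density is replaced by
    \<open>\<rho>0\<close>, itself of mass 1; thus every time gives a probability measure and no
    space-time integral changes.\<close>
  define \<sigma> where "\<sigma> t x = (if t \<in> G then \<rho> (t, x) else \<rho>0 x)" for t x
  have \<sigma>m [measurable]: "(\<lambda>v. \<sigma> (fst v) (snd v)) \<in> borel_measurable ?M" unfolding \<sigma>_def by measurable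
  have \<sigma>\<rho>: "AE v in ?M. \<sigma> (fst v) (snd v) = \<rho> v" using AEG2 by eventually_elim (simp add: \<sigma>_def)
  have \<sigma>0: "\<sigma> t x \<ge> 0" for t x using \<rho>0 nn by (simp add: \<sigma>_def)
  have prob: "prob_space (density \<gamma> (\<lambda>x. ennreal (\<sigma> t x)))" if t: "t \<in> {0..T}" for t
  proof (rule prob_spaceI)
    have "(\<lambda>x. \<rho> (t, x)) \<in> borel_measurable \<gamma>" using measurable_Pair2[OF \<rho>m, of t] t by simp
    hence "(\<lambda>x. \<sigma> t x) \<in> borel_measurable \<gamma>" unfolding \<sigma>_def by (cases "t \<in> G") auto
    hence "emeasure (density \<gamma> (\<lambda>x. ennreal (\<sigma> t x))) (space \<gamma>) = (\<integral>\<^sup>+x. ennreal (\<sigma> t x) \<partial>\<gamma>)"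
      by (subst emeasure_density) (auto intro!: nn_integral_cong)
    also have "\<dots> = 1" using rho0_norm unfolding \<sigma>_def by (cases "t \<in> G") (auto simp: G_def)
    finally show "emeasure (density \<gamma> (\<lambda>x. ennreal (\<sigma> t x))) (space (density \<gamma> (\<lambda>x. ennreal (\<sigma> t x)))) = 1" by simp
  qed
  have \<sigma>int: "integrable ?M (\<lambda>v. \<sigma> (fst v) (snd v))"
    using \<rho>int \<sigma>\<rho> by (subst integrable_cong_AE[of _ _ \<rho>]) auto
  have "solves_CE \<gamma> Y T F \<rho>0 \<sigma>" unfolding solves_CE_def
  proof (intro conjI ballI)
    show "integrable ?M (\<lambda>(t, x). \<sigma> t x)" using \<sigma>int by (simp add: case_prod_unfold)
    fix u assume "u \<in> FCbT T Y 1"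
    then obtain n :: nat and g f where gf': "\<forall>m<n. C1_on_interval T (g m) \<and> g m T = 0 \<and> f m \<in> FCb Y 1"
      and u: "u = (\<lambda>t x. \<Sum>m<n. g m t * f m x)" unfolding FCbT_def mem_Collect_eq by (elim exE conjE) (rule that; assumption)
    have gf: "C1_on_interval T (g m) \<and> g m T = 0 \<and> f m \<in> FCb Y 1" if "m < n" for m using gf' that by blast
    have "\<exists>D. cyl (f m) D" if "m < n" for m using FCb_cyl gf[OF that] by metis
    then obtain D where D: "\<And>m. m < n \<Longrightarrow> cyl (f m) (D m)" by metis
    have "\<exists>g'. continuous_on {0..T} g' \<and> (\<forall>t\<in>{0..T}. (g m has_real_derivative g' t) (at t within {0..T}))" if "m < n" for m
      using gf[OF that] unfolding C1_on_interval_def by blast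
    then obtain g' where g': "\<And>m. m < n \<Longrightarrow> continuous_on {0..T} (g' m)"
      "\<And>m t. m < n \<Longrightarrow> t \<in> {0..T} \<Longrightarrow> (g m has_real_derivative g' m t) (at t within {0..T})" by metis
    let ?V = "\<lambda>m. V (f m) (D m) (g m) (g' m) F"
    have W: "integrable ?M (\<lambda>v. ?V m v * \<rho> v)" "(\<integral>v. ?V m v * \<rho> v \<partial>?M) = - g m 0 * (\<integral>z. f m z * \<rho>0 z \<partial>\<gamma>)" if m: "m < n" for m
      using weak[OF D[OF m] g'(2)[OF m] g'(1)[OF m]] gf[OF m] by blast+
    \<comment> \<open>Term by term, the time derivative within the closed interval and the gradient
      paired with \<open>F t x\<close> form the expression \<open>V\<close> with field
      \<open>F\<close>.\<close>
    have der: "vector_derivative (\<lambda>s. u s x) (at t within {0..T}) + dirderiv (u t) x (F t x) = (\<Sum>m<n. ?V m (t, x))"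
      if t: "t \<in> {0..T}" for t x
    proof -
      have "((\<lambda>s. u s x) has_real_derivative (\<Sum>m<n. g' m t * f m x)) (at t within {0..T})"
        unfolding u using g'(2)[OF _ t] by (intro DERIV_sum DERIV_cmult_right) auto
      hence "vector_derivative (\<lambda>s. u s x) (at t within {0..T}) = (\<Sum>m<n. g' m t * f m x)"
        using T_pos t by (intro vector_derivative_within_closed_interval) (auto simp: has_real_derivative_iff_has_vector_derivative)
      moreover have "((\<lambda>s. u t (x + s *\<^sub>R F t x)) has_real_derivative (\<Sum>m<n. g m t * inner (D m x) (F t x))) (at 0)"
        unfolding u using D by (intro DERIV_sum DERIV_cmult) (auto simp: cyl_def)
      hence "dirderiv (u t) x (F t x) = (\<Sum>m<n. g m t * inner (D m x) (F t x))"
        unfolding dirderiv_def by (rule DERIV_imp_deriv)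
      ultimately show ?thesis by (simp add: V_def sum.distrib)
    qed
    let ?S = "\<lambda>v. (\<Sum>m<n. ?V m v) * \<sigma> (fst v) (snd v)"
    have S1: "integrable ?M (\<lambda>v. \<Sum>m<n. ?V m v * \<rho> v)" using W(1) by (intro Bochner_Integration.integrable_sum) auto
    have Vm: "?V m \<in> borel_measurable ?M" if m: "m < n" for m
    proof -
      have "continuous_on {0..T} (g m)" using g'(2)[OF m] by (intro DERIV_continuous_on) auto
      note [measurable] = mT[OF this] mT[OF g'(1)[OF m]]
      have [measurable]: "f m \<in> borel_measurable borel" "D m \<in> borel_measurable borel"
        using D[OF m] by (auto simp: cyl_def intro: borel_measurable_continuous_onI)
      show ?thesis unfolding V_def by measurable
    qed
    have Sm: "?S \<in> borel_measurable ?M" using Vm by (intro borel_measurable_times borel_measurable_sum \<sigma>m) auto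
    have Se: "AE v in ?M. ?S v = (\<Sum>m<n. ?V m v * \<rho> v)" using \<sigma>\<rho> by eventually_elim (simp add: sum_distrib_right)
    have S2: "integrable ?M ?S"
      using S1 Se Sm by (subst integrable_cong_AE[OF Sm borel_measurable_integrable[OF S1] Se])
    have "(\<integral>t. (\<integral>x. (vector_derivative (\<lambda>s. u s x) (at t within {0..T}) + dirderiv (u t) x (F t x)) * \<sigma> t x \<partial>\<gamma>) \<partial>lebT T)
       = (\<integral>t. (\<integral>x. ?S (t, x) \<partial>\<gamma>) \<partial>lebT T)"
      by (intro Bochner_Integration.integral_cong refl) (simp add: der)
    also have "\<dots> = (\<integral>v. ?S v \<partial>?M)" by (rule PS.integral_fst'[OF S2])
    also have "\<dots> = (\<integral>v. (\<Sum>m<n. ?V m v * \<rho> v) \<partial>?M)"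
      by (rule integral_cong_AE[OF Sm borel_measurable_integrable[OF S1] Se])
    also have "\<dots> = (\<Sum>m<n. - g m 0 * (\<integral>z. f m z * \<rho>0 z \<partial>\<gamma>))"
      using W by (subst Bochner_Integration.integral_sum) auto
    also have "\<dots> = - (\<Sum>m<n. (\<integral>z. g m 0 * (f m z * \<rho>0 z) \<partial>\<gamma>))" by (simp add: sum_negf)
    also have "(\<Sum>m<n. (\<integral>z. g m 0 * (f m z * \<rho>0 z) \<partial>\<gamma>)) = (\<integral>z. (\<Sum>m<n. g m 0 * (f m z * \<rho>0 z)) \<partial>\<gamma>)"
    proof (rule Bochner_Integration.integral_sum[symmetric])
      fix m assume "m \<in> {..<n}"
      hence m: "m < n" by simp
      have [measurable]: "f m \<in> borel_measurable borel" using D[OF m] by (auto simp: cyl_def intro: borel_measurable_continuous_onI)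
      obtain B where B: "\<And>z. \<bar>f m z\<bar> \<le> B" using D[OF m] unfolding cyl_def bounded_iff by auto
      have "integrable \<gamma> (\<lambda>z. f m z * \<rho>0 z)"
      proof (rule Bochner_Integration.integrable_bound[where f="\<lambda>z. B * \<rho>0 z"])
        show "AE z in \<gamma>. norm (f m z * \<rho>0 z) \<le> norm (B * \<rho>0 z)"
          using order_trans[OF B abs_ge_self] by (intro AE_I2) (auto simp: abs_mult intro!: mult_right_mono)
      qed (use \<rho>i in auto)
      thus "integrable \<gamma> (\<lambda>z. g m 0 * (f m z * \<rho>0 z))" by simp
    qed
    also have "\<dots> = (\<integral>z. u 0 z * \<rho>0 z \<partial>\<gamma>)" by (simp add: u sum_distrib_right mult.assoc)
    finally show "(\<integral>t. (\<integral>x. (vector_derivative (\<lambda>s. u s x) (at t within {0..T}) + dirderiv (u t) x (F t x)) * \<sigma> t x \<partial>\<gamma>) \<partial>lebT T)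
       = - (\<integral>z. u 0 z * \<rho>0 z \<partial>\<gamma>)" .
  qed
  moreover have "(\<integral>\<^sup>+t. (\<integral>\<^sup>+x. ennreal (\<sigma> t x * ln (\<sigma> t x)) \<partial>\<gamma>) \<partial>lebT T) < \<infinity>"
  proof -
    have "(\<integral>\<^sup>+t. (\<integral>\<^sup>+x. ennreal (\<sigma> t x * ln (\<sigma> t x)) \<partial>\<gamma>) \<partial>lebT T)
       = (\<integral>\<^sup>+t. (\<integral>\<^sup>+x. ennreal (\<sigma> (fst (t, x)) (snd (t, x)) * ln (\<sigma> (fst (t, x)) (snd (t, x)))) \<partial>\<gamma>) \<partial>lebT T)" by simp
    also have "\<dots> = (\<integral>\<^sup>+v. ennreal (\<sigma> (fst v) (snd v) * ln (\<sigma> (fst v) (snd v))) \<partial>?M)"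
      by (rule ga.nn_integral_fst) measurable
    \<comment> \<open>As \<open>r * ln r = hfun r + r - 1\<close>, dropping the constant gives an
      upper bound by two nonnegative terms of finite integral.\<close>
    also have "\<dots> \<le> (\<integral>\<^sup>+v. ennreal (hfun (\<rho> v)) + ennreal (\<rho> v) \<partial>?M)"
    proof (rule nn_integral_mono_AE)
      show "AE v in ?M. ennreal (\<sigma> (fst v) (snd v) * ln (\<sigma> (fst v) (snd v))) \<le> ennreal (hfun (\<rho> v)) + ennreal (\<rho> v)"
        using \<sigma>\<rho>
      proof eventually_elim
        case (elim v)
        have "ennreal (\<rho> v * ln (\<rho> v)) \<le> ennreal (hfun (\<rho> v) + \<rho> v)" by (intro ennreal_leI) (simp add: hfun_def)
        thus ?case using elim hfun_nonneg[OF \<rho>0] \<rho>0 by simp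
      qed
    qed
    also have "\<dots> = (\<integral>\<^sup>+v. ennreal (hfun (\<rho> v)) \<partial>?M) + (\<integral>\<^sup>+v. ennreal (\<rho> v) \<partial>?M)" by (rule nn_integral_add) measurable
    also have "\<dots> < \<infinity>"
    proof -
      have "(\<integral>\<^sup>+v. ennreal (\<rho> v) \<partial>?M) = ennreal (\<integral>v. \<rho> v \<partial>?M)" using \<rho>0 by (intro nn_integral_eq_integral[OF \<rho>int]) auto
      moreover have "(\<integral>\<^sup>+v. ennreal (hfun (\<rho> v)) \<partial>?M) < \<infinity>" using \<rho>h by (rule le_less_trans) simp
      ultimately show ?thesis by simp
    qed
    finally show ?thesis .
  qed
  moreover have "(\<lambda>(t, x). \<sigma> t x) \<in> borel_measurable (restrict_space borel ({0..T} \<times> UNIV))"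
    unfolding borel_measurable_lebT_borel_iff using \<sigma>m unfolding mM by (simp add: case_prod_unfold)
  ultimately show ?thesis using \<sigma>0 prob by (intro exI[of _ \<sigma>]) blast
qed

end
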